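(* Let $S$ be a smooth, connected, oriented, finite-type surface with negative Euler characteristic. Let $\mu\in\mathcal C(S)$ be a convex $\mathbb{RP}^2$ structure, let $\rho\in\mathrm{hol}_\mu$, and let $\Omega$ be the $\rho$-equivariant developing image of $\mu$. Let $\mathscr F$ be the set of all fixed points in $\mathbb{RP}^2$ of non-identity elements of $\rho(\pi_1(S))$, with the saddle fixed points of hyperbolic elements of $\rho(\pi_1(S))$ removed, and let $\check{\Omega}\subset\Omega$ be the interior of the convex hull of $\overline{\mathscr F}$ in $\Omega$. For $p\in\check{\Omega}$, let $\Lambda_p$ be the set of accumulation points in $\partial\check{\Omega}$ of the orbit $\rho(\pi_1(S))\cdot p$. Then for every $p\in\check{\Omega}$, $\Lambda_p=\overline{\mathscr F}$. In particular, $\Lambda_{p_1}=\Lambda_{p_2}$ for all $p_1,p_2\in\check{\Omega}$.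
   Context: A domain $\Omega\subset\mathbb{RP}^2$ is properly convex if its closure contains no projective line and any two distinct points of $\Omega$ are joined by a projective line segment lying in $\Omega$. An $\mathbb{RP}^2$ surface is a surface with a maximal atlas of charts to $\mathbb{RP}^2$ whose transition maps are locally restrictions of projective transformations; it is convex if its developing map is a diffeomorphism onto a properly convex domain. $\mathcal C(S)$ is the set of pairs $(f,\Sigma)$, with $\Sigma$ a convex $\mathbb{RP}^2$ surface and $f:S\to\Sigma$ a diffeomorphism, modulo $(f,\Sigma)\sim(f',\Sigma')$ if $f'\circ f^{-1}$ is homotopic to a projective isomorphism. Each $\mu\in\mathcal C(S)$ has a developing pair $(\phi,\rho)$, unique up to $\mathrm{PGL}(3,\mathbb R)$ and equivariant homotopy of $\phi$: a representation $\rho:\pi_1(S)\to\mathrm{PGL}(3,\mathbb R)$ and a $\rho$-equivariant diffeomorphism $\phi:\widetilde S\to\Omega$ onto a properly convex domain $\Omega$, called the $\rho$-equivariant developing image. $\mathrm{hol}_\mu$ is the conjugacy class of $\rho$. An element of $\mathrm{PGL}(3,\mathbb R)$ is hyperbolic if conjugate to $\mathrm{diag}(\lambda_1,\lambda_2,\lambda_3)$ with pairwise distinct positive $\lambda_i$; it has an attracting, a repelling, and a third ("saddle") fixed point in $\mathbb{RP}^2$. The set $\mathscr F$ is contained in $\partial\Omega$; the convex hull of $\overline{\mathscr F}$ is taken in an affine chart containing $\overline\Omega$. The group $\rho(\pi_1(S))$ preserves $\check{\Omega}$. *)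

theory Defs
  imports "HOL-Analysis.Analysis" "HOL-Homology.Homology"
begin

section \<open>The projective plane and its transformations\<close>

typedef rp2 = "{L :: (real^3) set. subspace L \<and> dim L = 1}"
proof -
  have "dim (span {axis 1 1 :: real^3}) = 1"
    by (simp add: dim_span dim_singleton axis_eq_0_iff)
  then show ?thesis by (blast intro: subspace_span)
qed

definition rp2_of :: "real^3 \<Rightarrow> rp2"
  where "rp2_of v = Abs_rp2 (span {v})"

text \<open>The quotient topology of the nonzero vectors.\<close>

instantiation rp2 :: topological_space
begin

definition open_rp2 :: "rp2 set \<Rightarrow> bool"
  where "open_rp2 U \<longleftrightarrow> open {v. v \<noteq> 0 \<and> rp2_of v \<in> U}"

instance
proof
  have "{v :: real^3. v \<noteq> 0 \<and> rp2_of v \<in> UNIV} = - {0}" by auto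
  then show "open (UNIV :: rp2 set)" by (simp add: open_rp2_def open_Compl)
next
  fix S T :: "rp2 set"
  assume "open S" "open T"
  moreover have "{v. v \<noteq> 0 \<and> rp2_of v \<in> S \<inter> T}
      = {v. v \<noteq> 0 \<and> rp2_of v \<in> S} \<inter> {v. v \<noteq> 0 \<and> rp2_of v \<in> T}" by auto
  ultimately show "open (S \<inter> T)" by (simp only: open_rp2_def open_Int)
next
  fix K :: "rp2 set set"
  assume "\<forall>S\<in>K. open S"
  moreover have "{v. v \<noteq> 0 \<and> rp2_of v \<in> \<Union>K} = (\<Union>S\<in>K. {v. v \<noteq> 0 \<and> rp2_of v \<in> S})" by auto
  ultimately show "open (\<Union>K)" by (auto simp only: open_rp2_def intro!: open_UN)
qed

end

definition proj_map :: "real^3^3 \<Rightarrow> rp2 \<Rightarrow> rp2"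
  where "proj_map A x = Abs_rp2 ((*v) A ` Rep_rp2 x)"

text \<open>\<open>PGL(3,\<real>)\<close>, identified with the group of projective transformations through its
  faithful action on the projective plane.\<close>

definition PGL3 :: "(rp2 \<Rightarrow> rp2) monoid"
  where "PGL3 = \<lparr>carrier = {proj_map A | A. invertible A}, mult = (\<circ>), one = id\<rparr>"

definition diag3 :: "real^3 \<Rightarrow> real^3^3"
  where "diag3 l = (\<chi> i j. if i = j then l $ i else 0)"

definition diagonalizes :: "(rp2 \<Rightarrow> rp2) \<Rightarrow> real^3^3 \<Rightarrow> real^3 \<Rightarrow> bool"
  where "diagonalizes g P l \<longleftrightarrow> invertible P \<and> (\<forall>i. l $ i > 0) \<and> inj (($) l) \<and>
    g = proj_map (P ** diag3 l ** matrix_inv P)"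

definition hyperbolic :: "(rp2 \<Rightarrow> rp2) \<Rightarrow> bool"
  where "hyperbolic g \<longleftrightarrow> (\<exists>P l. diagonalizes g P l)"

text \<open>The attracting (repelling) fixed point of a hyperbolic element is the eigenline of its
  largest (smallest) eigenvalue; the saddle fixed point is the remaining eigenline.\<close>

definition saddle_point :: "(rp2 \<Rightarrow> rp2) \<Rightarrow> rp2 \<Rightarrow> bool"
  where "saddle_point g x \<longleftrightarrow> (\<exists>P l i j k. diagonalizes g P l \<and>
    l $ j < l $ i \<and> l $ i < l $ k \<and> x = rp2_of (P *v axis i 1))"

definition proj_line :: "real^3 \<Rightarrow> rp2 set"
  where "proj_line a = {rp2_of v | v. v \<noteq> 0 \<and> a \<bullet> v = 0}"

definition affine_chart :: "real^3 \<Rightarrow> rp2 set"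
  where "affine_chart a = {rp2_of v | v. a \<bullet> v \<noteq> 0}"

text \<open>The two projective segments joining distinct points \<open>[v]\<close>, \<open>[w]\<close> are the images of the
  segments from \<open>v\<close> to \<open>w\<close> and from \<open>v\<close> to \<open>-w\<close>, so the choice of representatives below is a
  choice of one of them.\<close>

definition properly_convex :: "rp2 set \<Rightarrow> bool"
  where "properly_convex \<Omega> \<longleftrightarrow> open \<Omega> \<and> connected \<Omega> \<and> \<Omega> \<noteq> {} \<and>
    (\<forall>a. a \<noteq> 0 \<longrightarrow> \<not> proj_line a \<subseteq> closure \<Omega>) \<and>
    (\<forall>x\<in>\<Omega>. \<forall>y\<in>\<Omega>. x \<noteq> y \<longrightarrow>
      (\<exists>v w. v \<noteq> 0 \<and> w \<noteq> 0 \<and> rp2_of v = x \<and> rp2_of w = y \<and> rp2_of ` closed_segment v w \<subseteq> \<Omega>))"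

text \<open>Convex hull in the affine chart \<open>a \<bullet> v \<noteq> 0\<close>, which is modelled by the affine plane
  \<open>a \<bullet> v = 1\<close>.\<close>

definition chart_hull :: "real^3 \<Rightarrow> rp2 set \<Rightarrow> rp2 set"
  where "chart_hull a X = rp2_of ` (convex hull {v. a \<bullet> v = 1 \<and> rp2_of v \<in> X})"

section \<open>Geometric structures\<close>

text \<open>A chart of \<open>M\<close> is a pair of its domain and its coordinate map (whose values outside the
  domain are irrelevant). The predicate \<open>G X t\<close> says that the map \<open>t\<close> on the open subset \<open>X\<close> of the
  model is an admissible change of coordinates.\<close>

type_synonym ('a, 'm) chart = "'a set \<times> ('a \<Rightarrow> 'm)"

definition chart_on ::
    "'a::topological_space set \<Rightarrow> ('a, 'm::topological_space) chart \<Rightarrow> bool"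
  where "chart_on M = (\<lambda>(U, c). openin (top_of_set M) U \<and> open (c ` U) \<and>
    (\<exists>c'. homeomorphism U (c ` U) c c'))"

definition morphism :: "('m set \<Rightarrow> ('m \<Rightarrow> 'm) \<Rightarrow> bool) \<Rightarrow>
    ('a, 'm) chart set \<Rightarrow> ('b, 'm) chart set \<Rightarrow> ('a \<Rightarrow> 'b) \<Rightarrow> bool"
  where "morphism G A B f \<longleftrightarrow> (\<forall>(U, c)\<in>A. \<forall>(V, d)\<in>B.
    G (c ` (U \<inter> f -` V)) (d \<circ> f \<circ> inv_into U c))"

definition isomorphism :: "('m set \<Rightarrow> ('m \<Rightarrow> 'm) \<Rightarrow> bool) \<Rightarrow>
    'a::topological_space set \<Rightarrow> ('a, 'm) chart set \<Rightarrow>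
    'b::topological_space set \<Rightarrow> ('b, 'm) chart set \<Rightarrow> ('a \<Rightarrow> 'b) \<Rightarrow> bool"
  where "isomorphism G M A N B f \<longleftrightarrow>
    (\<exists>f'. homeomorphism M N f f' \<and> morphism G A B f \<and> morphism G B A f')"

definition atlas_on :: "('m::topological_space set \<Rightarrow> ('m \<Rightarrow> 'm) \<Rightarrow> bool) \<Rightarrow>
    'a::topological_space set \<Rightarrow> ('a, 'm) chart set \<Rightarrow> bool"
  where "atlas_on G M A \<longleftrightarrow> (\<forall>C\<in>A. chart_on M C) \<and> \<Union>(fst ` A) = M \<and> morphism G A A id"

definition maximal_atlas_on :: "('m::topological_space set \<Rightarrow> ('m \<Rightarrow> 'm) \<Rightarrow> bool) \<Rightarrow>
    'a::topological_space set \<Rightarrow> ('a, 'm) chart set \<Rightarrow> bool"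
  where "maximal_atlas_on G M A \<longleftrightarrow>
    atlas_on G M A \<and> (\<forall>C. atlas_on G M (insert C A) \<longrightarrow> C \<in> A)"

definition pullback_charts :: "'b::topological_space set \<Rightarrow> ('b \<Rightarrow> 'a) \<Rightarrow>
    ('a, 'm) chart set \<Rightarrow> ('b, 'm) chart set"
  where "pullback_charts Mt p A = {(V, c \<circ> p) | V U c. (U, c) \<in> A \<and>
    openin (top_of_set Mt) V \<and> inj_on p V \<and> p ` V \<subseteq> U}"

section \<open>Smooth oriented surfaces of finite type\<close>

primrec Ck_on :: "nat \<Rightarrow> 'a::real_normed_vector set \<Rightarrow> ('a \<Rightarrow> 'b::real_normed_vector) \<Rightarrow> bool"
  where
    "Ck_on 0 X f \<longleftrightarrow> continuous_on X f"
  | "Ck_on (Suc k) X f \<longleftrightarrow> (\<forall>x\<in>X. f differentiable (at x)) \<and>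
      (\<forall>v. Ck_on k X (\<lambda>x. frechet_derivative f (at x) v))"

definition smooth_on :: "'a::real_normed_vector set \<Rightarrow> ('a \<Rightarrow> 'b::real_normed_vector) \<Rightarrow> bool"
  where "smooth_on X f \<longleftrightarrow> (\<forall>k. Ck_on k X f)"

definition oriented_smooth_on :: "(real^2) set \<Rightarrow> (real^2 \<Rightarrow> real^2) \<Rightarrow> bool"
  where "oriented_smooth_on X f \<longleftrightarrow> smooth_on X f \<and>
    (\<forall>x\<in>X. det (matrix (frechet_derivative f (at x))) > 0)"

definition oriented_smooth_surface ::
    "'a::topological_space set \<Rightarrow> ('a, real^2) chart set \<Rightarrow> bool"
  where "oriented_smooth_surface S A \<longleftrightarrow> Hausdorff_space (top_of_set S) \<and>
    second_countable (top_of_set S) \<and> maximal_atlas_on oriented_smooth_on S A"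

abbreviation diffeomorphism :: "'a::topological_space set \<Rightarrow> ('a, real^2) chart set \<Rightarrow>
    'b::topological_space set \<Rightarrow> ('b, real^2) chart set \<Rightarrow> ('a \<Rightarrow> 'b) \<Rightarrow> bool"
  where "diffeomorphism \<equiv> isomorphism smooth_on"

definition closed_surface :: "'a topology \<Rightarrow> bool"
  where "closed_surface K \<longleftrightarrow> compact_space K \<and> Hausdorff_space K \<and>
    (\<forall>x\<in>topspace K. \<exists>U (V :: (real^2) set). openin K U \<and> x \<in> U \<and> open V \<and>
      subtopology K U homeomorphic_space top_of_set V)"

text \<open>Finite type: a closed surface minus finitely many points. The type \<open>'a + nat\<close> only serves
  to provide room for the missing points.\<close>

definition finite_type :: "'a::topological_space set \<Rightarrow> bool"
  where "finite_type S \<longleftrightarrow> (\<exists>(K :: ('a + nat) topology) F. closed_surface K \<and> finite F \<and>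
    F \<subseteq> topspace K \<and> top_of_set S homeomorphic_space subtopology K (topspace K - F))"

definition int_independent :: "('g, 'r) monoid_scheme \<Rightarrow> 'g set \<Rightarrow> bool"
  where "int_independent G B \<longleftrightarrow> finite B \<and> B \<subseteq> carrier G \<and>
    (\<forall>k :: 'g \<Rightarrow> int. finprod G (\<lambda>b. b [^]\<^bsub>G\<^esub> k b) B = \<one>\<^bsub>G\<^esub> \<longrightarrow> (\<forall>b\<in>B. k b = 0))"

text \<open>The rank of an abelian group (meaningful when it is finite).\<close>

definition abelian_rank :: "('g, 'r) monoid_scheme \<Rightarrow> nat"
  where "abelian_rank G = Max {card B | B. int_independent G B}"

text \<open>The homology of a surface is finitely generated when the surface has finite type, and
  vanishes above degree 2.\<close>

definition euler_char :: "'a::topological_space set \<Rightarrow> int"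
  where "euler_char S =
    (\<Sum>i\<le>2. (- 1) ^ i * int (abelian_rank (homology_group (int i) (top_of_set S))))"

section \<open>Fundamental group and universal cover\<close>

definition loop_class :: "'a::topological_space set \<Rightarrow> (real \<Rightarrow> 'a) \<Rightarrow> (real \<Rightarrow> 'a) set"
  where "loop_class S \<gamma> = {\<delta>. homotopic_paths S \<gamma> \<delta>}"

definition fundamental_group :: "'a::topological_space set \<Rightarrow> 'a \<Rightarrow> (real \<Rightarrow> 'a) set monoid"
  where "fundamental_group S x0 =
    \<lparr>carrier = {loop_class S \<gamma> | \<gamma>. path \<gamma> \<and> path_image \<gamma> \<subseteq> S \<and>
        pathstart \<gamma> = x0 \<and> pathfinish \<gamma> = x0},
     mult = (\<lambda>C D. {\<eta>. \<exists>\<gamma>\<in>C. \<exists>\<delta>\<in>D. homotopic_paths S (\<gamma> +++ \<delta>) \<eta>}),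
     one = loop_class S (\<lambda>_. x0)\<rparr>"

definition universal_cover ::
    "'b::topological_space set \<Rightarrow> ('b \<Rightarrow> 'a::topological_space) \<Rightarrow> 'a set \<Rightarrow> bool"
  where "universal_cover St p S \<longleftrightarrow> covering_space St p S \<and> simply_connected St"

definition deck_transformation ::
    "'b::topological_space set \<Rightarrow> ('b \<Rightarrow> 'a) \<Rightarrow> ('b \<Rightarrow> 'b) \<Rightarrow> bool"
  where "deck_transformation St p T \<longleftrightarrow>
    (\<exists>T'. homeomorphism St St T T') \<and> (\<forall>x\<in>St. p (T x) = p x)"

text \<open>Relative to the base point \<open>b\<close> of the universal cover, the class of a loop \<open>\<gamma>\<close> at \<open>p b\<close> acts
  as the deck transformation \<open>T\<close> for which \<open>T b\<close> is the endpoint of the lift of \<open>\<gamma>\<close> starting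
  at \<open>b\<close>. Below, \<open>\<gamma>\<close> stands for that lift.\<close>

definition equivariant :: "'a::topological_space set \<Rightarrow> 'b::topological_space set \<Rightarrow>
    ('b \<Rightarrow> 'a) \<Rightarrow> 'b \<Rightarrow> ((real \<Rightarrow> 'a) set \<Rightarrow> rp2 \<Rightarrow> rp2) \<Rightarrow> ('b \<Rightarrow> rp2) \<Rightarrow> bool"
  where "equivariant S St p b \<rho> \<phi> \<longleftrightarrow> (\<forall>T \<gamma>. deck_transformation St p T \<and>
    path \<gamma> \<and> path_image \<gamma> \<subseteq> St \<and> pathstart \<gamma> = b \<and> pathfinish \<gamma> = T b \<longrightarrow>
    (\<forall>x\<in>St. \<phi> (T x) = \<rho> (loop_class S (p \<circ> \<gamma>)) (\<phi> x)))"

section \<open>Convex projective structures\<close>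

definition locally_projective :: "rp2 set \<Rightarrow> (rp2 \<Rightarrow> rp2) \<Rightarrow> bool"
  where "locally_projective X t \<longleftrightarrow> (\<forall>x\<in>X. \<exists>W. open W \<and> x \<in> W \<and> W \<subseteq> X \<and>
    (\<exists>g\<in>carrier PGL3. \<forall>y\<in>W. t y = g y))"

definition rp2_surface :: "'c::topological_space set \<Rightarrow> ('c, rp2) chart set \<Rightarrow> bool"
  where "rp2_surface N B \<longleftrightarrow> Hausdorff_space (top_of_set N) \<and>
    second_countable (top_of_set N) \<and> maximal_atlas_on locally_projective N B"

abbreviation projective_isomorphism :: "'c::topological_space set \<Rightarrow> ('c, rp2) chart set \<Rightarrow>
    'd::topological_space set \<Rightarrow> ('d, rp2) chart set \<Rightarrow> ('c \<Rightarrow> 'd) \<Rightarrow> bool"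
  where "projective_isomorphism \<equiv> isomorphism locally_projective"

text \<open>Smooth coordinates on the projective plane, one chart for each projective frame.\<close>

definition affine_coords :: "real^3^3 \<Rightarrow> rp2 \<Rightarrow> real^2"
  where "affine_coords P x =
    (let v = P *v (SOME v. v \<noteq> 0 \<and> rp2_of v = x) in vector [v $ 1 / v $ 3, v $ 2 / v $ 3])"

definition rp2_smooth_charts :: "rp2 set \<Rightarrow> (rp2, real^2) chart set"
  where "rp2_smooth_charts \<Omega> =
    {(\<Omega> \<inter> {rp2_of v | v. (P *v v) $ 3 \<noteq> 0}, affine_coords P) | P. invertible P}"

definition underlying_smooth :: "('c, rp2) chart set \<Rightarrow> ('c, real^2) chart set"
  where "underlying_smooth B =
    {(U \<inter> c -` V, d \<circ> c) | U c V d. (U, c) \<in> B \<and> (V, d) \<in> rp2_smooth_charts UNIV}"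

text \<open>Since the atlas \<open>B\<close> is maximal, a developing map is a map on the universal cover that
  locally is a chart of \<open>B\<close>.\<close>

definition developing_map :: "'b::topological_space set \<Rightarrow> ('b \<Rightarrow> 'c) \<Rightarrow>
    ('c, rp2) chart set \<Rightarrow> ('b \<Rightarrow> rp2) \<Rightarrow> bool"
  where "developing_map Nt q B dev \<longleftrightarrow> (\<forall>x\<in>Nt. \<exists>V. openin (top_of_set Nt) V \<and> x \<in> V \<and>
    (\<exists>(U, c)\<in>B. q ` V \<subseteq> U \<and> (\<forall>y\<in>V. dev y = c (q y))))"

text \<open>Convexity is expressed with the developing map on a given universal cover \<open>q : Nt \<rightarrow> N\<close>; it does
  not depend on the choice of that cover, nor on that of the developing map.\<close>

definition convex_rp2_surface :: "'b::topological_space set \<Rightarrow> ('b \<Rightarrow> 'c) \<Rightarrow>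
    'c::topological_space set \<Rightarrow> ('c, rp2) chart set \<Rightarrow> bool"
  where "convex_rp2_surface Nt q N B \<longleftrightarrow> universal_cover Nt q N \<and> rp2_surface N B \<and>
    (\<exists>dev. developing_map Nt q B dev \<and> properly_convex (dev ` Nt) \<and>
      diffeomorphism Nt (pullback_charts Nt q (underlying_smooth B))
        (dev ` Nt) (rp2_smooth_charts (dev ` Nt)) dev)"

text \<open>A triple \<open>(f, N, B)\<close> is a surface \<open>N\<close> with maximal projective atlas \<open>B\<close> and marking
  \<open>f : S \<rightarrow> N\<close>. If \<open>p : St \<rightarrow> S\<close> is a universal cover, then so is \<open>f \<circ> p : St \<rightarrow> N\<close>.\<close>

type_synonym ('a, 'c) marked_surface = "('a \<Rightarrow> 'c) \<times> 'c set \<times> ('c, rp2) chart set"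

definition marked_convex :: "'a::topological_space set \<Rightarrow> ('a, real^2) chart set \<Rightarrow>
    'b::topological_space set \<Rightarrow> ('b \<Rightarrow> 'a) \<Rightarrow> ('a, 'c::topological_space) marked_surface \<Rightarrow> bool"
  where "marked_convex S A St p = (\<lambda>(f, N, B).
    diffeomorphism S A N (underlying_smooth B) f \<and> convex_rp2_surface St (f \<circ> p) N B)"

definition marking_equiv :: "'a set \<Rightarrow> ('a, 'c::topological_space) marked_surface \<Rightarrow>
    ('a, 'c) marked_surface \<Rightarrow> bool"
  where "marking_equiv S = (\<lambda>(f, N, B) (f', N', B').
    \<exists>h. projective_isomorphism N B N' B' h \<and>
      homotopic_with_canon (\<lambda>_. True) N N' (f' \<circ> inv_into S f) h)"

definition convex_structures :: "'a::topological_space set \<Rightarrow> ('a, real^2) chart set \<Rightarrow>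
    'b::topological_space set \<Rightarrow> ('b \<Rightarrow> 'a) \<Rightarrow> ('a, 'c::topological_space) marked_surface set set"
  where "convex_structures S A St p = {X. marked_convex S A St p X} //
    {(X, Y). marked_convex S A St p X \<and> marked_convex S A St p Y \<and> marking_equiv S X Y}"

definition developing_pair :: "'a::topological_space set \<Rightarrow> ('a, real^2) chart set \<Rightarrow>
    'b::topological_space set \<Rightarrow> ('b \<Rightarrow> 'a) \<Rightarrow> 'b \<Rightarrow> ('a, 'c::topological_space) marked_surface set \<Rightarrow>
    ('b \<Rightarrow> rp2) \<Rightarrow> ((real \<Rightarrow> 'a) set \<Rightarrow> rp2 \<Rightarrow> rp2) \<Rightarrow> bool"
  where "developing_pair S A St p b \<mu> \<phi> \<rho> \<longleftrightarrow>
    \<rho> \<in> hom (fundamental_group S (p b)) PGL3 \<and> equivariant S St p b \<rho> \<phi> \<and>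
    properly_convex (\<phi> ` St) \<and>
    diffeomorphism St (pullback_charts St p A) (\<phi> ` St) (rp2_smooth_charts (\<phi> ` St)) \<phi> \<and>
    (\<exists>(f, N, B)\<in>\<mu>. developing_map St (f \<circ> p) B \<phi>)"

definition holonomy :: "'a::topological_space set \<Rightarrow> ('a, real^2) chart set \<Rightarrow>
    'b::topological_space set \<Rightarrow> ('b \<Rightarrow> 'a) \<Rightarrow> 'b \<Rightarrow> ('a, 'c::topological_space) marked_surface set \<Rightarrow>
    ((real \<Rightarrow> 'a) set \<Rightarrow> rp2 \<Rightarrow> rp2) set"
  where "holonomy S A St p b \<mu> = {\<rho>. \<exists>\<phi>. developing_pair S A St p b \<mu> \<phi> \<rho>}"

definition developing_image :: "'a::topological_space set \<Rightarrow> ('a, real^2) chart set \<Rightarrow>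
    'b::topological_space set \<Rightarrow> ('b \<Rightarrow> 'a) \<Rightarrow> 'b \<Rightarrow> ('a, 'c::topological_space) marked_surface set \<Rightarrow>
    ((real \<Rightarrow> 'a) set \<Rightarrow> rp2 \<Rightarrow> rp2) \<Rightarrow> rp2 set \<Rightarrow> bool"
  where "developing_image S A St p b \<mu> \<rho> \<Omega> \<longleftrightarrow>
    (\<exists>\<phi>. developing_pair S A St p b \<mu> \<phi> \<rho> \<and> \<Omega> = \<phi> ` St)"

section \<open>Fixed points, hull and limit sets\<close>

definition nonsaddle_fixed_points :: "(rp2 \<Rightarrow> rp2) set \<Rightarrow> rp2 set"
  where "nonsaddle_fixed_points \<Gamma> =
    {x. \<exists>g\<in>\<Gamma>. g \<noteq> id \<and> g x = x} - {x. \<exists>g\<in>\<Gamma>. hyperbolic g \<and> saddle_point g x}"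

definition hull_interior :: "real^3 \<Rightarrow> rp2 set \<Rightarrow> rp2 set \<Rightarrow> rp2 set"
  where "hull_interior a \<Omega> X = interior (chart_hull a (closure X) \<inter> \<Omega>)"

definition boundary_accumulation :: "(rp2 \<Rightarrow> rp2) set \<Rightarrow> rp2 set \<Rightarrow> rp2 \<Rightarrow> rp2 set"
  where "boundary_accumulation \<Gamma> D x = {y \<in> frontier D. y islimpt {g x | g. g \<in> \<Gamma>}}"

end

theory Submission
  imports Defs
begin

text \<open>Let \<open>C\<close> be the open convex cone over \<open>\<Omega>\<close>; the deck group \<open>\<Gamma>\<close> acts on it by matrices, and on
  \<open>\<Omega>\<close> freely and without accumulation points. If a sequence \<open>A\<^sub>n\<close> of such matrices leaves every
  compact part of \<open>C\<close>, the rescaled sequence has a limit \<open>T\<close> that is not invertible. When \<open>C\<close> is not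
  simplicial, \<open>T\<close> has rank one, \<open>T x = (\<phi> \<bullet> x) u\<close> with \<open>\<phi> > 0\<close> on \<open>C\<close>. So every orbit accumulates at
  \<open>[u]\<close>, and so does \<open>\<Gamma> f\<close> for every \<open>f \<in> F\<close> with \<open>\<phi> \<bullet> f \<noteq> 0\<close>, which exists because a point of \<open>\<Omega>\<close> lies
  in the hull of \<open>F\<close>; since \<open>F\<close> is invariant, \<open>[u]\<close> is in its closure. Conversely the powers of \<open>g\<^sup>2\<close> and
  \<open>g\<^sup>-\<^sup>2\<close> attract to two (possibly equal) fixed points of \<open>g\<^sup>2\<close>, and any other fixed point of \<open>g\<close> outside
  \<open>\<Omega>\<close> is a saddle point of \<open>g\<^sup>2\<close>.

  A simplicial \<open>C\<close> is excluded by the Euler characteristic. The matrices are then monomial, and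
  \<open>\<Gamma>\<close> is a lattice of translations in logarithmic coordinates, up to swaps of two vertices. As \<open>\<Omega>\<close> is
  contractible, \<open>H\<^sub>1(S)\<close> consists of the classes of elements of \<open>\<Gamma>\<close>; it has rank at most one unless
  \<open>\<Gamma>\<close> is a rank two lattice, in which case the Koszul complex shows that \<open>H\<^sub>2(S)\<close> has positive
  rank.\<close>

section \<open>The Koszul complex of a free action of two commuting permutations\<close>

text \<open>The triangle is a genuine exception, which is why the Euler characteristic has to enter.
  The maps diag(4^n, 4^n, 1) act freely on the open coordinate triangle, with an annulus as
  quotient. None of them is hyperbolic, so \<open>F\<close> contains a whole projective line, while
  each orbit accumulates at only two points. When the cone is not simplicial, rank one limits force
  the points of \<open>F\<close> to be limits of orbits, and only this places \<open>F\<close> in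
  the closure of the domain. The square of g is taken because a lift of g to the cone may have a
  negative eigenvalue on a fixed line outside the domain. Then g need not be diagonalizable with
  positive entries, whereas for the square the eigenvalue is positive and its position among the
  other two decides between attracting, saddle and repelling. In the simplicial case the homology is
  compared directly with the group. Since the rank of H_0 is at least 1, it suffices that the rank
  of H_1 is at most 1, or that it is at most 2 and H_2 contains a class of infinite order. An upper
  bound for the rank of H_2 is needed as well, since the rank is a maximum that is meaningful only
  for bounded sets.\<close>

definition frag_push :: "('x \<Rightarrow> 'y) \<Rightarrow> ('x \<Rightarrow>\<^sub>0 int) \<Rightarrow> ('y \<Rightarrow>\<^sub>0 int)"
  where "frag_push f = frag_extend (frag_of \<circ> f)"

lemma frag_push_0 [simp]: "frag_push f 0 = 0"
  and frag_push_of [simp]: "frag_push f (frag_of x) = frag_of (f x)"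
  and frag_push_diff: "frag_push f (a - b) = frag_push f a - frag_push f b"
  and frag_push_add: "frag_push f (a + b) = frag_push f a + frag_push f b"
  and frag_push_minus: "frag_push f (- a) = - frag_push f a"
  and frag_push_cmul: "frag_push f (frag_cmul k a) = frag_cmul k (frag_push f a)"
  by (simp_all add: frag_push_def frag_extend_diff frag_extend_add frag_extend_minus
      frag_extend_cmul)

lemma frag_push_comp: "frag_push f (frag_push g a) = frag_push (f \<circ> g) a"
  by (simp add: frag_push_def frag_extend_compose flip: comp_assoc)

lemma frag_push_cong:
  assumes "Poly_Mapping.keys a \<subseteq> X" "\<And>x. x \<in> X \<Longrightarrow> f x = g x"
  shows "frag_push f a = frag_push g a"
  unfolding frag_push_def using assms by (intro frag_extend_eq) auto

lemma keys_frag_push: "Poly_Mapping.keys (frag_push f a) \<subseteq> f ` Poly_Mapping.keys a"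
  unfolding frag_push_def using keys_frag_extend[of "frag_of \<circ> f" a] by (auto simp: keys_frag_of)

lemma keys_frag_push_subset:
  assumes "Poly_Mapping.keys a \<subseteq> X" "f ` X \<subseteq> Y"
  shows "Poly_Mapping.keys (frag_push f a) \<subseteq> Y"
  using keys_frag_push[of f a] assms by blast

lemma keys_diff_subset:
  assumes "Poly_Mapping.keys a \<subseteq> X" "Poly_Mapping.keys b \<subseteq> X"
  shows "Poly_Mapping.keys (a - b :: 'x \<Rightarrow>\<^sub>0 int) \<subseteq> X"
  using keys_diff[of a b] assms by blast

text \<open>The support condition is carried along as part of the induction predicate, so that the
  difference step may assume it for both chains.\<close>

lemma frag_induction_keys [consumes 1, case_names zero one diff]:
  assumes "Poly_Mapping.keys c \<subseteq> S" "P 0" "\<And>x. x \<in> S \<Longrightarrow> P (frag_of x)"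
    and "\<And>a b. \<lbrakk>Poly_Mapping.keys a \<subseteq> S; Poly_Mapping.keys b \<subseteq> S; P a; P b\<rbrakk> \<Longrightarrow> P (a - b)"
  shows "P c"
proof -
  have "Poly_Mapping.keys c \<subseteq> S \<and> P c"
    using assms(1)
    by (induction c rule: frag_induction) (auto simp: assms keys_frag_of keys_diff_subset)
  then show ?thesis ..
qed

text \<open>A telescoping sum: w is x + t x + ... up to the iterate n - 1.\<close>

lemma frag_orbit_difference:
  assumes t: "t ` X \<subseteq> X" and x: "x \<in> X"
  shows "\<exists>w. Poly_Mapping.keys w \<subseteq> X \<and> frag_of x - frag_of ((t ^^ n) x) = w - frag_push t w"
proof (induction n)
  case 0
  then show ?case by (intro exI[of _ 0]) simp
next
  case (Suc n)
  then obtain w where w: "Poly_Mapping.keys w \<subseteq> X"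
    "frag_of x - frag_of ((t ^^ n) x) = w - frag_push t w" by blast
  have inX: "(t ^^ n) x \<in> X" using t x by (induction n) auto
  show ?case
  proof (intro exI conjI)
    show "Poly_Mapping.keys (w + frag_of ((t ^^ n) x)) \<subseteq> X"
      using w inX keys_add[of w "frag_of ((t ^^ n) x)"] by (auto simp: keys_frag_of)
    show "frag_of x - frag_of ((t ^^ Suc n) x) =
        w + frag_of ((t ^^ n) x) - frag_push t (w + frag_of ((t ^^ n) x))"
      using w(2) by (simp add: frag_push_add algebra_simps)
  qed
qed

text \<open>Let r pick a representative in each fibre of f. Every generator x differs from r (f x)
  by an element of the image of 1 - t, because forward iterates of the two meet. Hence a is
  congruent to its image under \<open>r \<circ> f\<close>, and that image vanishes with the image
  under f.\<close>

lemma frag_push_kernel: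
  assumes t: "t ` X \<subseteq> X"
    and fib: "\<And>x y. \<lbrakk>x \<in> X; y \<in> X; f x = f y\<rbrakk> \<Longrightarrow> \<exists>m n. (t ^^ m) x = (t ^^ n) y"
    and a: "Poly_Mapping.keys a \<subseteq> X" and ker: "frag_push f a = 0"
  shows "\<exists>w. Poly_Mapping.keys w \<subseteq> X \<and> a = w - frag_push t w"
proof -
  define r where "r y = (SOME x. x \<in> X \<and> f x = y)" for y
  have r: "r (f x) \<in> X" "f (r (f x)) = f x" if "x \<in> X" for x
    unfolding r_def using that by (metis (mono_tags, lifting) someI_ex)+
  have "\<exists>w. Poly_Mapping.keys w \<subseteq> X \<and> a - frag_push (r \<circ> f) a = w - frag_push t w"
    using a
  proof (induction a rule: frag_induction_keys)
    case zero
    then show ?case by (intro exI[of _ 0]) simp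
  next
    case (one x)
    obtain m n where mn: "(t ^^ m) x = (t ^^ n) (r (f x))"
      using fib[of x "r (f x)"] r one by metis
    obtain v where v: "Poly_Mapping.keys v \<subseteq> X"
      "frag_of x - frag_of ((t ^^ m) x) = v - frag_push t v"
      using frag_orbit_difference[OF t one] by blast
    obtain w where w: "Poly_Mapping.keys w \<subseteq> X"
      "frag_of (r (f x)) - frag_of ((t ^^ n) (r (f x))) = w - frag_push t w"
      using frag_orbit_difference[OF t] r one by blast
    have "frag_of x - frag_push (r \<circ> f) (frag_of x) = (v - w) - frag_push t (v - w)"
      using v(2) w(2) mn by (simp add: frag_push_diff algebra_simps)
    then show ?case using keys_diff_subset[OF v(1) w(1)] by blast
  next
    case (diff a b)
    obtain v w where "Poly_Mapping.keys v \<subseteq> X" "Poly_Mapping.keys w \<subseteq> X"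
      "a - frag_push (r \<circ> f) a = v - frag_push t v" "b - frag_push (r \<circ> f) b = w - frag_push t w"
      using diff.IH by blast
    moreover have "(a - b) - frag_push (r \<circ> f) (a - b) =
        (a - frag_push (r \<circ> f) a) - (b - frag_push (r \<circ> f) b)"
      by (simp add: frag_push_diff)
    ultimately show ?case
      by (intro exI[of _ "v - w"]) (simp add: frag_push_diff keys_diff_subset del: o_apply)
  qed
  moreover have "frag_push (r \<circ> f) a = 0"
    using ker by (simp flip: frag_push_comp)
  ultimately show ?thesis by simp
qed

text \<open>The finite support of a would be mapped onto itself by t and so contain the infinite
  forward orbit of one of its points.\<close>

lemma frag_push_fixed_imp_zero:
  assumes t: "t ` X \<subseteq> X"
    and free: "\<And>x m n. \<lbrakk>x \<in> X; (t ^^ m) x = (t ^^ n) x\<rbrakk> \<Longrightarrow> m = n"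
    and a: "Poly_Mapping.keys a \<subseteq> X" and fixed: "a = frag_push t a"
  shows "a = 0"
proof (rule ccontr)
  assume "a \<noteq> 0"
  let ?K = "Poly_Mapping.keys a"
  obtain x where x: "x \<in> ?K" using \<open>a \<noteq> 0\<close> by fastforce
  have "?K \<subseteq> t ` ?K" using keys_frag_push[of t a] fixed by simp
  then have tK: "t ` ?K = ?K"
    by (metis card_image_le card_seteq finite_imageI finite_keys)
  then have "(t ^^ n) x \<in> ?K" for n using x by (induction n) auto
  then have "range (\<lambda>n. (t ^^ n) x) \<subseteq> ?K" by blast
  moreover have "inj (\<lambda>n. (t ^^ n) x)" using free a x by (auto intro!: injI)
  ultimately show False
    using finite_subset[OF _ finite_keys] finite_imageD infinite_UNIV_nat by blast
qed

lemma funpow_commute_on: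
  assumes "s ` X \<subseteq> X" "t ` X \<subseteq> X" "\<And>x. x \<in> X \<Longrightarrow> s (t x) = t (s x)" "x \<in> X"
  shows "(s ^^ i) ((t ^^ j) x) = (t ^^ j) ((s ^^ i) x)"
proof -
  have tX: "(t ^^ j) y \<in> X" if "y \<in> X" for y j using assms(2) that by (induction j) auto
  have sX: "(s ^^ i) y \<in> X" if "y \<in> X" for y i using assms(1) that by (induction i) auto
  have *: "s ((t ^^ j) y) = (t ^^ j) (s y)" if "y \<in> X" for y
    using that by (induction j) (auto simp: assms(3) tX)
  show ?thesis using assms(4) by (induction i) (auto simp: * sX)
qed

text \<open>An action of the free abelian group of rank two without mention of inverses: an integer
  exponent appears as a pair of natural exponents on the two sides of an equation.\<close>

locale free_Z2_action =
  fixes X :: "'x set" and s t :: "'x \<Rightarrow> 'x"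
  assumes s_closed: "s ` X \<subseteq> X" and t_closed: "t ` X \<subseteq> X"
    and commute: "x \<in> X \<Longrightarrow> s (t x) = t (s x)"
    and free: "\<lbrakk>x \<in> X; (s ^^ i) ((t ^^ j) x) = (s ^^ i') ((t ^^ j') x)\<rbrakk> \<Longrightarrow> i = i' \<and> j = j'"
begin

lemma funpow_closed:
  assumes "x \<in> X"
  shows "(s ^^ n) x \<in> X" and "(t ^^ n) x \<in> X"
  using s_closed t_closed assms by (induction n) auto

lemma funpow_commute: "x \<in> X \<Longrightarrow> (s ^^ i) ((t ^^ j) x) = (t ^^ j) ((s ^^ i) x)"
  using funpow_commute_on[OF s_closed t_closed commute] by blast

text \<open>Two points belong together when some forward iterates of them meet; for an invertible
  map this is its usual orbit relation.\<close>

definition orb :: "'x \<Rightarrow> 'x set"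
  where "orb x = {y \<in> X. \<exists>m n. (t ^^ m) x = (t ^^ n) y}"

text \<open>The map that s induces on t-orbits. The choice of a representative is harmless because s
  commutes with t.\<close>

definition orb_shift :: "'x set \<Rightarrow> 'x set"
  where "orb_shift O' = orb (s (SOME x. x \<in> O'))"

lemma orb_eq_iff:
  assumes "x \<in> X" "y \<in> X"
  shows "orb x = orb y \<longleftrightarrow> (\<exists>m n. (t ^^ m) x = (t ^^ n) y)"
proof
  assume "orb x = orb y"
  moreover have "y \<in> orb y" using assms by (auto simp: orb_def)
  ultimately have "y \<in> orb x" by simp
  then show "\<exists>m n. (t ^^ m) x = (t ^^ n) y" unfolding orb_def by blast
next
  have sub: "orb y \<subseteq> orb x" if xy: "(t ^^ m) x = (t ^^ n) y" for x y m n
  proof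
    fix z assume "z \<in> orb y"
    then obtain k l where z: "z \<in> X" "(t ^^ k) y = (t ^^ l) z" by (auto simp: orb_def)
    have "(t ^^ (k + m)) x = (t ^^ (n + k)) y" by (simp add: funpow_add xy add.commute[of n k])
    also have "\<dots> = (t ^^ (n + l)) z" by (simp add: funpow_add z)
    finally show "z \<in> orb x" using z unfolding orb_def by blast
  qed
  assume "\<exists>m n. (t ^^ m) x = (t ^^ n) y"
  then obtain m n where "(t ^^ m) x = (t ^^ n) y" by blast
  then show "orb x = orb y" using sub[of m x n y] sub[of n y m x] by (metis subset_antisym)
qed

lemma orb_shift_orb:
  assumes x: "x \<in> X"
  shows "orb_shift (orb x) = orb (s x)"
proof -
  define y where "y = (SOME y. y \<in> orb x)"
  have "x \<in> orb x" using x by (auto simp: orb_def)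
  then have y: "y \<in> orb x" unfolding y_def by (metis someI)
  then obtain m n where mn: "y \<in> X" "(t ^^ m) x = (t ^^ n) y" by (auto simp: orb_def)
  have "(t ^^ m) (s x) = s ((t ^^ m) x)" using funpow_commute[of x 1 m] x by simp
  also have "\<dots> = (t ^^ n) (s y)" using funpow_commute[of y 1 n] mn by simp
  finally have "orb (s x) = orb (s y)"
    using x mn s_closed by (subst orb_eq_iff) auto
  then show ?thesis by (simp add: orb_shift_def y_def)
qed

lemma orb_shift_funpow: "x \<in> X \<Longrightarrow> (orb_shift ^^ n) (orb x) = orb ((s ^^ n) x)"
  by (induction n) (simp_all add: orb_shift_orb funpow_closed)

lemma orb_shift_closed: "orb_shift ` orb ` X \<subseteq> orb ` X"
  using s_closed by (auto simp: orb_shift_orb)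

lemma frag_push_orb_t:
  assumes "Poly_Mapping.keys a \<subseteq> X"
  shows "frag_push orb (frag_push t a) = frag_push orb a"
  unfolding frag_push_comp
proof (rule frag_push_cong[OF assms])
  fix x assume x: "x \<in> X"
  have "(t ^^ 0) (t x) = (t ^^ 1) x" by simp
  then have "orb (t x) = orb x"
    using orb_eq_iff[of "t x" x] x t_closed by blast
  then show "(orb \<circ> t) x = orb x" by simp
qed

lemma frag_push_orb_s:
  assumes "Poly_Mapping.keys a \<subseteq> X"
  shows "frag_push orb (frag_push s a) = frag_push orb_shift (frag_push orb a)"
  unfolding frag_push_comp by (rule frag_push_cong[OF assms]) (simp add: orb_shift_orb)

lemma orb_fibres: "\<lbrakk>x \<in> X; y \<in> X; orb x = orb y\<rbrakk> \<Longrightarrow> \<exists>m n. (t ^^ m) x = (t ^^ n) y"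
  by (simp add: orb_eq_iff)

lemma t_free: "\<lbrakk>x \<in> X; (t ^^ m) x = (t ^^ n) x\<rbrakk> \<Longrightarrow> m = n"
  using free[of x 0 m 0 n] by simp

text \<open>Exactness of the Koszul complex of \<open>1 - s\<close>, \<open>1 - t\<close> in the middle: modulo the image of
  \<open>1 - t\<close> one obtains the free group on the \<open>t\<close>-orbits, on which \<open>1 - s\<close> is injective.\<close>

lemma koszul_middle:
  assumes a: "Poly_Mapping.keys a \<subseteq> X" and b: "Poly_Mapping.keys b \<subseteq> X"
    and eq: "a - frag_push s a = b - frag_push t b"
  shows "\<exists>w. Poly_Mapping.keys w \<subseteq> X \<and> a = w - frag_push t w \<and> b = w - frag_push s w"
proof -
  have "frag_push orb (a - frag_push s a) = frag_push orb (b - frag_push t b)"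
    using eq by simp
  then have fixed: "frag_push orb a = frag_push orb_shift (frag_push orb a)"
    using a b by (simp add: frag_push_diff frag_push_orb_t frag_push_orb_s)
  have "frag_push orb a = 0"
  proof (rule frag_push_fixed_imp_zero[OF orb_shift_closed _ _ fixed])
    fix u m n assume "u \<in> orb ` X" and eq: "(orb_shift ^^ m) u = (orb_shift ^^ n) u"
    then obtain x where x: "x \<in> X" "u = orb x" by blast
    then obtain i j where "(t ^^ i) ((s ^^ m) x) = (t ^^ j) ((s ^^ n) x)"
      using eq by (auto simp: orb_shift_funpow orb_eq_iff funpow_closed)
    then show "m = n" using x free[of x m i n j] by (simp add: funpow_commute)
  qed (rule keys_frag_push_subset[OF a subset_refl])
  then obtain w where w: "Poly_Mapping.keys w \<subseteq> X" "a = w - frag_push t w"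
    using frag_push_kernel[OF t_closed orb_fibres a] by blast
  have st: "frag_push s (frag_push t w) = frag_push t (frag_push s w)"
    unfolding frag_push_comp by (rule frag_push_cong[OF w(1)]) (simp add: commute)
  \<comment> \<open>The defect of b is fixed by t because 1 - s and 1 - t commute, and a finitely
    supported chain fixed by a free map is zero.\<close>
  let ?d = "b - (w - frag_push s w)"
  have "?d = frag_push t ?d"
    using eq by (simp add: w(2) frag_push_diff frag_push_add st algebra_simps)
  moreover have "Poly_Mapping.keys ?d \<subseteq> X"
    by (intro keys_diff_subset b w keys_frag_push_subset[OF w(1) s_closed])
  ultimately have "?d = 0"
    using t_free by (intro frag_push_fixed_imp_zero[OF t_closed])
  then show ?thesis using w by auto
qed

text \<open>Exactness at the end, in two stages. On the set of t-orbits the fibres of the map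
  induced by f are orbits of the induced shift, so the kernel lemma applies there; what remains
  after lifting that solution dies on t-orbits, and the same lemma applies to t.\<close>

lemma koszul_end:
  assumes fib: "\<And>x y. \<lbrakk>x \<in> X; y \<in> X; f x = f y\<rbrakk> \<Longrightarrow>
      \<exists>i j i' j'. (s ^^ i) ((t ^^ j) x) = (s ^^ i') ((t ^^ j') y)"
    and inv: "\<And>x. x \<in> X \<Longrightarrow> f (t x) = f x"
    and a: "Poly_Mapping.keys a \<subseteq> X" and ker: "frag_push f a = 0"
  shows "\<exists>v w. Poly_Mapping.keys v \<subseteq> X \<and> Poly_Mapping.keys w \<subseteq> X \<and>
    a = (v - frag_push s v) + (w - frag_push t w)"
proof -
  have inv': "f ((t ^^ n) x) = f x" if "x \<in> X" for x n
    using that by (induction n) (auto simp: inv funpow_closed)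
  define r where "r u = (SOME x. x \<in> X \<and> orb x = u)" for u
  have r: "r (orb x) \<in> X" "orb (r (orb x)) = orb x" if "x \<in> X" for x
    unfolding r_def using that by (metis (mono_tags, lifting) someI_ex)+
  have fr: "f (r (orb x)) = f x" if "x \<in> X" for x
    using orb_fibres[OF r(1) that r(2)] that inv' r by metis
  have "frag_push (f \<circ> r) (frag_push orb a) = 0"
    using ker frag_push_cong[OF a, of "f \<circ> r \<circ> orb" f] by (simp add: frag_push_comp fr)
  moreover have "Poly_Mapping.keys (frag_push orb a) \<subseteq> orb ` X"
    by (rule keys_frag_push_subset[OF a subset_refl])
  moreover have "\<exists>m n. (orb_shift ^^ m) u = (orb_shift ^^ n) v"
    if uv: "u \<in> orb ` X" "v \<in> orb ` X" "(f \<circ> r) u = (f \<circ> r) v" for u v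
  proof -
    obtain x y where xy: "x \<in> X" "y \<in> X" "u = orb x" "v = orb y" using uv by blast
    then obtain i j i' j' where "(s ^^ i) ((t ^^ j) x) = (s ^^ i') ((t ^^ j') y)"
      using fib[of x y] uv(3) by (auto simp: fr)
    then have "(orb_shift ^^ i) u = (orb_shift ^^ i') v"
      using xy by (auto simp: orb_shift_funpow orb_eq_iff funpow_closed funpow_commute)
    then show ?thesis by blast
  qed
  ultimately have "\<exists>W. Poly_Mapping.keys W \<subseteq> orb ` X \<and>
      frag_push orb a = W - frag_push orb_shift W"
    by (intro frag_push_kernel[OF orb_shift_closed, where f = "f \<circ> r"])
  then obtain W where W: "Poly_Mapping.keys W \<subseteq> orb ` X"
    "frag_push orb a = W - frag_push orb_shift W"
    by blast
  \<comment> \<open>Chosen representatives lift the solution W from the orbit set to X. After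
    subtraction of v - s v the chain maps to zero on t-orbits.\<close>
  define v where "v = frag_push r W"
  have v: "Poly_Mapping.keys v \<subseteq> X"
    unfolding v_def using r by (intro keys_frag_push_subset[OF W(1)]) auto
  have "frag_push orb v = W"
    unfolding v_def frag_push_comp
    using frag_push_cong[OF W(1), of "orb \<circ> r" id] r
    by (auto simp: frag_push_def frag_expansion[symmetric])
  then have "frag_push orb (a - (v - frag_push s v)) = 0"
    using W(2) by (simp add: frag_push_diff frag_push_orb_s[OF v])
  moreover have "Poly_Mapping.keys (a - (v - frag_push s v)) \<subseteq> X"
    by (intro keys_diff_subset a v keys_frag_push_subset[OF v s_closed])
  ultimately obtain w where w: "Poly_Mapping.keys w \<subseteq> X"
      "a - (v - frag_push s v) = w - frag_push t w"
    using frag_push_kernel[OF t_closed orb_fibres] by blast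
  then have "a = (v - frag_push s v) + (w - frag_push t w)" by (simp add: algebra_simps)
  with v w show ?thesis by blast
qed

end

section \<open>Covering spaces of arbitrary topological spaces\<close>

lemma continuous_on_locally_imp:
  fixes f :: "'a::topological_space \<Rightarrow> 'b::topological_space"
  assumes "\<And>x. x \<in> X \<Longrightarrow> \<exists>V. openin (top_of_set X) V \<and> x \<in> V \<and> continuous_on V f"
  shows "continuous_on X f"
  unfolding continuous_on_topological
proof (intro ballI allI impI)
  fix x B assume x: "x \<in> X" and B: "open B" "f x \<in> B"
  obtain V where V: "openin (top_of_set X) V" "x \<in> V" "continuous_on V f"
    using assms[OF x] by blast
  obtain O1 where O1: "open O1" "V = X \<inter> O1" using V(1) by (auto simp: openin_open)
  obtain O2 where O2: "open O2" "x \<in> O2" "\<forall>y\<in>V. y \<in> O2 \<longrightarrow> f y \<in> B"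
    using V B unfolding continuous_on_topological by metis
  show "\<exists>A. open A \<and> x \<in> A \<and> (\<forall>y\<in>X. y \<in> A \<longrightarrow> f y \<in> B)"
    using O1 O2 V by (intro exI[of _ "O1 \<inter> O2"]) auto
qed

text \<open>The library proves uniqueness and existence of lifts only for subsets of normed spaces.\<close>

lemma covering_sheet:
  assumes "covering_space C p S" "x \<in> C"
  obtains T u q where "openin (top_of_set S) T" "p x \<in> T" "x \<in> u"
    "openin (top_of_set C) u" "homeomorphism u T p q"
    "\<And>y. \<lbrakk>y \<in> C; p y \<in> T; y \<notin> u\<rbrakk> \<Longrightarrow>
       \<exists>u'. y \<in> u' \<and> openin (top_of_set C) u' \<and> u' \<inter> u = {}"
proof -
  have "p x \<in> S" using assms by (auto simp: covering_space_def)
  then obtain T v where T: "p x \<in> T" "openin (top_of_set S) T" "\<Union>v = C \<inter> p -` T"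
    "\<forall>u \<in> v. openin (top_of_set C) u" "pairwise disjnt v" "\<forall>u\<in>v. \<exists>q. homeomorphism u T p q"
    using assms(1) unfolding covering_space_def by metis
  then obtain u where u: "u \<in> v" "x \<in> u" using assms(2) by blast
  then obtain q where "homeomorphism u T p q" using T by blast
  moreover have sep: "\<exists>u'. y \<in> u' \<and> openin (top_of_set C) u' \<and> u' \<inter> u = {}"
    if y: "y \<in> C" "p y \<in> T" "y \<notin> u" for y
  proof -
    obtain u' where "u' \<in> v" "y \<in> u'" using T y by blast
    then show ?thesis using T(4,5) u y by (metis disjnt_def pairwise_def)
  qed
  ultimately show ?thesis using that[of T u q] T u by blast
qed

text \<open>The set of agreement is open and closed in U. A sheet around a common value gives
  openness, by injectivity of p on the sheet. Distinct values over one point lie in disjoint sheets,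
  which replaces a separation axiom for C.\<close>

lemma lift_unique:
  fixes g1 :: "'z::topological_space \<Rightarrow> 'a::topological_space"
  assumes cov: "covering_space C p S" and conn: "connected U"
    and g1: "continuous_on U g1" "g1 ` U \<subseteq> C" and g2: "continuous_on U g2" "g2 ` U \<subseteq> C"
    and eq: "\<And>x. x \<in> U \<Longrightarrow> p (g1 x) = p (g2 x)"
    and a: "a \<in> U" "g1 a = g2 a" and x: "x \<in> U"
  shows "g1 x = g2 x"
proof -
  let ?E = "{x \<in> U. g1 x = g2 x}"
  have pre: "openin (top_of_set U) (U \<inter> g -` u)"
    if "continuous_on U g" "g ` U \<subseteq> C" "openin (top_of_set C) u"
    for g :: "'z \<Rightarrow> 'a" and u
    using that continuous_openin_preimage[of U g C u] by (auto simp: image_subset_iff_funcset)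
  have "openin (top_of_set U) ?E"
  proof (subst openin_subopen, safe)
    fix z assume z: "z \<in> U" "g1 z = g2 z"
    obtain T u q where u: "g1 z \<in> u" "openin (top_of_set C) u" "homeomorphism u T p q"
      using covering_sheet[OF cov] g1(2) z(1) by (metis image_subset_iff)
    let ?V = "(U \<inter> g1 -` u) \<inter> (U \<inter> g2 -` u)"
    have "openin (top_of_set U) ?V" by (intro openin_Int pre g1 g2 u)
    moreover have "z \<in> ?V" using z u by auto
    moreover have "?V \<subseteq> ?E"
      using eq u(3) by (auto simp: homeomorphism_def) metis
    ultimately show "\<exists>V. openin (top_of_set U) V \<and> z \<in> V \<and> V \<subseteq> ?E" by blast
  qed
  moreover have "openin (top_of_set U) (U - ?E)"
  proof (subst openin_subopen, intro ballI)
    fix z assume "z \<in> U - ?E"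
    then have z: "z \<in> U" "g1 z \<noteq> g2 z" by auto
    have gz: "g1 z \<in> C" "g2 z \<in> C" using g1(2) g2(2) z(1) by auto
    obtain T u q where u: "g1 z \<in> u" "openin (top_of_set C) u" "homeomorphism u T p q" "p (g1 z) \<in> T"
      "\<And>y. \<lbrakk>y \<in> C; p y \<in> T; y \<notin> u\<rbrakk> \<Longrightarrow> \<exists>u'. y \<in> u' \<and> openin (top_of_set C) u' \<and> u' \<inter> u = {}"
      using covering_sheet[OF cov gz(1)] by metis
    have "g2 z \<notin> u"
      using u(1,3) z eq[OF z(1)] by (auto simp: homeomorphism_def) metis
    then obtain u' where u': "g2 z \<in> u'" "openin (top_of_set C) u'" "u' \<inter> u = {}"
      using u(4,5) gz eq[OF z(1)] by metis
    let ?V = "(U \<inter> g1 -` u) \<inter> (U \<inter> g2 -` u')"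
    have "openin (top_of_set U) ?V" by (intro openin_Int pre g1 g2 u u')
    moreover have "z \<in> ?V" using z u u' by auto
    moreover have "?V \<subseteq> U - ?E" using u'(3) by auto
    ultimately show "\<exists>V. openin (top_of_set U) V \<and> z \<in> V \<and> V \<subseteq> U - ?E" by blast
  qed
  ultimately have "?E = U"
    using conn a unfolding connected_clopen closedin_def by (auto simp: topspace_euclidean_subtopology)
  then show ?thesis using x by blast
qed

text \<open>Bolzano's subdivision principle on the unit interval: short intervals lift through one
  evenly covered set, and lifts over adjacent intervals are glued after shrinking the neighbourhood
  of y.\<close>

lemma lift_tube:
  fixes h :: "real \<times> 'z::topological_space \<Rightarrow> 's::topological_space"
    and p :: "'a::topological_space \<Rightarrow> 's"
  assumes cov: "covering_space C p S"
    and h: "continuous_on ({0..1} \<times> U) h" "h ` ({0..1} \<times> U) \<subseteq> S"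
    and f: "continuous_on U f" "f ` U \<subseteq> C" "\<And>z. z \<in> U \<Longrightarrow> p (f z) = h (0, z)"
    and y: "y \<in> U"
  obtains N k where "openin (top_of_set U) N" "y \<in> N" "continuous_on ({0..1} \<times> N) k"
    "k ` ({0..1} \<times> N) \<subseteq> C" "\<And>z. z \<in> N \<Longrightarrow> k (0, z) = f z"
    "\<And>w. w \<in> {0..1} \<times> N \<Longrightarrow> p (k w) = h w"
proof -
  define good where "good s t N f N' k \<longleftrightarrow> openin (top_of_set U) N' \<and> y \<in> N' \<and> N' \<subseteq> N \<and>
      continuous_on ({s..t} \<times> N') k \<and> k ` ({s..t} \<times> N') \<subseteq> C \<and>
      (\<forall>z\<in>N'. k (s, z) = f z) \<and> (\<forall>w\<in>{s..t} \<times> N'. p (k w) = h w)"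
    for s t :: real and N f N' k
  \<comment> \<open>All neighbourhoods and all initial lifts are quantified inside P, because the
    second interval starts from the end of the first lift and on the neighbourhood to which that
    lift has been cut down.\<close>
  define P where "P s t \<longleftrightarrow> (0 \<le> s \<and> s \<le> t \<and> t \<le> 1 \<longrightarrow>
      (\<forall>N f. openin (top_of_set U) N \<and> y \<in> N \<and> continuous_on N f \<and> f ` N \<subseteq> C \<and>
        (\<forall>z\<in>N. p (f z) = h (s, z)) \<longrightarrow> (\<exists>N' k. good s t N f N' k)))" for s t
  have "P 0 1"
  proof (rule Bolzano)
    fix a b c :: real assume Pab: "P a b" and Pbc: "P b c" and abc: "a \<le> b" "b \<le> c"
    show "P a c" unfolding P_def
    proof (intro impI allI)
      fix N f assume ac: "0 \<le> a \<and> a \<le> c \<and> c \<le> 1"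
        and N: "openin (top_of_set U) N \<and> y \<in> N \<and> continuous_on N f \<and> f ` N \<subseteq> C \<and>
          (\<forall>z\<in>N. p (f z) = h (a, z))"
      obtain N1 k1 where 1: "good a b N f N1 k1"
        using Pab ac abc N unfolding P_def by (meson order_trans)
      have "continuous_on N1 (\<lambda>z. k1 (b, z))"
        using 1 abc unfolding good_def
        by (intro continuous_on_compose2[of "{a..b} \<times> N1" k1 N1 "\<lambda>z. (b, z)"] continuous_intros) auto
      moreover have "(\<lambda>z. k1 (b, z)) ` N1 \<subseteq> C" "\<forall>z\<in>N1. p (k1 (b, z)) = h (b, z)"
        using 1 abc unfolding good_def by auto
      ultimately obtain N2 k2 where 2: "good b c N1 (\<lambda>z. k1 (b, z)) N2 k2"
        using Pbc ac abc 1 unfolding P_def good_def[of a b] by (metis order_trans)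
      define k where "k = (\<lambda>w. if fst w \<le> b then k1 w else k2 w)"
      have "continuous_on ({a..c} \<times> N2) k" unfolding k_def
      proof (rule continuous_on_cases_le)
        show "continuous_on {t \<in> {a..c} \<times> N2. fst t \<le> b} k1"
          using 1 2 unfolding good_def by (auto elim!: continuous_on_subset)
        show "continuous_on {t \<in> {a..c} \<times> N2. b \<le> fst t} k2"
          using 2 unfolding good_def by (auto elim!: continuous_on_subset)
        show "continuous_on ({a..c} \<times> N2) (fst :: real \<times> 'z \<Rightarrow> real)" by (intro continuous_intros)
        show "k1 t = k2 t" if "t \<in> {a..c} \<times> N2" "fst t = b" for t
          using that 1 2 unfolding good_def by (cases t) auto
      qed
      moreover have "\<forall>w \<in> {a..c} \<times> N2. k w \<in> C \<and> p (k w) = h w"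
      proof
        fix w assume w: "w \<in> {a..c} \<times> N2"
        show "k w \<in> C \<and> p (k w) = h w"
        proof (cases "fst w \<le> b")
          case True
          then have "w \<in> {a..b} \<times> N1" using w 2 unfolding good_def by (cases w) auto
          then show ?thesis using 1 True unfolding good_def k_def by auto
        next
          case False
          then have "w \<in> {b..c} \<times> N2" using w by (cases w) auto
          then show ?thesis using 2 False unfolding good_def k_def by auto
        qed
      qed
      moreover have "\<forall>z\<in>N2. k (a, z) = f z"
        using 1 2 abc unfolding k_def good_def by auto
      ultimately have "good a c N f N2 k"
        using 1 2 unfolding good_def by blast
      then show "\<exists>N' k. good a c N f N' k" by blast
    qed
  next
    fix x :: real assume x: "0 \<le> x" "x \<le> 1"
    then have "h (x, y) \<in> S" using h(2) y by auto
    then obtain T v where T: "h (x, y) \<in> T" "openin (top_of_set S) T" "\<Union>v = C \<inter> p -` T"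
      "\<forall>u \<in> v. openin (top_of_set C) u" "\<forall>u\<in>v. \<exists>q. homeomorphism u T p q"
      using cov unfolding covering_space_def by metis
    have "openin (top_of_set ({0..1} \<times> U)) (({0..1} \<times> U) \<inter> h -` T)"
      using h T by (intro continuous_openin_preimage[of _ h S T]) auto
    then obtain W where W: "open W" "({0..1} \<times> U) \<inter> h -` T = ({0..1} \<times> U) \<inter> W"
      by (auto simp: openin_open)
    then have "(x, y) \<in> W" using x y T by auto
    then obtain I N0 where IN: "open I" "open N0" "x \<in> I" "y \<in> N0" "I \<times> N0 \<subseteq> W"
      using W(1) by (metis open_prod_elim mem_Times_iff fst_conv snd_conv)
    obtain d where d: "d > 0" "ball x d \<subseteq> I" using IN open_contains_ball by blast
    show "\<exists>d>0. \<forall>a b. a \<le> x \<and> x \<le> b \<and> b - a < d \<longrightarrow> P a b"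
    proof (intro exI[of _ d] conjI d allI impI)
      fix a b assume ab: "a \<le> x \<and> x \<le> b \<and> b - a < d"
      show "P a b" unfolding P_def
      proof (intro impI allI)
        fix N f assume ab': "0 \<le> a \<and> a \<le> b \<and> b \<le> 1"
          and N: "openin (top_of_set U) N \<and> y \<in> N \<and> continuous_on N f \<and> f ` N \<subseteq> C \<and>
            (\<forall>z\<in>N. p (f z) = h (a, z))"
        have inI: "s \<in> I" if "s \<in> {a..b}" for s
          using that ab d(2) by (auto simp: dist_real_def subset_iff)
        have hT: "h (s, z) \<in> T" if "s \<in> {a..b}" "z \<in> U \<inter> N0" for s z
          using inI[OF that(1)] that ab' IN W(2) by auto
        have aT: "h (a, y) \<in> T" using hT ab IN y by auto
        have "f y \<in> C" "p (f y) = h (a, y)" using N by auto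
        with aT have "f y \<in> \<Union>v" unfolding T(3) by simp
        then obtain u where u: "u \<in> v" "f y \<in> u" by blast
        then obtain q where q: "homeomorphism u T p q" using T by blast
        have NU: "N \<subseteq> U" using N openin_imp_subset by blast
        have "openin (top_of_set N) (N \<inter> f -` u)"
          using N u T(4) by (intro continuous_openin_preimage[of _ _ C]) auto
        then have o1: "openin (top_of_set U) (N \<inter> f -` u)"
          using N openin_trans by blast
        define N' where "N' = (N \<inter> f -` u) \<inter> (U \<inter> N0)"
        have "openin (top_of_set U) N'"
          unfolding N'_def using openin_Int[OF o1 openin_open_Int[OF IN(2)]] by blast
        moreover have "y \<in> N'" using N u(2) IN(4) y by (simp add: N'_def)
        moreover have "continuous_on ({a..b} \<times> N') (q \<circ> h)"
        proof (rule continuous_on_compose)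
          show "continuous_on ({a..b} \<times> N') h"
          proof (rule continuous_on_subset[OF h(1)])
            show "{a..b} \<times> N' \<subseteq> {0..1} \<times> U"
              using ab' by (intro Sigma_mono) (auto simp: N'_def)
          qed
          show "continuous_on (h ` ({a..b} \<times> N')) q"
          proof (rule continuous_on_subset[OF homeomorphism_cont2[OF q]])
            show "h ` ({a..b} \<times> N') \<subseteq> T" using hT unfolding N'_def by blast
          qed
        qed
        moreover have "(q \<circ> h) w \<in> C \<and> p ((q \<circ> h) w) = h w" if "w \<in> {a..b} \<times> N'" for w
        proof -
          have hw: "h w \<in> T" using hT[of "fst w" "snd w"] that by (auto simp: N'_def)
          then have "q (h w) \<in> u" using homeomorphism_image2[OF q] by blast
          then show ?thesis using u(1) T(3) homeomorphism_apply2[OF q hw] by auto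
        qed
        moreover have "\<forall>z\<in>N'. (q \<circ> h) (a, z) = f z"
          using N homeomorphism_apply1[OF q] unfolding N'_def by (metis IntD1 IntD2 o_apply vimage_eq)
        ultimately have "good a b N f N' (q \<circ> h)"
          unfolding good_def using N'_def by (metis (no_types, lifting) IntD1 image_subsetI subsetI)
        then show "\<exists>N' k. good a b N f N' k" by blast
      qed
    qed
  qed simp
  then have "\<exists>N' k. good 0 1 U f N' k" using f y unfolding P_def by auto
  then obtain N k where Nk: "good 0 1 U f N k" by blast
  show ?thesis using that[of N k] Nk unfolding good_def by blast
qed

text \<open>Each point y has a lift k y on a tube N y. On overlaps the tubes agree along every
  vertical segment by uniqueness of path lifting, so evaluating the tube of the point itself gives a
  map that locally coincides with a single continuous lift.\<close>

lemma lift_homotopy: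
  fixes h :: "real \<times> 'z::topological_space \<Rightarrow> 's::topological_space"
    and p :: "'a::topological_space \<Rightarrow> 's"
  assumes cov: "covering_space C p S"
    and h: "continuous_on ({0..1} \<times> U) h" "h ` ({0..1} \<times> U) \<subseteq> S"
    and f: "continuous_on U f" "f ` U \<subseteq> C" "\<And>z. z \<in> U \<Longrightarrow> p (f z) = h (0, z)"
  obtains k where "continuous_on ({0..1} \<times> U) k" "k ` ({0..1} \<times> U) \<subseteq> C"
    "\<And>z. z \<in> U \<Longrightarrow> k (0, z) = f z" "\<And>w. w \<in> {0..1} \<times> U \<Longrightarrow> p (k w) = h w"
proof -
  let ?P = "\<lambda>y N k. openin (top_of_set U) N \<and> y \<in> N \<and> continuous_on ({0..1} \<times> N) k \<and>
    k ` ({0..1} \<times> N) \<subseteq> C \<and> (\<forall>z\<in>N. k (0, z) = f z) \<and> (\<forall>w\<in>{0..1} \<times> N. p (k w) = h w)"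
  have "\<forall>y\<in>U. \<exists>N k. ?P y N k"
  proof
    fix y assume y: "y \<in> U"
    show "\<exists>N k. ?P y N k"
    proof (rule lift_tube[OF assms y])
      fix N k assume "openin (top_of_set U) N" "y \<in> N" "continuous_on ({0..1} \<times> N) k"
        "k ` ({0..1} \<times> N) \<subseteq> C" "\<And>z. z \<in> N \<Longrightarrow> k (0, z) = f z"
        "\<And>w. w \<in> {0..1} \<times> N \<Longrightarrow> p (k w) = h w"
      then have "?P y N k" by simp
      then show "\<exists>N k. ?P y N k" by blast
    qed
  qed
  then obtain N k where Nk: "\<And>y. y \<in> U \<Longrightarrow> ?P y (N y) (k y)" by metis
  define K where "K w = k (snd w) w" for w
  have sub: "N y \<subseteq> U" if "y \<in> U" for y using Nk[OF that] openin_imp_subset by blast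
  have path: "continuous_on {0..1} (\<lambda>t. k y (t, z))" if "y \<in> U" "z \<in> N y" for y z
    using Nk[OF that(1)] that
    by (intro continuous_on_compose2[of "{0..1} \<times> N y" "k y" "{0..1}" "\<lambda>t. (t, z)"] continuous_intros)
      auto
  have agree: "K w = k y w" if y: "y \<in> U" and w: "w \<in> {0..1} \<times> N y" for y w
  proof -
    obtain t z where tz: "w = (t, z)" "t \<in> {0..1}" "z \<in> N y" using w by auto
    then have z: "z \<in> U" using sub[OF y] by blast
    have "k z (t, z) = k y (t, z)"
    proof (rule lift_unique[OF cov connected_Icc, where ?g1.0 = "\<lambda>t. k z (t, z)"
          and ?g2.0 = "\<lambda>t. k y (t, z)" and a = 0])
      have zN: "z \<in> N z" using Nk[OF z] by blast
      then show "continuous_on {0..1} (\<lambda>t. k z (t, z))" by (rule path[OF z])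
      show "continuous_on {0..1} (\<lambda>t. k y (t, z))" by (rule path[OF y tz(3)])
      show "(\<lambda>t. k z (t, z)) ` {0..1} \<subseteq> C" using Nk[OF z] zN by blast
      show "(\<lambda>t. k y (t, z)) ` {0..1} \<subseteq> C" using Nk[OF y] tz(3) by blast
      show "p (k z (s, z)) = p (k y (s, z))" if "s \<in> {0..1}" for s
        using Nk[OF z] zN Nk[OF y] tz(3) that by (metis SigmaI)
      show "k z (0, z) = k y (0, z)" using Nk[OF z] zN Nk[OF y] tz(3) by metis
    qed (use tz in auto)
    then show ?thesis by (simp add: K_def tz)
  qed
  show ?thesis
  proof (rule that[of K])
    show "continuous_on ({0..1} \<times> U) K"
    proof (rule continuous_on_locally_imp)
      fix w assume "w \<in> {0..1::real} \<times> U"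
      then obtain t y where w: "w = (t, y)" "t \<in> {0..1}" "y \<in> U" by auto
      have "openin (top_of_set ({0..1} \<times> U)) ({0..1::real} \<times> N y)"
        using Nk[OF w(3)] by (simp add: openin_Times)
      moreover have "continuous_on ({0..1} \<times> N y) K"
      proof (rule continuous_on_eq)
        show "continuous_on ({0..1} \<times> N y) (k y)" using Nk[OF w(3)] by blast
      qed (simp only: agree[OF w(3)])
      ultimately show "\<exists>V. openin (top_of_set ({0..1} \<times> U)) V \<and> w \<in> V \<and> continuous_on V K"
        using w Nk[OF w(3)] by (intro exI[of _ "{0..1} \<times> N y"]) simp
    qed
    show "K ` ({0..1} \<times> U) \<subseteq> C"
    proof
      fix c assume "c \<in> K ` ({0..1} \<times> U)"
      then obtain t z where "c = k z (t, z)" "t \<in> {0..1}" "z \<in> U" by (auto simp: K_def)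
      then show "c \<in> C" using Nk[of z] by blast
    qed
    show "K (0, z) = f z" if "z \<in> U" for z unfolding K_def snd_conv using Nk[OF that] by blast
    show "p (K w) = h w" if w: "w \<in> {0..1} \<times> U" for w
    proof -
      have "snd w \<in> U" using w by auto
      from Nk[OF this] have "w \<in> {0..1} \<times> N (snd w)" "\<forall>w'\<in>{0..1} \<times> N (snd w). p (k (snd w) w') = h w'"
        using w by (auto simp del: split_paired_All split_paired_Ex)
      then show ?thesis unfolding K_def by blast
    qed
  qed
qed

text \<open>Contractions fixing the base point, so that lifts can be normalised there.\<close>

definition contractible_rel :: "'a::topological_space set \<Rightarrow> 'a \<Rightarrow> bool"
  where "contractible_rel U c \<longleftrightarrow> c \<in> U \<and> (\<exists>H. continuous_on ({0..1} \<times> U) H \<and>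
    H ` ({0..1} \<times> U) \<subseteq> U \<and> (\<forall>x\<in>U. H (0::real, x) = c \<and> H (1, x) = x) \<and> (\<forall>t\<in>{0..1}. H (t, c) = c))"

lemma contractible_rel_imp_contractible:
  assumes "contractible_rel U c"
  shows "contractible U"
proof -
  obtain H where H: "continuous_on ({0..1} \<times> U) H" "H ` ({0..1} \<times> U) \<subseteq> U"
    "\<forall>x\<in>U. H (0::real, x) = c \<and> H (1, x) = x"
    using assms unfolding contractible_rel_def by auto
  have "homotopic_with_canon (\<lambda>x. True) U U (\<lambda>x. c) id"
    using H by (subst homotopic_with) (auto intro!: exI[of _ H])
  then show ?thesis
    unfolding contractible_def using homotopic_with_sym by blast
qed

lemma contractible_rel_imp_path_connected:
  assumes "contractible_rel U c"
  shows "path_connected U"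
proof -
  obtain H where H: "continuous_on ({0..1} \<times> U) H" "H ` ({0..1} \<times> U) \<subseteq> U"
    "\<And>x. x \<in> U \<Longrightarrow> H (0::real, x) = c \<and> H (1, x) = x"
    using assms unfolding contractible_rel_def by auto
  have "path_component U c x" if x: "x \<in> U" for x
    unfolding path_component_def
  proof (intro exI conjI)
    show "path (\<lambda>t. H (t, x))"
      unfolding path_def using x
      by (intro continuous_on_compose2[OF H(1)] continuous_intros) auto
    show "path_image (\<lambda>t. H (t, x)) \<subseteq> U" unfolding path_image_def using H(2) x by blast
  qed (use H(3)[OF x] in \<open>auto simp: pathstart_def pathfinish_def\<close>)
  then show ?thesis
    unfolding path_connected_component by (meson path_component_sym path_component_trans)
qed

lemma contractible_rel_homeomorphic:
  assumes "contractible_rel U c" "homeomorphism U V f f'"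
  shows "contractible_rel V (f c)"
proof -
  obtain H where H: "continuous_on ({0..1} \<times> U) H" "H ` ({0..1} \<times> U) \<subseteq> U"
    "\<forall>x\<in>U. H (0::real, x) = c \<and> H (1, x) = x" "\<forall>t\<in>{0..1}. H (t, c) = c" and c: "c \<in> U"
    using assms(1) unfolding contractible_rel_def by auto
  have f: "continuous_on U f" "f ` U = V" "\<And>x. x \<in> U \<Longrightarrow> f' (f x) = x"
    and f': "continuous_on V f'" "f' ` V = U" "\<And>y. y \<in> V \<Longrightarrow> f (f' y) = y"
    using assms(2) by (auto simp: homeomorphism_def)
  define K where "K w = f (H (fst w, f' (snd w)))" for w
  have "continuous_on ({0..1} \<times> V) K" unfolding K_def
  proof (rule continuous_on_compose2[OF f(1)])
    show "continuous_on ({0..1} \<times> V) (\<lambda>w. H (fst w, f' (snd w)))"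
      using f'
      by (intro continuous_on_compose2[OF H(1)] continuous_intros
          continuous_on_compose2[OF f'(1)]) auto
    show "(\<lambda>w. H (fst w, f' (snd w))) ` ({0..1} \<times> V) \<subseteq> U" using H(2) f' by force
  qed
  moreover have "K ` ({0..1} \<times> V) \<subseteq> V" unfolding K_def using H(2) f f' by force
  moreover have "\<forall>x\<in>V. K (0, x) = f c \<and> K (1, x) = x" "\<forall>t\<in>{0..1}. K (t, f c) = f c"
    unfolding K_def using H f f' c by auto
  ultimately show ?thesis unfolding contractible_rel_def using c f by blast
qed

lemma convex_imp_contractible_rel:
  fixes U :: "'a::real_normed_vector set"
  assumes "convex U" "c \<in> U"
  shows "contractible_rel U c"
  unfolding contractible_rel_def
proof (intro conjI exI[of _ "\<lambda>w. (1 - fst w) *\<^sub>R c + fst w *\<^sub>R snd w"])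
  show "continuous_on ({0..1} \<times> U) (\<lambda>w. (1 - fst w) *\<^sub>R c + fst w *\<^sub>R snd w)"
    by (intro continuous_intros)
  show "(\<lambda>w. (1 - fst w) *\<^sub>R c + fst w *\<^sub>R snd w) ` ({0..1} \<times> U) \<subseteq> U"
    using assms by (auto intro!: convexD)
qed (use assms in \<open>auto simp: algebra_simps\<close>)

text \<open>The simplex lies in \<open>nat \<Rightarrow> real\<close> with the product topology,
  which is not a normed space, so the straight-line contraction is checked coordinatewise.\<close>

lemma contractible_rel_standard_simplex:
  assumes "c \<in> standard_simplex n"
  shows "contractible_rel (standard_simplex n) c"
  unfolding contractible_rel_def
proof (intro conjI exI[of _ "\<lambda>w i. (1 - fst w) * c i + fst w * snd w i"])
  show "continuous_on ({0..1} \<times> standard_simplex n) (\<lambda>w i. (1 - fst w) * c i + fst w * snd w i)"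
    by (intro continuous_on_coordinatewise_then_product continuous_intros
        continuous_on_compose2[OF continuous_on_product_coordinates continuous_on_snd]) auto
  show "(\<lambda>w i. (1 - fst w) * c i + fst w * snd w i) ` ({0..1} \<times> standard_simplex n)
      \<subseteq> standard_simplex n"
    using convex_standard_simplex[OF assms] by auto
qed (use assms in \<open>auto simp: algebra_simps fun_eq_iff\<close>)

text \<open>Lift the contraction, starting from the constant e, and evaluate at time 1. Over c the
  contraction stands still, so its lift does too and the value at c is still e.\<close>

lemma lift_from_contractible:
  fixes f :: "'z::topological_space \<Rightarrow> 's::topological_space"
    and p :: "'a::topological_space \<Rightarrow> 's"
  assumes cov: "covering_space C p S" and U: "contractible_rel U c"
    and f: "continuous_on U f" "f ` U \<subseteq> S" and e: "e \<in> C" "p e = f c"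
  obtains g where "continuous_on U g" "g ` U \<subseteq> C" "g c = e" "\<And>x. x \<in> U \<Longrightarrow> p (g x) = f x"
proof -
  obtain H where H: "continuous_on ({0..1} \<times> U) H" "H ` ({0..1} \<times> U) \<subseteq> U"
    "\<And>x. x \<in> U \<Longrightarrow> H (0::real, x) = c" "\<And>x. x \<in> U \<Longrightarrow> H (1, x) = x"
    "\<And>t. t \<in> {0..1} \<Longrightarrow> H (t, c) = c" and c: "c \<in> U"
    using U unfolding contractible_rel_def by auto
  obtain k where k: "continuous_on ({0..1} \<times> U) k" "k ` ({0..1} \<times> U) \<subseteq> C"
    "\<And>z. z \<in> U \<Longrightarrow> k (0, z) = e" "\<And>w. w \<in> {0..1} \<times> U \<Longrightarrow> p (k w) = (f \<circ> H) w"
  proof (rule lift_homotopy[OF cov, of U "f \<circ> H" "\<lambda>_. e"])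
    show "continuous_on ({0..1} \<times> U) (f \<circ> H)"
      using H by (intro continuous_on_compose continuous_on_subset[OF f(1)])
    show "(f \<circ> H) ` ({0..1} \<times> U) \<subseteq> S" using H(2) f(2) by (auto simp flip: image_comp)
    show "p e = (f \<circ> H) (0, z)" if "z \<in> U" for z using H that e by simp
  qed (use e in auto)
  have "k (1, c) = e"
  proof (rule lift_unique[OF cov connected_Icc, where ?g1.0 = "\<lambda>t. k (t, c)"
        and ?g2.0 = "\<lambda>_. e" and a = 0])
    show "continuous_on {0..1} (\<lambda>t. k (t, c))"
      using c by (intro continuous_on_compose2[OF k(1)] continuous_intros) auto
    show "(\<lambda>t. k (t, c)) ` {0..1} \<subseteq> C" using k(2) c by blast
    show "p (k (s, c)) = p e" if "s \<in> {0..1}" for s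
      using k(4)[of "(s, c)"] H(5)[OF that] c e that by simp
  qed (use k(3)[OF c] e in auto)
  moreover have "continuous_on U (\<lambda>z. k (1, z))"
    by (intro continuous_on_compose2[OF k(1)] continuous_intros) auto
  moreover have "(\<lambda>z. k (1, z)) ` U \<subseteq> C" using k(2) by auto
  ultimately show ?thesis using that[of "\<lambda>z. k (1, z)"] k(4) H(4) by simp
qed

lemma deck_transformation_unique:
  assumes cov: "covering_space St p S" and conn: "connected St"
    and T: "deck_transformation St p T" "deck_transformation St p T'"
    and a: "a \<in> St" "T a = T' a" and x: "x \<in> St"
  shows "T x = T' x"
proof (rule lift_unique[OF cov conn, where ?g1.0 = T and ?g2.0 = T' and a = a])
  show "continuous_on St T" "continuous_on St T'" "T ` St \<subseteq> St" "T' ` St \<subseteq> St"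
    using T unfolding deck_transformation_def
    by (metis homeomorphism_cont1 homeomorphism_image1 order_refl)+
  show "p (T z) = p (T' z)" if "z \<in> St" for z
    using T that unfolding deck_transformation_def by simp
qed (use a x in auto)

text \<open>Lifting p through itself with x sent to y, and with y sent to x, gives two maps whose
  composites fix a point; uniqueness of lifts makes them mutually inverse.\<close>

lemma deck_transformation_exists:
  assumes cov: "covering_space St p S" and contr: "\<And>x. x \<in> St \<Longrightarrow> contractible_rel St x"
    and x: "x \<in> St" and y: "y \<in> St" and eq: "p x = p y"
  obtains T where "deck_transformation St p T" "T x = y"
proof -
  have p: "continuous_on St p" "p ` St \<subseteq> S" using cov by (auto simp: covering_space_def)
  have conn: "connected St"
    by (rule path_connected_imp_connected[OF contractible_rel_imp_path_connected[OF contr[OF x]]])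
  obtain T where T: "continuous_on St T" "T ` St \<subseteq> St" "T x = y" "\<And>z. z \<in> St \<Longrightarrow> p (T z) = p z"
    using lift_from_contractible[OF cov contr[OF x] p y eq[symmetric]] by blast
  obtain T' where T': "continuous_on St T'" "T' ` St \<subseteq> St" "T' y = x" "\<And>z. z \<in> St \<Longrightarrow> p (T' z) = p z"
    using lift_from_contractible[OF cov contr[OF y] p x eq] by blast
  have id1: "(T' \<circ> T) z = id z" if "z \<in> St" for z
  proof (rule lift_unique[OF cov conn, where ?g1.0 = "T' \<circ> T" and ?g2.0 = id and a = x])
    show "continuous_on St (T' \<circ> T)"
      by (rule continuous_on_compose[OF T(1) continuous_on_subset[OF T'(1) T(2)]])
    show "(T' \<circ> T) ` St \<subseteq> St" using T(2) T'(2) by auto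
    show "p ((T' \<circ> T) w) = p (id w)" if "w \<in> St" for w
      using T(2,4) T'(2,4) that by (metis comp_apply id_apply image_subset_iff)
    show "(T' \<circ> T) x = id x" using T(3) T'(3) by simp
  qed (use that x in auto)
  have id2: "(T \<circ> T') z = id z" if "z \<in> St" for z
  proof (rule lift_unique[OF cov conn, where ?g1.0 = "T \<circ> T'" and ?g2.0 = id and a = y])
    show "continuous_on St (T \<circ> T')"
      by (rule continuous_on_compose[OF T'(1) continuous_on_subset[OF T(1) T'(2)]])
    show "(T \<circ> T') ` St \<subseteq> St" using T(2) T'(2) by auto
    show "p ((T \<circ> T') w) = p (id w)" if "w \<in> St" for w
      using T(2,4) T'(2,4) that by (metis comp_apply id_apply image_subset_iff)
    show "(T \<circ> T') y = id y" using T(3) T'(3) by simp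
  qed (use that y in auto)
  have "homeomorphism St St T T'"
    using T(1,2) T'(1,2) id1 id2 unfolding id_apply comp_apply by (intro homeomorphismI)
  then show ?thesis using that T unfolding deck_transformation_def by blast
qed

lemma covering_fibre_isolated:
  assumes cov: "covering_space St p S" and y: "y \<in> St"
  obtains u where "openin (top_of_set St) u" "y \<in> u" "inj_on p u"
  using covering_sheet[OF cov y] by (metis homeomorphism_def inj_on_inverseI)

section \<open>Ranks of homology groups\<close>

text \<open>The bound itself makes the set of cardinalities finite, and the empty family makes it
  nonempty, so the maximum is attained.\<close>

lemma abelian_rank_le:
  assumes "\<And>B. int_independent G B \<Longrightarrow> card B \<le> m"
  shows "abelian_rank G \<le> m"
proof -
  let ?C = "{card B | B. int_independent G B}"
  have "finite ?C" using assms by (intro finite_subset[of ?C "{..m}"]) auto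
  moreover have "int_independent G {}" by (simp add: int_independent_def)
  ultimately have "Max ?C \<in> ?C" by (intro Max_in) auto
  then show ?thesis using assms by (auto simp: abelian_rank_def)
qed

text \<open>The upper bound m only serves to make the maximum meaningful; its value does not enter
  the conclusion.\<close>

lemma abelian_rank_ge:
  assumes "\<And>B. int_independent G B \<Longrightarrow> card B \<le> m" and "int_independent G B"
  shows "card B \<le> abelian_rank G"
  unfolding abelian_rank_def using assms
  by (intro Max_ge finite_subset[of "{card B | B. int_independent G B}" "{..m}"]) auto

lemma (in comm_group) card_independent_le:
  assumes dep: "\<And>f :: nat \<Rightarrow> 'a. (\<And>i. i \<le> m \<Longrightarrow> f i \<in> carrier G) \<Longrightarrow>
      \<exists>k :: nat \<Rightarrow> int. (\<exists>i\<le>m. k i \<noteq> 0) \<and> finprod G (\<lambda>i. f i [^] k i) {..m} = \<one>"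
    and B: "int_independent G B"
  shows "card B \<le> m"
proof (rule ccontr)
  assume "\<not> card B \<le> m"
  then have "card {..m} \<le> card B" by simp
  moreover have fin: "finite B" and BG: "B \<subseteq> carrier G"
    using B by (auto simp: int_independent_def)
  ultimately obtain f where f: "f ` {..m} \<subseteq> B" "inj_on f {..m}"
    using card_le_inj[of "{..m}" B] by auto
  then obtain k :: "nat \<Rightarrow> int" where k: "\<exists>i\<le>m. k i \<noteq> 0"
    "finprod G (\<lambda>i. f i [^] k i) {..m} = \<one>"
    using dep[of f] BG by blast
  \<comment> \<open>The relation among the m + 1 chosen elements is extended by zero coefficients to
    all of B.\<close>
  define k' where "k' b = (if b \<in> f ` {..m} then k (the_inv_into {..m} f b) else 0)" for b
  have k'f: "k' (f i) = k i" if "i \<le> m" for i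
    using that f(2) by (auto simp: k'_def the_inv_into_f_f)
  have "finprod G (\<lambda>b. b [^] k' b) B = finprod G (\<lambda>b. b [^] k' b) (f ` {..m})"
    using fin BG f(1) by (intro finprod_mono_neutral_cong_right) (auto simp: k'_def)
  also have "\<dots> = finprod G (\<lambda>i. f i [^] k' (f i)) {..m}"
    using f BG by (intro finprod_reindex) auto
  also have "\<dots> = finprod G (\<lambda>i. f i [^] k i) {..m}"
    using f(1) BG by (intro finprod_cong) (auto simp: k'f simp_implies_def)
  finally have "\<forall>b\<in>B. k' b = 0"
    using B k(2) unfolding int_independent_def by simp
  then show False using k(1) k'f f(1) by (metis atMost_iff image_subset_iff)
qed

abbreviation hclass :: "nat \<Rightarrow> 'a topology \<Rightarrow> 'a chain \<Rightarrow> 'a chain set"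
  where "hclass n X \<equiv> homologous_rel_set n X {}"

abbreviation cycle :: "nat \<Rightarrow> 'a topology \<Rightarrow> 'a chain \<Rightarrow> bool"
  where "cycle n X \<equiv> singular_relcycle n X {}"

abbreviation bdry :: "nat \<Rightarrow> 'a topology \<Rightarrow> 'a chain \<Rightarrow> bool"
  where "bdry n X \<equiv> singular_relboundary n X {}"

lemma hclass_carrier: "cycle n X z \<Longrightarrow> hclass n X z \<in> carrier (homology_group (int n) X)"
  by (auto simp: carrier_relative_homology_group)

lemma hclass_cases:
  assumes "b \<in> carrier (homology_group (int n) X)"
  obtains z where "cycle n X z" "b = hclass n X z"
  using assms by (auto simp: carrier_relative_homology_group)

lemma hclass_eq_one_iff: "hclass n X a = \<one>\<^bsub>homology_group (int n) X\<^esub> \<longleftrightarrow> bdry n X a"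
  by (simp add: homologous_rel_set_eq_relboundary)

lemma hclass_add:
  assumes "cycle n X a" "cycle n X b"
  shows "hclass n X a \<otimes>\<^bsub>homology_group (int n) X\<^esub> hclass n X b = hclass n X (a + b)"
proof -
  have "group_hom (relcycle_group n X {}) (relcycle_group n X {} Mod singular_relboundary_set n X {})
      (\<lambda>a. singular_relboundary_set n X {} #>\<^bsub>relcycle_group n X {}\<^esub> a)"
    using normal.r_coset_hom_Mod[OF normal_subgroup_singular_relboundary_relcycle[of n X "{}"]]
    by (simp add: group_hom_def group_hom_axioms_def normal.factorgroup_is_group
        normal_subgroup_singular_relboundary_relcycle)
  from group_hom.hom_mult[OF this, of a b] show ?thesis
    using assms by (simp add: right_coset_singular_relboundary relative_homology_group_def)
qed

lemma hclass_int_pow: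
  assumes "cycle n X z"
  shows "hclass n X z [^]\<^bsub>homology_group (int n) X\<^esub> (k::int) = hclass n X (frag_cmul k z)"
proof -
  have "z \<in> carrier (subgroup_generated
      (free_Abelian_group (singular_simplex_set n X)) (singular_relcycle_set n X {}))"
    by (metis assms carrier_relcycle_group chain_group_def mem_Collect_eq relcycle_group_def)
  moreover have "Poly_Mapping.keys z \<subseteq> singular_simplex_set n X"
    using assms by (simp add: singular_cycle singular_chain_def)
  ultimately have "z [^]\<^bsub>relcycle_group n X {}\<^esub> k = frag_cmul k z"
    by (simp add: relcycle_group_def chain_group_def group.int_pow_subgroup_generated)
  moreover have "hclass n X a = singular_relboundary_set n X {} #>\<^bsub>relcycle_group n X {}\<^esub> a" for a
    by (simp add: right_coset_singular_relboundary)
  moreover have "z \<in> carrier (relcycle_group n X {})" using assms by simp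
  ultimately show ?thesis
    using normal.FactGroup_int_pow[OF normal_subgroup_singular_relboundary_relcycle, of z n X "{}" k]
    by (simp add: relative_homology_group_def)
qed

lemma hclass_finprod:
  assumes "finite I" "\<And>i. i \<in> I \<Longrightarrow> cycle n X (z i)"
  shows "finprod (homology_group (int n) X) (\<lambda>i. hclass n X (z i)) I = hclass n X (sum z I)"
  using assms
proof (induction I)
  case empty
  interpret comm_group "homology_group (int n) X" by (rule abelian_homology_group)
  show ?case using hclass_eq_one_iff[of n X 0] by simp
next
  case (insert x I)
  interpret comm_group "homology_group (int n) X" by (rule abelian_homology_group)
  have "(\<lambda>i. hclass n X (z i)) \<in> I \<rightarrow> carrier (homology_group (int n) X)"
    using insert by (auto intro: hclass_carrier)
  then show ?case
    using insert hclass_add[of n X "z x" "sum z I"]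
    by (simp add: hclass_carrier singular_relcycle_sum)
qed

lemma card_independent_homology_le:
  assumes dep: "\<And>z :: nat \<Rightarrow> 'a chain. (\<And>i. i \<le> m \<Longrightarrow> cycle n X (z i)) \<Longrightarrow>
      \<exists>k :: nat \<Rightarrow> int. (\<exists>i\<le>m. k i \<noteq> 0) \<and> bdry n X (\<Sum>i\<le>m. frag_cmul (k i) (z i))"
    and B: "int_independent (homology_group (int n) X) B"
  shows "card B \<le> m"
proof (rule comm_group.card_independent_le[OF abelian_homology_group _ B])
  fix f :: "nat \<Rightarrow> 'a chain set"
  assume "\<And>i. i \<le> m \<Longrightarrow> f i \<in> carrier (homology_group (int n) X)"
  then have "\<forall>i. \<exists>z. i \<le> m \<longrightarrow> cycle n X z \<and> f i = hclass n X z"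
    by (metis hclass_cases)
  then obtain z where z: "\<And>i. i \<le> m \<Longrightarrow> cycle n X (z i)" "\<And>i. i \<le> m \<Longrightarrow> f i = hclass n X (z i)"
    by metis
  have "\<exists>k :: nat \<Rightarrow> int. (\<exists>i\<le>m. k i \<noteq> 0) \<and> bdry n X (\<Sum>i\<le>m. frag_cmul (k i) (z i))"
    by (rule dep) (rule z(1))
  then obtain k :: "nat \<Rightarrow> int" where
    k: "(\<exists>i\<le>m. k i \<noteq> 0) \<and> bdry n X (\<Sum>i\<le>m. frag_cmul (k i) (z i))" ..
  interpret comm_group "homology_group (int n) X" by (rule abelian_homology_group)
  have "finprod (homology_group (int n) X) (\<lambda>i. f i [^]\<^bsub>homology_group (int n) X\<^esub> k i) {..m} =
      finprod (homology_group (int n) X) (\<lambda>i. hclass n X (frag_cmul (k i) (z i))) {..m}"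
  proof (rule finprod_cong'[OF refl])
    show "(\<lambda>i. hclass n X (frag_cmul (k i) (z i))) \<in> {..m} \<rightarrow> carrier (homology_group (int n) X)"
      using z(1) by (intro Pi_I hclass_carrier singular_relcycle_cmul) simp
    show "f i [^]\<^bsub>homology_group (int n) X\<^esub> k i = hclass n X (frag_cmul (k i) (z i))"
      if "i \<in> {..m}" for i
      using z(2)[of i] hclass_int_pow[OF z(1), of i "k i"] that by simp
  qed
  also have "\<dots> = hclass n X (\<Sum>i\<le>m. frag_cmul (k i) (z i))"
    using z by (intro hclass_finprod singular_relcycle_cmul) auto
  also have "\<dots> = \<one>\<^bsub>homology_group (int n) X\<^esub>"
    using k unfolding hclass_eq_one_iff by (rule conjunct2)
  finally show "\<exists>k :: nat \<Rightarrow> int. (\<exists>i\<le>m. k i \<noteq> 0) \<and> finprod (homology_group (int n) X)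
      (\<lambda>i. f i [^]\<^bsub>homology_group (int n) X\<^esub> k i) {..m} = \<one>\<^bsub>homology_group (int n) X\<^esub>"
    using conjunct1[OF k] by (intro exI[of _ k] conjI)
qed

lemma independent_singleton:
  assumes z: "cycle n X z" and "\<And>k. bdry n X (frag_cmul k z) \<Longrightarrow> k = 0"
  shows "int_independent (homology_group (int n) X) {hclass n X z}"
proof -
  interpret comm_group "homology_group (int n) X" by (rule abelian_homology_group)
  let ?c = "hclass n X z" and ?H = "homology_group (int n) X"
  have "k ?c = 0" if "finprod ?H (\<lambda>b. b [^]\<^bsub>?H\<^esub> k b) {?c} = \<one>\<^bsub>?H\<^esub>" for k :: "_ \<Rightarrow> int"
  proof -
    have "finprod ?H (\<lambda>b. b [^]\<^bsub>?H\<^esub> k b) {?c} = ?c [^]\<^bsub>?H\<^esub> k ?c"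
      using finprod_insert[of "{}" ?c "\<lambda>b. b [^]\<^bsub>?H\<^esub> k b"] hclass_carrier[OF z]
      by (simp del: one_relative_homology_group)
    then have "hclass n X (frag_cmul (k ?c) z) = \<one>\<^bsub>?H\<^esub>"
      using that hclass_int_pow[OF z] by metis
    then show ?thesis using assms(2) unfolding hclass_eq_one_iff by blast
  qed
  then show ?thesis
    using hclass_carrier[OF z] unfolding int_independent_def by blast
qed

text \<open>The group is infinite cyclic with generator q. That q is independent gives the lower
  bound; that any two multiples of q are dependent bounds the set under the maximum.\<close>

lemma abelian_rank_zeroth_homology:
  assumes X: "path_connected_space X" and ne: "topspace X \<noteq> {}"
  shows "abelian_rank (homology_group 0 X) \<ge> 1"
proof -
  obtain a where a: "a \<in> topspace X" using ne by blast
  define f where "f = restrict (\<lambda>x. a) (standard_simplex 0)"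
  have f: "singular_simplex 0 X f" by (simp add: singular_simplex_def f_def a)
  define q where "q = hclass 0 X (frag_of f)"
  let ?H = "homology_group 0 X"
  have iso: "pow ?H q \<in> iso integer_group ?H"
    unfolding q_def by (rule iso_integer_zeroth_homology_group[OF X f])
  interpret comm_group ?H by (rule abelian_homology_group)
  have "cycle 0 X (frag_of f)"
    by (simp add: chain_boundary_def f singular_chain_of singular_cycle)
  then have q: "q \<in> carrier ?H" unfolding q_def using hclass_carrier[of 0] by simp
  have inj: "q [^]\<^bsub>?H\<^esub> k = \<one>\<^bsub>?H\<^esub> \<Longrightarrow> k = 0" for k :: int
    using iso inj_onD[of "pow ?H q" UNIV k 0] unfolding iso_def bij_betw_def by simp
  have surj: "\<exists>k :: int. x = q [^]\<^bsub>?H\<^esub> k" if "x \<in> carrier ?H" for x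
    using iso that unfolding iso_def bij_betw_def by auto
  have "card {q} \<le> abelian_rank ?H"
  proof (rule abelian_rank_ge[where m = 1])
    show "int_independent ?H {q}" using q inj by (auto simp: int_independent_def)
    fix B assume B: "int_independent ?H B"
    show "card B \<le> 1"
    proof (rule card_independent_le[OF _ B])
      fix f :: "nat \<Rightarrow> _" assume f: "\<And>i. i \<le> 1 \<Longrightarrow> f i \<in> carrier ?H"
      obtain m n :: int where mn: "f 0 = q [^]\<^bsub>?H\<^esub> m" "f 1 = q [^]\<^bsub>?H\<^esub> n"
        using surj f by (meson le_numeral_extra(4) zero_le_one)
      \<comment> \<open>The relation n (m q) - m (n q) = 0, with an arbitrary nonzero choice when
        both multiples vanish.\<close>
      define k where "k i = (if m = 0 \<and> n = 0 then 1 else if i = 0 then n else - m)" for i :: nat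
      have "{..1::nat} = {0, 1}" by auto
      then have "finprod ?H (\<lambda>i. f i [^]\<^bsub>?H\<^esub> k i) {..1} = \<one>\<^bsub>?H\<^esub>"
      proof -
        have "finprod ?H (\<lambda>i. f i [^]\<^bsub>?H\<^esub> k i) {0, 1} =
            f 0 [^]\<^bsub>?H\<^esub> k 0 \<otimes>\<^bsub>?H\<^esub> f 1 [^]\<^bsub>?H\<^esub> k 1"
          using f[of 0] f[of 1] finprod_insert[of "{1}" 0 "\<lambda>i. f i [^]\<^bsub>?H\<^esub> k i"]
            finprod_insert[of "{}" 1 "\<lambda>i. f i [^]\<^bsub>?H\<^esub> k i"] by simp
        also have "\<dots> = q [^]\<^bsub>?H\<^esub> (m * k 0 + n * k 1)"
          using q by (simp only: mn int_pow_pow int_pow_mult)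
        also have "m * k 0 + n * k 1 = 0" by (simp add: k_def)
        finally show ?thesis using \<open>{..1::nat} = {0, 1}\<close> by (simp only: int_pow_0)
      qed
      moreover have "\<exists>i\<le>1. k i \<noteq> 0"
        by (cases "m = 0 \<and> n = 0"; cases "n = 0") (auto simp: k_def intro: exI[of _ 1] exI[of _ 0])
      ultimately show "\<exists>k :: nat \<Rightarrow> int. (\<exists>i\<le>1. k i \<noteq> 0) \<and>
          finprod ?H (\<lambda>i. f i [^]\<^bsub>?H\<^esub> k i) {..1} = \<one>\<^bsub>?H\<^esub>" by blast
    qed
  qed
  then show ?thesis by simp
qed

lemma bdry_of_contractible:
  assumes "contractible U" and n: "n > 0" and z: "cycle n (top_of_set U) z"
  shows "bdry n (top_of_set U) z"
proof -
  have "contractible_space (top_of_set U)"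
    using assms(1) by simp
  then have "trivial_group (homology_group (int n) (top_of_set U))"
    using trivial_reduced_homology_group_contractible_space[of "top_of_set U" "int n"] n
    by (simp add: un_reduced_homology_group)
  then have "carrier (homology_group (int n) (top_of_set U)) =
      {\<one>\<^bsub>homology_group (int n) (top_of_set U)\<^esub>}"
    unfolding trivial_group_def by (rule conjunct2)
  then have "hclass n (top_of_set U) z = \<one>\<^bsub>homology_group (int n) (top_of_set U)\<^esub>"
    using hclass_carrier[OF z] by (metis singletonD)
  then show ?thesis by (simp only: hclass_eq_one_iff)
qed

section \<open>Homology of the quotient by a free group of deck transformations\<close>

lemma singular_simplex_top_of_set:
  fixes U :: "'a::topological_space set"
  shows "singular_simplex n (top_of_set U) f \<longleftrightarrow>
    continuous_on (standard_simplex n) f \<and> f ` standard_simplex n \<subseteq> U \<and> f \<in> extensional (standard_simplex n)"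
  unfolding singular_simplex_def euclidean_product_topology[symmetric]
  by (auto simp: euclidean_product_topology image_subset_iff_funcset)

definition vertex0 :: "nat \<Rightarrow> real"
  where "vertex0 = (\<lambda>j. if j = 0 then 1 else 0)"

lemma vertex0_in [simp]: "vertex0 \<in> standard_simplex n"
  unfolding vertex0_def by (simp only: basis_in_standard_simplex)

text \<open>Singular simplices are extensional, so a 0-simplex is the restricted constant map and is
  determined by its value at \<open>vertex0\<close>.\<close>

definition pt :: "'a \<Rightarrow> (nat \<Rightarrow> real) \<Rightarrow> 'a"
  where "pt x = restrict (\<lambda>_. x) (standard_simplex 0)"

lemma pt_vertex0 [simp]: "pt x vertex0 = x"
  by (simp add: pt_def)

lemma singular_simplex_pt: "x \<in> topspace X \<Longrightarrow> singular_simplex 0 X (pt x)"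
  by (simp add: singular_simplex_def pt_def)

lemma singular_simplex_0_eq_pt:
  assumes "singular_simplex 0 X f"
  shows "f vertex0 \<in> topspace X" and "f = pt (f vertex0)"
proof -
  show "f vertex0 \<in> topspace X"
    using assms vertex0_in[of 0] unfolding singular_simplex_def continuous_map_def by auto
  have "f \<in> extensional {vertex0}"
    using assms unfolding singular_simplex_def standard_simplex_0 vertex0_def by simp
  then show "f = pt (f vertex0)"
    unfolding pt_def standard_simplex_0 vertex0_def[symmetric]
    by (intro extensionalityI[of _ "{vertex0}"]) auto
qed

lemma simplex_map_pt [simp]: "simplex_map 0 g (pt x) = pt (g x)"
  by (auto simp: simplex_map_def pt_def)

lemma chain_map_pt [simp]: "chain_map 0 g (frag_of (pt x)) = frag_of (pt (g x))"
  by simp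

lemma chain_map_eq_frag_push: "chain_map n g = frag_push (simplex_map n g)"
  by (simp add: fun_eq_iff chain_map_def frag_push_def)

declare One_nat_def [simp del]

text \<open>The last axiom asks for equality of total functions, although a deck transformation is
  determined only on \<open>St\<close>. The intended group consists of projective maps, which are
  determined by their values on a nonempty open set.\<close>

locale galois_cover =
  fixes St :: "'b::topological_space set" and p :: "'b \<Rightarrow> 'a::topological_space" and S :: "'a set"
    and \<Gamma> :: "('b \<Rightarrow> 'b) set"
  assumes cov: "covering_space St p S"
    and contr: "\<And>x. x \<in> St \<Longrightarrow> contractible_rel St x"
    and nonempty: "St \<noteq> {}"
    and deck: "\<And>g. g \<in> \<Gamma> \<Longrightarrow> deck_transformation St p g"
    and id_in: "id \<in> \<Gamma>"
    and comp_in: "\<And>g h. \<lbrakk>g \<in> \<Gamma>; h \<in> \<Gamma>\<rbrakk> \<Longrightarrow> g \<circ> h \<in> \<Gamma>"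
    and inv_ex: "\<And>g. g \<in> \<Gamma> \<Longrightarrow> \<exists>h\<in>\<Gamma>. h \<circ> g = id \<and> g \<circ> h = id"
    and transitive: "\<And>x y. \<lbrakk>x \<in> St; y \<in> St; p x = p y\<rbrakk> \<Longrightarrow> \<exists>g\<in>\<Gamma>. g x = y"
    and free: "\<And>g x. \<lbrakk>g \<in> \<Gamma>; x \<in> St; g x = x\<rbrakk> \<Longrightarrow> g = id"
begin

abbreviation "X \<equiv> top_of_set St"
abbreviation "Y \<equiv> top_of_set S"

lemma deck_props:
  assumes "g \<in> \<Gamma>"
  shows "continuous_on St g" and "g ` St \<subseteq> St" and "\<And>x. x \<in> St \<Longrightarrow> p (g x) = p x"
    and "continuous_map X X g" and "\<And>x. x \<in> St \<Longrightarrow> g x \<in> St"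
proof -
  obtain g' where g': "homeomorphism St St g g'" and pg: "\<forall>x\<in>St. p (g x) = p x"
    using deck[OF assms] unfolding deck_transformation_def by blast
  show c: "continuous_on St g" and i: "g ` St \<subseteq> St"
    using homeomorphism_cont1[OF g'] homeomorphism_image1[OF g'] by auto
  show "\<And>x. x \<in> St \<Longrightarrow> p (g x) = p x" using pg by blast
  show "continuous_map X X g" using c i by auto
  show "\<And>x. x \<in> St \<Longrightarrow> g x \<in> St" using i by blast
qed

lemma p_map: "continuous_map X Y p"
  using cov unfolding covering_space_def by auto

lemma path_connected_X: "path_connected_space X"
  using nonempty contr contractible_rel_imp_path_connected by auto

lemma cancel: "\<lbrakk>g \<in> \<Gamma>; h \<in> \<Gamma>; x \<in> St; g x = h x\<rbrakk> \<Longrightarrow> g = h"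
proof -
  assume g: "g \<in> \<Gamma>" and h: "h \<in> \<Gamma>" and x: "x \<in> St" and eq: "g x = h x"
  obtain k where k: "k \<in> \<Gamma>" "k \<circ> h = id" "h \<circ> k = id" using inv_ex[OF h] by blast
  have "(k \<circ> g) x = x" using eq fun_cong[OF k(2), of x] by simp
  then have "k \<circ> g = id" using free[OF comp_in[OF k(1) g] x] by blast
  then have "h \<circ> (k \<circ> g) = h" by simp
  then show "g = h" using k(3) by (simp flip: comp_assoc)
qed

lemma lift_simplex:
  assumes "singular_simplex n Y \<sigma>"
  obtains \<tau> where "singular_simplex n X \<tau>" "simplex_map n p \<tau> = \<sigma>"
proof -
  let ?D = "standard_simplex n"
  have \<sigma>: "continuous_on ?D \<sigma>" "\<sigma> ` ?D \<subseteq> S" "\<sigma> \<in> extensional ?D"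
    using assms by (simp_all add: singular_simplex_top_of_set)
  have "\<sigma> vertex0 \<in> S" using \<sigma>(2) vertex0_in by blast
  then obtain e where e: "e \<in> St" "p e = \<sigma> vertex0"
    using covering_space_imp_surjective[OF cov] by (metis imageE)
  obtain g where g: "continuous_on ?D g" "g ` ?D \<subseteq> St" "\<And>x. x \<in> ?D \<Longrightarrow> p (g x) = \<sigma> x"
    by (rule lift_from_contractible[where f = \<sigma> and p = p and c = vertex0,
          OF cov contractible_rel_standard_simplex[OF vertex0_in] \<sigma>(1) \<sigma>(2) e]) (rule that)
  show ?thesis
  proof (rule that[of "restrict g ?D"])
    show "singular_simplex n X (restrict g ?D)"
      using g by (auto simp: singular_simplex_top_of_set continuous_on_cong[of ?D ?D "restrict g ?D" g])
    show "simplex_map n p (restrict g ?D) = \<sigma>"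
      unfolding simplex_map_def using \<sigma>(3) g(3) by (intro extensionalityI[of _ ?D]) auto
  qed
qed

text \<open>A deck transformation matching the zeroth vertices carries one lift to the other, since
  the simplex is connected and both are lifts of the same map.\<close>

lemma simplex_fibre:
  assumes \<tau>: "singular_simplex n X \<tau>" and \<tau>': "singular_simplex n X \<tau>'"
    and eq: "simplex_map n p \<tau> = simplex_map n p \<tau>'"
  obtains g where "g \<in> \<Gamma>" "simplex_map n g \<tau> = \<tau>'"
proof -
  let ?D = "standard_simplex n"
  have t: "continuous_on ?D \<tau>" "\<tau> ` ?D \<subseteq> St" "\<tau> \<in> extensional ?D"
    and t': "continuous_on ?D \<tau>'" "\<tau>' ` ?D \<subseteq> St" "\<tau>' \<in> extensional ?D"
    using \<tau> \<tau>' by (simp_all add: singular_simplex_top_of_set)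
  have peq: "p (\<tau> x) = p (\<tau>' x)" if "x \<in> ?D" for x
    using fun_cong[OF eq, of x] that by (simp add: simplex_map_def)
  have in1: "\<tau> x \<in> St" "\<tau>' x \<in> St" if "x \<in> ?D" for x using t t' that by auto
  obtain g where g: "g \<in> \<Gamma>" "g (\<tau> vertex0) = \<tau>' vertex0"
    using transitive[OF in1[OF vertex0_in] peq[OF vertex0_in]] by blast
  have conn: "connected ?D"
    by (metis contractible_rel_imp_path_connected contractible_rel_standard_simplex
        path_connected_imp_connected vertex0_in)
  have "(g \<circ> \<tau>) x = \<tau>' x" if x: "x \<in> ?D" for x
  proof (rule lift_unique[OF cov conn, where ?g1.0 = "g \<circ> \<tau>" and ?g2.0 = \<tau>' and a = vertex0])
    show "continuous_on ?D (g \<circ> \<tau>)"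
      by (rule continuous_on_compose[OF t(1) continuous_on_subset[OF deck_props(1)[OF g(1)] t(2)]])
    show "(g \<circ> \<tau>) ` ?D \<subseteq> St" using deck_props(5)[OF g(1)] in1 by auto
    show "p ((g \<circ> \<tau>) x) = p (\<tau>' x)" if "x \<in> ?D" for x
      using deck_props(3)[OF g(1) in1(1)[OF that]] peq[OF that] by simp
  qed (use t' g x in auto)
  then have "simplex_map n g \<tau> = \<tau>'"
    unfolding simplex_map_def using t'(3) by (intro extensionalityI[of _ ?D]) auto
  then show ?thesis using that g by blast
qed

lemma simplex_map_p_deck:
  assumes "g \<in> \<Gamma>" "singular_simplex n X \<tau>"
  shows "simplex_map n p (simplex_map n g \<tau>) = simplex_map n p \<tau>"
proof -
  have "\<tau> x \<in> St" if "x \<in> standard_simplex n" for x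
    using assms(2) that by (auto simp: singular_simplex_top_of_set)
  then show ?thesis
    unfolding simplex_map_def using deck_props(3)[OF assms(1)] by (auto simp: restrict_def)
qed

lemma chain_map_p_deck:
  assumes g: "g \<in> \<Gamma>" and c: "singular_chain n X c"
  shows "chain_map n p (chain_map n g c) = chain_map n p c"
  unfolding chain_map_eq_frag_push frag_push_comp
  using c simplex_map_p_deck[OF g]
  by (intro frag_push_cong[of c "singular_simplex_set n X"]) (auto simp: singular_chain_def)

lemma lift_chain:
  assumes "singular_chain n Y c"
  obtains c' where "singular_chain n X c'" "chain_map n p c' = c"
proof -
  have "\<exists>c'. singular_chain n X c' \<and> chain_map n p c' = c"
    using assms unfolding singular_chain_def[of n Y]
  proof (induction c rule: frag_induction_keys)
    case zero
    then show ?case by (intro exI[of _ 0]) simp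
  next
    case (one \<sigma>)
    then obtain \<tau> where "singular_simplex n X \<tau>" "simplex_map n p \<tau> = \<sigma>"
      using lift_simplex by blast
    then show ?case by (intro exI[of _ "frag_of \<tau>"]) (simp add: singular_chain_of)
  next
    case (diff a b)
    then obtain a' b' where "singular_chain n X a'" "chain_map n p a' = a"
      "singular_chain n X b'" "chain_map n p b' = b" by blast
    then show ?case
      by (intro exI[of _ "a' - b'"]) (simp add: singular_chain_diff chain_map_diff)
  qed
  then show ?thesis using that by blast
qed

lemma chain_map_X: "\<lbrakk>g \<in> \<Gamma>; singular_chain n X c\<rbrakk> \<Longrightarrow> singular_chain n X (chain_map n g c)"
  using singular_chain_chain_map deck_props(4) by blast

lemma fill_cycle:
  assumes "n > 0" "singular_chain n X c" "chain_boundary n c = 0"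
  obtains d where "singular_chain (Suc n) X d" "chain_boundary (Suc n) d = c"
proof -
  obtain x where "x \<in> St" using nonempty by blast
  then have "contractible St" using contr contractible_rel_imp_contractible by blast
  moreover have "cycle n X c" using assms by (simp add: singular_cycle)
  ultimately have "bdry n X c" using bdry_of_contractible assms(1) by blast
  then show ?thesis using that by (auto simp: singular_boundary)
qed

text \<open>The difference of c and c' is a cycle upstairs, hence a boundary because
  \<open>St\<close> is contractible, and the filling is projected. This turns every homology between
  1-cycles below into a comparison of end points.\<close>

lemma homologous_projections:
  assumes c: "singular_chain 1 X c" "singular_chain 1 X c'"
    and eq: "chain_boundary 1 c = chain_boundary 1 c'"
  shows "bdry 1 Y (chain_map 1 p c - chain_map 1 p c')"
proof -
  obtain d where d: "singular_chain (Suc 1) X d" "chain_boundary (Suc 1) d = c - c'"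
    using fill_cycle[of 1 "c - c'"] c eq by (auto simp: singular_chain_diff chain_boundary_diff)
  have "chain_boundary (Suc 1) (chain_map (Suc 1) p d) = chain_map 1 p c - chain_map 1 p c'"
    using chain_boundary_chain_map[OF d(1), of p] d(2) by (simp add: chain_map_diff)
  moreover have "singular_chain (Suc 1) Y (chain_map (Suc 1) p d)"
    by (rule singular_chain_chain_map[OF d(1) p_map])
  ultimately show ?thesis unfolding singular_boundary by blast
qed

text \<open>Any 1-chain with the prescribed boundary; that it is a chain and not a path costs
  nothing, since only its boundary matters.\<close>

definition join :: "'b \<Rightarrow> 'b \<Rightarrow> 'b chain"
  where "join x y = (SOME d. singular_chain 1 X d \<and> chain_boundary 1 d = frag_of (pt y) - frag_of (pt x))"

lemma join:
  assumes "x \<in> St" "y \<in> St"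
  shows "singular_chain 1 X (join x y)" "chain_boundary 1 (join x y) = frag_of (pt y) - frag_of (pt x)"
proof -
  have "homologous_rel 0 X {} (frag_of (pt y)) (frag_of (pt x))"
    using assms by (intro iso_integer_zeroth_homology_group_aux[OF path_connected_X] singular_simplex_pt) auto
  then have "\<exists>d. singular_chain 1 X d \<and> chain_boundary 1 d = frag_of (pt y) - frag_of (pt x)"
    by (simp add: homologous_rel_def singular_boundary One_nat_def)
  from someI_ex[OF this] have "singular_chain 1 X (join x y) \<and>
      chain_boundary 1 (join x y) = frag_of (pt y) - frag_of (pt x)"
    unfolding join_def .
  then show "singular_chain 1 X (join x y)"
    "chain_boundary 1 (join x y) = frag_of (pt y) - frag_of (pt x)" by simp_all
qed

definition base :: 'b where "base = (SOME x. x \<in> St)"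

lemma base_in: "base \<in> St"
  using nonempty unfolding base_def by (simp add: some_in_eq)

text \<open>The Hurewicz image of a deck transformation: a cycle in the quotient whose class does
  not depend on the chain that was chosen.\<close>

definition loop :: "('b \<Rightarrow> 'b) \<Rightarrow> 'a chain"
  where "loop g = chain_map 1 p (join base (g base))"

lemma chain_boundary_1_chain_map:
  "singular_chain 1 X c \<Longrightarrow> chain_boundary 1 (chain_map 1 g c) = chain_map 0 g (chain_boundary 1 c)"
  using chain_boundary_chain_map[of 1 X c g] by (simp add: One_nat_def)

text \<open>A chain from the base point to its image under g h may be replaced by one to its image
  under g followed by the g-translate of one to its image under h, and the translate has the same
  projection.\<close>

lemma loop_comp:
  assumes g: "g \<in> \<Gamma>" and h: "h \<in> \<Gamma>"
  shows "bdry 1 Y (loop (g \<circ> h) - (loop g + loop h))"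
proof -
  note ag = join[OF base_in deck_props(5)[OF g base_in]]
  note ah = join[OF base_in deck_props(5)[OF h base_in]]
  note agh = join[OF base_in deck_props(5)[OF comp_in[OF g h] base_in]]
  have "bdry 1 Y (chain_map 1 p (join base ((g \<circ> h) base)) -
      chain_map 1 p (join base (g base) + chain_map 1 g (join base (h base))))"
    using ag ah agh chain_map_X[OF g ah(1)]
    by (intro homologous_projections)
      (auto simp: singular_chain_add chain_boundary_add chain_boundary_1_chain_map chain_map_diff)
  then show ?thesis
    by (simp add: loop_def chain_map_add chain_map_p_deck[OF g ah(1)])
qed

lemma loop_id: "bdry 1 Y (loop id)"
proof -
  have "loop (id \<circ> id) - (loop id + loop id) = - loop id" by simp
  then show ?thesis using loop_comp[OF id_in id_in] by (simp only: singular_relboundary_minus)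
qed

text \<open>An arbitrary chain becomes a loop after joining the end points of its simplices to the
  base point.\<close>

lemma cycle_homologous_to_loop:
  assumes "cycle 1 Y z"
  obtains g where "g \<in> \<Gamma>" "bdry 1 Y (z - loop g)"
proof -
  define s where "s y = (SOME x. x \<in> St \<and> p x = y)" for y
  have s: "s y \<in> St" "p (s y) = y" if "y \<in> S" for y
  proof -
    have "\<exists>x. x \<in> St \<and> p x = y"
      using that covering_space_imp_surjective[OF cov] by (metis imageE)
    from someI_ex[OF this] have "s y \<in> St \<and> p (s y) = y" unfolding s_def .
    then show "s y \<in> St" "p (s y) = y" by simp_all
  qed
  \<comment> \<open>E joins the base point to a chosen lift of each end point. It is applied to the
    boundary, so its contribution disappears for cycles, while on a single simplex it supplies the
    missing closing chains.\<close>
  define E where "E = frag_extend (\<lambda>f. chain_map 1 p (join base (s (f vertex0))))"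
  have E: "E (a - b) = E a - E b" "E 0 = 0" for a b by (simp_all add: E_def frag_extend_diff)
  have "\<exists>g\<in>\<Gamma>. bdry 1 Y (c - E (chain_boundary 1 c) - loop g)"
    if "singular_chain 1 Y c" for c
    using that unfolding singular_chain_def
  proof (induction c rule: frag_induction_keys)
    case zero
    have "bdry 1 Y (- loop id)" using loop_id by (simp only: singular_relboundary_minus)
    then show ?case using id_in by (auto simp: E)
  next
    case (one \<sigma>)
    then obtain \<tau> where \<tau>: "singular_simplex 1 X \<tau>" "simplex_map 1 p \<tau> = \<sigma>"
      using lift_simplex by blast
    define x0 where "x0 = singular_face 1 1 \<tau> vertex0"
    define x1 where "x1 = singular_face 1 0 \<tau> vertex0"
    have faces: "singular_simplex 0 X (singular_face 1 k \<tau>)" if "k \<le> 1" for k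
      using singular_simplex_singular_face[OF \<tau>(1) _ that] by (simp add: One_nat_def)
    have x: "x0 \<in> St" "x1 \<in> St"
      using singular_simplex_0_eq_pt(1)[OF faces] by (auto simp: x0_def x1_def)
    have "{..1::nat} = {0, 1}" by auto
    then have dt: "chain_boundary 1 (frag_of \<tau>) = frag_of (pt x1) - frag_of (pt x0)"
      using singular_simplex_0_eq_pt(2)[OF faces, of 0] singular_simplex_0_eq_pt(2)[OF faces, of 1]
      by (simp add: chain_boundary_of x0_def x1_def)
    have ts: "chain_map 1 p (frag_of \<tau>) = frag_of \<sigma>" using \<tau>(2) by simp
    have ct: "singular_chain 1 X (frag_of \<tau>)" using \<tau>(1) by (simp add: singular_chain_of)
    have ds: "chain_boundary 1 (frag_of \<sigma>) = frag_of (pt (p x1)) - frag_of (pt (p x0))"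
      using chain_boundary_1_chain_map[OF ct, of p] ts dt by (simp add: chain_map_diff)
    have pS: "p x0 \<in> S" "p x1 \<in> S" using x covering_space_imp_surjective[OF cov] by auto
    define a0 where "a0 = s (p x0)"
    define a1 where "a1 = s (p x1)"
    have a: "a0 \<in> St" "a1 \<in> St" "p a0 = p x0" "p a1 = p x1"
      using s pS by (auto simp: a0_def a1_def)
    obtain g0 g1 where g0: "g0 \<in> \<Gamma>" "g0 a0 = x0" and g1: "g1 \<in> \<Gamma>" "g1 a1 = x1"
      using transitive a x by metis
    obtain h where h: "h \<in> \<Gamma>" "g0 \<circ> h = id" using inv_ex[OF g0(1)] by blast
    have hg: "h \<circ> g1 \<in> \<Gamma>" using comp_in h g1 by blast
    note A0 = join[OF base_in a(1)] and A1 = join[OF base_in a(2)]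
    note A2 = join[OF base_in deck_props(5)[OF hg base_in], unfolded comp_apply]
    have gh: "g0 (h (g1 base)) = g1 base" using fun_cong[OF h(2)] by simp
    \<comment> \<open>The lift of the simplex, closed up by translates of the joining chains, runs
      from g0 base to g1 base. So does the g0-translate of a chain from base to h (g1 base), where h
      is the inverse of g0; the loop therefore belongs to h g1.\<close>
    let ?c = "chain_map 1 g0 (join base a0) + frag_of \<tau> - chain_map 1 g1 (join base a1)"
    let ?d = "chain_map 1 g0 (join base (h (g1 base)))"
    have "chain_boundary 1 ?c = frag_of (pt (g1 base)) - frag_of (pt (g0 base))"
      by (simp add: chain_boundary_add chain_boundary_diff chain_boundary_1_chain_map A0 A1 dt
          chain_map_diff g0(2) g1(2))
    moreover have "chain_boundary 1 ?d = frag_of (pt (g1 base)) - frag_of (pt (g0 base))"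
      using gh by (simp add: chain_boundary_1_chain_map A2 chain_map_diff)
    moreover have "singular_chain 1 X ?c" "singular_chain 1 X ?d"
      using A0 A1 A2 ct chain_map_X g0(1) g1(1)
      by (auto intro!: singular_chain_add singular_chain_diff)
    ultimately have "bdry 1 Y (chain_map 1 p ?c - chain_map 1 p ?d)"
      by (intro homologous_projections) auto
    moreover have "chain_map 1 p ?d = loop (h \<circ> g1)"
      unfolding loop_def comp_apply by (rule chain_map_p_deck[OF g0(1) A2(1)])
    moreover have "chain_map 1 p ?c = frag_of \<sigma> - E (chain_boundary 1 (frag_of \<sigma>))"
      unfolding ds E by (simp add: E_def chain_map_add chain_map_diff ts chain_map_p_deck g0(1) g1(1)
          A0(1) A1(1) del: chain_map_of) (simp add: a0_def a1_def)
    ultimately show ?case using hg by auto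
  next
    case (diff a b)
    then obtain g h where gh: "g \<in> \<Gamma>" "h \<in> \<Gamma>"
      and bg: "bdry 1 Y (a - E (chain_boundary 1 a) - loop g)"
      and bh: "bdry 1 Y (b - E (chain_boundary 1 b) - loop h)" by blast
    \<comment> \<open>With k the inverse of h, additivity of loops applied to g = h (k g) shows that
      the difference of the loops of g and h is the loop of k g.\<close>
    obtain k where k: "k \<in> \<Gamma>" "h \<circ> k = id" using inv_ex[OF gh(2)] by blast
    have kg: "k \<circ> g \<in> \<Gamma>" using comp_in k gh by blast
    have "bdry 1 Y (loop (h \<circ> (k \<circ> g)) - (loop h + loop (k \<circ> g)))"
      by (rule loop_comp[OF gh(2) kg])
    moreover have "h \<circ> (k \<circ> g) = g" using k(2) by (simp flip: comp_assoc)
    ultimately have b3: "bdry 1 Y (loop g - (loop h + loop (k \<circ> g)))" by simp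
    have "bdry 1 Y ((a - E (chain_boundary 1 a) - loop g) - (b - E (chain_boundary 1 b) - loop h)
        + (loop g - (loop h + loop (k \<circ> g))))"
      by (intro singular_relboundary_add singular_relboundary_diff bg bh b3)
    then have "bdry 1 Y (a - b - E (chain_boundary 1 (a - b)) - loop (k \<circ> g))"
      by (simp add: chain_boundary_diff E algebra_simps)
    then show ?case using kg by blast
  qed
  moreover have z: "singular_chain 1 Y z" "chain_boundary 1 z = 0"
    using assms by (simp_all add: singular_cycle)
  ultimately have "\<exists>g\<in>\<Gamma>. bdry 1 Y (z - E (chain_boundary 1 z) - loop g)" by blast
  then show ?thesis using that by (auto simp: z(2) E(2))
qed

end

declare One_nat_def [simp]

lemma singular_chain_pt: "x \<in> topspace X \<Longrightarrow> singular_chain 0 X (frag_of (pt x))"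
  by (simp add: singular_chain_of singular_simplex_pt)

lemma frag_cmul_diff: "frag_cmul j (u - v) = frag_cmul j u - frag_cmul j v"
  by (metis frag_cmul_distrib2 add_diff_cancel diff_add_cancel)

context galois_cover
begin

lemma card_independent_H1_le:
  assumes dep: "\<And>f :: nat \<Rightarrow> _. (\<And>i. i \<le> m \<Longrightarrow> f i \<in> \<Gamma>) \<Longrightarrow>
      \<exists>k :: nat \<Rightarrow> int. (\<exists>i\<le>m. k i \<noteq> 0) \<and> bdry 1 Y (\<Sum>i\<le>m. frag_cmul (k i) (loop (f i)))"
    and B: "int_independent (homology_group 1 Y) B"
  shows "card B \<le> m"
proof (rule card_independent_homology_le[where n = 1])
  show "int_independent (homology_group (int 1) Y) B" using B by simp
  fix z :: "nat \<Rightarrow> 'a chain" assume z: "\<And>i. i \<le> m \<Longrightarrow> cycle 1 Y (z i)"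
  have "\<forall>i. \<exists>g. i \<le> m \<longrightarrow> g \<in> \<Gamma> \<and> bdry 1 Y (z i - loop g)"
    using z cycle_homologous_to_loop by metis
  then obtain f where f: "\<And>i. i \<le> m \<Longrightarrow> f i \<in> \<Gamma>" "\<And>i. i \<le> m \<Longrightarrow> bdry 1 Y (z i - loop (f i))"
    by metis
  have "\<exists>k :: nat \<Rightarrow> int. (\<exists>i\<le>m. k i \<noteq> 0) \<and> bdry 1 Y (\<Sum>i\<le>m. frag_cmul (k i) (loop (f i)))"
    by (rule dep) (rule f(1))
  then obtain k :: "nat \<Rightarrow> int" where k:
    "(\<exists>i\<le>m. k i \<noteq> 0) \<and> bdry 1 Y (\<Sum>i\<le>m. frag_cmul (k i) (loop (f i)))" ..
  have "bdry 1 Y (\<Sum>i\<in>I. frag_cmul (k i) (z i - loop (f i)))" if "finite I" "I \<subseteq> {..m}" for I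
    using that
    by (induction I) (auto intro!: singular_relboundary_add singular_relboundary_cmul f(2) simp del: One_nat_def)
  then have "bdry 1 Y ((\<Sum>i\<le>m. frag_cmul (k i) (z i - loop (f i))) +
      (\<Sum>i\<le>m. frag_cmul (k i) (loop (f i))))"
    using k by (intro singular_relboundary_add) auto
  also have "(\<Sum>i\<le>m. frag_cmul (k i) (z i - loop (f i))) + (\<Sum>i\<le>m. frag_cmul (k i) (loop (f i))) =
      (\<Sum>i\<le>m. frag_cmul (k i) (z i))"
    by (simp flip: sum.distrib frag_cmul_distrib2)
  finally show "\<exists>k :: nat \<Rightarrow> int. (\<exists>i\<le>m. k i \<noteq> 0) \<and> bdry 1 Y (\<Sum>i\<le>m. frag_cmul (k i) (z i))"
    using conjunct1[OF k] by (intro exI[of _ k] conjI)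
qed

text \<open>Call a chain represented by v if it is homologous to the loop of some h in \<Delta> with
  \<tau> h = v. This relation is closed under integer combinations, so the chain in question is
  represented by 0, that is, by the identity, whose loop bounds.\<close>

lemma loop_combination:
  fixes \<tau> :: "('b \<Rightarrow> 'b) \<Rightarrow> 'v::real_vector"
  assumes sub: "\<Delta> \<subseteq> \<Gamma>" and idD: "id \<in> \<Delta>"
    and compD: "\<And>g h. \<lbrakk>g \<in> \<Delta>; h \<in> \<Delta>\<rbrakk> \<Longrightarrow> g \<circ> h \<in> \<Delta>"
    and invD: "\<And>g. g \<in> \<Delta> \<Longrightarrow> \<exists>h\<in>\<Delta>. h \<circ> g = id"
    and add: "\<And>g h. \<lbrakk>g \<in> \<Delta>; h \<in> \<Delta>\<rbrakk> \<Longrightarrow> \<tau> (g \<circ> h) = \<tau> g + \<tau> h"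
    and inj: "\<And>g. \<lbrakk>g \<in> \<Delta>; \<tau> g = 0\<rbrakk> \<Longrightarrow> g = id"
    and I: "finite I" and f: "\<And>i. i \<in> I \<Longrightarrow> f i \<in> \<Delta>"
    and rel: "(\<Sum>i\<in>I. of_int (k i) *\<^sub>R \<tau> (f i)) = 0"
  shows "bdry 1 Y (\<Sum>i\<in>I. frag_cmul (k i) (loop (f i)))"
proof -
  define Rel where "Rel v c \<longleftrightarrow> (\<exists>h\<in>\<Delta>. \<tau> h = v \<and> bdry 1 Y (loop h - c))" for v c
  have tid: "\<tau> id = 0" using add[OF idD idD] by simp
  have Rel0: "Rel 0 0" unfolding Rel_def using idD tid loop_id by auto
  have Rel_add: "Rel (v + w) (c + d)" if "Rel v c" "Rel w d" for v w c d
  proof -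
    obtain g h where g: "g \<in> \<Delta>" "\<tau> g = v" "bdry 1 Y (loop g - c)"
      and h: "h \<in> \<Delta>" "\<tau> h = w" "bdry 1 Y (loop h - d)" using \<open>Rel v c\<close> \<open>Rel w d\<close> unfolding Rel_def by blast
    have "bdry 1 Y ((loop (g \<circ> h) - (loop g + loop h)) + ((loop g - c) + (loop h - d)))"
      using g(1) h(1) sub
      by (intro singular_relboundary_add[OF loop_comp singular_relboundary_add[OF g(3) h(3)]]) auto
    then have "bdry 1 Y (loop (g \<circ> h) - (c + d))" by (simp add: algebra_simps)
    then show ?thesis unfolding Rel_def using compD g h add by blast
  qed
  have Rel_minus: "Rel (- v) (- c)" if R: "Rel v c" for v c
  proof -
    obtain g where g: "g \<in> \<Delta>" "\<tau> g = v" "bdry 1 Y (loop g - c)" using R unfolding Rel_def by blast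
    obtain h where h: "h \<in> \<Delta>" "h \<circ> g = id" using invD[OF g(1)] by blast
    have "\<tau> h + v = 0" using add[OF h(1) g(1)] h(2) tid g(2) by simp
    then have "\<tau> h = - v" by (simp add: eq_neg_iff_add_eq_0)
    moreover have "bdry 1 Y (loop id - (loop (h \<circ> g) - (loop h + loop g)) - (loop g - c))"
      using g(1) h(1) sub
      by (intro singular_relboundary_diff[OF singular_relboundary_diff[OF loop_id loop_comp] g(3)]) auto
    then have "bdry 1 Y (loop h - (- c))" unfolding h(2) by (simp add: algebra_simps)
    ultimately show ?thesis unfolding Rel_def using h(1) by blast
  qed
  have Rel_nat: "Rel (of_nat n *\<^sub>R v) (frag_cmul (int n) c)" if "Rel v c" for v c n
  proof (induction n)
    case (Suc n)
    then show ?case using Rel_add[OF that Suc]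
      by (simp add: frag_cmul_distrib scaleR_left_distrib)
  qed (simp add: Rel0)
  have Rel_int: "Rel (of_int n *\<^sub>R v) (frag_cmul n c)" if "Rel v c" for v c n
  proof (cases n rule: int_cases2)
    case (nonneg m)
    then show ?thesis using Rel_nat[OF that, of m] by simp
  next
    case (nonpos m)
    then show ?thesis using Rel_minus[OF Rel_nat[OF that, of m]] by simp
  qed
  have Rel_loop: "Rel (\<tau> g) (loop g)" if "g \<in> \<Delta>" for g
    unfolding Rel_def using that by auto
  have "Rel (\<Sum>i\<in>I. of_int (k i) *\<^sub>R \<tau> (f i)) (\<Sum>i\<in>I. frag_cmul (k i) (loop (f i)))"
    using I f by (induction I) (auto simp: Rel0 intro!: Rel_add Rel_int Rel_loop)
  then obtain h where h: "h \<in> \<Delta>" "\<tau> h = 0"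
    "bdry 1 Y (loop h - (\<Sum>i\<in>I. frag_cmul (k i) (loop (f i))))"
    unfolding rel Rel_def by blast
  have "bdry 1 Y (loop id - (loop h - (\<Sum>i\<in>I. frag_cmul (k i) (loop (f i)))))"
    by (intro singular_relboundary_diff loop_id h)
  then show ?thesis using inj[OF h(1,2)] by simp
qed

end

section \<open>Second homology of the quotient by a free abelian group of rank two\<close>

locale rank2_galois_cover = galois_cover +
  fixes s t :: "'a \<Rightarrow> 'a"
  assumes s_in: "s \<in> \<Gamma>" and t_in: "t \<in> \<Gamma>" and st: "s \<circ> t = t \<circ> s"
    and gen: "\<And>g. g \<in> \<Gamma> \<Longrightarrow> \<exists>i j i' j'. s ^^ i \<circ> t ^^ j \<circ> g = s ^^ i' \<circ> t ^^ j'"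
    and indep: "\<And>i j i' j'. s ^^ i \<circ> t ^^ j = s ^^ i' \<circ> t ^^ j' \<Longrightarrow> i = i' \<and> j = j'"
begin

lemma funpow_in: "(g::'a \<Rightarrow> 'a) \<in> \<Gamma> \<Longrightarrow> g ^^ n \<in> \<Gamma>"
  by (induction n) (simp_all add: comp_in id_in[unfolded id_def] id_in)

lemma simplex_map_funpow:
  fixes g :: "'a \<Rightarrow> 'a"
  assumes "singular_simplex n X \<tau>"
  shows "(simplex_map n g ^^ i) \<tau> = simplex_map n (g ^^ i) \<tau>"
proof (induction i)
  case 0
  have "simplex_map n (\<lambda>x. x) \<tau> = \<tau>" by (rule simplex_map_id_gen[OF assms]) simp
  then show ?case by (simp only: funpow.simps(1) id_def)
next
  case (Suc i)
  then show ?case by (metis comp_apply funpow.simps(2) simplex_map_compose)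
qed

text \<open>Freeness on simplices is read off at the zeroth vertex: a deck transformation is
  determined by its value at one point.\<close>

lemma Z2_action: "free_Z2_action (singular_simplex_set n X) (simplex_map n s) (simplex_map n t)"
proof
  show "simplex_map n s ` singular_simplex_set n X \<subseteq> singular_simplex_set n X"
    "simplex_map n t ` singular_simplex_set n X \<subseteq> singular_simplex_set n X"
    using singular_simplex_simplex_map[OF _ deck_props(4)[OF s_in]]
      singular_simplex_simplex_map[OF _ deck_props(4)[OF t_in]] by blast+
  fix x assume "x \<in> singular_simplex_set n X"
  then have x: "singular_simplex n X x" by simp
  show "simplex_map n s (simplex_map n t x) = simplex_map n t (simplex_map n s x)"
    using st by (metis comp_apply simplex_map_compose)
  have vx: "x vertex0 \<in> St"
    using x vertex0_in[of n] unfolding singular_simplex_top_of_set by blast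
  have ev: "(simplex_map n s ^^ i) ((simplex_map n t ^^ j) x) = simplex_map n (s ^^ i \<circ> t ^^ j) x" for i j
  proof -
    have "singular_simplex n X (simplex_map n (t ^^ j) x)"
      using singular_simplex_simplex_map[OF x] deck_props(4)[OF funpow_in[OF t_in]] by blast
    then show ?thesis by (metis x comp_apply simplex_map_compose simplex_map_funpow)
  qed
  show "i = i' \<and> j = j'"
    if "(simplex_map n s ^^ i) ((simplex_map n t ^^ j) x) = (simplex_map n s ^^ i') ((simplex_map n t ^^ j') x)"
    for i j i' j'
  proof -
    have "simplex_map n (s ^^ i \<circ> t ^^ j) x vertex0 = simplex_map n (s ^^ i' \<circ> t ^^ j') x vertex0"
      using that unfolding ev by simp
    then have "(s ^^ i \<circ> t ^^ j) (x vertex0) = (s ^^ i' \<circ> t ^^ j') (x vertex0)"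
      by (simp add: simplex_map_def)
    then have "s ^^ i \<circ> t ^^ j = s ^^ i' \<circ> t ^^ j'"
      by (intro cancel[OF _ _ vx] comp_in funpow_in s_in t_in)
    then show ?thesis by (rule indep)
  qed
qed

lemma fibres:
  assumes x: "singular_simplex n X x" and y: "singular_simplex n X y"
    and eq: "simplex_map n p x = simplex_map n p y"
  shows "\<exists>i j i' j'. (simplex_map n s ^^ i) ((simplex_map n t ^^ j) x) =
    (simplex_map n s ^^ i') ((simplex_map n t ^^ j') y)"
proof -
  have ev: "(simplex_map n s ^^ i) ((simplex_map n t ^^ j) x) = simplex_map n (s ^^ i \<circ> t ^^ j) x"
    if "singular_simplex n X x" for i j x
  proof -
    have "singular_simplex n X (simplex_map n (t ^^ j) x)"
      using singular_simplex_simplex_map[OF that] deck_props(4)[OF funpow_in[OF t_in]] by blast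
    then show ?thesis by (metis that comp_apply simplex_map_compose simplex_map_funpow)
  qed
  obtain g where g: "g \<in> \<Gamma>" "simplex_map n g x = y" using simplex_fibre[OF x y eq] .
  obtain i j i' j' where "s ^^ i \<circ> t ^^ j \<circ> g = s ^^ i' \<circ> t ^^ j'" using gen[OF g(1)] by blast
  then have "simplex_map n (s ^^ i' \<circ> t ^^ j') x = simplex_map n (s ^^ i \<circ> t ^^ j) y"
    using g(2) by (metis comp_apply simplex_map_compose)
  then show ?thesis using ev x y by metis
qed

lemma koszul1:
  assumes "singular_chain n X a" "chain_map n p a = 0"
  obtains v w where "singular_chain n X v" "singular_chain n X w"
    "a = (v - chain_map n s v) + (w - chain_map n t w)"
proof -
  interpret Z: free_Z2_action "singular_simplex_set n X" "simplex_map n s" "simplex_map n t"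
    by (rule Z2_action)
  have "\<exists>v w. Poly_Mapping.keys v \<subseteq> singular_simplex_set n X \<and>
      Poly_Mapping.keys w \<subseteq> singular_simplex_set n X \<and>
      a = (v - frag_push (simplex_map n s) v) + (w - frag_push (simplex_map n t) w)"
    using assms fibres simplex_map_p_deck[OF t_in]
    by (intro Z.koszul_end[where f = "simplex_map n p"])
      (auto simp: singular_chain_def chain_map_eq_frag_push)
  then show ?thesis using that by (auto simp: singular_chain_def chain_map_eq_frag_push)
qed

lemma koszul2:
  assumes "singular_chain n X a" "singular_chain n X b"
    "a - chain_map n s a = b - chain_map n t b"
  obtains w where "singular_chain n X w" "a = w - chain_map n t w" "b = w - chain_map n s w"
proof -
  interpret Z: free_Z2_action "singular_simplex_set n X" "simplex_map n s" "simplex_map n t"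
    by (rule Z2_action)
  show ?thesis
    using Z.koszul_middle[where a = a and b = b] assms that
    by (auto simp: singular_chain_def chain_map_eq_frag_push)
qed

lemma t_injective:
  assumes "singular_chain n X a" "a - chain_map n t a = 0"
  shows "a = 0"
proof -
  interpret Z: free_Z2_action "singular_simplex_set n X" "simplex_map n s" "simplex_map n t"
    by (rule Z2_action)
  show ?thesis
    using frag_push_fixed_imp_zero[OF Z.t_closed Z.t_free, where a = a] assms
    by (auto simp: singular_chain_def chain_map_eq_frag_push)
qed

lemma chain_map_st:
  "chain_map n s (chain_map n t c) = chain_map n t (chain_map n s c)"
  using st by (metis chain_map_compose comp_apply)

lemma boundary_map:
  "singular_chain (Suc n) X c \<Longrightarrow> chain_boundary (Suc n) (chain_map (Suc n) g c) = chain_map n g (chain_boundary (Suc n) c)"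
  using chain_boundary_chain_map[of "Suc n" X c g] by simp

lemma boundary_chain: "singular_chain (Suc n) X c \<Longrightarrow> singular_chain n X (chain_boundary (Suc n) c)"
  using singular_chain_boundary[of "Suc n" X c] by simp

lemma boundary_boundary:
  "singular_chain (Suc (Suc n)) X c \<Longrightarrow> chain_boundary (Suc n) (chain_boundary (Suc (Suc n)) c) = 0"
  using chain_boundary_boundary[of "Suc (Suc n)" X c] by simp

lemmas chain_intros = singular_chain_add singular_chain_diff chain_map_X s_in t_in boundary_chain
  singular_chain_cmul

lemmas chain_simps = chain_boundary_add chain_boundary_diff chain_boundary_cmul chain_map_add
  chain_map_diff boundary_map chain_map_st boundary_boundary

text \<open>\<open>degree2 z m\<close> says that the cycle \<open>z\<close> of the quotient corresponds to \<open>m\<close> times the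
  fundamental class: the three layers of the Koszul double complex connect \<open>z\<close> with
  a \<open>0\<close>-chain of augmentation \<open>m\<close>.\<close>

definition degree2 :: "'b chain \<Rightarrow> int \<Rightarrow> bool"
  where "degree2 z m \<longleftrightarrow> (\<exists>\<zeta> \<eta> \<eta>' \<omega> \<beta>. singular_chain (Suc (Suc 0)) X \<zeta> \<and> singular_chain (Suc 0) X \<eta> \<and>
    singular_chain (Suc 0) X \<eta>' \<and> singular_chain 0 X \<omega> \<and> singular_chain (Suc 0) X \<beta> \<and>
    chain_map (Suc (Suc 0)) p \<zeta> = z \<and>
    chain_boundary (Suc (Suc 0)) \<zeta> = (\<eta> - chain_map (Suc 0) s \<eta>) + (\<eta>' - chain_map (Suc 0) t \<eta>') \<and>
    chain_boundary (Suc 0) \<eta> = \<omega> - chain_map 0 t \<omega> \<and>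
    - chain_boundary (Suc 0) \<eta>' = \<omega> - chain_map 0 s \<omega> \<and>
    chain_boundary (Suc 0) \<beta> = \<omega> - frag_cmul m (frag_of (pt base)))"

lemma zero_chain_homologous:
  assumes "singular_chain 0 X \<omega>"
  shows "\<exists>m \<beta>. singular_chain (Suc 0) X \<beta> \<and> chain_boundary (Suc 0) \<beta> = \<omega> - frag_cmul m (frag_of (pt base))"
  using assms unfolding singular_chain_def[of 0]
proof (induction \<omega> rule: frag_induction_keys)
  case zero
  show ?case by (intro exI[of _ 0]) simp
next
  case (one f)
  then have f: "f vertex0 \<in> St" "f = pt (f vertex0)"
    using singular_simplex_0_eq_pt[of X f] by auto
  show ?case
    using join[OF base_in f(1)] f(2)
    by (intro exI[of _ 1] exI[of _ "join base (f vertex0)"]) simp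
next
  case (diff a b)
  then obtain m \<beta> n \<beta>' where "singular_chain (Suc 0) X \<beta>"
    "chain_boundary (Suc 0) \<beta> = a - frag_cmul m (frag_of (pt base))" "singular_chain (Suc 0) X \<beta>'"
    "chain_boundary (Suc 0) \<beta>' = b - frag_cmul n (frag_of (pt base))" by blast
  then show ?case
    by (intro exI[of _ "m - n"] exI[of _ "\<beta> - \<beta>'"])
      (simp add: singular_chain_diff chain_boundary_diff frag_cmul_diff_distrib)
qed

text \<open>A zigzag through the double complex. The boundary of a lift of z dies downstairs, so it
  is a combination of images of 1 - s and 1 - t; the boundaries of the two coefficients satisfy the
  middle Koszul relation and come from a common 0-chain \<omega>.\<close>

lemma degree2_exists:
  assumes "cycle 2 Y z"
  shows "\<exists>m. degree2 z m"
proof -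
  have z: "singular_chain (Suc (Suc 0)) Y z" "chain_boundary (Suc (Suc 0)) z = 0"
    using assms by (simp_all add: singular_cycle numeral_2_eq_2)
  obtain \<zeta> where \<zeta>: "singular_chain (Suc (Suc 0)) X \<zeta>" "chain_map (Suc (Suc 0)) p \<zeta> = z"
    using lift_chain[OF z(1)] .
  have "chain_map (Suc 0) p (chain_boundary (Suc (Suc 0)) \<zeta>) = 0"
    using boundary_map[OF \<zeta>(1), of p] \<zeta>(2) z(2) by simp
  then obtain \<eta> \<eta>' where \<eta>: "singular_chain (Suc 0) X \<eta>" "singular_chain (Suc 0) X \<eta>'"
    "chain_boundary (Suc (Suc 0)) \<zeta> = (\<eta> - chain_map (Suc 0) s \<eta>) + (\<eta>' - chain_map (Suc 0) t \<eta>')"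
    using koszul1[OF boundary_chain[OF \<zeta>(1)]] by blast
  let ?e = "chain_boundary (Suc 0) \<eta>" and ?e' = "- chain_boundary (Suc 0) \<eta>'"
  have "0 = chain_boundary (Suc 0) (chain_boundary (Suc (Suc 0)) \<zeta>)"
    using boundary_boundary[OF \<zeta>(1)] by simp
  also have "\<dots> = (?e - chain_map 0 s ?e) - (?e' - chain_map 0 t ?e')"
    unfolding \<eta>(3) using \<eta>(1,2) by (simp add: chain_simps chain_map_minus)
  finally have "?e - chain_map 0 s ?e = ?e' - chain_map 0 t ?e'" by simp
  moreover have "singular_chain 0 X ?e" "singular_chain 0 X ?e'"
    using \<eta> by (auto simp: singular_chain_minus intro: chain_intros)
  ultimately obtain \<omega> where \<omega>: "singular_chain 0 X \<omega>" "?e = \<omega> - chain_map 0 t \<omega>"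
    "?e' = \<omega> - chain_map 0 s \<omega>" using koszul2 by metis
  obtain m \<beta> where "singular_chain (Suc 0) X \<beta>"
    "chain_boundary (Suc 0) \<beta> = \<omega> - frag_cmul m (frag_of (pt base))"
    using zero_chain_homologous[OF \<omega>(1)] by blast
  then show ?thesis unfolding degree2_def using \<zeta> \<eta> \<omega> by blast
qed

text \<open>All layers of the zigzag are linear. The degree is treated as a relation closed under
  integer combinations, not as a function of z.\<close>

lemma degree2_linear:
  assumes "degree2 z m" "degree2 z' m'"
  shows "degree2 (frag_cmul k z + frag_cmul k' z') (k * m + k' * m')"
proof -
  obtain \<zeta>1 \<eta>1 \<eta>1' \<omega>1 \<beta>1 where 1: "singular_chain (Suc (Suc 0)) X \<zeta>1" "singular_chain (Suc 0) X \<eta>1"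
    "singular_chain (Suc 0) X \<eta>1'" "singular_chain 0 X \<omega>1" "singular_chain (Suc 0) X \<beta>1"
    "chain_map (Suc (Suc 0)) p \<zeta>1 = z"
    "chain_boundary (Suc (Suc 0)) \<zeta>1 = (\<eta>1 - chain_map (Suc 0) s \<eta>1) + (\<eta>1' - chain_map (Suc 0) t \<eta>1')"
    "chain_boundary (Suc 0) \<eta>1 = \<omega>1 - chain_map 0 t \<omega>1"
    "- chain_boundary (Suc 0) \<eta>1' = \<omega>1 - chain_map 0 s \<omega>1"
    "chain_boundary (Suc 0) \<beta>1 = \<omega>1 - frag_cmul m (frag_of (pt base))"
    using assms(1) unfolding degree2_def by blast
  obtain \<zeta>2 \<eta>2 \<eta>2' \<omega>2 \<beta>2 where 2: "singular_chain (Suc (Suc 0)) X \<zeta>2" "singular_chain (Suc 0) X \<eta>2"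
    "singular_chain (Suc 0) X \<eta>2'" "singular_chain 0 X \<omega>2" "singular_chain (Suc 0) X \<beta>2"
    "chain_map (Suc (Suc 0)) p \<zeta>2 = z'"
    "chain_boundary (Suc (Suc 0)) \<zeta>2 = (\<eta>2 - chain_map (Suc 0) s \<eta>2) + (\<eta>2' - chain_map (Suc 0) t \<eta>2')"
    "chain_boundary (Suc 0) \<eta>2 = \<omega>2 - chain_map 0 t \<omega>2"
    "- chain_boundary (Suc 0) \<eta>2' = \<omega>2 - chain_map 0 s \<omega>2"
    "chain_boundary (Suc 0) \<beta>2 = \<omega>2 - frag_cmul m' (frag_of (pt base))"
    using assms(2) unfolding degree2_def by blast
  let ?L = "\<lambda>c c' :: 'a chain. frag_cmul k c + frag_cmul k' c'"
  have neg: "chain_boundary (Suc 0) \<eta>1' = - (\<omega>1 - chain_map 0 s \<omega>1)"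
    "chain_boundary (Suc 0) \<eta>2' = - (\<omega>2 - chain_map 0 s \<omega>2)"
    using 1(9) 2(9) by (metis minus_minus)+
  show ?thesis unfolding degree2_def
  proof (rule exI[of _ "?L \<zeta>1 \<zeta>2"], rule exI[of _ "?L \<eta>1 \<eta>2"], rule exI[of _ "?L \<eta>1' \<eta>2'"],
      rule exI[of _ "?L \<omega>1 \<omega>2"], rule exI[of _ "?L \<beta>1 \<beta>2"], intro conjI)
    show "chain_boundary (Suc (Suc 0)) (?L \<zeta>1 \<zeta>2) =
      (?L \<eta>1 \<eta>2 - chain_map (Suc 0) s (?L \<eta>1 \<eta>2)) + (?L \<eta>1' \<eta>2' - chain_map (Suc 0) t (?L \<eta>1' \<eta>2'))"
      by (simp add: chain_boundary_add chain_boundary_cmul chain_map_add 1(7) 2(7) frag_cmul_diff frag_cmul_distrib2)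
    show "chain_boundary (Suc 0) (?L \<eta>1 \<eta>2) = ?L \<omega>1 \<omega>2 - chain_map 0 t (?L \<omega>1 \<omega>2)"
      by (simp add: chain_boundary_add chain_boundary_cmul chain_map_add 1(8) 2(8) frag_cmul_diff)
    show "- chain_boundary (Suc 0) (?L \<eta>1' \<eta>2') = ?L \<omega>1 \<omega>2 - chain_map 0 s (?L \<omega>1 \<omega>2)"
      by (simp add: chain_boundary_add chain_boundary_cmul chain_map_add neg frag_cmul_diff frag_cmul_distrib2
          del: minus_frag_cmul minus_diff_eq)
        (simp add: frag_cmul_diff frag_cmul_distrib2)
    show "chain_boundary (Suc 0) (?L \<beta>1 \<beta>2) = ?L \<omega>1 \<omega>2 - frag_cmul (k * m + k' * m') (frag_of (pt base))"
      by (simp add: chain_boundary_add chain_boundary_cmul 1(10) 2(10) frag_cmul_diff frag_cmul_distrib)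
  qed (use 1 2 in \<open>auto intro!: chain_intros simp: chain_map_add\<close>)
qed

text \<open>The zigzag run backwards. In degree zero \<beta> fills \<omega>; correcting \<eta> and
  \<eta>' by multiples of \<beta> makes them cycles, hence boundaries, and correcting \<zeta> by
  their fillings makes it a cycle, hence a boundary. All corrections of \<zeta> have the form c - g
  c and vanish under projection.\<close>

lemma degree2_zero_imp_bdry:
  assumes "degree2 z 0"
  shows "bdry 2 Y z"
proof -
  obtain \<zeta> \<eta> \<eta>' \<omega> \<beta> where c: "singular_chain (Suc (Suc 0)) X \<zeta>" "singular_chain (Suc 0) X \<eta>"
    "singular_chain (Suc 0) X \<eta>'" "singular_chain 0 X \<omega>" "singular_chain (Suc 0) X \<beta>"
    and pz: "chain_map (Suc (Suc 0)) p \<zeta> = z"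
    and d\<zeta>: "chain_boundary (Suc (Suc 0)) \<zeta> = (\<eta> - chain_map (Suc 0) s \<eta>) + (\<eta>' - chain_map (Suc 0) t \<eta>')"
    and d\<eta>: "chain_boundary (Suc 0) \<eta> = \<omega> - chain_map 0 t \<omega>"
    and d\<eta>': "- chain_boundary (Suc 0) \<eta>' = \<omega> - chain_map 0 s \<omega>"
    and d\<beta>: "chain_boundary (Suc 0) \<beta> = \<omega>"
    using assms unfolding degree2_def by auto
  have d\<eta>'2: "chain_boundary (Suc 0) \<eta>' = chain_map 0 s \<omega> - \<omega>"
    using d\<eta>' by (metis minus_diff_eq minus_minus)
  have ch1: "singular_chain (Suc 0) X (\<eta> - (\<beta> - chain_map (Suc 0) t \<beta>))"
    and ch2: "singular_chain (Suc 0) X (\<eta>' + (\<beta> - chain_map (Suc 0) s \<beta>))"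
    by (intro chain_intros c)+
  have "chain_boundary (Suc 0) (\<eta> - (\<beta> - chain_map (Suc 0) t \<beta>)) = 0"
    using c by (simp add: chain_simps d\<eta> d\<beta>)
  then obtain \<theta> where \<theta>: "singular_chain (Suc (Suc 0)) X \<theta>"
    "chain_boundary (Suc (Suc 0)) \<theta> = \<eta> - (\<beta> - chain_map (Suc 0) t \<beta>)"
    by (rule fill_cycle[OF zero_less_Suc ch1])
  have "chain_boundary (Suc 0) (\<eta>' + (\<beta> - chain_map (Suc 0) s \<beta>)) = 0"
    using c by (simp add: chain_simps d\<eta>'2 d\<beta>)
  then obtain \<theta>' where \<theta>': "singular_chain (Suc (Suc 0)) X \<theta>'"
    "chain_boundary (Suc (Suc 0)) \<theta>' = \<eta>' + (\<beta> - chain_map (Suc 0) s \<beta>)"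
    by (rule fill_cycle[OF zero_less_Suc ch2])
  let ?\<xi> = "\<zeta> - (\<theta> - chain_map (Suc (Suc 0)) s \<theta>) - (\<theta>' - chain_map (Suc (Suc 0)) t \<theta>')"
  have ch: "singular_chain (Suc (Suc 0)) X ?\<xi>" using c \<theta> \<theta>' by (intro chain_intros)
  have "chain_boundary (Suc (Suc 0)) ?\<xi> = 0"
    using c \<theta> \<theta>' by (simp add: chain_simps d\<zeta>)
  then obtain \<xi> where \<xi>: "singular_chain (Suc (Suc (Suc 0))) X \<xi>"
    "chain_boundary (Suc (Suc (Suc 0))) \<xi> = ?\<xi>"
    by (rule fill_cycle[OF zero_less_Suc ch])
  have "chain_boundary (Suc (Suc (Suc 0))) (chain_map (Suc (Suc (Suc 0))) p \<xi>) = z"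
    using \<theta> \<theta>' pz by (simp add: boundary_map[OF \<xi>(1)] \<xi>(2) chain_map_diff chain_map_p_deck s_in t_in)
  moreover have "singular_chain (Suc (Suc (Suc 0))) Y (chain_map (Suc (Suc (Suc 0))) p \<xi>)"
    by (rule singular_chain_chain_map[OF \<xi>(1) p_map])
  ultimately show ?thesis unfolding singular_boundary numeral_2_eq_2 by blast
qed

text \<open>If two cycles have degrees m and n, their combination with coefficients n and -m has
  degree zero and therefore bounds.\<close>

lemma card_independent_H2_le:
  assumes "int_independent (homology_group 2 Y) B"
  shows "card B \<le> 1"
proof (rule card_independent_homology_le[where n = 2])
  show "int_independent (homology_group (int 2) Y) B" using assms by simp
  fix z :: "nat \<Rightarrow> 'b chain" assume "\<And>i. i \<le> 1 \<Longrightarrow> cycle 2 Y (z i)"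
  then obtain m n where mn: "degree2 (z 0) m" "degree2 (z 1) n"
    using degree2_exists by (meson le_numeral_extra(4) zero_le_one)
  define k where "k i = (if m = 0 \<and> n = 0 then 1 else if i = 0 then n else - m)" for i :: nat
  have "degree2 (frag_cmul (k 0) (z 0) + frag_cmul (k 1) (z 1)) (k 0 * m + k 1 * n)"
    by (rule degree2_linear[OF mn])
  moreover have "k 0 * m + k 1 * n = 0" by (simp add: k_def)
  moreover have "{..1::nat} = {0, 1}" by auto
  ultimately have "bdry 2 Y (\<Sum>i\<le>1. frag_cmul (k i) (z i))"
    using degree2_zero_imp_bdry by simp
  moreover have "\<exists>i\<le>1. k i \<noteq> 0"
  proof (cases "k 0 = 0")
    case True
    then have "k 1 \<noteq> 0" by (auto simp: k_def split: if_splits)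
    then show ?thesis by blast
  qed blast
  ultimately show "\<exists>k :: nat \<Rightarrow> int. (\<exists>i\<le>1. k i \<noteq> 0) \<and> bdry 2 Y (\<Sum>i\<le>1. frag_cmul (k i) (z i))"
    by blast
qed

text \<open>The class of the torus, obtained by filling the square spanned by s and t. If a multiple
  k of it bounded, the zigzag would produce a 1-chain whose boundary plus k times the base point is
  fixed by t, hence zero; augmentation gives k = 0.\<close>

lemma fundamental_class:
  obtains z where "cycle 2 Y z" "\<And>k. bdry 2 Y (frag_cmul k z) \<Longrightarrow> k = 0"
proof -
  let ?ls = "join base (s base)" and ?lt = "join base (t base)" and ?b = "frag_of (pt base)"
  note ls = join[OF base_in deck_props(5)[OF s_in base_in], unfolded One_nat_def]
  note lt = join[OF base_in deck_props(5)[OF t_in base_in], unfolded One_nat_def]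
  have stb: "s (t base) = t (s base)" using fun_cong[OF st, of base] by simp
  \<comment> \<open>The perimeter of the square with corners base, s base, t base and s (t base);
    opposite sides are translates of each other and cancel after projection.\<close>
  let ?c = "(?ls - chain_map (Suc 0) t ?ls) - (?lt - chain_map (Suc 0) s ?lt)"
  have ch: "singular_chain (Suc 0) X ?c" using ls lt by (intro chain_intros)
  have "chain_boundary (Suc 0) ?c = 0"
    using ls lt stb by (simp add: chain_simps)
  then obtain \<xi> where \<xi>: "singular_chain (Suc (Suc 0)) X \<xi>" "chain_boundary (Suc (Suc 0)) \<xi> = ?c"
    by (rule fill_cycle[OF zero_less_Suc ch])
  let ?z = "chain_map (Suc (Suc 0)) p \<xi>"
  have "chain_boundary (Suc (Suc 0)) ?z = 0"
    by (simp add: boundary_map[OF \<xi>(1)] \<xi>(2) chain_map_diff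
        chain_map_p_deck[OF t_in ls(1)] chain_map_p_deck[OF s_in lt(1)])
  then have cyc: "cycle 2 Y ?z"
    unfolding singular_cycle numeral_2_eq_2
    by (intro conjI singular_chain_chain_map[OF \<xi>(1) p_map])
  moreover have "k = 0" if bk: "bdry 2 Y (frag_cmul k ?z)" for k
  proof -
    obtain d where d: "singular_chain (Suc (Suc (Suc 0))) Y d"
      "chain_boundary (Suc (Suc (Suc 0))) d = frag_cmul k ?z"
      using bk unfolding singular_boundary numeral_2_eq_2 by blast
    obtain \<kappa> where \<kappa>: "singular_chain (Suc (Suc (Suc 0))) X \<kappa>" "chain_map (Suc (Suc (Suc 0))) p \<kappa> = d"
      using lift_chain[OF d(1)] .
    let ?e = "frag_cmul k \<xi> - chain_boundary (Suc (Suc (Suc 0))) \<kappa>"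
    have che: "singular_chain (Suc (Suc 0)) X ?e" using \<xi> \<kappa> by (intro chain_intros)
    have "chain_map (Suc (Suc 0)) p ?e = 0"
      using boundary_map[OF \<kappa>(1), of p] \<kappa>(2) d(2) by (simp add: chain_map_diff)
    then obtain v w where vw: "singular_chain (Suc (Suc 0)) X v" "singular_chain (Suc (Suc 0)) X w"
      "?e = (v - chain_map (Suc (Suc 0)) s v) + (w - chain_map (Suc (Suc 0)) t w)"
      using koszul1[OF che] by blast
    let ?v = "chain_boundary (Suc (Suc 0)) v" and ?w = "chain_boundary (Suc (Suc 0)) w"
    have "frag_cmul k ?c = chain_boundary (Suc (Suc 0)) ?e"
      using \<kappa>(1) \<xi>(2) by (simp add: chain_simps)
    also have "\<dots> = (?v - chain_map (Suc 0) s ?v) + (?w - chain_map (Suc 0) t ?w)"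
      unfolding vw(3) using vw(1,2) by (simp add: chain_simps)
    finally have eq: "frag_cmul k ?c = (?v - chain_map (Suc 0) s ?v) + (?w - chain_map (Suc 0) t ?w)" .
    \<comment> \<open>The relation \<open>eq\<close>, sorted by 1 - s and 1 - t, is exactly the
      hypothesis of middle exactness for these two chains.\<close>
    let ?A = "frag_cmul k ?lt + ?v" and ?B = "frag_cmul k ?ls - ?w"
    have "?A - chain_map (Suc 0) s ?A = ?B - chain_map (Suc 0) t ?B"
      using eq by (simp add: frag_cmul_diff frag_cmul_distrib2 chain_map_add chain_map_diff algebra_simps)
    moreover have "singular_chain (Suc 0) X ?A" "singular_chain (Suc 0) X ?B"
      using ls lt vw by (auto intro!: chain_intros)
    ultimately obtain \<psi> where \<psi>: "singular_chain (Suc 0) X \<psi>" "?A = \<psi> - chain_map (Suc 0) t \<psi>"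
      using koszul2 by metis
    have "chain_boundary (Suc 0) ?A = frag_cmul k (frag_of (pt (t base)) - ?b)"
      using vw(1) lt by (simp add: chain_simps)
    moreover have "chain_boundary (Suc 0) ?A = chain_boundary (Suc 0) \<psi> - chain_map 0 t (chain_boundary (Suc 0) \<psi>)"
      unfolding \<psi>(2) using \<psi>(1) by (simp add: chain_simps)
    ultimately have "chain_boundary (Suc 0) \<psi> - chain_map 0 t (chain_boundary (Suc 0) \<psi>) =
        frag_cmul k (frag_of (pt (t base))) - frag_cmul k ?b"
      by (metis frag_cmul_diff)
    then have "(chain_boundary (Suc 0) \<psi> + frag_cmul k ?b) -
        chain_map 0 t (chain_boundary (Suc 0) \<psi> + frag_cmul k ?b) = 0"
      by (simp add: chain_map_add add_diff_add)
    moreover have "singular_chain 0 X (chain_boundary (Suc 0) \<psi> + frag_cmul k ?b)"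
      using \<psi>(1) base_in by (intro chain_intros singular_chain_pt) auto
    ultimately have z: "chain_boundary (Suc 0) \<psi> + frag_cmul k ?b = 0"
      by (rule t_injective[rotated])
    \<comment> \<open>The augmentation, the sum of all coefficients, vanishes on boundaries of
      1-chains and is 1 on the base point.\<close>
    have aug: "frag_push (\<lambda>_. ()) (chain_boundary (Suc 0) c) = 0" for c :: "'a chain"
    proof -
      have "frag_push (\<lambda>_. ()) (chain_boundary (Suc 0) c) = 0" if "Poly_Mapping.keys c \<subseteq> UNIV"
        using that
        by (induction c rule: frag_induction_keys)
          (simp_all add: chain_boundary_of frag_push_diff frag_push_add frag_push_minus chain_boundary_diff)
      then show ?thesis by simp
    qed
    have "frag_push (\<lambda>_. ()) (chain_boundary (Suc 0) \<psi> + frag_cmul k ?b) = 0" unfolding z by simp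
    then show "k = 0" by (simp add: frag_push_add aug frag_push_cmul)
  qed
  ultimately show ?thesis using that by blast
qed

lemma abelian_rank_H2: "abelian_rank (homology_group 2 Y) \<ge> 1"
proof -
  obtain z where z: "cycle 2 Y z" "\<And>k. bdry 2 Y (frag_cmul k z) \<Longrightarrow> k = 0"
    using fundamental_class by blast
  have "int_independent (homology_group (int 2) Y) {hclass 2 Y z}"
    by (rule independent_singleton[OF z])
  then have "int_independent (homology_group 2 Y) {hclass 2 Y z}" by simp
  from abelian_rank_ge[OF card_independent_H2_le this] show ?thesis by simp
qed

end

text \<open>Rounding multiples of a real relation yields infinitely many integer combinations
  in a bounded region; two of them must agree.\<close>

section \<open>Lattices of rank at most two\<close>

lemma int_relation_of_real_relation:
  fixes v :: "nat \<Rightarrow> 'v::real_normed_vector" and c :: "nat \<Rightarrow> real"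
  assumes fin: "\<And>R. finite {x \<in> \<Lambda>. norm x \<le> R}"
    and comb: "\<And>k :: nat \<Rightarrow> int. (\<Sum>i\<le>m. of_int (k i) *\<^sub>R v i) \<in> \<Lambda>"
    and rel: "(\<Sum>i\<le>m. c i *\<^sub>R v i) = 0" and nz: "i0 \<le> m" "c i0 \<noteq> 0"
  shows "\<exists>k :: nat \<Rightarrow> int. (\<exists>i\<le>m. k i \<noteq> 0) \<and> (\<Sum>i\<le>m. of_int (k i) *\<^sub>R v i) = 0"
proof -
  \<comment> \<open>N makes consecutive multiples of c at i0 differ by at least 1, so two distinct q
    always give distinct rounded coefficients there. This keeps the final relation
    nontrivial.\<close>
  obtain N :: nat where N: "N * \<bar>c i0\<bar> \<ge> 1"
    using nz reals_Archimedean3[of "\<bar>c i0\<bar>"] by (metis less_eq_real_def zero_less_abs_iff)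
  define P where "P q i = \<lfloor>real (N * q) * c i\<rfloor>" for q i
  define x where "x q = (\<Sum>i\<le>m. of_int (P q i) *\<^sub>R v i)" for q
  have "norm (x q) \<le> (\<Sum>i\<le>m. norm (v i))" for q
  proof -
    have "(\<Sum>i\<le>m. (real (N * q) * c i) *\<^sub>R v i) = real (N * q) *\<^sub>R (\<Sum>i\<le>m. c i *\<^sub>R v i)"
      by (simp add: scaleR_sum_right)
    then have "x q = (\<Sum>i\<le>m. (of_int (P q i) - real (N * q) * c i) *\<^sub>R v i)"
      by (simp add: x_def rel scaleR_left_diff_distrib sum_subtractf)
    also have "norm \<dots> \<le> (\<Sum>i\<le>m. norm (v i))"
    proof (rule sum_norm_le)
      fix i
      have "\<bar>of_int (P q i) - real (N * q) * c i\<bar> \<le> 1" unfolding P_def by linarith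
      then show "norm ((of_int (P q i) - real (N * q) * c i) *\<^sub>R v i) \<le> norm (v i)"
        by (simp add: mult_left_le_one_le)
    qed
    finally show ?thesis .
  qed
  then have "range x \<subseteq> {y \<in> \<Lambda>. norm y \<le> (\<Sum>i\<le>m. norm (v i))}"
    using comb unfolding x_def by auto
  then have "finite (range x)" using fin finite_subset by blast
  then have "\<not> inj x" using finite_imageD infinite_UNIV_nat by blast
  then obtain q r where qr: "x q = x r" "q < r" unfolding inj_def by (metis nat_neq_iff)
  have "P q i0 \<noteq> P r i0"
  proof
    assume "P q i0 = P r i0"
    then have "\<bar>real (N * q) * c i0 - real (N * r) * c i0\<bar> < 1" unfolding P_def by linarith
    moreover have "\<bar>real (N * q) * c i0 - real (N * r) * c i0\<bar> = (N * \<bar>c i0\<bar>) * (real r - real q)"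
    proof -
      have "real (N * q) * c i0 - real (N * r) * c i0 = - (real N * c i0 * (real r - real q))"
        by (simp add: algebra_simps)
      then show ?thesis using qr(2) by (simp add: abs_mult)
    qed
    moreover have "(N * \<bar>c i0\<bar>) * (real r - real q) \<ge> 1 * 1"
      using N qr(2) by (intro mult_mono) auto
    ultimately show False by simp
  qed
  moreover have "(\<Sum>i\<le>m. of_int (P q i - P r i) *\<^sub>R v i) = 0"
    using qr(1) by (simp add: x_def scaleR_left_diff_distrib sum_subtractf)
  ultimately show ?thesis
    using nz(1) by (intro exI[of _ "\<lambda>i. P q i - P r i"]) auto
qed

text \<open>The oriented area of the parallelogram spanned by u and w.\<close>

abbreviation cdet :: "complex \<Rightarrow> complex \<Rightarrow> real"
  where "cdet u w \<equiv> Im (cnj u * w)"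

lemma cdet_zero_imp_multiple:
  assumes "u \<noteq> 0" "cdet u w = 0"
  obtains c where "w = c *\<^sub>R u"
proof -
  let ?n = "(Re u)\<^sup>2 + (Im u)\<^sup>2"
  have n: "?n \<noteq> 0" using assms(1) by (simp add: complex_eq_iff sum_power2_eq_zero_iff)
  have d: "Re u * Im w = Im u * Re w" using assms(2) by simp
  have "Re w * ?n = (Re u * Re w + Im u * Im w) * Re u"
    using d by (simp add: power2_eq_square algebra_simps)
  moreover have "Im w * ?n = (Re u * Re w + Im u * Im w) * Im u"
    using d by (simp add: power2_eq_square algebra_simps)
  ultimately have "w = ((Re u * Re w + Im u * Im w) / ?n) *\<^sub>R u"
    using n by (simp add: complex_eq_iff field_simps)
  then show ?thesis using that by blast
qed

lemma real_relation_2: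
  assumes "cdet (v 0) (v 1) = 0"
  shows "\<exists>c :: nat \<Rightarrow> real. (\<exists>i\<le>1. c i \<noteq> 0) \<and> (\<Sum>i\<le>1. c i *\<^sub>R v i) = (0 :: complex)"
proof (cases "v 0 = 0")
  case True
  then show ?thesis by (intro exI[of _ "\<lambda>i. if i = 0 then 1 else 0"]) auto
next
  case False
  then obtain r where "v 1 = r *\<^sub>R v 0" using cdet_zero_imp_multiple assms by blast
  then show ?thesis by (intro exI[of _ "\<lambda>i. if i = 0 then - r else 1"]) auto
qed

lemma real_relation_3:
  fixes v :: "nat \<Rightarrow> complex"
  shows "\<exists>c :: nat \<Rightarrow> real. (\<exists>i\<le>2. c i \<noteq> 0) \<and> (\<Sum>i\<le>2. c i *\<^sub>R v i) = 0"
proof (cases "cdet (v 0) (v 1) = 0")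
  case True
  then obtain c :: "nat \<Rightarrow> real" where c: "\<exists>i\<le>1. c i \<noteq> 0" "(\<Sum>i\<le>1. c i *\<^sub>R v i) = 0"
    using real_relation_2[of v] by blast
  then show ?thesis
    by (intro exI[of _ "\<lambda>i. if i = 2 then 0 else c i"]) (auto simp: numeral_2_eq_2 le_Suc_eq)
next
  case False
  \<comment> \<open>Cramer's rule: the coefficients of the relation among three plane vectors are
    the oriented areas of the complementary pairs.\<close>
  define c where "c i = (if i = 0 then cdet (v 1) (v 2) else if i = 1 then cdet (v 2) (v 0)
    else cdet (v 0) (v 1))" for i :: nat
  have "(\<Sum>i\<le>2. c i *\<^sub>R v i) = 0"
    by (simp add: c_def numeral_2_eq_2 complex_eq_iff algebra_simps)
  moreover have "c 2 \<noteq> 0" using False by (simp add: c_def)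
  ultimately show ?thesis by blast
qed

text \<open>u is a shortest nonzero lattice vector on the line of u0, so the lattice meets this line
  in its integer multiples. v minimises the area spanned with u; rounding off the v-coordinate of a
  lattice point leaves an area smaller than the minimum, hence zero, and the rest lies on the line
  of u.\<close>

lemma complex_lattice_basis:
  fixes \<Lambda> :: "complex set"
  assumes diff: "\<And>x y. \<lbrakk>x \<in> \<Lambda>; y \<in> \<Lambda>\<rbrakk> \<Longrightarrow> x - y \<in> \<Lambda>"
    and fin: "\<And>R. finite {x \<in> \<Lambda>. cmod x \<le> R}"
    and u0: "u0 \<in> \<Lambda>" and w0: "w0 \<in> \<Lambda>" and det0: "cdet u0 w0 \<noteq> 0"
  obtains u v where "u \<in> \<Lambda>" "v \<in> \<Lambda>" "cdet u v \<noteq> 0"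
    "\<And>x. x \<in> \<Lambda> \<Longrightarrow> \<exists>i j :: int. x = of_int i * u + of_int j * v"
proof -
  have zero: "0 \<in> \<Lambda>" using diff[OF u0 u0] by simp
  have neg: "- x \<in> \<Lambda>" if "x \<in> \<Lambda>" for x using diff[OF zero that] by simp
  have add: "x + y \<in> \<Lambda>" if "x \<in> \<Lambda>" "y \<in> \<Lambda>" for x y using diff[OF that(1) neg[OF that(2)]] by simp
  have natm: "of_nat n * x \<in> \<Lambda>" if "x \<in> \<Lambda>" for x n
    using that by (induction n) (auto simp: zero add algebra_simps)
  have intm: "of_int n * x \<in> \<Lambda>" if "x \<in> \<Lambda>" for x n
    using natm[OF that] neg by (cases n rule: int_cases2) auto
  have u0nz: "u0 \<noteq> 0" using det0 by auto
  let ?U = "{x \<in> \<Lambda>. cmod x \<le> cmod u0} \<inter> {x. x \<noteq> 0 \<and> cdet u0 x = 0}"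
  have "finite ?U" using fin by blast
  moreover have "u0 \<in> ?U" using u0 u0nz by simp
  ultimately obtain u where u: "u \<in> ?U" "\<And>x. x \<in> ?U \<Longrightarrow> cmod u \<le> cmod x"
    using ex_min_if_finite[of "cmod ` ?U"] arg_min_if_finite[of ?U cmod]
    by (metis (no_types, lifting) empty_iff not_le)
  have unz: "u \<noteq> 0" and uL: "u \<in> \<Lambda>" using u by auto
  obtain r where r: "u = r *\<^sub>R u0" using cdet_zero_imp_multiple[OF u0nz] u(1) by blast
  have rnz: "r \<noteq> 0" using r unz by auto
  have det_u: "cdet u x = r * cdet u0 x" for x by (simp add: r algebra_simps)
  have multiples: "\<exists>i :: int. x = of_int i * u" if x: "x \<in> \<Lambda>" "cdet u x = 0" for x
  proof -
    obtain c where c: "x = c *\<^sub>R u" using cdet_zero_imp_multiple[OF unz x(2)] .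
    define y where "y = x - of_int \<lfloor>c\<rfloor> * u"
    have y: "y \<in> \<Lambda>" unfolding y_def using diff x intm uL by blast
    have yc: "y = (c - of_int \<lfloor>c\<rfloor>) *\<^sub>R u" by (simp add: y_def c scaleR_conv_of_real left_diff_distrib)
    have "cmod y = \<bar>c - of_int \<lfloor>c\<rfloor>\<bar> * cmod u" unfolding yc by (rule norm_scaleR)
    moreover have "\<bar>c - of_int \<lfloor>c\<rfloor>\<bar> < 1" by linarith
    ultimately have lt: "cmod y < cmod u" using unz by simp
    have "y = 0"
    proof (rule ccontr)
      assume "y \<noteq> 0"
      moreover have "cdet u0 y = 0" unfolding yc r by (simp add: algebra_simps)
      moreover have "cmod y \<le> cmod u0" using lt u(1) by auto
      ultimately have "y \<in> ?U" using y by auto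
      then show False using u(2) lt by fastforce
    qed
    then show ?thesis unfolding y_def by auto
  qed
  \<comment> \<open>Among vectors of bounded norm the minimal area exists by finiteness. The bound
    is large enough for all lattice vectors: adding multiples of u does not change the area, and a
    vector whose area does not exceed that of w0 can be moved in this way into the given
    disc.\<close>
  let ?V = "{x \<in> \<Lambda>. cmod x \<le> cmod u + cmod w0} \<inter> {x. cdet u x \<noteq> 0}"
  have "finite ?V" using fin by blast
  moreover have w0V: "w0 \<in> ?V" using w0 det0 rnz det_u by auto
  ultimately obtain v where v: "v \<in> ?V" "\<And>x. x \<in> ?V \<Longrightarrow> \<bar>cdet u v\<bar> \<le> \<bar>cdet u x\<bar>"
    using arg_min_if_finite[of ?V "\<lambda>x. \<bar>cdet u x\<bar>"] by (metis (no_types, lifting) empty_iff not_le)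
  have vL: "v \<in> \<Lambda>" and dv: "cdet u v \<noteq> 0" using v(1) by auto
  have min: "\<bar>cdet u v\<bar> \<le> \<bar>cdet u x\<bar>" if x: "x \<in> \<Lambda>" "cdet u x \<noteq> 0" for x
  proof (cases "\<bar>cdet u x\<bar> \<le> \<bar>cdet u w0\<bar>")
    case False
    then show ?thesis using v(2)[OF w0V] by linarith
  next
    case True
    define \<beta> where "\<beta> = cdet u x / cdet u w0"
    have dw: "cdet u w0 \<noteq> 0" using w0V by simp
    have b1: "\<bar>\<beta>\<bar> \<le> 1" using True dw by (simp add: \<beta>_def divide_le_eq_1)
    have "cdet u (x - \<beta> *\<^sub>R w0) = cdet u x - \<beta> * cdet u w0" by (simp add: algebra_simps)
    also have "\<dots> = 0" using dw by (simp add: \<beta>_def)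
    finally obtain \<alpha> where \<alpha>: "x - \<beta> *\<^sub>R w0 = \<alpha> *\<^sub>R u" using cdet_zero_imp_multiple[OF unz] by blast
    define y where "y = x - of_int \<lfloor>\<alpha>\<rfloor> * u"
    have yL: "y \<in> \<Lambda>" unfolding y_def using diff x intm uL by blast
    have ya: "y = (\<alpha> - of_int \<lfloor>\<alpha>\<rfloor>) *\<^sub>R u + \<beta> *\<^sub>R w0"
      using \<alpha> by (simp add: y_def scaleR_conv_of_real algebra_simps)
    have "cmod y \<le> \<bar>\<alpha> - of_int \<lfloor>\<alpha>\<rfloor>\<bar> * cmod u + \<bar>\<beta>\<bar> * cmod w0"
      unfolding ya using norm_triangle_ineq[of "(\<alpha> - of_int \<lfloor>\<alpha>\<rfloor>) *\<^sub>R u" "\<beta> *\<^sub>R w0"] by (simp only: norm_scaleR)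
    also have "\<dots> \<le> 1 * cmod u + 1 * cmod w0"
    proof (intro add_mono mult_right_mono b1)
      show "\<bar>\<alpha> - of_int \<lfloor>\<alpha>\<rfloor>\<bar> \<le> 1" by linarith
    qed auto
    finally have "cmod y \<le> cmod u + cmod w0" by simp
    moreover have dy: "cdet u y = cdet u x" by (simp add: y_def algebra_simps)
    ultimately have yV: "y \<in> ?V" using yL x(2) by simp
    show ?thesis unfolding dy[symmetric] by (rule v(2)[OF yV])
  qed
  have "\<exists>i j :: int. x = of_int i * u + of_int j * v" if x: "x \<in> \<Lambda>" for x
  proof -
    define \<beta> where "\<beta> = cdet u x / cdet u v"
    define y where "y = x - of_int \<lfloor>\<beta>\<rfloor> * v"
    have yL: "y \<in> \<Lambda>" unfolding y_def using diff x intm vL by blast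
    have "cdet u y = cdet u x - of_int \<lfloor>\<beta>\<rfloor> * cdet u v" by (simp add: y_def algebra_simps)
    also have "cdet u x = \<beta> * cdet u v" using dv unfolding \<beta>_def by (metis nonzero_eq_divide_eq)
    also have "\<beta> * cdet u v - of_int \<lfloor>\<beta>\<rfloor> * cdet u v = (\<beta> - of_int \<lfloor>\<beta>\<rfloor>) * cdet u v"
      by (simp only: left_diff_distrib)
    finally have "\<bar>cdet u y\<bar> = \<bar>\<beta> - of_int \<lfloor>\<beta>\<rfloor>\<bar> * \<bar>cdet u v\<bar>" by (simp only: abs_mult)
    moreover have "\<bar>\<beta> - of_int \<lfloor>\<beta>\<rfloor>\<bar> < 1" by linarith
    moreover have "\<bar>cdet u v\<bar> > 0" unfolding zero_less_abs_iff by (rule dv)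
    ultimately have "\<bar>cdet u y\<bar> < \<bar>cdet u v\<bar>"
      using mult_strict_right_mono by fastforce
    then have "cdet u y = 0" using min[OF yL] by linarith
    then obtain i :: int where "y = of_int i * u" using multiples yL by blast
    then have "x = of_int i * u + of_int \<lfloor>\<beta>\<rfloor> * v" unfolding y_def by (simp add: algebra_simps)
    then show ?thesis by blast
  qed
  then show ?thesis using that uL vL dv by blast
qed

section \<open>Euler characteristic of quotients by lattices of translations\<close>

context galois_cover
begin

lemma path_connected_Y: "path_connected_space Y" and S_nonempty: "S \<noteq> {}"
proof -
  have "p ` St = S" by (rule covering_space_imp_surjective[OF cov])
  then show "S \<noteq> {}" using nonempty by blast
  have "path_connected St"
    using nonempty contr contractible_rel_imp_path_connected by blast
  then have "path_connected (p ` St)"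
    by (rule path_connected_continuous_image[OF covering_space_imp_continuous[OF cov]])
  then show "path_connected_space Y" using \<open>p ` St = S\<close> by simp
qed

lemma euler_char_eq: "euler_char S = int (abelian_rank (homology_group 0 Y)) -
    int (abelian_rank (homology_group 1 Y)) + int (abelian_rank (homology_group 2 Y))"
  by (simp add: euler_char_def numeral_2_eq_2)

lemma rank_H0: "abelian_rank (homology_group 0 Y) \<ge> 1"
  using abelian_rank_zeroth_homology[OF path_connected_Y] S_nonempty by simp

text \<open>\<tau> embeds \<Delta> as a discrete subgroup of the line, so any two elements of
  \<Delta> are dependent. Some nonzero multiple of each loop is homologous to a loop from \<Delta>,
  so the rank of H_1 is at most one, and this is compensated by H_0.\<close>

lemma euler_char_nonneg_cyclic:
  fixes \<tau> :: "('b \<Rightarrow> 'b) \<Rightarrow> real"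
  assumes sub: "\<Delta> \<subseteq> \<Gamma>" and idD: "id \<in> \<Delta>"
    and compD: "\<And>g h. \<lbrakk>g \<in> \<Delta>; h \<in> \<Delta>\<rbrakk> \<Longrightarrow> g \<circ> h \<in> \<Delta>"
    and invD: "\<And>g. g \<in> \<Delta> \<Longrightarrow> \<exists>h\<in>\<Delta>. h \<circ> g = id"
    and add: "\<And>g h. \<lbrakk>g \<in> \<Delta>; h \<in> \<Delta>\<rbrakk> \<Longrightarrow> \<tau> (g \<circ> h) = \<tau> g + \<tau> h"
    and inj: "\<And>g. \<lbrakk>g \<in> \<Delta>; \<tau> g = 0\<rbrakk> \<Longrightarrow> g = id"
    and fin: "\<And>R. finite {x \<in> \<tau> ` \<Delta>. \<bar>x\<bar> \<le> R}"
    and power: "\<And>g. g \<in> \<Gamma> \<Longrightarrow> \<exists>h\<in>\<Delta>. \<exists>n :: int. n \<noteq> 0 \<and> bdry 1 Y (frag_cmul n (loop g) - loop h)"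
  shows "euler_char S \<ge> 0"
proof -
  have "abelian_rank (homology_group 1 Y) \<le> 1"
  proof (rule abelian_rank_le, rule card_independent_H1_le)
    fix f :: "nat \<Rightarrow> _" assume f: "\<And>i. i \<le> 1 \<Longrightarrow> f i \<in> \<Gamma>"
    have "\<forall>i. \<exists>h n. i \<le> 1 \<longrightarrow> h \<in> \<Delta> \<and> n \<noteq> (0::int) \<and> bdry 1 Y (frag_cmul n (loop (f i)) - loop h)"
      using power f by meson
    then obtain h n where hn: "\<And>i. i \<le> 1 \<Longrightarrow> h i \<in> \<Delta>" "\<And>i. i \<le> 1 \<Longrightarrow> n i \<noteq> (0::int)"
      "\<And>i. i \<le> 1 \<Longrightarrow> bdry 1 Y (frag_cmul (n i) (loop (f i)) - loop (h i))" by metis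
    have tid: "\<tau> id = 0" using add[OF idD idD] by simp
    have tneg: "- x \<in> \<tau> ` \<Delta>" if x: "x \<in> \<tau> ` \<Delta>" for x
    proof -
      obtain g where g: "g \<in> \<Delta>" "x = \<tau> g" using x by blast
      obtain k where k: "k \<in> \<Delta>" "k \<circ> g = id" using invD g by blast
      then have "\<tau> k + x = 0" using add[OF k(1) g(1)] tid g by simp
      then have "- x = \<tau> k" by simp
      then show ?thesis using k by blast
    qed
    have tadd: "x + y \<in> \<tau> ` \<Delta>" if "x \<in> \<tau> ` \<Delta>" "y \<in> \<tau> ` \<Delta>" for x y
      using that add compD by (metis (no_types, lifting) image_iff)
    have t0: "0 \<in> \<tau> ` \<Delta>" using tid idD by (metis imageI)
    have tnat: "of_nat k * x \<in> \<tau> ` \<Delta>" if "x \<in> \<tau> ` \<Delta>" for x k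
      using that by (induction k) (auto simp: t0 tadd algebra_simps)
    have tint: "of_int k * x \<in> \<tau> ` \<Delta>" if "x \<in> \<tau> ` \<Delta>" for x k
    proof (cases k rule: int_cases2)
      case (nonneg j)
      then show ?thesis using tnat[OF that, of j] by simp
    next
      case (nonpos j)
      then show ?thesis using tneg[OF tnat[OF that, of j]] by simp
    qed
    have set01: "{..1::nat} = {0, 1}" by auto
    have "\<exists>c :: nat \<Rightarrow> real. (\<exists>i\<le>1. c i \<noteq> 0) \<and> (\<Sum>i\<le>1. c i *\<^sub>R \<tau> (h i)) = 0"
    proof (cases "\<tau> (h 0) = 0")
      case True
      then show ?thesis by (intro exI[of _ "\<lambda>i. if i = 0 then 1 else 0"]) (auto simp: set01)
    next
      case False
      then show ?thesis
        by (intro exI[of _ "\<lambda>i. if i = 0 then - \<tau> (h 1) else \<tau> (h 0)"]) (auto simp: set01 intro: exI[of _ 1])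
    qed
    then obtain c :: "nat \<Rightarrow> real" and i0 where c: "i0 \<le> 1" "c i0 \<noteq> 0" "(\<Sum>i\<le>1. c i *\<^sub>R \<tau> (h i)) = 0" by blast
    have "\<exists>k :: nat \<Rightarrow> int. (\<exists>i\<le>1. k i \<noteq> 0) \<and> (\<Sum>i\<le>1. of_int (k i) *\<^sub>R \<tau> (h i)) = 0"
    proof (rule int_relation_of_real_relation[OF _ _ c(3) c(1) c(2), where \<Lambda> = "\<tau> ` \<Delta>"])
      show "finite {x \<in> \<tau> ` \<Delta>. norm x \<le> R}" for R using fin[of R] by simp
      show "(\<Sum>i\<le>1. of_int (k i) *\<^sub>R \<tau> (h i)) \<in> \<tau> ` \<Delta>" for k :: "nat \<Rightarrow> int"
        using hn(1)[of 0] hn(1)[of 1] by (simp add: set01 tadd tint)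
    qed
    then obtain k :: "nat \<Rightarrow> int" where k: "\<exists>i\<le>1. k i \<noteq> 0" "(\<Sum>i\<le>1. of_int (k i) *\<^sub>R \<tau> (h i)) = 0" by blast
    have b1: "bdry 1 Y (\<Sum>i\<le>1. frag_cmul (k i) (loop (h i)))"
      by (rule loop_combination[OF sub idD compD invD add inj _ _ k(2)]) (use hn in auto)
    have b2: "bdry 1 Y (\<Sum>i\<le>1. frag_cmul (k i) (frag_cmul (n i) (loop (f i)) - loop (h i)))"
      using hn(3)[of 0] hn(3)[of 1] unfolding set01
      by (simp add: singular_relboundary_add singular_relboundary_cmul del: One_nat_def)
    \<comment> \<open>The relation holds for the loops of h; replacing these by multiples of the
      original loops multiplies each coefficient by the nonzero n i.\<close>
    have "bdry 1 Y (\<Sum>i\<le>1. frag_cmul (k i * n i) (loop (f i)))"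
      using singular_relboundary_add[OF b2 b1] by (simp add: frag_cmul_diff del: One_nat_def flip: sum.distrib)
    moreover have "\<exists>i\<le>1. k i * n i \<noteq> 0" using k(1) hn(2) by auto
    ultimately show "\<exists>k :: nat \<Rightarrow> int. (\<exists>i\<le>1. k i \<noteq> 0) \<and> bdry 1 Y (\<Sum>i\<le>1. frag_cmul (k i) (loop (f i)))"
      by (intro exI[of _ "\<lambda>i. k i * n i"] conjI)
  qed
  then show ?thesis using rank_H0 unfolding euler_char_eq by linarith
qed

text \<open>A lattice on a line gives rank at most one for H_1. A lattice spanning the plane gives
  rank at most two, and a basis of it turns the cover into one with group of rank two, for which H_2
  contributes at least one.\<close>

lemma euler_char_nonneg_translations:
  fixes \<tau> :: "('b \<Rightarrow> 'b) \<Rightarrow> complex"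
  assumes add: "\<And>g h. \<lbrakk>g \<in> \<Gamma>; h \<in> \<Gamma>\<rbrakk> \<Longrightarrow> \<tau> (g \<circ> h) = \<tau> g + \<tau> h"
    and inj: "\<And>g. \<lbrakk>g \<in> \<Gamma>; \<tau> g = 0\<rbrakk> \<Longrightarrow> g = id"
    and fin: "\<And>R. finite {x \<in> \<tau> ` \<Gamma>. cmod x \<le> R}"
  shows "euler_char S \<ge> 0"
proof -
  have tid: "\<tau> id = 0" using add[OF id_in id_in] by simp
  have invG: "\<exists>h\<in>\<Gamma>. h \<circ> g = id" if "g \<in> \<Gamma>" for g using inv_ex[OF that] by blast
  have inv_tau: "\<tau> k = - \<tau> g" if "k \<in> \<Gamma>" "g \<in> \<Gamma>" "k \<circ> g = id" for k g
    using add[OF that(1,2)] that(3) tid by (simp add: eq_neg_iff_add_eq_0)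
  have tau_inj: "g = h" if gh: "g \<in> \<Gamma>" "h \<in> \<Gamma>" "\<tau> g = \<tau> h" for g h
  proof -
    obtain k where k: "k \<in> \<Gamma>" "k \<circ> h = id" "h \<circ> k = id" using inv_ex[OF gh(2)] by blast
    have "\<tau> (k \<circ> g) = 0" using add[OF k(1) gh(1)] inv_tau[OF k(1) gh(2) k(2)] gh(3) by simp
    then have "k \<circ> g = id" using inj comp_in k gh by blast
    then have "h \<circ> (k \<circ> g) = h" by simp
    then show ?thesis using k(3) by (simp flip: comp_assoc)
  qed
  have tdiff: "x - y \<in> \<tau> ` \<Gamma>" if xy: "x \<in> \<tau> ` \<Gamma>" "y \<in> \<tau> ` \<Gamma>" for x y
  proof -
    obtain g h where gh: "g \<in> \<Gamma>" "h \<in> \<Gamma>" "x = \<tau> g" "y = \<tau> h" using xy by blast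
    obtain k where k: "k \<in> \<Gamma>" "k \<circ> h = id" using invG[OF gh(2)] by blast
    have "x - y = \<tau> (g \<circ> k)" using add[OF gh(1) k(1)] inv_tau[OF k(1) gh(2) k(2)] gh by simp
    then show ?thesis using comp_in[OF gh(1) k(1)] by blast
  qed
  have t0: "0 \<in> \<tau> ` \<Gamma>" using tid id_in by (metis imageI)
  have tneg: "- x \<in> \<tau> ` \<Gamma>" if "x \<in> \<tau> ` \<Gamma>" for x using tdiff[OF t0 that] by simp
  have tadd: "x + y \<in> \<tau> ` \<Gamma>" if "x \<in> \<tau> ` \<Gamma>" "y \<in> \<tau> ` \<Gamma>" for x y
    using tdiff[OF that(1) tneg[OF that(2)]] by simp
  have tnat: "of_nat k * x \<in> \<tau> ` \<Gamma>" if "x \<in> \<tau> ` \<Gamma>" for x k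
    using that by (induction k) (auto simp: t0 tadd algebra_simps)
  have tint: "of_int k *\<^sub>R x \<in> \<tau> ` \<Gamma>" if "x \<in> \<tau> ` \<Gamma>" for x k
  proof (cases k rule: int_cases2)
    case (nonneg j)
    then show ?thesis using tnat[OF that, of j] by (simp add: scaleR_conv_of_real)
  next
    case (nonpos j)
    then show ?thesis using tneg[OF tnat[OF that, of j]] by (simp add: scaleR_conv_of_real)
  qed
  have dependent: "\<exists>k :: nat \<Rightarrow> int. (\<exists>i\<le>m. k i \<noteq> 0) \<and> bdry 1 Y (\<Sum>i\<le>m. frag_cmul (k i) (loop (f i)))"
    if f: "\<And>i. i \<le> m \<Longrightarrow> f i \<in> \<Gamma>"
      and rel: "\<exists>c :: nat \<Rightarrow> real. (\<exists>i\<le>m. c i \<noteq> 0) \<and> (\<Sum>i\<le>m. c i *\<^sub>R \<tau> (f i)) = 0" for f m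
  proof -
    obtain c :: "nat \<Rightarrow> real" and i0 where c: "i0 \<le> m" "c i0 \<noteq> 0" "(\<Sum>i\<le>m. c i *\<^sub>R \<tau> (f i)) = 0"
      using rel by blast
    have "\<exists>k :: nat \<Rightarrow> int. (\<exists>i\<le>m. k i \<noteq> 0) \<and> (\<Sum>i\<le>m. of_int (k i) *\<^sub>R \<tau> (f i)) = 0"
    proof (rule int_relation_of_real_relation[OF fin _ c(3) c(1) c(2)])
      fix k :: "nat \<Rightarrow> int"
      have "(\<Sum>i\<in>I. of_int (k i) *\<^sub>R \<tau> (f i)) \<in> \<tau> ` \<Gamma>" if "finite I" "I \<subseteq> {..m}" for I
        using that f by (induction I) (auto intro!: tadd tint simp: t0)
      then show "(\<Sum>i\<le>m. of_int (k i) *\<^sub>R \<tau> (f i)) \<in> \<tau> ` \<Gamma>" by simp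
    qed
    then obtain k :: "nat \<Rightarrow> int" where k: "\<exists>i\<le>m. k i \<noteq> 0" "(\<Sum>i\<le>m. of_int (k i) *\<^sub>R \<tau> (f i)) = 0" by blast
    have "bdry 1 Y (\<Sum>i\<le>m. frag_cmul (k i) (loop (f i)))"
      by (rule loop_combination[OF subset_refl id_in comp_in invG add inj _ _ k(2)]) (use f in auto)
    then show ?thesis using k(1) by blast
  qed
  have r1: "abelian_rank (homology_group 1 Y) \<le> 2"
    by (rule abelian_rank_le, rule card_independent_H1_le, rule dependent)
      (auto intro: real_relation_3)
  show ?thesis
  proof (cases "\<exists>g\<in>\<Gamma>. \<exists>h\<in>\<Gamma>. cdet (\<tau> g) (\<tau> h) \<noteq> 0")
    case False
    have "abelian_rank (homology_group 1 Y) \<le> 1"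
    proof (rule abelian_rank_le, rule card_independent_H1_le, rule dependent)
      fix f :: "nat \<Rightarrow> _" assume "\<And>i. i \<le> 1 \<Longrightarrow> f i \<in> \<Gamma>"
      then have "cdet (\<tau> (f 0)) (\<tau> (f 1)) = 0" using False by auto
      then show "\<exists>c :: nat \<Rightarrow> real. (\<exists>i\<le>1. c i \<noteq> 0) \<and> (\<Sum>i\<le>1. c i *\<^sub>R \<tau> (f i)) = 0"
        by (rule real_relation_2)
    qed
    then show ?thesis using rank_H0 unfolding euler_char_eq by linarith
  next
    case True
    then obtain g0 h0 where gh: "g0 \<in> \<Gamma>" "h0 \<in> \<Gamma>" "cdet (\<tau> g0) (\<tau> h0) \<noteq> 0" by blast
    obtain u v where uv: "u \<in> \<tau> ` \<Gamma>" "v \<in> \<tau> ` \<Gamma>" "cdet u v \<noteq> 0"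
      "\<And>x. x \<in> \<tau> ` \<Gamma> \<Longrightarrow> \<exists>i j :: int. x = of_int i * u + of_int j * v"
      using complex_lattice_basis[OF tdiff fin imageI[OF gh(1)] imageI[OF gh(2)] gh(3)] by metis
    obtain s t where s: "s \<in> \<Gamma>" "\<tau> s = u" and t: "t \<in> \<Gamma>" "\<tau> t = v" using uv(1,2) by blast
    have pow: "g ^^ n \<in> \<Gamma> \<and> \<tau> (g ^^ n) = of_nat n * \<tau> g" if "g \<in> \<Gamma>" for g n
    proof (induction n)
      case 0
      then show ?case using id_in tid by (simp add: id_def)
    next
      case (Suc n)
      have "\<tau> (g \<circ> g ^^ n) = of_nat (Suc n) * \<tau> g"
        using Suc add[OF that, of "g ^^ n"] by (simp add: distrib_right)
      then show ?case
        using comp_in[OF that, of "g ^^ n"] Suc unfolding funpow.simps(2) by blast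
    qed
    have st: "s ^^ i \<circ> t ^^ j \<in> \<Gamma>" "\<tau> (s ^^ i \<circ> t ^^ j) = of_nat i * u + of_nat j * v" for i j
      using pow[OF s(1), of i] pow[OF t(1), of j] comp_in add s t by auto
    have "rank2_galois_cover St p S \<Gamma> s t"
    proof
      show "s \<circ> t = t \<circ> s"
        using s t by (intro tau_inj comp_in) (simp_all add: add)
      fix g assume g: "g \<in> \<Gamma>"
      obtain i j :: int where ij: "\<tau> g = of_int i * u + of_int j * v" using uv(4) g by blast
      \<comment> \<open>Integer exponents are split into negative and positive parts, which are
        placed on opposite sides; one of each pair is zero.\<close>
      have "s ^^ nat (- i) \<circ> t ^^ nat (- j) \<circ> g = s ^^ nat i \<circ> t ^^ nat j"
      proof (rule tau_inj)
        have nn: "of_nat (nat (- k)) + of_int k = (of_nat (nat k) :: complex)" for k :: int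
          by (cases "k \<ge> 0") auto
        have "\<tau> (s ^^ nat (- i) \<circ> t ^^ nat (- j) \<circ> g) =
            (of_nat (nat (- i)) + of_int i) * u + (of_nat (nat (- j)) + of_int j) * v"
          using st g by (simp add: add ij algebra_simps)
        then show "\<tau> (s ^^ nat (- i) \<circ> t ^^ nat (- j) \<circ> g) = \<tau> (s ^^ nat i \<circ> t ^^ nat j)"
          by (simp only: nn st)
      qed (use st g comp_in in auto)
      then show "\<exists>i j i' j'. s ^^ i \<circ> t ^^ j \<circ> g = s ^^ i' \<circ> t ^^ j'" by blast
    next
      fix i j i' j' assume "s ^^ i \<circ> t ^^ j = s ^^ i' \<circ> t ^^ j'"
      then have "of_nat i * u + of_nat j * v = of_nat i' * u + of_nat j' * v" using st(2) by metis
      then have eq: "(of_real (real i - real i') * u) = (of_real (real j' - real j) * v)"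
        by (simp add: algebra_simps)
      have "cdet u (of_real (real j' - real j) * v) = 0" unfolding eq[symmetric] by (simp add: algebra_simps)
      moreover have "cdet u (of_real (real j' - real j) * v) = (real j' - real j) * cdet u v"
        by (simp add: algebra_simps)
      ultimately have j: "j = j'" using uv(3) by simp
      then have "of_real (real i - real i') * u = 0" using eq by simp
      moreover have "u \<noteq> 0" using uv(3) by auto
      ultimately have "real i - real i' = 0" by simp
      then show "i = i' \<and> j = j'" using j by simp
    qed (use s t in auto)
    then have "abelian_rank (homology_group 2 Y) \<ge> 1" by (rule rank2_galois_cover.abelian_rank_H2)
    then show ?thesis using rank_H0 r1 unfolding euler_char_eq by linarith
  qed
qed

end

section \<open>Limits of automorphisms of a properly convex cone\<close>

lemma tendsto_matrix_vector_mult: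
  fixes A :: "nat \<Rightarrow> real^'n^'m"
  assumes "A \<longlonglongrightarrow> T" "x \<longlonglongrightarrow> y"
  shows "(\<lambda>n. A n *v x n) \<longlonglongrightarrow> T *v y"
  unfolding matrix_vector_mult_def
  by (intro vec_tendstoI) (auto intro!: tendsto_intros assms)

lemma tendsto_matrix_vector_mult_left:
  fixes A :: "nat \<Rightarrow> real^'n^'m"
  assumes "A \<longlonglongrightarrow> T"
  shows "(\<lambda>n. A n *v x) \<longlonglongrightarrow> T *v x"
  by (rule tendsto_matrix_vector_mult[OF assms tendsto_const])

lemma bounded_matrix_sequence_subseq:
  fixes A :: "nat \<Rightarrow> real^'n^'m"
  assumes "\<And>n. norm (A n) \<le> B"
  obtains T r where "strict_mono (r :: nat \<Rightarrow> nat)" "(A \<circ> r) \<longlonglongrightarrow> T"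
proof -
  have "bounded (range A)" using assms by (auto simp: bounded_iff)
  then show ?thesis using bounded_imp_convergent_subsequence that by metis
qed

lemma limit_in_closure:
  fixes x :: "'a::metric_space"
  assumes "\<And>n. f n \<in> S" "f \<longlonglongrightarrow> x"
  shows "x \<in> closure S"
  using assms unfolding closure_sequential by (intro exI[of _ f]) simp

text \<open>The lower bound for a is a quantitative form of proper convexity. Being a closed
  condition it passes to the closure of C, where it excludes opposite vectors.\<close>

locale proper_cone =
  fixes C :: "(real^3) set" and a :: "real^3" and c :: real
  assumes open_C: "open C" and convex_C: "convex C" and nonempty_C: "C \<noteq> {}"
    and scale_C: "\<And>x r. \<lbrakk>x \<in> C; r > 0\<rbrakk> \<Longrightarrow> r *\<^sub>R x \<in> C"
    and c_pos: "c > 0" and bound_C: "\<And>x. x \<in> C \<Longrightarrow> c * norm x \<le> a \<bullet> x"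
begin

lemma bound_closure: "x \<in> closure C \<Longrightarrow> c * norm x \<le> a \<bullet> x"
proof -
  have "closed {x. c * norm x \<le> a \<bullet> x}"
    by (intro closed_Collect_le continuous_intros)
  then have "closure C \<subseteq> {x. c * norm x \<le> a \<bullet> x}" by (intro closure_minimal) (auto simp: bound_C)
  then show "x \<in> closure C \<Longrightarrow> c * norm x \<le> a \<bullet> x" by auto
qed

lemma closure_pos:
  assumes "x \<in> closure C" "x \<noteq> 0"
  shows "a \<bullet> x > 0"
proof -
  have "c * norm x > 0" using assms(2) c_pos by simp
  then show ?thesis using bound_closure[OF assms(1)] by linarith
qed

lemma closure_antisym: "\<lbrakk>x \<in> closure C; - x \<in> closure C\<rbrakk> \<Longrightarrow> x = 0"
  using closure_pos[of x] closure_pos[of "- x"] by fastforce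

lemma add_C: "\<lbrakk>x \<in> C; y \<in> C\<rbrakk> \<Longrightarrow> x + y \<in> C"
proof -
  assume xy: "x \<in> C" "y \<in> C"
  have "2 *\<^sub>R ((1/2) *\<^sub>R x + (1/2) *\<^sub>R y) \<in> C"
    by (intro scale_C convexD[OF convex_C xy]) auto
  then show "x + y \<in> C" by (simp add: scaleR_right_distrib)
qed

text \<open>Replace x by a nearby point of C and put the error into y, which has room because C is
  open.\<close>

lemma add_closure_C: "\<lbrakk>x \<in> closure C; y \<in> C\<rbrakk> \<Longrightarrow> x + y \<in> C"
proof -
  assume x: "x \<in> closure C" and y: "y \<in> C"
  obtain e where e: "e > 0" "ball y e \<subseteq> C" using open_C y open_contains_ball by blast
  obtain x' where x': "x' \<in> C" "dist x' x < e" using x e closure_approachable by blast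
  have "dist y (x + y - x') = dist x' x" by (simp add: dist_norm algebra_simps)
  then have "x + y - x' \<in> C" using e x' by auto
  then have "x' + (x + y - x') \<in> C" using add_C x' by blast
  then show "x + y \<in> C" by simp
qed

lemma zero_notin: "0 \<notin> C"
proof
  assume "0 \<in> C"
  then obtain e where e: "e > 0" "ball 0 e \<subseteq> C" using open_C open_contains_ball by blast
  define z where "z = (e / 2) *\<^sub>R (axis 1 1 :: real^3)"
  have "norm z = e / 2" using e by (simp add: z_def)
  then have "z \<in> C" "- z \<in> C" using e by (auto simp: subset_iff)
  then have "z = 0" using closure_antisym closure_subset by blast
  then show False using \<open>norm z = e / 2\<close> e by simp
qed

lemma scale_closure: "\<lbrakk>x \<in> closure C; r \<ge> 0\<rbrakk> \<Longrightarrow> r *\<^sub>R x \<in> closure C"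
proof -
  assume x: "x \<in> closure C" and r: "r \<ge> 0"
  obtain y where y: "y \<in> C" using nonempty_C by blast
  obtain f where f: "\<And>n. f n \<in> C" "f \<longlonglongrightarrow> x" using x closure_sequential by metis
  show "r *\<^sub>R x \<in> closure C"
  proof (cases "r = 0")
    case True
    have "(\<lambda>n. inverse (real (Suc n)) *\<^sub>R y) \<longlonglongrightarrow> 0 *\<^sub>R y"
      by (intro tendsto_scaleR LIMSEQ_inverse_real_of_nat tendsto_const)
    moreover have "inverse (real (Suc n)) *\<^sub>R y \<in> C" for n using y scale_C by simp
    ultimately have "0 *\<^sub>R y \<in> closure C" by (rule limit_in_closure[rotated])
    then show ?thesis using True by simp
  next
    case False
    then have "\<And>n. r *\<^sub>R f n \<in> C" using f r scale_C by simp
    moreover have "(\<lambda>n. r *\<^sub>R f n) \<longlonglongrightarrow> r *\<^sub>R x" by (intro tendsto_scaleR f tendsto_const)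
    ultimately show ?thesis by (rule limit_in_closure)
  qed
qed

lemma add_closure: "\<lbrakk>x \<in> closure C; y \<in> closure C\<rbrakk> \<Longrightarrow> x + y \<in> closure C"
proof -
  assume xy: "x \<in> closure C" "y \<in> closure C"
  have "2 *\<^sub>R ((1/2) *\<^sub>R x + (1/2) *\<^sub>R y) \<in> closure C"
    by (intro scale_closure convexD[OF convex_closure[OF convex_C] xy]) auto
  then show "x + y \<in> closure C" by (simp add: scaleR_right_distrib)
qed

text \<open>Points far out on the line, scaled down, converge to q and to -q, which cannot both lie
  in the closure unless q is zero.\<close>

lemma not_affine_line: "\<lbrakk>\<And>R. x + R *\<^sub>R q \<in> C\<rbrakk> \<Longrightarrow> q = 0"
proof (rule ccontr)
  assume line: "\<And>R. x + R *\<^sub>R q \<in> C" and q: "q \<noteq> 0"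
  have lim: "(\<lambda>n. (1 / real (Suc n)) *\<^sub>R (x + (s * real (Suc n)) *\<^sub>R q)) \<longlonglongrightarrow> 0 *\<^sub>R x + s *\<^sub>R q" for s
  proof -
    have "(\<lambda>n. (1 / real (Suc n)) *\<^sub>R x + s *\<^sub>R q) \<longlonglongrightarrow> 0 *\<^sub>R x + s *\<^sub>R q"
      using LIMSEQ_inverse_real_of_nat by (intro tendsto_intros) (simp add: inverse_eq_divide)
    then show ?thesis by (simp add: scaleR_right_distrib)
  qed
  have "s *\<^sub>R q \<in> closure C" for s
    using limit_in_closure[OF _ lim[of s], of C] line scale_C by simp
  from this[of 1] this[of "-1"] show False using q closure_antisym by simp
qed

lemma interior_both_directions:
  assumes "x \<in> C"
  obtains \<epsilon> where "\<epsilon> > 0" "x + \<epsilon> *\<^sub>R h \<in> C" "x - \<epsilon> *\<^sub>R h \<in> C"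
proof -
  obtain e where e: "e > 0" "ball x e \<subseteq> C" using open_C assms open_contains_ball by blast
  define \<epsilon> where "\<epsilon> = e / (2 * (norm h + 1))"
  have "\<epsilon> > 0" using e by (simp add: \<epsilon>_def add_nonneg_pos)
  moreover have "\<epsilon> * norm h < e"
  proof -
    have "norm h < 2 * (norm h + 1)" using norm_ge_zero[of h] by (smt (verit))
    then have "e * norm h < e * (2 * (norm h + 1))" using e(1) by (rule mult_strict_left_mono)
    then show ?thesis by (simp add: \<epsilon>_def divide_less_eq add_nonneg_pos)
  qed
  ultimately have "x + \<epsilon> *\<^sub>R h \<in> ball x e" "x - \<epsilon> *\<^sub>R h \<in> ball x e"
    by (auto simp: dist_norm)
  then show ?thesis using that \<open>\<epsilon> > 0\<close> e by blast
qed

lemma functional_pos: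
  assumes "\<And>x. x \<in> C \<Longrightarrow> \<beta> \<bullet> x \<ge> 0" "\<beta> \<noteq> 0" "x \<in> C"
  shows "\<beta> \<bullet> x > 0"
proof (rule ccontr)
  assume "\<not> \<beta> \<bullet> x > 0"
  then have z: "\<beta> \<bullet> x = 0" using assms by force
  obtain \<epsilon> where "\<epsilon> > 0" "x - \<epsilon> *\<^sub>R \<beta> \<in> C" using interior_both_directions[OF assms(3)] by blast
  then have "\<beta> \<bullet> (x - \<epsilon> *\<^sub>R \<beta>) \<ge> 0" using assms by blast
  then have "\<epsilon> * (\<beta> \<bullet> \<beta>) \<le> 0" using z by (simp add: inner_diff_right)
  moreover have "\<beta> \<bullet> \<beta> > 0" using assms(2) by simp
  ultimately show False using \<open>\<epsilon> > 0\<close> by (meson mult_pos_pos not_less)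
qed

text \<open>A separating functional is bounded above on the subspace P, and a functional bounded
  above on a subspace vanishes there.\<close>

lemma supporting_functional:
  assumes P: "subspace P" and disj: "P \<inter> C = {}"
  obtains \<beta> where "\<beta> \<noteq> 0" "\<And>x. x \<in> P \<Longrightarrow> \<beta> \<bullet> x = 0" "\<And>x. x \<in> C \<Longrightarrow> \<beta> \<bullet> x > 0"
    "\<And>x. x \<in> closure C \<Longrightarrow> \<beta> \<bullet> x \<ge> 0"
proof -
  have "P \<noteq> {}" using P subspace_0 by blast
  then obtain \<beta> b where b: "\<beta> \<noteq> 0" "\<forall>x\<in>P. \<beta> \<bullet> x \<le> b" "\<forall>x\<in>C. \<beta> \<bullet> x \<ge> b"
    using separating_hyperplane_sets[OF subspace_imp_convex[OF P] convex_C _ nonempty_C disj] by blast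
  have b0: "b \<ge> 0" using b(2) subspace_0[OF P] by force
  have zero: "\<beta> \<bullet> x = 0" if x: "x \<in> P" for x
  proof (rule ccontr)
    assume nz: "\<beta> \<bullet> x \<noteq> 0"
    have "((b + 1) / (\<beta> \<bullet> x)) *\<^sub>R x \<in> P" using P x subspace_scale by blast
    then have "\<beta> \<bullet> (((b + 1) / (\<beta> \<bullet> x)) *\<^sub>R x) \<le> b" using b by blast
    then show False using nz by simp
  qed
  have nn: "\<beta> \<bullet> x \<ge> 0" if "x \<in> C" for x using b(3) b0 that by force
  have "closed {x. \<beta> \<bullet> x \<ge> 0}" by (intro closed_Collect_le continuous_intros)
  then have "closure C \<subseteq> {x. \<beta> \<bullet> x \<ge> 0}" using nn by (intro closure_minimal) auto
  then show ?thesis using that[of \<beta>] b(1) zero functional_pos[OF nn b(1)] by blast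
qed

lemma supporting_functional_point:
  assumes y: "y \<in> closure C" "y \<notin> C"
  obtains \<beta> where "\<beta> \<noteq> 0" "\<beta> \<bullet> y = 0" "\<And>x. x \<in> C \<Longrightarrow> \<beta> \<bullet> x > 0" "\<And>x. x \<in> closure C \<Longrightarrow> \<beta> \<bullet> x \<ge> 0"
proof -
  have "span {y} \<inter> C = {}"
  proof (rule ccontr)
    assume "span {y} \<inter> C \<noteq> {}"
    then obtain k where k: "k *\<^sub>R y \<in> C" by (auto simp: span_singleton)
    show False
    proof (cases "k > 0")
      case True
      then have "(1/k) *\<^sub>R (k *\<^sub>R y) \<in> C" by (intro scale_C k) simp
      then show False using True y by simp
    next
      case False
      then have "(- k) *\<^sub>R y \<in> closure C" by (intro scale_closure[OF y(1)]) simp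
      then have "(- k) *\<^sub>R y + k *\<^sub>R y \<in> C" using add_closure_C k by blast
      then show False using zero_notin by simp
    qed
  qed
  then show ?thesis
    using supporting_functional[OF subspace_span] that span_base by (metis singletonI)
qed

definition preserves :: "real^3^3 \<Rightarrow> bool"
  where "preserves A \<longleftrightarrow> invertible A \<and> (\<forall>x. A *v x \<in> C \<longleftrightarrow> x \<in> C)"

lemma preserves_scale: "\<lbrakk>preserves A; r > 0\<rbrakk> \<Longrightarrow> preserves (r *\<^sub>R A)"
proof -
  assume A: "preserves A" and r: "r > 0"
  have "invertible (r *\<^sub>R A)"
    using A r scalar_invertible[of r A] unfolding preserves_def by simp
  moreover have "(r *\<^sub>R A) *v x \<in> C \<longleftrightarrow> x \<in> C" for x
  proof -
    have "r *\<^sub>R (A *v x) \<in> C \<longleftrightarrow> A *v x \<in> C"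
      using scale_C[of "A *v x" r] scale_C[of "r *\<^sub>R (A *v x)" "inverse r"] r by auto
    then show ?thesis using A by (simp only: preserves_def scaleR_matrix_vector_assoc[symmetric])
  qed
  ultimately show "preserves (r *\<^sub>R A)" by (simp add: preserves_def)
qed

lemma limit_closure:
  assumes A: "\<And>n. preserves (A n)" and T: "A \<longlonglongrightarrow> T" and x: "x \<in> closure C"
  shows "T *v x \<in> closure C"
proof -
  have in_closure: "T *v z \<in> closure C" if "z \<in> C" for z
    using limit_in_closure[OF _ tendsto_matrix_vector_mult_left[OF T, of z], of C] A that
    unfolding preserves_def by blast
  obtain f where f: "\<And>n. f n \<in> C" "f \<longlonglongrightarrow> x" using x closure_sequential by metis
  have "(\<lambda>n. T *v f n) \<longlonglongrightarrow> T *v x" by (rule tendsto_matrix_vector_mult[OF tendsto_const f(2)])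
  then have "T *v x \<in> closure (closure C)"
    by (rule limit_in_closure[rotated]) (rule in_closure[OF f(1)])
  then show ?thesis by simp
qed

text \<open>If the limit killed an interior point x, then the images of x + \<epsilon> h and x -
  \<epsilon> h would be opposite vectors of the closed cone, so every h would be killed.\<close>

lemma limit_nonzero:
  assumes A: "\<And>n. preserves (A n)" and T: "A \<longlonglongrightarrow> T" and nz: "T \<noteq> 0" and x: "x \<in> C"
  shows "T *v x \<noteq> 0"
proof
  assume 0: "T *v x = 0"
  have "T *v h = 0 *v h" for h
  proof -
    obtain \<epsilon> where e: "\<epsilon> > 0" "x + \<epsilon> *\<^sub>R h \<in> C" "x - \<epsilon> *\<^sub>R h \<in> C"
      using interior_both_directions[OF x] by blast
    have "T *v (x + \<epsilon> *\<^sub>R h) \<in> closure C" "T *v (x - \<epsilon> *\<^sub>R h) \<in> closure C"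
      using limit_closure[OF A T] e closure_subset by blast+
    then have "\<epsilon> *\<^sub>R (T *v h) \<in> closure C" "- (\<epsilon> *\<^sub>R (T *v h)) \<in> closure C"
      by (simp_all add: matrix_vector_right_distrib matrix_vector_mult_diff_distrib 0 matrix_vector_mult_scaleR)
    then have "\<epsilon> *\<^sub>R (T *v h) = 0" by (rule closure_antisym)
    then show ?thesis using e(1) by simp
  qed
  then have "T = 0" by (simp add: matrix_eq)
  then show False using nz by simp
qed

text \<open>C is a linear image of the open positive octant; in the projective plane, the domain is
  an open triangle.\<close>

definition simplicial :: bool
  where "simplicial \<longleftrightarrow> (\<exists>P :: real^3^3. invertible P \<and> (\<forall>x. P *v x \<in> C \<longleftrightarrow> (\<forall>i. x $ i > 0)))"

text \<open>The image of T is the plane of a supporting functional \<beta>, and this plane cuts the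
  closed cone in a two-dimensional face. The two edges of the face, pulled back by T, give two
  half-spaces. The third comes from the functionals \<beta> A_n, which tend to zero but have a
  normalised limit \<omega>. The intersection of the three is C: if x satisfies all three
  inequalities, A_n x lies in C for some n, and A_n preserves C.\<close>

lemma rank_two_limit_imp_simplicial:
  assumes A: "\<And>n. preserves (A n)" and T: "A \<longlonglongrightarrow> T" and x0: "x0 \<in> C"
    and y: "T *v x0 \<notin> C" and x1: "T *v x1 \<notin> span {T *v x0}"
  shows simplicial
proof -
  define y where "y = T *v x0"
  define y1 where "y1 = T *v x1"
  have T0: "T \<noteq> 0" using x1 span_zero by auto
  have yc: "y \<in> closure C" unfolding y_def using limit_closure[OF A T] x0 closure_subset by blast
  have ynz: "y \<noteq> 0" unfolding y_def by (rule limit_nonzero[OF A T T0 x0])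
  have ay: "a \<bullet> y > 0" by (rule closure_pos[OF yc ynz])
  obtain \<beta> where \<beta>: "\<beta> \<noteq> 0" "\<beta> \<bullet> y = 0" "\<And>x. x \<in> C \<Longrightarrow> \<beta> \<bullet> x > 0"
    "\<And>x. x \<in> closure C \<Longrightarrow> \<beta> \<bullet> x \<ge> 0"
    using supporting_functional_point[OF yc y[folded y_def]] by blast
  have T_lin: "T *v (x + r *\<^sub>R h) = T *v x + r *\<^sub>R (T *v h)" for x h r
    by (simp add: matrix_vector_right_distrib matrix_vector_mult_scaleR)
  have \<beta>T: "\<beta> \<bullet> (T *v h) = 0" for h
  proof -
    obtain \<epsilon> where e: "\<epsilon> > 0" "x0 + \<epsilon> *\<^sub>R h \<in> C" "x0 - \<epsilon> *\<^sub>R h \<in> C"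
      using interior_both_directions[OF x0] by blast
    have "T *v (x0 + \<epsilon> *\<^sub>R h) \<in> closure C" "T *v (x0 - \<epsilon> *\<^sub>R h) \<in> closure C"
      using limit_closure[OF A T] e closure_subset by blast+
    then have "\<beta> \<bullet> (y + \<epsilon> *\<^sub>R (T *v h)) \<ge> 0" "\<beta> \<bullet> (y + (- \<epsilon>) *\<^sub>R (T *v h)) \<ge> 0"
      using \<beta>(4) T_lin[of x0 \<epsilon> h] T_lin[of x0 "- \<epsilon>" h] unfolding y_def by auto
    then have "\<epsilon> * (\<beta> \<bullet> (T *v h)) = 0" using \<beta>(2) by (simp add: inner_add_right inner_diff_right)
    then show ?thesis using e(1) by simp
  qed
  \<comment> \<open>The multiple of x0 is chosen so that d = T h satisfies a \<bullet> d = 0; then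
    \<eta> and d parametrise the slice a = 1 of the plane \<beta> = 0.\<close>
  define h where "h = x1 + (- (a \<bullet> y1) / (a \<bullet> y)) *\<^sub>R x0"
  define d where "d = T *v h"
  have d_eq: "d = y1 + (- (a \<bullet> y1) / (a \<bullet> y)) *\<^sub>R y"
    unfolding d_def h_def T_lin y_def y1_def ..
  have ad: "a \<bullet> d = 0" unfolding d_eq using ay by (simp add: inner_add_right inner_diff_right)
  have \<beta>d: "\<beta> \<bullet> d = 0" unfolding d_def by (rule \<beta>T)
  have dnz: "d \<noteq> 0"
  proof
    assume "d = 0"
    then have "y1 = ((a \<bullet> y1) / (a \<bullet> y)) *\<^sub>R y" unfolding d_eq by (simp add: add_eq_0_iff)
    then have "y1 \<in> span {y}" by (metis span_base span_scale singletonI)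
    then show False using x1 unfolding y_def y1_def by simp
  qed
  define \<eta> where "\<eta> = y /\<^sub>R (a \<bullet> y)"
  have a\<eta>: "a \<bullet> \<eta> = 1" and \<beta>\<eta>: "\<beta> \<bullet> \<eta> = 0" using ay \<beta>(2) by (simp_all add: \<eta>_def)
  have \<eta>c: "\<eta> \<in> closure C" unfolding \<eta>_def using scale_closure[OF yc] ay by simp
  define \<gamma> where "\<gamma> p = d \<bullet> (p - (a \<bullet> p) *\<^sub>R \<eta>) / (d \<bullet> d)" for p
  have plane: "p = (a \<bullet> p) *\<^sub>R \<eta> + \<gamma> p *\<^sub>R d" if p: "\<beta> \<bullet> p = 0" for p
  proof -
    have indep: "independent {\<eta>, d}"
    proof (rule independent_insertI)
      show "\<eta> \<notin> span {d}"
      proof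
        assume "\<eta> \<in> span {d}"
        then obtain k where "\<eta> = k *\<^sub>R d" by (auto simp: span_singleton)
        then show False using a\<eta> ad by simp
      qed
      show "independent {d}" using dnz by simp
    qed
    have "\<eta> \<noteq> d" using a\<eta> ad by auto
    then have "dim (span {\<eta>, d}) = 2" using dim_span_eq_card_independent[OF indep] by simp
    moreover have "dim {x. \<beta> \<bullet> x = 0} = 2" using dim_hyperplane[OF \<beta>(1)] by simp
    moreover have "span {\<eta>, d} \<subseteq> {x. \<beta> \<bullet> x = 0}"
      using \<beta>\<eta> \<beta>d by (intro span_minimal subspace_hyperplane) auto
    ultimately have "span {\<eta>, d} = {x. \<beta> \<bullet> x = 0}"
      by (intro subspace_dim_equal subspace_span subspace_hyperplane) auto
    then have "p \<in> span {\<eta>, d}" using p by simp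
    then obtain k where "p - k *\<^sub>R \<eta> \<in> span {d}" by (auto simp: span_insert)
    then obtain l where "p - k *\<^sub>R \<eta> = l *\<^sub>R d" by (auto simp: span_singleton)
    then have kl: "p = k *\<^sub>R \<eta> + l *\<^sub>R d" by (metis add.commute diff_add_cancel)
    then have "a \<bullet> p = k" using a\<eta> ad by (simp add: inner_add_right)
    moreover from this have "\<gamma> p = l" unfolding \<gamma>_def using kl dnz by simp
    ultimately show ?thesis using kl by simp
  qed
  \<comment> \<open>The face of the closed cone in this slice, a compact interval whose end points
    give the edges u and v.\<close>
  define I where "I = {\<tau>. \<eta> + \<tau> *\<^sub>R d \<in> closure C}"
  have "I = (\<lambda>\<tau>. \<eta> + \<tau> *\<^sub>R d) -` closure C" by (auto simp: I_def)
  then have "closed I" by (simp add: continuous_closed_vimage continuous_intros)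
  moreover have "bounded I"
  proof -
    have "\<bar>\<tau>\<bar> \<le> (1 / c + norm \<eta>) / norm d" if "\<tau> \<in> I" for \<tau>
    proof -
      have "c * norm (\<eta> + \<tau> *\<^sub>R d) \<le> 1"
        using bound_closure[of "\<eta> + \<tau> *\<^sub>R d"] that a\<eta> ad by (simp add: I_def inner_add_right)
      then have "norm (\<eta> + \<tau> *\<^sub>R d) \<le> 1 / c" using c_pos by (simp add: field_simps)
      moreover have "norm (\<tau> *\<^sub>R d) \<le> norm (\<eta> + \<tau> *\<^sub>R d) + norm \<eta>"
        using norm_triangle_ineq4[of "\<eta> + \<tau> *\<^sub>R d" \<eta>] by simp
      ultimately have "\<bar>\<tau>\<bar> * norm d \<le> 1 / c + norm \<eta>" by simp
      then show ?thesis using dnz by (simp add: field_simps)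
    qed
    then show ?thesis unfolding bounded_iff by auto
  qed
  ultimately have "compact I" using compact_eq_bounded_closed by blast
  moreover have "connected I"
  proof -
    have "convex I"
    proof (rule convexI)
      fix \<tau> \<tau>' m m' :: real
      assume t: "\<tau> \<in> I" "\<tau>' \<in> I" "0 \<le> m" "0 \<le> m'" "m + m' = 1"
      have "m *\<^sub>R (\<eta> + \<tau> *\<^sub>R d) + m' *\<^sub>R (\<eta> + \<tau>' *\<^sub>R d) \<in> closure C"
        using add_closure[OF scale_closure[OF _ t(3)] scale_closure[OF _ t(4)]] t(1,2)
        unfolding I_def by blast
      also have "m *\<^sub>R (\<eta> + \<tau> *\<^sub>R d) + m' *\<^sub>R (\<eta> + \<tau>' *\<^sub>R d) =
          (m + m') *\<^sub>R \<eta> + (m * \<tau> + m' * \<tau>') *\<^sub>R d" by (simp add: algebra_simps)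
      finally show "m *\<^sub>R \<tau> + m' *\<^sub>R \<tau>' \<in> I" using t(5) by (simp add: I_def)
    qed
    then show ?thesis by (rule convex_connected)
  qed
  ultimately obtain \<tau>1 \<tau>2 where I: "I = {\<tau>1..\<tau>2}" using connected_compact_interval_1 by metis
  \<comment> \<open>The strict inequalities come from openness of C: the point x can be moved in
    both directions h, which moves T x along d to both sides within the closed face.\<close>
  have image: "a \<bullet> (T *v x) > 0 \<and> \<tau>1 * (a \<bullet> (T *v x)) < \<gamma> (T *v x) \<and> \<gamma> (T *v x) < \<tau>2 * (a \<bullet> (T *v x))"
    if x: "x \<in> C" for x
  proof -
    define k where "k = a \<bullet> (T *v x)"
    define l where "l = \<gamma> (T *v x)"
    have Tx: "T *v x = k *\<^sub>R \<eta> + l *\<^sub>R d" unfolding k_def l_def by (rule plane[OF \<beta>T])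
    have "T *v x \<in> closure C" using limit_closure[OF A T] x closure_subset by blast
    then have k: "k > 0" unfolding k_def using limit_nonzero[OF A T T0 x] closure_pos by blast
    obtain \<epsilon> where e: "\<epsilon> > 0" "x + \<epsilon> *\<^sub>R h \<in> C" "x - \<epsilon> *\<^sub>R h \<in> C"
      using interior_both_directions[OF x] by blast
    have "T *v (x + \<epsilon> *\<^sub>R h) \<in> closure C" "T *v (x - \<epsilon> *\<^sub>R h) \<in> closure C"
      using limit_closure[OF A T] e closure_subset by blast+
    then have "k *\<^sub>R \<eta> + (l + \<epsilon>) *\<^sub>R d \<in> closure C" "k *\<^sub>R \<eta> + (l - \<epsilon>) *\<^sub>R d \<in> closure C"
      using T_lin[of x \<epsilon> h] T_lin[of x "- \<epsilon>" h] Tx unfolding d_def by (simp_all add: algebra_simps)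
    then have "(1 / k) *\<^sub>R (k *\<^sub>R \<eta> + (l + \<epsilon>) *\<^sub>R d) \<in> closure C"
      "(1 / k) *\<^sub>R (k *\<^sub>R \<eta> + (l - \<epsilon>) *\<^sub>R d) \<in> closure C"
      using k by (auto intro!: scale_closure)
    moreover have "(1 / k) *\<^sub>R (k *\<^sub>R \<eta> + m *\<^sub>R d) = \<eta> + (m / k) *\<^sub>R d" for m
      using k by (simp add: scaleR_right_distrib)
    ultimately have "(l + \<epsilon>) / k \<in> I" "(l - \<epsilon>) / k \<in> I" unfolding I_def by simp_all
    then have "l + \<epsilon> \<le> \<tau>2 * k" "\<tau>1 * k \<le> l - \<epsilon>" using k by (simp_all add: I field_simps)
    then show ?thesis using e(1) k unfolding k_def l_def by linarith
  qed
  have t12: "\<tau>1 < \<tau>2" using image[OF x0] by (smt (verit) mult_right_mono)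
  define u where "u = \<eta> + \<tau>1 *\<^sub>R d"
  define v where "v = \<eta> + \<tau>2 *\<^sub>R d"
  have uv: "u \<in> closure C" "v \<in> closure C" using t12 I unfolding u_def v_def I_def by auto
  define s where "s p = (\<tau>2 * (a \<bullet> p) - \<gamma> p) / (\<tau>2 - \<tau>1)" for p
  define t where "t p = (\<gamma> p - \<tau>1 * (a \<bullet> p)) / (\<tau>2 - \<tau>1)" for p
  have coords: "p = s p *\<^sub>R u + t p *\<^sub>R v" if "\<beta> \<bullet> p = 0" for p
  proof -
    have "s p + t p = ((\<tau>2 * (a \<bullet> p) - \<gamma> p) + (\<gamma> p - \<tau>1 * (a \<bullet> p))) / (\<tau>2 - \<tau>1)"
      by (simp only: s_def t_def add_divide_distrib)
    also have "(\<tau>2 * (a \<bullet> p) - \<gamma> p) + (\<gamma> p - \<tau>1 * (a \<bullet> p)) = (a \<bullet> p) * (\<tau>2 - \<tau>1)"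
      by (simp add: algebra_simps)
    finally have "s p + t p = a \<bullet> p" using t12 by simp
    have "s p * \<tau>1 + t p * \<tau>2 =
        ((\<tau>2 * (a \<bullet> p) - \<gamma> p) * \<tau>1 + (\<gamma> p - \<tau>1 * (a \<bullet> p)) * \<tau>2) / (\<tau>2 - \<tau>1)"
      by (simp add: s_def t_def add_divide_distrib)
    also have "(\<tau>2 * (a \<bullet> p) - \<gamma> p) * \<tau>1 + (\<gamma> p - \<tau>1 * (a \<bullet> p)) * \<tau>2 = \<gamma> p * (\<tau>2 - \<tau>1)"
      by (simp add: algebra_simps)
    finally have "s p * \<tau>1 + t p * \<tau>2 = \<gamma> p" using t12 by simp
    with \<open>s p + t p = a \<bullet> p\<close> have "s p + t p = a \<bullet> p \<and> s p * \<tau>1 + t p * \<tau>2 = \<gamma> p" by blast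
    moreover have "s p *\<^sub>R u + t p *\<^sub>R v = (s p + t p) *\<^sub>R \<eta> + (s p * \<tau>1 + t p * \<tau>2) *\<^sub>R d"
      by (simp add: u_def v_def algebra_simps)
    ultimately show ?thesis using plane[OF that] by simp
  qed
  define e where "e = \<beta> /\<^sub>R (\<beta> \<bullet> \<beta>)"
  have \<beta>e: "\<beta> \<bullet> e = 1" unfolding e_def using \<beta>(1) by simp
  define pr where "pr z = z - (\<beta> \<bullet> z) *\<^sub>R e" for z
  have \<beta>pr: "\<beta> \<bullet> pr z = 0" for z by (simp add: pr_def inner_diff_right \<beta>e)
  have decomp: "z = s (pr z) *\<^sub>R u + t (pr z) *\<^sub>R v + (\<beta> \<bullet> z) *\<^sub>R e" for z
    using coords[OF \<beta>pr, of z] by (simp add: pr_def)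
  have cont: "(\<lambda>n. s (f n)) \<longlonglongrightarrow> s z" "(\<lambda>n. t (f n)) \<longlonglongrightarrow> t z" if "f \<longlonglongrightarrow> z" for f z
    unfolding s_def t_def \<gamma>_def using t12 dnz by (auto intro!: tendsto_intros that)
  define w where "w n = \<beta> v* A n" for n
  have w: "w n \<bullet> x = \<beta> \<bullet> (A n *v x)" for n x by (simp add: w_def dot_lmul_matrix)
  have w_pos: "w n \<bullet> x > 0" if "x \<in> C" for n x
    using \<beta>(3)[of "A n *v x"] A[of n] that unfolding w preserves_def by blast
  have w_nz: "w n \<noteq> 0" for n using w_pos[OF x0, of n] by auto
  have w_lim: "w \<longlonglongrightarrow> 0"
  proof (rule vec_tendstoI)
    fix i
    have "(\<lambda>n. \<beta> \<bullet> (A n *v axis i 1)) \<longlonglongrightarrow> \<beta> \<bullet> (T *v axis i 1)"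
      by (intro tendsto_intros tendsto_matrix_vector_mult_left T)
    then show "(\<lambda>n. w n $ i) \<longlonglongrightarrow> 0 $ i"
      by (simp add: \<beta>T flip: w) (simp add: inner_axis)
  qed
  have "\<exists>r \<omega>. strict_mono (r :: nat \<Rightarrow> nat) \<and> (\<lambda>n. w (r n) /\<^sub>R norm (w (r n))) \<longlonglongrightarrow> \<omega>"
  proof -
    have "bounded (range (\<lambda>n. w n /\<^sub>R norm (w n)))"
      using w_nz by (intro boundedI[of _ 1]) auto
    from bounded_imp_convergent_subsequence[OF this] show ?thesis by (auto simp: o_def)
  qed
  then obtain r \<omega> where r: "strict_mono (r :: nat \<Rightarrow> nat)"
    and \<omega>: "(\<lambda>n. w (r n) /\<^sub>R norm (w (r n))) \<longlonglongrightarrow> \<omega>" by blast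
  have "norm \<omega> = 1"
  proof -
    have "(\<lambda>n. norm (w (r n) /\<^sub>R norm (w (r n)))) \<longlonglongrightarrow> norm \<omega>" by (intro tendsto_norm \<omega>)
    moreover have "(\<lambda>n. norm (w (r n) /\<^sub>R norm (w (r n)))) = (\<lambda>n. 1)" using w_nz by auto
    ultimately show ?thesis by (metis LIMSEQ_unique tendsto_const)
  qed
  then have \<omega>nz: "\<omega> \<noteq> 0" by auto
  have \<omega>_pos: "\<omega> \<bullet> x > 0" if "x \<in> C" for x
  proof (rule functional_pos[OF _ \<omega>nz that])
    fix x assume x: "x \<in> C"
    have "(\<lambda>n. (w (r n) /\<^sub>R norm (w (r n))) \<bullet> x) \<longlonglongrightarrow> \<omega> \<bullet> x" by (intro tendsto_intros \<omega>)
    then show "\<omega> \<bullet> x \<ge> 0"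
      by (rule LIMSEQ_le_const) (use w_pos[OF x] w_nz in \<open>auto intro!: exI[of _ 0] less_imp_le mult_pos_pos\<close>)
  qed
  have Ar: "(\<lambda>n. A (r n)) \<longlonglongrightarrow> T" using LIMSEQ_subseq_LIMSEQ[OF T r] by (simp add: o_def)
  have nr: "(\<lambda>n. norm (w (r n))) \<longlonglongrightarrow> 0"
    using tendsto_norm[OF LIMSEQ_subseq_LIMSEQ[OF w_lim r]] by (simp add: o_def)
  have char: "x \<in> C \<longleftrightarrow> s (T *v x) > 0 \<and> t (T *v x) > 0 \<and> \<omega> \<bullet> x > 0" for x
  proof
    assume x: "x \<in> C"
    show "s (T *v x) > 0 \<and> t (T *v x) > 0 \<and> \<omega> \<bullet> x > 0"
      using image[OF x] \<omega>_pos[OF x] t12 unfolding s_def t_def by (simp add: zero_less_divide_iff)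
  next
    assume pos: "s (T *v x) > 0 \<and> t (T *v x) > 0 \<and> \<omega> \<bullet> x > 0"
    define \<rho> where "\<rho> n = \<beta> \<bullet> (A (r n) *v x)" for n
    have "\<rho> = (\<lambda>n. norm (w (r n)) * ((w (r n) /\<^sub>R norm (w (r n))) \<bullet> x))"
      using w_nz by (auto simp: \<rho>_def fun_eq_iff simp flip: w)
    moreover have lim: "(\<lambda>n. (w (r n) /\<^sub>R norm (w (r n))) \<bullet> x) \<longlonglongrightarrow> \<omega> \<bullet> x" by (intro tendsto_intros \<omega>)
    ultimately have \<rho>_lim: "\<rho> \<longlonglongrightarrow> 0"
      using tendsto_mult[OF nr lim] by (simp only: mult_zero_left)
    have "eventually (\<lambda>n. (w (r n) /\<^sub>R norm (w (r n))) \<bullet> x > 0) sequentially"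
      using order_tendstoD(1)[OF lim] pos by blast
    then have ev1: "eventually (\<lambda>n. \<rho> n > 0) sequentially"
      by eventually_elim (use w_nz in \<open>simp add: \<rho>_def zero_less_mult_iff flip: w\<close>)
    have Ax: "(\<lambda>n. A (r n) *v x) \<longlonglongrightarrow> T *v x" by (rule tendsto_matrix_vector_mult_left[OF Ar])
    have prT: "pr (T *v x) = T *v x" by (simp add: pr_def \<beta>T)
    have "(\<lambda>n. pr (A (r n) *v x)) \<longlonglongrightarrow> pr (T *v x)"
      unfolding pr_def by (intro tendsto_intros Ax)
    note st = cont[OF this, unfolded prT]
    define r' where "r' = \<beta> \<bullet> x0"
    have r': "r' > 0" unfolding r'_def by (rule \<beta>(3)[OF x0])
    \<comment> \<open>Subtracting the multiple of x0 with the same \<beta>-value as A_n x leaves a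
      vector of the face plane. That multiple tends to zero, so the remaining coordinates S and U
      stay near those of T x and are eventually positive.\<close>
    define S where "S n = s (pr (A (r n) *v x)) - (\<rho> n / r') * s (pr x0)" for n
    define U where "U n = t (pr (A (r n) *v x)) - (\<rho> n / r') * t (pr x0)" for n
    have "S \<longlonglongrightarrow> s (T *v x) - (0 / r') * s (pr x0)" "U \<longlonglongrightarrow> t (T *v x) - (0 / r') * t (pr x0)"
      unfolding S_def U_def using r'
      by (auto simp only: intro!: tendsto_diff st tendsto_mult tendsto_divide \<rho>_lim tendsto_const)
    then have "eventually (\<lambda>n. S n > 0) sequentially" "eventually (\<lambda>n. U n > 0) sequentially"
      using pos by (auto intro: order_tendstoD)
    with ev1 have "eventually (\<lambda>n. A (r n) *v x \<in> C) sequentially"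
    proof eventually_elim
      case (elim n)
      have "A (r n) *v x = s (pr (A (r n) *v x)) *\<^sub>R u + t (pr (A (r n) *v x)) *\<^sub>R v + \<rho> n *\<^sub>R e"
        unfolding \<rho>_def by (rule decomp)
      also have "\<dots> = (S n *\<^sub>R u + U n *\<^sub>R v) + (\<rho> n / r') *\<^sub>R (s (pr x0) *\<^sub>R u + t (pr x0) *\<^sub>R v + r' *\<^sub>R e)"
        using r' by (simp add: S_def U_def algebra_simps)
      also have "s (pr x0) *\<^sub>R u + t (pr x0) *\<^sub>R v + r' *\<^sub>R e = x0"
        unfolding r'_def by (rule decomp[symmetric])
      finally have eq: "A (r n) *v x = (S n *\<^sub>R u + U n *\<^sub>R v) + (\<rho> n / r') *\<^sub>R x0" .
      show ?case unfolding eq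
        using elim r' by (intro add_closure_C add_closure scale_closure scale_C uv x0) auto
    qed
    then obtain n where "A (r n) *v x \<in> C" using eventually_happens' sequentially_bot by blast
    then show "x \<in> C" using A[of "r n"] unfolding preserves_def by blast
  qed
  have s_lin: "s (x + k *\<^sub>R z) = s x + k * s z" "t (x + k *\<^sub>R z) = t x + k * t z" for x z k
    unfolding s_def t_def \<gamma>_def using t12 dnz
    by (simp_all add: inner_add_right inner_diff_right add_divide_distrib diff_divide_distrib algebra_simps)
  define N where "N x = (vector [s (T *v x), t (T *v x), \<omega> \<bullet> x] :: real^3)" for x
  have "linear N"
  proof (rule linearI)
    fix x z k
    have "N (x + z) $ i = (N x + N z) $ i" for i
      using exhaust_3[of i] s_lin[of "T *v x" 1 "T *v z"]
      by (auto simp: N_def matrix_vector_right_distrib inner_add_right)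
    then show "N (x + z) = N x + N z" by (simp only: vec_eq_iff) simp
    have "s 0 = 0" "t 0 = 0" by (simp_all add: s_def t_def \<gamma>_def)
    then have "N (k *\<^sub>R x) $ i = (k *\<^sub>R N x) $ i" for i
      using exhaust_3[of i] s_lin[of 0 k "T *v x"]
      by (auto simp: N_def matrix_vector_mult_scaleR)
    then show "N (k *\<^sub>R x) = k *\<^sub>R N x" by (simp only: vec_eq_iff) simp
  qed
  have "inj N"
  \<comment> \<open>A kernel vector changes none of the three coordinates, so a whole affine line
    through x0 would lie in C.\<close>
  proof (subst linear_injective_0[OF \<open>linear N\<close>], safe)
    fix q assume "N q = 0"
    then have "N q $ 1 = 0" "N q $ 2 = 0" "N q $ 3 = 0" by simp_all
    then have q: "s (T *v q) = 0" "t (T *v q) = 0" "\<omega> \<bullet> q = 0" by (simp_all add: N_def)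
    have "x0 + R *\<^sub>R q \<in> C" for R
      using char[of x0] x0 unfolding char[of "x0 + R *\<^sub>R q"]
      by (simp add: T_lin s_lin q inner_add_right)
    then show "q = 0" by (rule not_affine_line)
  qed
  define Q where "Q = matrix N"
  have NQ: "N x = Q *v x" for x unfolding Q_def by (simp add: \<open>linear N\<close>)
  have "inj ((*v) Q)" using \<open>inj N\<close> NQ by (metis (no_types, lifting) injD injI)
  then have "invertible Q"
    using matrix_left_invertible_injective invertible_left_inverse by blast
  then obtain Q' where Q': "Q ** Q' = mat 1" "Q' ** Q = mat 1" unfolding invertible_def by blast
  have "invertible Q'" using Q' unfolding invertible_def by blast
  moreover have "Q' *v x \<in> C \<longleftrightarrow> (\<forall>i. x $ i > 0)" for x
  proof -
    have "N (Q' *v x) = x" unfolding NQ by (simp add: matrix_vector_mul_assoc Q')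
    moreover have "Q' *v x \<in> C \<longleftrightarrow> N (Q' *v x) $ 1 > 0 \<and> N (Q' *v x) $ 2 > 0 \<and> N (Q' *v x) $ 3 > 0"
      unfolding char[of "Q' *v x"] by (simp add: N_def)
    ultimately show ?thesis by (simp add: forall_3)
  qed
  ultimately show ?thesis unfolding simplicial_def by blast
qed

text \<open>Without a rank two limit the image of T is the line of y = T x0; pairing with y / (y
  \<bullet> y) reads off the coefficient as a functional. It is positive on C since T maps C into
  nonzero vectors of the closed cone.\<close>

lemma rank_one_limit:
  assumes ns: "\<not> simplicial" and A: "\<And>n. preserves (A n)" and T: "A \<longlonglongrightarrow> T" and T0: "T \<noteq> 0"
    and x0: "x0 \<in> C" and y: "T *v x0 \<notin> C"
  obtains \<phi> where "\<And>x. T *v x = (\<phi> \<bullet> x) *\<^sub>R (T *v x0)" "\<And>x. x \<in> C \<Longrightarrow> \<phi> \<bullet> x > 0"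
proof -
  define y where "y = T *v x0"
  have yc: "y \<in> closure C" unfolding y_def using limit_closure[OF A T] x0 closure_subset by blast
  have ynz: "y \<noteq> 0" unfolding y_def by (rule limit_nonzero[OF A T T0 x0])
  define \<phi> where "\<phi> = (y /\<^sub>R (y \<bullet> y)) v* T"
  have eq: "T *v x = (\<phi> \<bullet> x) *\<^sub>R y" for x
  proof -
    have "T *v x \<in> span {y}"
      using rank_two_limit_imp_simplicial[OF A T x0 y] ns unfolding y_def by blast
    then obtain k where k: "T *v x = k *\<^sub>R y" by (auto simp: span_singleton)
    have "\<phi> \<bullet> x = (y /\<^sub>R (y \<bullet> y)) \<bullet> (T *v x)" unfolding \<phi>_def by (rule dot_lmul_matrix)
    also have "\<dots> = k" unfolding k using ynz by simp
    finally show ?thesis using k by simp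
  qed
  have pos: "\<phi> \<bullet> x > 0" if x: "x \<in> C" for x
  proof -
    have "(\<phi> \<bullet> x) *\<^sub>R y \<in> closure C" "(\<phi> \<bullet> x) *\<^sub>R y \<noteq> 0"
      using limit_closure[OF A T, of x] x closure_subset limit_nonzero[OF A T T0 x] unfolding eq by auto
    then have "a \<bullet> ((\<phi> \<bullet> x) *\<^sub>R y) > 0" by (rule closure_pos)
    then show ?thesis using closure_pos[OF yc ynz] by (simp add: zero_less_mult_iff)
  qed
  show ?thesis using that[of \<phi>] eq pos unfolding y_def by blast
qed

end

section \<open>Attracting directions\<close>

definition mpow :: "real^'n^'n \<Rightarrow> nat \<Rightarrow> real^'n^'n"
  where "mpow A n = (((**) A) ^^ n) (mat 1)"

lemma mpow_0 [simp]: "mpow A 0 = mat 1"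
  and mpow_Suc: "mpow A (Suc n) = A ** mpow A n"
  by (simp_all add: mpow_def)

lemma mpow_Suc_vec: "mpow A (Suc n) *v x = A *v (mpow A n *v x)"
  by (simp add: mpow_Suc matrix_vector_mul_assoc)

lemma mpow_commute: "mpow A n *v (A *v x) = A *v (mpow A n *v x)"
  by (induction n) (simp_all add: mpow_Suc_vec)

lemma mpow_eigen: "A *v x = k *\<^sub>R x \<Longrightarrow> mpow A n *v x = (k ^ n) *\<^sub>R x"
  by (induction n) (simp_all add: mpow_Suc_vec matrix_vector_mult_scaleR mult.commute)

text \<open>Powers of a Jordan block. The quotient k^n / k stands for k^(n-1) and is correct for n =
  0 as well, where its coefficient vanishes.\<close>

lemma mpow_unipotent:
  assumes "A *v x = k *\<^sub>R x + p" "A *v p = k *\<^sub>R p" "k \<noteq> 0"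
  shows "mpow A n *v x = (k ^ n) *\<^sub>R x + (real n * k ^ n / k) *\<^sub>R p"
proof (induction n)
  case (Suc n)
  have "mpow A (Suc n) *v x = (k ^ n) *\<^sub>R (k *\<^sub>R x + p) + (real n * k ^ n / k) *\<^sub>R (k *\<^sub>R p)"
    by (simp only: mpow_Suc_vec Suc matrix_vector_right_distrib matrix_vector_mult_scaleR assms(1,2))
  also have "\<dots> = (k ^ Suc n) *\<^sub>R x + (k ^ n + real n * k ^ n) *\<^sub>R p"
    using assms(3) by (simp add: algebra_simps)
  also have "k ^ n + real n * k ^ n = real (Suc n) * k ^ n" by (simp add: distrib_right)
  also have "\<dots> = real (Suc n) * k ^ Suc n / k" using assms(3) by simp
  finally show ?case .
qed simp

lemma mpow_covector:
  assumes "\<And>x. \<phi> \<bullet> (A *v x) = k * (\<phi> \<bullet> x)"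
  shows "\<phi> \<bullet> (mpow A n *v x) = k ^ n * (\<phi> \<bullet> x)"
  by (induction n) (simp_all add: mpow_Suc_vec assms)

lemma in_span_pair: "x \<in> span {u, f} \<longleftrightarrow> (\<exists>k l. x = k *\<^sub>R u + l *\<^sub>R f)"
proof
  assume "x \<in> span {u, f}"
  then obtain k where "x - k *\<^sub>R u \<in> span {f}" by (auto simp: span_insert)
  then obtain l where "x - k *\<^sub>R u = l *\<^sub>R f" by (auto simp: span_singleton)
  then have "x = k *\<^sub>R u + l *\<^sub>R f" by (metis add.commute diff_add_cancel)
  then show "\<exists>k l. x = k *\<^sub>R u + l *\<^sub>R f" by blast
qed (auto simp: span_add span_scale span_base)

lemma plane_coordinates:
  fixes \<beta> :: "real^3"
  assumes "\<beta> \<noteq> 0" "\<beta> \<bullet> u = 0" "\<beta> \<bullet> f = 0" "u \<noteq> 0" "f \<notin> span {u}" "\<beta> \<bullet> x = 0"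
  shows "\<exists>k l. x = k *\<^sub>R u + l *\<^sub>R f"
proof -
  have indep: "independent {f, u}" by (rule independent_insertI[OF assms(5)]) (simp add: assms(4))
  have "f \<noteq> u" using assms(5) span_base by blast
  then have "dim (span {f, u}) = 2" using dim_span_eq_card_independent[OF indep] by simp
  moreover have "dim {x. \<beta> \<bullet> x = 0} = 2" using dim_hyperplane[OF assms(1)] by simp
  moreover have "span {f, u} \<subseteq> {x. \<beta> \<bullet> x = 0}"
    using assms by (intro span_minimal subspace_hyperplane) auto
  ultimately have "span {f, u} = {x. \<beta> \<bullet> x = 0}"
    by (intro subspace_dim_equal subspace_span subspace_hyperplane) auto
  then have "x \<in> span {u, f}" using assms by (simp add: insert_commute)
  then show ?thesis by (simp only: in_span_pair)
qed

context proper_cone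
begin

text \<open>In the projective plane: no subsequence of the images of a point of the domain converges
  inside the domain. The factors s account for the choice of homogeneous coordinates.\<close>

definition escapes :: "(nat \<Rightarrow> real^3^3) \<Rightarrow> bool"
  where "escapes A \<longleftrightarrow> (\<forall>x\<in>C. \<forall>r s z. strict_mono (r :: nat \<Rightarrow> nat) \<and> (\<forall>n. s n > (0::real)) \<and>
    (\<lambda>n. s n *\<^sub>R (A (r n) *v x)) \<longlonglongrightarrow> z \<longrightarrow> z \<notin> C)"

text \<open>Along the subsequence r, and scaled by N, the matrices converge to a rank one map whose
  image is a boundary ray and whose kernel misses the cone.\<close>

definition attracts :: "(nat \<Rightarrow> real^3^3) \<Rightarrow> real^3 \<Rightarrow> real^3 \<Rightarrow> (nat \<Rightarrow> nat) \<Rightarrow> (nat \<Rightarrow> real) \<Rightarrow> bool"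
  where "attracts A u \<phi> r N \<longleftrightarrow> u \<in> closure C \<and> u \<noteq> 0 \<and> u \<notin> C \<and> (\<forall>x\<in>C. \<phi> \<bullet> x > 0) \<and>
    strict_mono r \<and> (\<forall>n. N n > 0) \<and> (\<forall>x. (\<lambda>n. N n *\<^sub>R (A (r n) *v x)) \<longlonglongrightarrow> (\<phi> \<bullet> x) *\<^sub>R u)"

lemma escapes_imp_attracts:
  assumes ns: "\<not> simplicial" and A: "\<And>n. preserves (A n)" and esc: "escapes A"
  obtains u \<phi> r N where "attracts A u \<phi> r N"
proof -
  obtain x0 where x0: "x0 \<in> C" using nonempty_C by blast
  have A0: "A n \<noteq> 0" for n
  proof
    assume "A n = 0"
    then have "A n *v x0 = 0" by simp
    moreover have "A n *v x0 \<in> C" using A x0 by (simp add: preserves_def)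
    ultimately show False using zero_notin by simp
  qed
  define B where "B n = (1 / norm (A n)) *\<^sub>R A n" for n
  have "norm (B n) \<le> 1" for n using A0[of n] by (simp add: B_def)
  then obtain T r where r: "strict_mono (r :: nat \<Rightarrow> nat)" and T: "(B \<circ> r) \<longlonglongrightarrow> T"
    using bounded_matrix_sequence_subseq by blast
  have pB: "preserves ((B \<circ> r) n)" for n
    unfolding B_def comp_apply using A A0 by (intro preserves_scale) auto
  have "norm T = 1"
  proof -
    have "(\<lambda>n. norm ((B \<circ> r) n)) \<longlonglongrightarrow> norm T" by (intro tendsto_norm T)
    moreover have "(\<lambda>n. norm ((B \<circ> r) n)) = (\<lambda>n. 1)" using A0 by (auto simp: B_def)
    ultimately show ?thesis by (metis LIMSEQ_unique tendsto_const)
  qed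
  then have T0: "T \<noteq> 0" by auto
  define N where "N n = 1 / norm (A (r n))" for n
  have N: "N n > 0" for n using A0 by (simp add: N_def)
  have lim: "(\<lambda>n. N n *\<^sub>R (A (r n) *v x)) \<longlonglongrightarrow> T *v x" for x
    using tendsto_matrix_vector_mult_left[OF T, of x]
    by (simp add: B_def N_def scaleR_matrix_vector_assoc)
  have y: "T *v x0 \<notin> C" using esc x0 r N lim unfolding escapes_def by blast
  obtain \<phi> where \<phi>: "\<And>x. T *v x = (\<phi> \<bullet> x) *\<^sub>R (T *v x0)" "\<And>x. x \<in> C \<Longrightarrow> \<phi> \<bullet> x > 0"
    using rank_one_limit[OF ns pB T T0 x0 y] by blast
  have uc: "T *v x0 \<in> closure C" using limit_closure[OF pB T] x0 closure_subset by blast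
  have u0: "T *v x0 \<noteq> 0" by (rule limit_nonzero[OF pB T T0 x0])
  have lim': "(\<lambda>n. N n *\<^sub>R (A (r n) *v x)) \<longlonglongrightarrow> (\<phi> \<bullet> x) *\<^sub>R (T *v x0)" for x
    unfolding \<phi>(1)[of x, symmetric] by (rule lim)
  have "attracts A (T *v x0) \<phi> r N"
    unfolding attracts_def by (intro conjI ballI allI uc u0 y \<phi>(2) r N lim')
  then show ?thesis by (rule that)
qed

text \<open>The two scalings of the same orbit are compared through their a-values: the quotient of
  these values converges, so both limits lie on one ray.\<close>

lemma attracts_direction:
  assumes at: "attracts A u \<phi> r N" and A: "\<And>n. preserves (A n)" and x: "x \<in> C"
    and s: "\<And>n. s n > (0::real)" and lim: "(\<lambda>n. s n *\<^sub>R (A n *v x)) \<longlonglongrightarrow> d" and d: "d \<noteq> 0"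
  obtains k where "k > 0" "d = k *\<^sub>R u"
proof -
  have r: "strict_mono r" and N: "\<And>n. N n > 0"
    and limN: "(\<lambda>n. N n *\<^sub>R (A (r n) *v x)) \<longlonglongrightarrow> (\<phi> \<bullet> x) *\<^sub>R u"
    and u: "u \<in> closure C" "u \<noteq> 0" and \<phi>: "\<phi> \<bullet> x > 0"
    using at x unfolding attracts_def by auto
  have inC: "A n *v x \<in> C" for n using A x by (simp add: preserves_def)
  have dc: "d \<in> closure C" by (rule limit_in_closure[OF _ lim]) (intro scale_C inC s)
  have ad: "a \<bullet> d > 0" by (rule closure_pos[OF dc d])
  have au: "a \<bullet> u > 0" by (rule closure_pos[OF u])
  have lims: "(\<lambda>n. s (r n) *\<^sub>R (A (r n) *v x)) \<longlonglongrightarrow> d"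
    using LIMSEQ_subseq_LIMSEQ[OF lim r] by (simp add: o_def)
  have pos: "a \<bullet> (A n *v x) > 0" for n
  proof (rule closure_pos)
    show "A n *v x \<in> closure C" using inC closure_subset by blast
    show "A n *v x \<noteq> 0" using inC[of n] zero_notin by metis
  qed
  have q: "(a \<bullet> (s (r n) *\<^sub>R (A (r n) *v x)) / (a \<bullet> (N n *\<^sub>R (A (r n) *v x)))) *\<^sub>R (N n *\<^sub>R (A (r n) *v x)) =
      s (r n) *\<^sub>R (A (r n) *v x)" for n
    using pos[of "r n"] N[of n] by simp
  have "(\<lambda>n. (a \<bullet> (s (r n) *\<^sub>R (A (r n) *v x)) / (a \<bullet> (N n *\<^sub>R (A (r n) *v x)))) *\<^sub>R (N n *\<^sub>R (A (r n) *v x)))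
      \<longlonglongrightarrow> (a \<bullet> d / (a \<bullet> ((\<phi> \<bullet> x) *\<^sub>R u))) *\<^sub>R ((\<phi> \<bullet> x) *\<^sub>R u)"
    using au \<phi> by (intro tendsto_intros lims limN) auto
  then have "d = (a \<bullet> d / (a \<bullet> ((\<phi> \<bullet> x) *\<^sub>R u))) *\<^sub>R ((\<phi> \<bullet> x) *\<^sub>R u)"
    unfolding q using LIMSEQ_unique[OF lims] by blast
  then have "d = (a \<bullet> d / (a \<bullet> u)) *\<^sub>R u" using \<phi> by simp
  moreover have "a \<bullet> d / (a \<bullet> u) > 0" using ad au by simp
  ultimately show ?thesis using that by blast
qed

text \<open>The rank one limit commutes with A. Hence A preserves its image and its kernel, and the
  eigenvalue on u equals the one on \<phi>.\<close>

lemma attracts_eigen: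
  assumes at: "attracts (mpow A) u \<phi> r N" and A: "preserves A"
  obtains k where "k > 0" "A *v u = k *\<^sub>R u" "\<And>x. \<phi> \<bullet> (A *v x) = k * (\<phi> \<bullet> x)"
proof -
  have u: "u \<noteq> 0" and \<phi>: "\<And>x. x \<in> C \<Longrightarrow> \<phi> \<bullet> x > 0"
    and lim: "\<And>x. (\<lambda>n. N n *\<^sub>R (mpow A (r n) *v x)) \<longlonglongrightarrow> (\<phi> \<bullet> x) *\<^sub>R u"
    using at unfolding attracts_def by auto
  obtain x0 where x0: "x0 \<in> C" using nonempty_C by blast
  have eq: "(\<phi> \<bullet> x) *\<^sub>R (A *v u) = (\<phi> \<bullet> (A *v x)) *\<^sub>R u" for x
  proof -
    have "(\<lambda>n. A *v (N n *\<^sub>R (mpow A (r n) *v x))) \<longlonglongrightarrow> A *v ((\<phi> \<bullet> x) *\<^sub>R u)"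
      by (rule tendsto_matrix_vector_mult[OF tendsto_const lim])
    then have "(\<lambda>n. N n *\<^sub>R (mpow A (r n) *v (A *v x))) \<longlonglongrightarrow> (\<phi> \<bullet> x) *\<^sub>R (A *v u)"
      by (simp add: matrix_vector_mult_scaleR mpow_commute)
    then show ?thesis using lim LIMSEQ_unique by blast
  qed
  define k where "k = \<phi> \<bullet> (A *v x0) / (\<phi> \<bullet> x0)"
  have k: "k > 0" unfolding k_def using \<phi> x0 A by (simp add: preserves_def)
  have "A *v u = (1 / (\<phi> \<bullet> x0)) *\<^sub>R ((\<phi> \<bullet> x0) *\<^sub>R (A *v u))" using \<phi>[OF x0] by simp
  also have "\<dots> = k *\<^sub>R u" unfolding eq by (simp add: k_def)
  finally have Au: "A *v u = k *\<^sub>R u" .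
  have "\<phi> \<bullet> (A *v x) = k * (\<phi> \<bullet> x)" for x
    using eq[of x] u unfolding Au by (simp add: mult.commute)
  then show ?thesis using that k Au by blast
qed

text \<open>The scaled powers applied to f stay on the line of f but converge to a multiple of u, so
  the limit can only be zero.\<close>

lemma attracts_other_eigenvector:
  assumes at: "attracts (mpow A) u \<phi> r N" and f: "A *v f = k *\<^sub>R f" "f \<notin> span {u}"
  shows "\<phi> \<bullet> f = 0" and "(\<lambda>n. N n * k ^ r n) \<longlonglongrightarrow> 0"
proof -
  have u: "u \<noteq> 0" and lim: "(\<lambda>n. N n *\<^sub>R (mpow A (r n) *v f)) \<longlonglongrightarrow> (\<phi> \<bullet> f) *\<^sub>R u"
    using at unfolding attracts_def by auto
  have fnz: "f \<noteq> 0" using f(2) span_zero by auto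
  have lim': "(\<lambda>n. (N n * k ^ r n) *\<^sub>R f) \<longlonglongrightarrow> (\<phi> \<bullet> f) *\<^sub>R u"
    using lim by (simp add: mpow_eigen[OF f(1)])
  have "(\<phi> \<bullet> f) *\<^sub>R u \<in> span {f}"
    using closed_sequentially[OF closed_span _ lim'] by (simp add: span_base span_scale)
  then obtain l where l: "(\<phi> \<bullet> f) *\<^sub>R u = l *\<^sub>R f" by (auto simp: span_singleton)
  have "l = 0"
  proof (rule ccontr)
    assume "l \<noteq> 0"
    then have "f = (1 / l) *\<^sub>R ((\<phi> \<bullet> f) *\<^sub>R u)" unfolding l by simp
    then have "f \<in> span {u}" by (metis span_base span_scale singletonI)
    then show False using f(2) by simp
  qed
  then show phi: "\<phi> \<bullet> f = 0" using l u by simp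
  have "(\<lambda>n. ((N n * k ^ r n) *\<^sub>R f) \<bullet> f) \<longlonglongrightarrow> ((\<phi> \<bullet> f) *\<^sub>R u) \<bullet> f"
    by (intro tendsto_intros lim')
  then have "(\<lambda>n. ((N n * k ^ r n) * (f \<bullet> f)) / (f \<bullet> f)) \<longlonglongrightarrow> 0 / (f \<bullet> f)"
    using fnz by (intro tendsto_divide) (simp_all add: phi)
  then show "(\<lambda>n. N n * k ^ r n) \<longlonglongrightarrow> 0" using fnz by simp
qed

text \<open>The factors N k^r tend to zero by the previous lemma. If k were at least l, so would N
  l^r, while on u the limit is nonzero.\<close>

lemma attracts_dominates:
  assumes at: "attracts (mpow A) u \<phi> r N" and u: "A *v u = l *\<^sub>R u" "l > 0" "\<phi> \<bullet> u \<noteq> 0"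
    and f: "A *v f = k *\<^sub>R f" "f \<notin> span {u}"
  shows "k < l"
proof (rule ccontr)
  assume "\<not> k < l"
  have un: "u \<noteq> 0" and N: "\<And>n. N n > 0"
    and lim: "(\<lambda>n. N n *\<^sub>R (mpow A (r n) *v u)) \<longlonglongrightarrow> (\<phi> \<bullet> u) *\<^sub>R u"
    using at unfolding attracts_def by auto
  have lim0: "(\<lambda>n. N n * k ^ r n) \<longlonglongrightarrow> 0" by (rule attracts_other_eigenvector[OF at f])
  have "(\<lambda>n. N n * l ^ r n) \<longlonglongrightarrow> 0"
  proof (rule tendsto_sandwich[OF _ _ tendsto_const lim0])
    show "\<forall>\<^sub>F n in sequentially. 0 \<le> N n * l ^ r n"
      using N u(2) by (auto intro!: always_eventually mult_nonneg_nonneg less_imp_le)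
    show "\<forall>\<^sub>F n in sequentially. N n * l ^ r n \<le> N n * k ^ r n"
      using N u(2) \<open>\<not> k < l\<close>
      by (intro always_eventually allI mult_left_mono power_mono) (auto intro: less_imp_le)
  qed
  then have "(\<lambda>n. (N n * l ^ r n) *\<^sub>R u) \<longlonglongrightarrow> 0 *\<^sub>R u" by (intro tendsto_intros)
  moreover have "(\<lambda>n. (N n * l ^ r n) *\<^sub>R u) \<longlonglongrightarrow> (\<phi> \<bullet> u) *\<^sub>R u"
    using lim by (simp add: mpow_eigen[OF u(1)])
  ultimately have "0 *\<^sub>R u = (\<phi> \<bullet> u) *\<^sub>R u" by (rule LIMSEQ_unique)
  then show False using u(3) un by simp
qed

lemma preserves_mpow: "preserves A \<Longrightarrow> preserves (mpow A n)"
proof (induction n)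
  case 0
  have "invertible (mat 1 :: real^3^3)" unfolding invertible_def by (intro exI[of _ "mat 1"]) simp
  then show ?case by (simp add: preserves_def)
next
  case (Suc n)
  then show ?case
    by (simp add: preserves_def mpow_Suc invertible_mult flip: matrix_vector_mul_assoc)
qed

lemma attracts_unipotent:
  assumes at: "attracts (mpow A) u \<phi> r N" and A: "preserves A"
    and x: "x \<in> C" "A *v x = k *\<^sub>R x + p" "A *v p = k *\<^sub>R p" "k > 0" "p \<noteq> 0"
  obtains l where "l > 0" "p = l *\<^sub>R u"
proof -
  \<comment> \<open>The Jordan block grows like n k^n in the direction p. Dividing by n + 1 instead
    of n keeps the scaling factor positive for n = 0.\<close>
  have "(\<lambda>n. (1 / (k ^ n * real (Suc n))) *\<^sub>R (mpow A n *v x)) =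
      (\<lambda>n. (1 / real (Suc n)) *\<^sub>R x + ((real n / real (Suc n)) / k) *\<^sub>R p)"
  proof
    fix n
    have cancel: "1 / (q * m) * (j * q) = j / m" if "q \<noteq> 0" for q m j :: real
      using that by simp
    have "1 / (k ^ n * real (Suc n)) * (real n * k ^ n / k) = real n / real (Suc n) / k"
      using cancel[of "k ^ n" "real (Suc n)" "real n / k"] x(4) by (simp del: of_nat_Suc)
    moreover have "1 / (k ^ n * real (Suc n)) * k ^ n = 1 / real (Suc n)"
      using cancel[of "k ^ n" "real (Suc n)" 1] x(4) by (simp del: of_nat_Suc)
    ultimately show "(1 / (k ^ n * real (Suc n))) *\<^sub>R (mpow A n *v x) =
        (1 / real (Suc n)) *\<^sub>R x + ((real n / real (Suc n)) / k) *\<^sub>R p"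
      using x(4) by (simp only: mpow_unipotent[OF x(2,3) less_imp_neq[OF x(4), symmetric]]
          scaleR_right_distrib scaleR_scaleR)
  qed
  moreover have "(\<lambda>n. (1 / real (Suc n)) *\<^sub>R x + ((real n / real (Suc n)) / k) *\<^sub>R p)
      \<longlonglongrightarrow> 0 *\<^sub>R x + (1 / k) *\<^sub>R p"
    using x(4) LIMSEQ_inverse_real_of_nat LIMSEQ_n_over_Suc_n
    by (intro tendsto_intros) (auto simp: inverse_eq_divide)
  ultimately have lim: "(\<lambda>n. (1 / (k ^ n * real (Suc n))) *\<^sub>R (mpow A n *v x)) \<longlonglongrightarrow> (1 / k) *\<^sub>R p" by simp
  obtain l where "l > 0" "(1 / k) *\<^sub>R p = l *\<^sub>R u"
    by (rule attracts_direction[OF at preserves_mpow[OF A] x(1) _ lim]) (use x in auto)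
  then have "k * l > 0" and "k *\<^sub>R ((1 / k) *\<^sub>R p) = k *\<^sub>R (l *\<^sub>R u)"
    using x(4) by (simp_all only: mult_pos_pos)
  then have "k * l > 0" "p = (k * l) *\<^sub>R u" using x(4) by simp_all
  then show ?thesis using that by blast
qed

end

context proper_cone
begin

text \<open>The strictly largest growth rate j determines the limit direction; the linear factor in
  the e' term admits a Jordan block for the smaller rate i.\<close>

lemma attracts_dominant:
  assumes at: "attracts (mpow A) u \<phi> r N" and A: "preserves A" and x: "x \<in> C"
    and pow: "\<And>n. mpow A n *v x = (i ^ n) *\<^sub>R e + (real n * i ^ n) *\<^sub>R e' + (j ^ n) *\<^sub>R d"
    and ij: "0 < i" "i < j" and d: "d \<noteq> 0"
  obtains c' where "c' > 0" "d = c' *\<^sub>R u"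
proof -
  have q: "norm (i / j) < 1" "0 \<le> i / j" "i / j < 1" using ij by simp_all
  have "(1 / j ^ n) *\<^sub>R (mpow A n *v x) =
      ((i / j) ^ n) *\<^sub>R e + (real n * (i / j) ^ n) *\<^sub>R e' + d" for n
  proof -
    have "j \<noteq> 0" using ij by simp
    then show ?thesis unfolding pow by (simp add: scaleR_right_distrib power_divide)
  qed
  moreover have "(\<lambda>n. ((i / j) ^ n) *\<^sub>R e + (real n * (i / j) ^ n) *\<^sub>R e' + d)
      \<longlonglongrightarrow> 0 *\<^sub>R e + 0 *\<^sub>R e' + d"
    by (intro tendsto_add tendsto_scaleR tendsto_const LIMSEQ_realpow_zero q powser_times_n_limit_0)
  ultimately have lim: "(\<lambda>n. (1 / j ^ n) *\<^sub>R (mpow A n *v x)) \<longlonglongrightarrow> d" by simp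
  show ?thesis
    by (rule attracts_direction[OF at preserves_mpow[OF A] x _ lim d]) (use that ij in auto)
qed

text \<open>Three configurations of the attracting direction u, the repelling direction w and a
  further eigenvector f. If u and w span the same line, or if f lies in their plane, then some point
  of C is fixed, drifts along a Jordan block, or is attracted to a wrong direction. There remain
  three independent eigenvectors, and dominance for A and for its inverse orders the
  eigenvalues.\<close>

lemma fixed_point_classification:
  assumes ns: "\<not> simplicial" and A: "preserves A" and B: "preserves B"
    and AB: "A ** B = mat 1" "B ** A = mat 1"
    and atA: "attracts (mpow A) u \<phi> r N" and atB: "attracts (mpow B) w \<psi> q M"
    and noeig: "\<And>x k. \<lbrakk>x \<in> C; k > 0\<rbrakk> \<Longrightarrow> A *v x \<noteq> k *\<^sub>R x"
    and f: "A *v f = k *\<^sub>R f" "k > 0" "f \<notin> span {u}" "f \<notin> span {w}"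
  obtains l m where "A *v u = l *\<^sub>R u" "A *v w = m *\<^sub>R w" "m > 0" "m < k" "k < l"
    "u \<noteq> 0" "w \<notin> span {u}" "f \<notin> span {u, w}"
proof -
  obtain x0 where x0: "x0 \<in> C" using nonempty_C by blast
  have u: "u \<in> closure C" "u \<noteq> 0" and \<phi>: "\<And>x. x \<in> C \<Longrightarrow> \<phi> \<bullet> x > 0"
    using atA unfolding attracts_def by auto
  have w: "w \<in> closure C" "w \<noteq> 0" and \<psi>: "\<And>x. x \<in> C \<Longrightarrow> \<psi> \<bullet> x > 0"
    using atB unfolding attracts_def by auto
  have ABv: "A *v (B *v x) = x" "B *v (A *v x) = x" for x
    using AB by (simp_all add: matrix_vector_mul_assoc)
  obtain l where l: "l > 0" "A *v u = l *\<^sub>R u" "\<And>x. \<phi> \<bullet> (A *v x) = l * (\<phi> \<bullet> x)"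
    using attracts_eigen[OF atA A] by blast
  obtain m' where m': "m' > 0" "B *v w = m' *\<^sub>R w" "\<And>x. \<psi> \<bullet> (B *v x) = m' * (\<psi> \<bullet> x)"
    using attracts_eigen[OF atB B] by blast
  define m where "m = 1 / m'"
  have m: "m > 0" using m' by (simp add: m_def)
  have inverse_eigen: "B *v x = (1 / j) *\<^sub>R x" if "A *v x = j *\<^sub>R x" "j > 0" for x j
  proof -
    have "x = j *\<^sub>R (B *v x)" using ABv(2)[of x] that(1) by (simp add: matrix_vector_mult_scaleR)
    then have "(1 / j) *\<^sub>R x = (1 / j) *\<^sub>R (j *\<^sub>R (B *v x))" by simp
    then show ?thesis using that(2) by simp
  qed
  have Aw: "A *v w = m *\<^sub>R w"
  proof -
    have "w = m' *\<^sub>R (A *v w)" using ABv(1)[of w] m'(2) by (simp add: matrix_vector_mult_scaleR)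
    then have "(1 / m') *\<^sub>R w = (1 / m') *\<^sub>R (m' *\<^sub>R (A *v w))" by simp
    then show ?thesis using m'(1) by (simp add: m_def)
  qed
  have Bf: "B *v f = (1 / k) *\<^sub>R f" by (rule inverse_eigen[OF f(1,2)])
  have fnz: "f \<noteq> 0" using f(3) span_zero by auto
  have multiple_w: "w \<in> span {u}" if "d \<noteq> 0" "d = j *\<^sub>R w" "d \<in> span {u}" for d j
  proof -
    have "w = (1 / j) *\<^sub>R d" using that(1,2) by auto
    then show ?thesis using that(3) span_scale by metis
  qed
  have \<phi>f: "\<phi> \<bullet> f = 0" and \<psi>f: "\<psi> \<bullet> f = 0"
    using attracts_other_eigenvector(1)[OF atA f(1,3)] attracts_other_eigenvector(1)[OF atB Bf f(4)] by auto
  \<comment> \<open>A drift p of A is a drift along a negative multiple of p for the inverse B. So u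
    and w would be positive multiples of p and of -p, although a is positive on both.\<close>
  have unipotent: False
    if x: "x \<in> C" "A *v x = j *\<^sub>R x + p" "A *v p = j *\<^sub>R p" "j > 0" for x p j
  proof -
    have pnz: "p \<noteq> 0" using noeig[OF x(1) x(4)] x(2) by auto
    obtain c1 where c1: "c1 > 0" "p = c1 *\<^sub>R u" by (rule attracts_unipotent[OF atA A x pnz])
    have Bp: "B *v p = (1 / j) *\<^sub>R p" by (rule inverse_eigen[OF x(3,4)])
    have "x = j *\<^sub>R (B *v x) + (1 / j) *\<^sub>R p"
      using ABv(2)[of x] x(2) by (simp add: matrix_vector_right_distrib matrix_vector_mult_scaleR Bp)
    then have "(1 / j) *\<^sub>R x = (1 / j) *\<^sub>R (j *\<^sub>R (B *v x)) + (1 / j) *\<^sub>R ((1 / j) *\<^sub>R p)"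
      by (metis scaleR_right_distrib)
    then have "B *v x = (1 / j) *\<^sub>R x + (- (1 / j) * (1 / j)) *\<^sub>R p"
      using x(4) by (simp add: algebra_simps)
    moreover have "B *v ((- (1 / j) * (1 / j)) *\<^sub>R p) = (1 / j) *\<^sub>R ((- (1 / j) * (1 / j)) *\<^sub>R p)"
      by (simp only: matrix_vector_mult_scaleR Bp scaleR_scaleR mult.commute)
    ultimately obtain c2 where c2: "c2 > 0" "(- (1 / j) * (1 / j)) *\<^sub>R p = c2 *\<^sub>R w"
      by (rule attracts_unipotent[OF atB B x(1)]) (use x(4) pnz in auto)
    have "a \<bullet> p > 0" using c1 closure_pos[OF u] by simp
    moreover have "- (1 / j) * (1 / j) * (a \<bullet> p) = c2 * (a \<bullet> w)"
      using arg_cong[OF c2(2), of "\<lambda>z. a \<bullet> z"] by simp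
    moreover have "c2 * (a \<bullet> w) > 0" using c2(1) closure_pos[OF w] by simp
    ultimately show False using x(4) by (smt (verit) divide_pos_pos mult_minus_left mult_pos_pos)
  qed
  have Bu: "B *v u = (1 / l) *\<^sub>R u" by (rule inverse_eigen[OF l(2,1)])
  show ?thesis
  proof (cases "w \<in> span {u}")
    case True
    then obtain c1 where c1: "w = c1 *\<^sub>R u" by (auto simp: span_singleton)
    have c1nz: "c1 \<noteq> 0" using c1 w(2) by auto
    \<comment> \<open>On the plane of u and f the map is diagonal. A point of C in this plane is
      fixed if k = l; otherwise powers of A or of B move it towards f, which is neither u nor
      w.\<close>
    have disj: "span {u, f} \<inter> C = {}"
    proof (rule ccontr)
      assume "span {u, f} \<inter> C \<noteq> {}"
      then obtain \<alpha> \<gamma> where x: "\<alpha> *\<^sub>R u + \<gamma> *\<^sub>R f \<in> C" by (auto simp: in_span_pair)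
      have powA: "mpow A n *v (\<alpha> *\<^sub>R u + \<gamma> *\<^sub>R f) = (l ^ n) *\<^sub>R (\<alpha> *\<^sub>R u) + (real n * l ^ n) *\<^sub>R 0 + (k ^ n) *\<^sub>R (\<gamma> *\<^sub>R f)" for n
        by (simp add: matrix_vector_right_distrib matrix_vector_mult_scaleR mpow_eigen[OF l(2)] mpow_eigen[OF f(1)] mult.commute)
      have powB: "mpow B n *v (\<alpha> *\<^sub>R u + \<gamma> *\<^sub>R f) = ((1 / l) ^ n) *\<^sub>R (\<alpha> *\<^sub>R u) + (real n * (1 / l) ^ n) *\<^sub>R 0 + ((1 / k) ^ n) *\<^sub>R (\<gamma> *\<^sub>R f)" for n
        by (simp add: matrix_vector_right_distrib matrix_vector_mult_scaleR mpow_eigen[OF Bu] mpow_eigen[OF Bf] mult.commute)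
      have \<gamma>: "\<gamma> \<noteq> 0"
      proof
        assume "\<gamma> = 0"
        then show False using noeig[OF x l(1)] by (simp add: matrix_vector_mult_scaleR l(2))
      qed
      have \<gamma>f: "\<gamma> *\<^sub>R f \<noteq> 0" using \<gamma> fnz by simp
      have fsp: "f \<in> span {g}" if "\<gamma> *\<^sub>R f = j *\<^sub>R g" for g j
      proof -
        have "f = (1 / \<gamma>) *\<^sub>R (\<gamma> *\<^sub>R f)" using \<gamma> by simp
        then show ?thesis unfolding that by (metis span_base span_scale singletonI)
      qed
      consider "k = l" | "l < k" | "k < l" by linarith
      then show False
      proof cases
        case 1
        then show False using noeig[OF x l(1)]
          by (simp add: matrix_vector_right_distrib matrix_vector_mult_scaleR l(2) f(1) scaleR_right_distrib mult.commute)
      next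
        case 2
        then obtain j where "\<gamma> *\<^sub>R f = j *\<^sub>R u"
          using attracts_dominant[OF atA A x powA l(1) _ \<gamma>f] by metis
        then show False using fsp f(3) by blast
      next
        case 3
        then have "1 / l < 1 / k" "0 < 1 / l" using f(2) by (simp_all add: frac_less2)
        then obtain j where "\<gamma> *\<^sub>R f = j *\<^sub>R w"
          using attracts_dominant[OF atB B x powB _ _ \<gamma>f] by metis
        then show False using fsp f(4) by blast
      qed
    qed
    obtain \<beta> where \<beta>: "\<beta> \<noteq> 0" "\<And>x. x \<in> span {u, f} \<Longrightarrow> \<beta> \<bullet> x = 0" "\<And>x. x \<in> C \<Longrightarrow> \<beta> \<bullet> x > 0"
      using supporting_functional[OF subspace_span disj] by metis
    have \<beta>u: "\<beta> \<bullet> u = 0" and \<beta>f: "\<beta> \<bullet> f = 0" using \<beta>(2) span_base by (metis insertI1, metis insertI1 insertI2)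
    have plane: "\<exists>k l. x = k *\<^sub>R u + l *\<^sub>R f" if "\<beta> \<bullet> x = 0" for x
      by (rule plane_coordinates[OF \<beta>(1) \<beta>u \<beta>f u(2) f(3) that])
    have \<beta>x0: "\<beta> \<bullet> x0 > 0" by (rule \<beta>(3)[OF x0])
    \<comment> \<open>Otherwise dominance gives k < l. The inverse powers scale \<phi> by 1 / l < 1
      / k, hence \<phi> tends to zero along the scaled orbit of B, whose limit is a nonzero multiple
      of u.\<close>
    have "\<phi> \<bullet> u = 0"
    proof (rule ccontr)
      assume nz: "\<phi> \<bullet> u \<noteq> 0"
      have kl: "k < l" by (rule attracts_dominates[OF atA l(2,1) nz f(1,3)])
      have M: "\<And>n. M n > 0" and limB: "(\<lambda>n. M n *\<^sub>R (mpow B (q n) *v x0)) \<longlonglongrightarrow> (\<psi> \<bullet> x0) *\<^sub>R w"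
        using atB unfolding attracts_def by auto
      have \<phi>B: "\<phi> \<bullet> (B *v x) = (1 / l) * (\<phi> \<bullet> x)" for x
        using l(3)[of "B *v x"] l(1) by (simp add: ABv)
      have lim0: "(\<lambda>n. M n * (1 / k) ^ q n) \<longlonglongrightarrow> 0"
        by (rule attracts_other_eigenvector(2)[OF atB Bf f(4)])
      have "1 / l \<le> 1 / k" using kl f(2) by (simp add: frac_le)
      have "(\<lambda>n. M n * (1 / l) ^ q n) \<longlonglongrightarrow> 0"
      proof (rule tendsto_sandwich[OF _ _ tendsto_const lim0])
        show "\<forall>\<^sub>F n in sequentially. 0 \<le> M n * (1 / l) ^ q n"
          using M l(1) by (intro always_eventually allI mult_nonneg_nonneg) (auto intro: less_imp_le)
        show "\<forall>\<^sub>F n in sequentially. M n * (1 / l) ^ q n \<le> M n * (1 / k) ^ q n"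
          using M l(1) \<open>1 / l \<le> 1 / k\<close>
          by (intro always_eventually allI mult_left_mono power_mono) (auto intro: less_imp_le)
      qed
      then have lim1: "(\<lambda>n. (M n * (1 / l) ^ q n) * (\<phi> \<bullet> x0)) \<longlonglongrightarrow> 0 * (\<phi> \<bullet> x0)"
        by (intro tendsto_mult tendsto_const)
      have "(\<lambda>n. \<phi> \<bullet> (M n *\<^sub>R (mpow B (q n) *v x0))) \<longlonglongrightarrow> \<phi> \<bullet> ((\<psi> \<bullet> x0) *\<^sub>R w)"
        by (intro tendsto_inner tendsto_const limB)
      then have "(\<lambda>n. (M n * (1 / l) ^ q n) * (\<phi> \<bullet> x0)) \<longlonglongrightarrow> \<phi> \<bullet> ((\<psi> \<bullet> x0) *\<^sub>R w)"
        by (simp only: inner_scaleR_right mpow_covector[OF \<phi>B] mult.assoc)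
      then have "\<phi> \<bullet> ((\<psi> \<bullet> x0) *\<^sub>R w) = 0 * (\<phi> \<bullet> x0)" by (rule LIMSEQ_unique) (rule lim1)
      then show False using \<psi>[OF x0] nz c1nz by (simp add: c1)
    qed
    \<comment> \<open>Both functionals vanish on the plane of u and f, so they are proportional and
      \<beta> is also scaled by l.\<close>
    have \<phi>_\<beta>: "\<phi> \<bullet> x = (\<phi> \<bullet> x0) / (\<beta> \<bullet> x0) * (\<beta> \<bullet> x)" for x
    proof -
      have "\<beta> \<bullet> (x - (\<beta> \<bullet> x / (\<beta> \<bullet> x0)) *\<^sub>R x0) = 0" using \<beta>x0 by (simp add: inner_diff_right)
      then obtain i j where ij: "x - (\<beta> \<bullet> x / (\<beta> \<bullet> x0)) *\<^sub>R x0 = i *\<^sub>R u + j *\<^sub>R f" using plane by blast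
      have "\<phi> \<bullet> (x - (\<beta> \<bullet> x / (\<beta> \<bullet> x0)) *\<^sub>R x0) = 0"
        unfolding ij using \<open>\<phi> \<bullet> u = 0\<close> \<phi>f by (simp add: inner_add_right)
      then show ?thesis by (simp add: inner_diff_right)
    qed
    have "\<beta> \<bullet> (A *v x0) = l * (\<beta> \<bullet> x0)"
      using l(3)[of x0] \<phi>_\<beta>[of "A *v x0"] \<phi>[OF x0] \<beta>x0 by (simp add: field_simps)
    then have "\<beta> \<bullet> (A *v x0 - l *\<^sub>R x0) = 0" by (simp add: inner_diff_right)
    then obtain \<alpha> \<gamma> where \<alpha>\<gamma>: "A *v x0 - l *\<^sub>R x0 = \<alpha> *\<^sub>R u + \<gamma> *\<^sub>R f" using plane by blast
    then have Ax0: "A *v x0 = l *\<^sub>R x0 + (\<alpha> *\<^sub>R u + \<gamma> *\<^sub>R f)" by (simp add: algebra_simps)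
    \<comment> \<open>Otherwise x0 splits into a generalised eigenvector z for l and a nonzero
      multiple of f, and the faster growth of the f-part under A or under B contradicts the
      attracting direction. In the remaining cases the perturbation is an l-eigenvector, which has
      been excluded.\<close>
    have "\<gamma> = 0 \<or> k = l"
    proof (rule ccontr)
      assume nn: "\<not> (\<gamma> = 0 \<or> k = l)"
      define \<delta> where "\<delta> = \<gamma> / (k - l)"
      have \<delta>: "\<delta> \<noteq> 0" "\<gamma> = \<delta> * (k - l)" using nn by (simp_all add: \<delta>_def)
      define z where "z = x0 - \<delta> *\<^sub>R f"
      have x0z: "x0 = z + \<delta> *\<^sub>R f" by (simp add: z_def)
      have Az: "A *v z = l *\<^sub>R z + \<alpha> *\<^sub>R u"
        unfolding z_def matrix_vector_mult_diff_distrib matrix_vector_mult_scaleR Ax0 f(1) \<delta>(2)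
        by (simp add: algebra_simps)
      have A\<alpha>u: "A *v (\<alpha> *\<^sub>R u) = l *\<^sub>R (\<alpha> *\<^sub>R u)" by (simp add: matrix_vector_mult_scaleR l(2))
      have "z = l *\<^sub>R (B *v z) + (1 / l) *\<^sub>R (\<alpha> *\<^sub>R u)"
        using arg_cong[OF Az, of "\<lambda>y. B *v y"]
        by (simp add: ABv matrix_vector_right_distrib matrix_vector_mult_scaleR Bu)
      then have "(1 / l) *\<^sub>R z = (1 / l) *\<^sub>R (l *\<^sub>R (B *v z)) + (1 / l) *\<^sub>R ((1 / l) *\<^sub>R (\<alpha> *\<^sub>R u))"
        by (metis scaleR_right_distrib)
      then have Bz: "B *v z = (1 / l) *\<^sub>R z + (- (1 / l) * (1 / l) * \<alpha>) *\<^sub>R u"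
        using l(1) by (simp add: algebra_simps)
      have B\<alpha>u: "B *v ((- (1 / l) * (1 / l) * \<alpha>) *\<^sub>R u) = (1 / l) *\<^sub>R ((- (1 / l) * (1 / l) * \<alpha>) *\<^sub>R u)"
        by (simp only: matrix_vector_mult_scaleR Bu scaleR_scaleR mult.commute)
      have powA: "mpow A n *v x0 = (l ^ n) *\<^sub>R z + (real n * l ^ n) *\<^sub>R ((1 / l) *\<^sub>R (\<alpha> *\<^sub>R u)) + (k ^ n) *\<^sub>R (\<delta> *\<^sub>R f)" for n
        unfolding x0z matrix_vector_right_distrib matrix_vector_mult_scaleR mpow_eigen[OF f(1)]
        using mpow_unipotent[OF Az A\<alpha>u, of n] l(1) by (simp add: mult.commute)
      have powB: "mpow B n *v x0 = ((1 / l) ^ n) *\<^sub>R z + (real n * (1 / l) ^ n) *\<^sub>R (l *\<^sub>R ((- (1 / l) * (1 / l) * \<alpha>) *\<^sub>R u)) + ((1 / k) ^ n) *\<^sub>R (\<delta> *\<^sub>R f)" for n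
        unfolding x0z matrix_vector_right_distrib matrix_vector_mult_scaleR mpow_eigen[OF Bf]
        using mpow_unipotent[OF Bz B\<alpha>u, of n] l(1) by (simp add: mult.commute)
      have \<delta>f: "\<delta> *\<^sub>R f \<noteq> 0" using \<delta> fnz by simp
      have fsp: "f \<in> span {g}" if "\<delta> *\<^sub>R f = j *\<^sub>R g" for g j
      proof -
        have "f = (1 / \<delta>) *\<^sub>R (\<delta> *\<^sub>R f)" using \<delta> by simp
        then show ?thesis unfolding that by (metis span_base span_scale singletonI)
      qed
      consider "l < k" | "k < l" using nn by linarith
      then show False
      proof cases
        case 1
        then obtain j where "\<delta> *\<^sub>R f = j *\<^sub>R u"
          using attracts_dominant[OF atA A x0 powA l(1) _ \<delta>f] by metis
        then show False using fsp f(3) by blast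
      next
        case 2
        then have "1 / l < 1 / k" "0 < 1 / l" using f(2) by (simp_all add: frac_less2)
        then obtain j where "\<delta> *\<^sub>R f = j *\<^sub>R w"
          using attracts_dominant[OF atB B x0 powB _ _ \<delta>f] by metis
        then show False using fsp f(4) by blast
      qed
    qed
    then have "A *v (\<alpha> *\<^sub>R u + \<gamma> *\<^sub>R f) = l *\<^sub>R (\<alpha> *\<^sub>R u + \<gamma> *\<^sub>R f)"
      by (auto simp: matrix_vector_right_distrib matrix_vector_mult_scaleR l(2) f(1) scaleR_right_distrib mult.commute)
    then show ?thesis using unipotent[OF x0 Ax0 _ l(1)] by blast
  next
    case wu: False
    show ?thesis
    proof (cases "f \<in> span {u, w}")
      case True
      then obtain \<alpha> \<gamma> where fe: "f = \<alpha> *\<^sub>R u + \<gamma> *\<^sub>R w" by (auto simp: in_span_pair)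
      have \<alpha>: "\<alpha> \<noteq> 0" using fe f(4) by (auto simp: span_scale span_base)
      have \<gamma>: "\<gamma> \<noteq> 0" using fe f(3) by (auto simp: span_scale span_base)
      have "(\<alpha> * l) *\<^sub>R u + (\<gamma> * m) *\<^sub>R w = (\<alpha> * k) *\<^sub>R u + (\<gamma> * k) *\<^sub>R w"
        using f(1) unfolding fe
        by (simp add: matrix_vector_right_distrib matrix_vector_mult_scaleR l(2) Aw scaleR_right_distrib mult.commute)
      then have eq: "(\<gamma> * (m - k)) *\<^sub>R w = (\<alpha> * (k - l)) *\<^sub>R u" by (simp add: algebra_simps)
      \<comment> \<open>Both coefficients of f are nonzero, so the three eigenvalues coincide and
        the whole plane of u and w consists of eigenvectors. It can then only touch the cone from
        outside.\<close>
      have mk: "m = k"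
      proof (rule ccontr)
        assume "m \<noteq> k"
        then have "w = (\<alpha> * (k - l) / (\<gamma> * (m - k))) *\<^sub>R u"
          using arg_cong[OF eq, of "\<lambda>z. (1 / (\<gamma> * (m - k))) *\<^sub>R z"] \<gamma> by simp
        then show False using wu by (metis span_base span_scale singletonI)
      qed
      then have lk: "l = k" using eq \<alpha> u(2) by simp
      have Auw: "A *v (i *\<^sub>R u + j *\<^sub>R w) = k *\<^sub>R (i *\<^sub>R u + j *\<^sub>R w)" for i j
        by (simp add: matrix_vector_right_distrib matrix_vector_mult_scaleR l(2) Aw mk lk scaleR_right_distrib mult.commute)
      have yc: "u + w \<in> closure C" by (rule add_closure[OF u(1) w(1)])
      have yn: "u + w \<notin> C" using noeig[of "u + w" k] f(2) Auw[of 1 1] by auto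
      obtain \<beta> where \<beta>: "\<beta> \<noteq> 0" "\<beta> \<bullet> (u + w) = 0" "\<And>x. x \<in> C \<Longrightarrow> \<beta> \<bullet> x > 0" "\<And>x. x \<in> closure C \<Longrightarrow> \<beta> \<bullet> x \<ge> 0"
        using supporting_functional_point[OF yc yn] by metis
      have \<beta>u: "\<beta> \<bullet> u = 0" and \<beta>w: "\<beta> \<bullet> w = 0"
        using \<beta>(2) \<beta>(4)[OF u(1)] \<beta>(4)[OF w(1)] by (simp_all add: inner_add_right)
      have plane: "\<exists>k l. x = k *\<^sub>R u + l *\<^sub>R w" if "\<beta> \<bullet> x = 0" for x
        by (rule plane_coordinates[OF \<beta>(1) \<beta>u \<beta>w u(2) wu that])
      have \<beta>x0: "\<beta> \<bullet> x0 > 0" by (rule \<beta>(3)[OF x0])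
      define e where "e = \<beta> \<bullet> (A *v x0) / (\<beta> \<bullet> x0)"
      have e: "e > 0" unfolding e_def using \<beta>(3)[of "A *v x0"] A x0 \<beta>x0 by (simp add: preserves_def)
      have "\<beta> \<bullet> (A *v x0 - e *\<^sub>R x0) = 0" using \<beta>x0 by (simp add: inner_diff_right e_def)
      then obtain i j where "A *v x0 - e *\<^sub>R x0 = i *\<^sub>R u + j *\<^sub>R w" using plane by blast
      moreover define p where "p = i *\<^sub>R u + j *\<^sub>R w"
      ultimately have Ax0: "A *v x0 = e *\<^sub>R x0 + p" by (simp add: algebra_simps)
      have Ap: "A *v p = k *\<^sub>R p" unfolding p_def by (rule Auw)
      have \<beta>p: "\<beta> \<bullet> p = 0" by (simp add: p_def inner_add_right \<beta>u \<beta>w)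
      have False
      proof (cases "e = k")
        case True
        then show False using unipotent[OF x0 Ax0 _ e] Ap by blast
      next
        case False
        \<comment> \<open>Removing a suitable multiple of p turns x0 into an eigenvector for e
          transverse to the plane. Under A or under B it is the dominant direction of x0, but
          neither u nor w is transverse.\<close>
        define z where "z = x0 + (1 / (e - k)) *\<^sub>R p"
        have x0z: "x0 = z + (- 1 / (e - k)) *\<^sub>R p" by (simp add: z_def)
        have "1 + k / (e - k) = e / (e - k)" using False by (simp add: field_simps)
        then have "p + (1 / (e - k)) *\<^sub>R (k *\<^sub>R p) = (e / (e - k)) *\<^sub>R p"
          by (metis scaleR_left_distrib scaleR_one scaleR_scaleR mult.left_neutral times_divide_eq_left)
        then have Az: "A *v z = e *\<^sub>R z"
          by (simp add: z_def matrix_vector_right_distrib matrix_vector_mult_scaleR Ax0 Ap scaleR_right_distrib add.assoc)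
        have Bz: "B *v z = (1 / e) *\<^sub>R z" by (rule inverse_eigen[OF Az e])
        have Bp: "B *v p = (1 / k) *\<^sub>R p" by (rule inverse_eigen[OF Ap f(2)])
        have \<beta>z: "\<beta> \<bullet> z > 0" using \<beta>x0 by (simp add: z_def inner_add_right \<beta>p)
        then have z: "z \<noteq> 0" by auto
        have powA: "mpow A n *v x0 = (k ^ n) *\<^sub>R ((- 1 / (e - k)) *\<^sub>R p) + (real n * k ^ n) *\<^sub>R 0 + (e ^ n) *\<^sub>R z" for n
          unfolding x0z by (simp add: matrix_vector_right_distrib matrix_vector_mult_diff_distrib
              matrix_vector_mult_scaleR mpow_eigen[OF Az] mpow_eigen[OF Ap] mult.commute)
        have powB: "mpow B n *v x0 = ((1 / k) ^ n) *\<^sub>R ((- 1 / (e - k)) *\<^sub>R p) + (real n * (1 / k) ^ n) *\<^sub>R 0 + ((1 / e) ^ n) *\<^sub>R z" for n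
          unfolding x0z by (simp add: matrix_vector_right_distrib matrix_vector_mult_diff_distrib
              matrix_vector_mult_scaleR mpow_eigen[OF Bz] mpow_eigen[OF Bp] mult.commute)
        consider "k < e" | "e < k" using False by linarith
        then show False
        proof cases
          case 1
          then obtain j where "z = j *\<^sub>R u"
            using attracts_dominant[OF atA A x0 powA f(2) _ z] by metis
          then show False using \<beta>z \<beta>u by simp
        next
          case 2
          then have "1 / k < 1 / e" "0 < 1 / k" using e f(2) by (simp_all add: frac_less2)
          then obtain j where "z = j *\<^sub>R w"
            using attracts_dominant[OF atB B x0 powB _ _ z] by metis
          then show False using \<beta>z \<beta>w by simp
        qed
      qed
      then show ?thesis ..
    next
      case fuw: False
      have uw: "u \<notin> span {w}"
      proof
        assume "u \<in> span {w}"
        then obtain j where j: "u = j *\<^sub>R w" by (auto simp: span_singleton)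
        then have "w = (1 / j) *\<^sub>R u" using u(2) by auto
        then show False using wu by (metis span_base span_scale singletonI)
      qed
      have indep: "independent {f, u, w}"
        using fuw w(2) by (intro independent_insertI[OF _ independent_insertI[OF uw]]) simp_all
      have "card {f, u, w} = 3"
        using fuw uw span_base by (auto simp: card_insert_if) 
      then have span: "span {f, u, w} = UNIV"
        using dim_eq_card_independent[OF indep] by (simp add: dim_eq_full[symmetric])
      have nz: "\<exists>x\<in>{f, u, w}. \<theta> \<bullet> x \<noteq> 0" if "\<theta> \<bullet> x0 \<noteq> 0" for \<theta>
      proof (rule ccontr)
        assume "\<not> (\<exists>x\<in>{f, u, w}. \<theta> \<bullet> x \<noteq> 0)"
        then have "span {f, u, w} \<subseteq> {x. \<theta> \<bullet> x = 0}"
          by (intro span_minimal subspace_hyperplane) auto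
        then show False using that span by auto
      qed
      have \<phi>w: "\<phi> \<bullet> w = 0" by (rule attracts_other_eigenvector(1)[OF atA Aw wu])
      have \<psi>u: "\<psi> \<bullet> u = 0" by (rule attracts_other_eigenvector(1)[OF atB Bu uw])
      \<comment> \<open>\<phi> vanishes on f and on w but not at x0, and the three eigenvectors span
        the space.\<close>
      have "\<phi> \<bullet> u \<noteq> 0" using nz[of \<phi>] \<phi>[OF x0] \<phi>f \<phi>w by auto
      then have kl: "k < l" by (rule attracts_dominates[OF atA l(2,1) _ f(1,3)])
      have "\<psi> \<bullet> w \<noteq> 0" using nz[of \<psi>] \<psi>[OF x0] \<psi>f \<psi>u by auto
      then have "1 / k < m'" by (rule attracts_dominates[OF atB m'(2,1) _ Bf f(4)])
      then have "m < k" using f(2) m'(1) by (simp add: m_def field_simps)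
      then show ?thesis using that[of l m] l(2) Aw m kl u(2) wu fuw by blast
    qed
  qed
qed

end

section \<open>The projective plane\<close>

lemma rp2_line: "v \<noteq> 0 \<Longrightarrow> span {v} \<in> {L :: (real^3) set. subspace L \<and> dim L = 1}"
  by (simp add: dim_span dim_singleton)

lemma Rep_rp2_of: "v \<noteq> 0 \<Longrightarrow> Rep_rp2 (rp2_of v) = span {v}"
  unfolding rp2_of_def by (rule Abs_rp2_inverse[OF rp2_line])

lemma rp2_of_cases:
  obtains v where "v \<noteq> 0" "x = rp2_of v"
proof -
  have L: "subspace (Rep_rp2 x)" "dim (Rep_rp2 x) = 1" using Rep_rp2[of x] by auto
  obtain b where b: "b \<in> Rep_rp2 x" "b \<noteq> 0"
  proof (rule ccontr)
    assume "\<not> thesis"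
    then have "Rep_rp2 x \<subseteq> {0}" using that by blast
    then have "dim (Rep_rp2 x) = 0" by (simp add: dim_eq_0)
    then show False using L by simp
  qed
  have "span {b} = Rep_rp2 x"
    using L b by (intro subspace_dim_equal subspace_span span_minimal) (auto simp: dim_singleton)
  then have "x = rp2_of b" unfolding rp2_of_def by (simp add: Rep_rp2_inverse)
  then show ?thesis using that b by blast
qed

lemma rp2_of_scale: "k \<noteq> 0 \<Longrightarrow> rp2_of (k *\<^sub>R v) = rp2_of v"
proof -
  assume k: "k \<noteq> 0"
  have "v = (1 / k) *\<^sub>R (k *\<^sub>R v)" using k by simp
  then have "v \<in> span {k *\<^sub>R v}" by (metis span_base span_scale singletonI)
  then have "span {k *\<^sub>R v} = span {v}"
    by (intro subset_antisym span_minimal subspace_span) (auto simp: span_scale span_base)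
  then show ?thesis by (simp add: rp2_of_def)
qed

lemma rp2_of_eq_iff:
  assumes "v \<noteq> 0" "w \<noteq> 0"
  shows "rp2_of v = rp2_of w \<longleftrightarrow> (\<exists>k. k \<noteq> 0 \<and> w = k *\<^sub>R v)"
proof
  assume "rp2_of v = rp2_of w"
  then have "span {v} = span {w}" using assms Rep_rp2_of by metis
  then have "w \<in> span {v}" using span_base by blast
  then obtain k where "w = k *\<^sub>R v" by (auto simp: span_singleton)
  then show "\<exists>k. k \<noteq> 0 \<and> w = k *\<^sub>R v" using assms(2) by auto
qed (auto simp: rp2_of_scale)

lemma invertible_mult_nonzero:
  fixes A :: "real^'n^'n"
  assumes "invertible A" "v \<noteq> 0"
  shows "A *v v \<noteq> 0"
proof
  assume 0: "A *v v = 0"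
  obtain B where "B ** A = mat 1" using assms(1) unfolding invertible_def by blast
  then have "v = B *v (A *v v)" by (simp add: matrix_vector_mul_assoc)
  then show False using 0 assms(2) by simp
qed

lemma proj_map_rp2_of: "v \<noteq> 0 \<Longrightarrow> proj_map A (rp2_of v) = rp2_of (A *v v)"
proof -
  assume v: "v \<noteq> 0"
  have "(*v) A ` span {v} = span {A *v v}"
    using linear_span_image[OF matrix_vector_mul_linear, of A "{v}"] by simp
  then show ?thesis unfolding proj_map_def Rep_rp2_of[OF v] by (simp add: rp2_of_def)
qed

lemma proj_map_mult:
  assumes "invertible B"
  shows "proj_map (A ** B) = proj_map A \<circ> proj_map B"
proof
  fix x
  obtain v where v: "v \<noteq> 0" "x = rp2_of v" by (rule rp2_of_cases)
  then show "proj_map (A ** B) x = (proj_map A \<circ> proj_map B) x"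
    using invertible_mult_nonzero[OF assms] by (simp add: proj_map_rp2_of matrix_vector_mul_assoc)
qed

lemma proj_map_id: "proj_map (mat 1) = id"
proof
  fix x
  obtain v where "v \<noteq> 0" "x = rp2_of v" by (rule rp2_of_cases)
  then show "proj_map (mat 1) x = id x" by (simp add: proj_map_rp2_of)
qed

lemma proj_map_scale:
  assumes "k \<noteq> 0"
  shows "proj_map (k *\<^sub>R A) = proj_map A"
proof
  fix x
  obtain v where "v \<noteq> 0" "x = rp2_of v" by (rule rp2_of_cases)
  then show "proj_map (k *\<^sub>R A) x = proj_map A x"
    using assms by (simp add: proj_map_rp2_of rp2_of_scale flip: scaleR_matrix_vector_assoc)
qed

definition cone_of :: "rp2 set \<Rightarrow> (real^3) set"
  where "cone_of U = {v. v \<noteq> 0 \<and> rp2_of v \<in> U}"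

lemma open_cone_of: "open U \<Longrightarrow> open (cone_of U)"
  by (simp add: cone_of_def open_rp2_def)

text \<open>The cone over the image is the union of all nonzero rescalings of V: the projection from
  nonzero vectors is open.\<close>

lemma open_rp2_image:
  assumes V: "open V" "0 \<notin> V"
  shows "open (rp2_of ` V)"
proof -
  have "{v. v \<noteq> 0 \<and> rp2_of v \<in> rp2_of ` V} = (\<Union>k\<in>-{0}. (*\<^sub>R) k ` V)" (is "?L = ?R")
  proof (rule Set.set_eqI, rule iffI)
    fix v assume "v \<in> ?L"
    then obtain w where w: "v \<noteq> 0" "w \<in> V" "rp2_of w = rp2_of v" by auto
    then obtain k where "k \<noteq> 0" "v = k *\<^sub>R w" using rp2_of_eq_iff[of w v] V by auto
    then show "v \<in> ?R" using w by auto
  next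
    fix v assume "v \<in> ?R"
    then obtain k w where "k \<noteq> 0" "w \<in> V" "v = k *\<^sub>R w" by auto
    then show "v \<in> ?L" using V rp2_of_scale by auto
  qed
  moreover have "open (\<Union>k\<in>-{0}. (*\<^sub>R) k ` V)" using V by (auto intro!: open_scaling)
  ultimately show ?thesis unfolding open_rp2_def by simp
qed

lemma continuous_on_rp2_of: "continuous_on (- {0}) rp2_of"
  unfolding continuous_on_open_vimage[OF open_Compl[OF closed_singleton]]
proof (intro allI impI)
  fix B :: "rp2 set" assume "open B"
  moreover have "- {0} \<inter> rp2_of -` B = {v. v \<noteq> 0 \<and> rp2_of v \<in> B}" by auto
  ultimately show "open (rp2_of -` B \<inter> - {0})" by (simp add: open_rp2_def Int_commute)
qed

lemma rp2_of_tendsto_eventually: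
  assumes "v \<noteq> 0" "f \<longlonglongrightarrow> v" "open U" "rp2_of v \<in> U"
  shows "\<forall>\<^sub>F n in sequentially. f n \<noteq> 0 \<and> rp2_of (f n) \<in> U"
proof -
  have "v \<in> cone_of U" using assms by (simp add: cone_of_def)
  then show ?thesis
    using topological_tendstoD[OF assms(2) open_cone_of[OF assms(3)]] by (simp add: cone_of_def)
qed

lemma closure_rp2_iff:
  assumes v: "v \<noteq> 0"
  shows "rp2_of v \<in> closure U \<longleftrightarrow> v \<in> closure (cone_of U)"
proof
  assume x: "rp2_of v \<in> closure U"
  show "v \<in> closure (cone_of U)"
    unfolding closure_iff_nhds_not_empty
  proof (intro allI impI)
    fix A V assume V: "V \<subseteq> A" "v \<in> V" "open V"
    have "open (rp2_of ` (V - {0}))" using V by (intro open_rp2_image) auto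
    moreover have "rp2_of v \<in> rp2_of ` (V - {0})" using V v by auto
    ultimately have "U \<inter> rp2_of ` (V - {0}) \<noteq> {}"
      using x unfolding closure_iff_nhds_not_empty by blast
    then show "cone_of U \<inter> A \<noteq> {}" using V by (auto simp: cone_of_def)
  qed
next
  assume vc: "v \<in> closure (cone_of U)"
  show "rp2_of v \<in> closure U"
    unfolding closure_iff_nhds_not_empty
  proof (intro allI impI)
    fix A V assume V: "V \<subseteq> A" "rp2_of v \<in> V" "open V"
    have "v \<in> cone_of V" using V v by (simp add: cone_of_def)
    then have "cone_of U \<inter> cone_of V \<noteq> {}"
      using vc open_cone_of[OF V(3)] unfolding closure_iff_nhds_not_empty by blast
    then show "U \<inter> A \<noteq> {}" using V by (auto simp: cone_of_def)
  qed
qed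

lemma rp2_of_limit_in_closure:
  assumes "v \<noteq> 0" "f \<longlonglongrightarrow> v" "\<And>n. f n \<in> cone_of U"
  shows "rp2_of v \<in> closure U"
  unfolding closure_rp2_iff[OF assms(1)] by (rule limit_in_closure[OF assms(3,2)])

lemma in_affine_chart_iff: "v \<noteq> 0 \<Longrightarrow> rp2_of v \<in> affine_chart a \<longleftrightarrow> a \<bullet> v \<noteq> 0"
proof
  assume v: "v \<noteq> 0" and "rp2_of v \<in> affine_chart a"
  then obtain w where w: "rp2_of v = rp2_of w" "a \<bullet> w \<noteq> 0" by (auto simp: affine_chart_def)
  then have "w \<noteq> 0" by auto
  then obtain k where "k \<noteq> 0" "v = k *\<^sub>R w" using rp2_of_eq_iff[of w v] v w(1) by metis
  then show "a \<bullet> v \<noteq> 0" using w(2) by simp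
qed (auto simp: affine_chart_def)

section \<open>The open convex cone over a properly convex domain\<close>

locale convex_domain =
  fixes \<Omega> :: "rp2 set" and a :: "real^3"
  assumes pc: "properly_convex \<Omega>" and chart: "closure \<Omega> \<subseteq> affine_chart a"
begin

definition C :: "(real^3) set"
  where "C = {v. a \<bullet> v > 0 \<and> rp2_of v \<in> \<Omega>}"

lemma open_\<Omega>: "open \<Omega>" and nonempty_\<Omega>: "\<Omega> \<noteq> {}"
  using pc by (auto simp: properly_convex_def)

lemma C_cone_of: "C = cone_of \<Omega> \<inter> {v. a \<bullet> v > 0}"
  by (auto simp: C_def cone_of_def)

lemma chart_nonzero: "\<lbrakk>v \<noteq> 0; rp2_of v \<in> closure \<Omega>\<rbrakk> \<Longrightarrow> a \<bullet> v \<noteq> 0"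
  using chart in_affine_chart_iff by blast

lemma \<Omega>_lift:
  assumes "x \<in> closure \<Omega>"
  obtains v where "a \<bullet> v = 1" "x = rp2_of v"
proof -
  obtain w where w: "w \<noteq> 0" "x = rp2_of w" by (rule rp2_of_cases)
  then have "a \<bullet> w \<noteq> 0" using chart_nonzero assms by blast
  then have "a \<bullet> ((1 / (a \<bullet> w)) *\<^sub>R w) = 1" "x = rp2_of ((1 / (a \<bullet> w)) *\<^sub>R w)"
    using w by (simp_all add: rp2_of_scale)
  then show ?thesis using that by blast
qed

lemma sign_constant_on_segment:
  assumes "\<And>z. z \<in> closed_segment v w \<Longrightarrow> a \<bullet> z \<noteq> 0"
  shows "a \<bullet> v > 0 \<longleftrightarrow> a \<bullet> w > 0"
proof -
  have "connected ((\<lambda>z. a \<bullet> z) ` closed_segment v w)"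
    by (intro connected_continuous_image continuous_intros connected_segment)
  moreover have "a \<bullet> v \<in> (\<lambda>z. a \<bullet> z) ` closed_segment v w" "a \<bullet> w \<in> (\<lambda>z. a \<bullet> z) ` closed_segment v w"
    by auto
  moreover have "0 \<notin> (\<lambda>z. a \<bullet> z) ` closed_segment v w" using assms by fastforce
  ultimately show ?thesis
    using connectedD_interval[of "(\<lambda>z. a \<bullet> z) ` closed_segment v w" "a \<bullet> v" "a \<bullet> w" 0]
      connectedD_interval[of "(\<lambda>z. a \<bullet> z) ` closed_segment v w" "a \<bullet> w" "a \<bullet> v" 0]
    by (meson less_imp_le not_less)
qed

text \<open>A segment in the domain comes with representatives v and w of its end points whose signs
  are unknown. The functional a has no zero on the segment, so both signs agree, and rescaling the
  weights turns a combination of x and y into a multiple of a point of the segment.\<close>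

lemma convex_C: "convex C"
proof (rule convexI)
  fix x y and s t :: real
  assume x: "x \<in> C" and y: "y \<in> C" and st: "0 \<le> s" "0 \<le> t" "s + t = 1"
  have ax: "a \<bullet> x > 0" "a \<bullet> y > 0" and xy: "rp2_of x \<in> \<Omega>" "rp2_of y \<in> \<Omega>" using x y by (auto simp: C_def)
  have nz: "x \<noteq> 0" "y \<noteq> 0" using ax by auto
  have pos: "a \<bullet> (s *\<^sub>R x + t *\<^sub>R y) > 0"
  proof (cases "s = 0")
    case False
    then have "s * (a \<bullet> x) > 0" "t * (a \<bullet> y) \<ge> 0" using st ax by auto
    then show ?thesis by (simp add: inner_add_right)
  qed (use st ax in simp)
  show "s *\<^sub>R x + t *\<^sub>R y \<in> C"
  proof (cases "rp2_of x = rp2_of y")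
    \<comment> \<open>Proper convexity speaks only of distinct points, so representatives of the
      same point are treated apart.\<close>
    case True
    then obtain k where "y = k *\<^sub>R x" using rp2_of_eq_iff[OF nz] by blast
    then have e: "s *\<^sub>R x + t *\<^sub>R y = (s + t * k) *\<^sub>R x" by (simp add: algebra_simps)
    then have "s + t * k \<noteq> 0" using pos by auto
    then show ?thesis using pos xy unfolding C_def e by (simp add: rp2_of_scale)
  next
    case False
    then obtain v w where vw: "v \<noteq> 0" "w \<noteq> 0" "rp2_of v = rp2_of x" "rp2_of w = rp2_of y"
      "rp2_of ` closed_segment v w \<subseteq> \<Omega>"
      using pc xy unfolding properly_convex_def by blast
    obtain k where k: "k \<noteq> 0" "v = k *\<^sub>R x" using rp2_of_eq_iff[OF nz(1) vw(1)] vw(3) by metis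
    obtain l where l: "l \<noteq> 0" "w = l *\<^sub>R y" using rp2_of_eq_iff[OF nz(2) vw(2)] vw(4) by metis
    have seg0: "z \<noteq> 0" if "z \<in> closed_segment v w" for z
    proof
      assume "z = 0"
      then have "0 \<in> closed_segment v w" using that by simp
      then obtain u where u: "0 = (1 - u) *\<^sub>R v + u *\<^sub>R w" unfolding in_segment by blast
      have u0: "u \<noteq> 0" using u vw(1) by auto
      have u1: "1 - u \<noteq> 0" using u vw(2) by auto
      have uw: "u *\<^sub>R w = (- (1 - u)) *\<^sub>R v" using u by (simp add: algebra_simps add_eq_0_iff)
      have "rp2_of w = rp2_of (u *\<^sub>R w)" using rp2_of_scale[OF u0] by simp
      also have "\<dots> = rp2_of v" unfolding uw using u1 by (intro rp2_of_scale) simp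
      finally have "rp2_of w = rp2_of v" .
      then show False using False vw by simp
    qed
    have az: "a \<bullet> z \<noteq> 0" if "z \<in> closed_segment v w" for z
    proof -
      have "rp2_of z \<in> closure \<Omega>" using vw(5) that closure_subset by blast
      then show ?thesis using chart_nonzero seg0[OF that] by blast
    qed
    have "a \<bullet> v > 0 \<longleftrightarrow> a \<bullet> w > 0" by (rule sign_constant_on_segment[OF az])
    then have kl: "k > 0 \<longleftrightarrow> l > 0" using ax unfolding k(2) l(2) by (simp add: zero_less_mult_iff)
    define p q r where "p = s / k" and "q = t / l" and "r = p + q"
    have pq: "p * k = s" "q * l = t" using k l by (simp_all add: p_def q_def)
    have pq0: "p \<noteq> 0 \<or> q \<noteq> 0" using st pq by auto
    have "0 \<le> p \<and> 0 \<le> q \<or> p \<le> 0 \<and> q \<le> 0"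
    proof (cases "k > 0")
      case True
      then show ?thesis using kl st by (simp add: p_def q_def)
    next
      case False
      then have "k \<le> 0" "l \<le> 0" using kl by auto
      then show ?thesis using st by (simp add: p_def q_def divide_nonneg_nonpos)
    qed
    then have rnz: "r \<noteq> 0" and r1: "0 \<le> q / r" "0 \<le> p / r"
      using pq0 by (auto simp: r_def zero_le_divide_iff)
    have "p / r + q / r = 1" using rnz by (simp add: r_def flip: add_divide_distrib)
    then have one: "1 - q / r = p / r" and r2: "0 \<le> q / r" "q / r \<le> 1" using r1 by linarith+
    have "(1 - q / r) *\<^sub>R v + (q / r) *\<^sub>R w = (1 / r) *\<^sub>R ((p * k) *\<^sub>R x + (q * l) *\<^sub>R y)"
      unfolding one k(2) l(2) by (simp add: scaleR_right_distrib)
    then have "(1 - q / r) *\<^sub>R v + (q / r) *\<^sub>R w = (1 / r) *\<^sub>R (s *\<^sub>R x + t *\<^sub>R y)"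
      unfolding pq .
    then have "(1 / r) *\<^sub>R (s *\<^sub>R x + t *\<^sub>R y) \<in> closed_segment v w"
      unfolding in_segment using r2 by (intro exI[of _ "q / r"]) simp
    then have "rp2_of ((1 / r) *\<^sub>R (s *\<^sub>R x + t *\<^sub>R y)) \<in> \<Omega>" using vw(5) by blast
    then have "rp2_of (s *\<^sub>R x + t *\<^sub>R y) \<in> \<Omega>" using rp2_of_scale[of "1 / r"] rnz by simp
    then show ?thesis using pos unfolding C_def by blast
  qed
qed

text \<open>The constant is the minimum of the absolute value of a on the compact set of unit
  vectors over the closure of the domain, where the chart condition keeps a away from zero.\<close>

lemma bound_exists: "\<exists>c>0. \<forall>x\<in>C. c * norm x \<le> a \<bullet> x"
proof -
  define K where "K = {v. norm v = 1 \<and> rp2_of v \<in> closure \<Omega>}"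
  have "K = sphere 0 1 - cone_of (- closure \<Omega>)"
    by (auto simp: K_def cone_of_def)
  then have "compact K"
    using compact_diff[OF compact_sphere open_cone_of[OF open_Compl[OF closed_closure]]] by metis
  obtain x0 where "x0 \<in> \<Omega>" using nonempty_\<Omega> by blast
  then obtain v0 where v0: "a \<bullet> v0 = 1" "x0 = rp2_of v0" using \<Omega>_lift closure_subset by blast
  then have "v0 \<noteq> 0" by auto
  then have "(1 / norm v0) *\<^sub>R v0 \<in> K"
    using \<open>x0 \<in> \<Omega>\<close> v0 closure_subset by (auto simp: K_def rp2_of_scale)
  then have "K \<noteq> {}" by blast
  moreover have "continuous_on K (\<lambda>v. \<bar>a \<bullet> v\<bar>)" by (intro continuous_intros)
  ultimately obtain m where m: "m \<in> K" "\<And>v. v \<in> K \<Longrightarrow> \<bar>a \<bullet> m\<bar> \<le> \<bar>a \<bullet> v\<bar>"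
    using continuous_attains_inf[OF \<open>compact K\<close>] by metis
  have "norm m = 1" "rp2_of m \<in> closure \<Omega>" using m(1) by (simp_all add: K_def)
  then have "\<bar>a \<bullet> m\<bar> > 0" using chart_nonzero[of m] by fastforce
  moreover have "\<bar>a \<bullet> m\<bar> * norm x \<le> a \<bullet> x" if x: "x \<in> C" for x
  proof -
    have x0: "x \<noteq> 0" "a \<bullet> x > 0" using x by (auto simp: C_def)
    then have "(1 / norm x) *\<^sub>R x \<in> K"
      using x closure_subset by (auto simp: K_def C_def rp2_of_scale)
    then have "\<bar>a \<bullet> m\<bar> \<le> \<bar>a \<bullet> ((1 / norm x) *\<^sub>R x)\<bar>" by (rule m(2))
    then show ?thesis using x0 by (simp add: field_simps)
  qed
  ultimately show ?thesis by blast
qed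

definition cc :: real where "cc = (SOME c. c > 0 \<and> (\<forall>x\<in>C. c * norm x \<le> a \<bullet> x))"

sublocale proper_cone C a cc
proof
  have cc: "cc > 0 \<and> (\<forall>x\<in>C. cc * norm x \<le> a \<bullet> x)"
    unfolding cc_def using bound_exists by (rule someI_ex)
  show "open C"
    unfolding C_cone_of using open_\<Omega> by (intro open_Int open_cone_of open_halfspace_gt)
  show "convex C" by (rule convex_C)
  show "C \<noteq> {}"
  proof -
    obtain x0 where "x0 \<in> \<Omega>" using nonempty_\<Omega> by blast
    then obtain v0 where "a \<bullet> v0 = 1" "x0 = rp2_of v0" using \<Omega>_lift closure_subset by blast
    then have "v0 \<in> C" using \<open>x0 \<in> \<Omega>\<close> by (simp add: C_def)
    then show ?thesis by blast
  qed
  show "r *\<^sub>R x \<in> C" if "x \<in> C" "r > 0" for x r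
    using that by (simp add: C_def rp2_of_scale)
  show "cc > 0" "\<And>x. x \<in> C \<Longrightarrow> cc * norm x \<le> a \<bullet> x" using cc by auto
qed

lemma rp2_of_in_\<Omega>: "v \<in> C \<Longrightarrow> rp2_of v \<in> \<Omega>" and C_pos: "v \<in> C \<Longrightarrow> a \<bullet> v > 0"
  by (simp_all add: C_def)

lemma C_nonzero: "v \<in> C \<Longrightarrow> v \<noteq> 0" using zero_notin by blast

lemma preserves_C: "\<lbrakk>preserves A; x \<in> C\<rbrakk> \<Longrightarrow> A *v x \<in> C" by (simp add: preserves_def)

lemma closure_C_iff:
  assumes v: "a \<bullet> v > 0"
  shows "rp2_of v \<in> closure \<Omega> \<longleftrightarrow> v \<in> closure C"
proof -
  have v0: "v \<noteq> 0" using v by auto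
  have "v \<in> closure (cone_of \<Omega>) \<longleftrightarrow> v \<in> closure C"
  proof
    assume vc: "v \<in> closure (cone_of \<Omega>)"
    have "open {v. a \<bullet> v > 0}" by (rule open_halfspace_gt)
    then show "v \<in> closure C"
      unfolding C_cone_of using open_Int_closure_subset[of "{v. a \<bullet> v > 0}" "cone_of \<Omega>"] vc v
      by (auto simp: Int_commute)
  next
    assume "v \<in> closure C"
    then show "v \<in> closure (cone_of \<Omega>)" using closure_mono[of C "cone_of \<Omega>"] by (auto simp: C_cone_of)
  qed
  then show ?thesis using closure_rp2_iff[OF v0] by blast
qed

lemma C_same_point:
  assumes "v \<in> C" "w \<in> C" "rp2_of v = rp2_of w"
  obtains k where "k > 0" "w = k *\<^sub>R v"
proof -
  have p: "a \<bullet> v > 0" "a \<bullet> w > 0" using assms by (auto simp: C_def)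
  then have "v \<noteq> 0" "w \<noteq> 0" by auto
  then obtain k where k: "k \<noteq> 0" "w = k *\<^sub>R v" using rp2_of_eq_iff assms(3) by metis
  then have "k > 0" using p by (simp add: zero_less_mult_iff)
  then show ?thesis using that k by blast
qed

lemma \<Omega>_lift_C:
  assumes "x \<in> \<Omega>"
  obtains v where "v \<in> C" "a \<bullet> v = 1" "x = rp2_of v"
proof -
  have "x \<in> closure \<Omega>" using assms closure_subset by blast
  then obtain v where v: "a \<bullet> v = 1" "x = rp2_of v" by (rule \<Omega>_lift)
  then have "v \<in> C" using assms by (simp add: C_def)
  then show ?thesis using that v by blast
qed

text \<open>A matrix is determined only up to sign by the choice of the cone over its opposite.
  Since C is connected and a never vanishes on its image, one global sign e moves the image into
  C.\<close>

lemma lift_preserves: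
  assumes A: "invertible A" and inv: "\<And>x. proj_map A x \<in> \<Omega> \<longleftrightarrow> x \<in> \<Omega>"
  obtains B where "preserves B" "proj_map B = proj_map A"
proof -
  have img: "rp2_of (A *v v) \<in> \<Omega> \<longleftrightarrow> rp2_of v \<in> \<Omega>" if "v \<noteq> 0" for v
    using inv[of "rp2_of v"] by (simp add: proj_map_rp2_of that)
  have nzA: "a \<bullet> (A *v v) \<noteq> 0" if "v \<in> C" for v
  proof -
    have v: "v \<noteq> 0" "rp2_of v \<in> \<Omega>" using that by (auto simp: C_def)
    then show ?thesis
      using chart_nonzero[OF invertible_mult_nonzero[OF A v(1)]] img[OF v(1)] closure_subset by blast
  qed
  obtain v0 where v0: "v0 \<in> C" using nonempty_C by blast
  define e where "e = sgn (a \<bullet> (A *v v0))"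
  have e: "e = 1 \<or> e = -1" using nzA[OF v0] by (auto simp: e_def sgn_if)
  have same: "e * (a \<bullet> (A *v v)) > 0" if v: "v \<in> C" for v
  proof -
    have "connected ((\<lambda>v. e * (a \<bullet> (A *v v))) ` C)"
      by (intro connected_continuous_image continuous_intros convex_connected[OF convex_C]
          matrix_vector_mult_linear_continuous_on)
    moreover have "0 \<notin> (\<lambda>v. e * (a \<bullet> (A *v v))) ` C" using nzA e by auto
    moreover have "e * (a \<bullet> (A *v v0)) > 0" using nzA[OF v0] unfolding e_def by (simp add: sgn_if)
    ultimately show ?thesis
      using connectedD_interval[of "(\<lambda>v. e * (a \<bullet> (A *v v))) ` C" "e * (a \<bullet> (A *v v))" "e * (a \<bullet> (A *v v0))" 0] v v0
      by (meson imageI less_imp_le not_less)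
  qed
  define B where "B = e *\<^sub>R A"
  have Bv: "B *v v = e *\<^sub>R (A *v v)" for v by (simp add: B_def scaleR_matrix_vector_assoc)
  have e0: "e \<noteq> 0" using e by auto
  have pB: "proj_map B = proj_map A" unfolding B_def by (rule proj_map_scale[OF e0])
  have iB: "invertible B" unfolding B_def by (rule scalar_invertible[OF e0 A])
  have fwd: "B *v x \<in> C" if "x \<in> C" for x
  proof -
    have "x \<noteq> 0" "rp2_of x \<in> \<Omega>" using that by (auto simp: C_def)
    then show ?thesis using same[OF that] img[of x] e0 unfolding C_def Bv by (simp add: rp2_of_scale)
  qed
  have "preserves B" unfolding preserves_def
  proof (intro conjI iB allI iffI fwd)
    fix x assume Bx: "B *v x \<in> C"
    then have x: "x \<noteq> 0" using zero_notin by auto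
    have "rp2_of x \<in> \<Omega>"
      using Bx img[OF x] e0 unfolding C_def Bv by (simp add: rp2_of_scale)
    then have "a \<bullet> x \<noteq> 0" using chart_nonzero[OF x] closure_subset by blast
    moreover have "\<not> a \<bullet> x < 0"
    proof
      assume "a \<bullet> x < 0"
      then have "- x \<in> C" using \<open>rp2_of x \<in> \<Omega>\<close> rp2_of_scale[of "-1" x] by (simp add: C_def)
      then have "B *v (- x) \<in> C" by (rule fwd)
      moreover have "B *v (- x) = - (B *v x)" using matrix_vector_mult_scaleR[of B "-1" x] by simp
      ultimately have "B *v x \<in> closure C" "- (B *v x) \<in> closure C" using Bx closure_subset by auto
      then show False using closure_antisym Bx zero_notin by metis
    qed
    ultimately show "x \<in> C" using \<open>rp2_of x \<in> \<Omega>\<close> by (simp add: C_def)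
  qed
  then show ?thesis using that pB by blast
qed

end

section \<open>Accumulation points of orbits\<close>

lemma matrix_inv_mult:
  fixes P :: "real^'n^'n"
  assumes "invertible P"
  shows "P ** matrix_inv P = mat 1" "matrix_inv P ** P = mat 1"
proof -
  have "P ** matrix_inv P = mat 1 \<and> matrix_inv P ** P = mat 1"
    unfolding matrix_inv_def using assms unfolding invertible_def by (rule someI_ex)
  then show "P ** matrix_inv P = mat 1" "matrix_inv P ** P = mat 1" by auto
qed

lemma matrix_inv_eqI:
  fixes P :: "real^'n^'n"
  assumes "P ** Q = mat 1" "Q ** P = mat 1"
  shows "matrix_inv P = Q"
proof -
  have "invertible P" using assms unfolding invertible_def by blast
  then have "matrix_inv P ** (P ** Q) = matrix_inv P" "(matrix_inv P ** P) ** Q = Q"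
    by (simp_all only: matrix_inv_mult assms matrix_mul_lid matrix_mul_rid)
  then show ?thesis unfolding matrix_mul_assoc by metis
qed

lemma invertible_diag3:
  assumes "\<And>i. l $ i \<noteq> 0"
  shows "invertible (diag3 l)"
  unfolding invertible_def
proof (intro exI conjI)
  have *: "diag3 l ** diag3 m = mat 1" if "\<And>i. l $ i * m $ i = 1" for l m :: "real^3"
  proof (rule matrix_eq[THEN iffD2], rule allI)
    fix x :: "real^3"
    have diag: "diag3 n *v y = (\<chi> i. n $ i * y $ i)" for n y :: "real^3"
      by (simp add: vec_eq_iff matrix_vector_mult_def diag3_def forall_3 sum_3)
    show "(diag3 l ** diag3 m) *v x = mat 1 *v x"
      unfolding matrix_vector_mul_assoc[symmetric] diag
      by (simp add: vec_eq_iff mult.assoc[symmetric] that)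
  qed
  show "diag3 l ** diag3 (\<chi> i. 1 / l $ i) = mat 1" "diag3 (\<chi> i. 1 / l $ i) ** diag3 l = mat 1"
    using assms by (intro *; simp)+
qed

lemma diagonalizes_conj:
  assumes d: "diagonalizes (proj_map A) P l" and A: "invertible A"
    and M: "M ** M' = mat 1" "M' ** M = mat 1"
  shows "diagonalizes (proj_map (M ** A ** M')) (M ** P) l"
proof -
  have P: "invertible P" and eq: "proj_map A = proj_map (P ** diag3 l ** matrix_inv P)"
    using d by (auto simp: diagonalizes_def)
  have M': "invertible M" "invertible M'" using M unfolding invertible_def by auto
  note inv = matrix_inv_mult[OF P]
  have "invertible (matrix_inv P)" using inv unfolding invertible_def by auto
  moreover have "l $ i \<noteq> 0" for i using d unfolding diagonalizes_def by (metis less_irrefl)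
  ultimately have iD: "invertible (P ** diag3 l ** matrix_inv P)"
    by (intro invertible_mult invertible_diag3 P)
  have "(M ** P) ** (matrix_inv P ** M') = M ** (P ** matrix_inv P) ** M'"
    "(matrix_inv P ** M') ** (M ** P) = matrix_inv P ** (M' ** M) ** P"
    by (simp_all only: matrix_mul_assoc)
  then have "matrix_inv (M ** P) = matrix_inv P ** M'"
    by (intro matrix_inv_eqI) (simp_all only: inv M matrix_mul_rid)
  then have e: "(M ** P) ** diag3 l ** matrix_inv (M ** P) = M ** (P ** diag3 l ** matrix_inv P) ** M'"
    by (simp only: matrix_mul_assoc)
  have "proj_map (M ** A ** M') = proj_map M \<circ> proj_map A \<circ> proj_map M'"
    by (simp only: proj_map_mult[OF M'(2)] proj_map_mult[OF A])
  also have "\<dots> = proj_map (M ** (P ** diag3 l ** matrix_inv P) ** M')"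
    by (simp only: proj_map_mult[OF M'(2)] proj_map_mult[OF iD] eq)
  finally show ?thesis
    using d P M' e unfolding diagonalizes_def by (simp only: invertible_mult simp_thms)
qed

section \<open>Free discrete actions by projective maps\<close>

locale rp2_action = convex_domain +
  fixes \<Gamma> :: "(rp2 \<Rightarrow> rp2) set"
  assumes projective: "\<And>g. g \<in> \<Gamma> \<Longrightarrow> \<exists>A. invertible A \<and> g = proj_map A"
    and \<Gamma>_inv: "\<And>g x. g \<in> \<Gamma> \<Longrightarrow> g x \<in> \<Omega> \<longleftrightarrow> x \<in> \<Omega>"
    and \<Gamma>_id: "id \<in> \<Gamma>" and \<Gamma>_comp: "\<And>g h. \<lbrakk>g \<in> \<Gamma>; h \<in> \<Gamma>\<rbrakk> \<Longrightarrow> g \<circ> h \<in> \<Gamma>"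
    and \<Gamma>_inverse: "\<And>g. g \<in> \<Gamma> \<Longrightarrow> \<exists>h\<in>\<Gamma>. h \<circ> g = id \<and> g \<circ> h = id"
    and \<Gamma>_free: "\<And>g x. \<lbrakk>g \<in> \<Gamma>; x \<in> \<Omega>; g x = x\<rbrakk> \<Longrightarrow> g = id"
    and discrete: "\<And>x y. \<lbrakk>x \<in> \<Omega>; y \<in> \<Omega>\<rbrakk> \<Longrightarrow> \<not> y islimpt {g x | g. g \<in> \<Gamma>}"
begin

lemma lift_exists: "g \<in> \<Gamma> \<Longrightarrow> \<exists>A. preserves A \<and> proj_map A = g"
proof -
  assume g: "g \<in> \<Gamma>"
  then obtain A where "invertible A" "g = proj_map A" using projective by blast
  then show ?thesis using lift_preserves[of A] \<Gamma>_inv[OF g] by metis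
qed

lemma free_agree:
  assumes g: "g \<in> \<Gamma>" and h: "h \<in> \<Gamma>" and x: "x \<in> \<Omega>" and eq: "g x = h x"
  shows "g = h"
proof -
  obtain h' where h': "h' \<in> \<Gamma>" "h' \<circ> h = id" "h \<circ> h' = id" using \<Gamma>_inverse[OF h] by blast
  have "(h' \<circ> g) x = x" using eq h'(2) by (simp add: fun_eq_iff)
  then have "h' \<circ> g = id" using \<Gamma>_free[OF \<Gamma>_comp[OF h'(1) g] x] by blast
  then have "h \<circ> (h' \<circ> g) = h" by simp
  then show ?thesis using h'(3) by (simp add: o_assoc)
qed

lemma funpow_in: "g \<in> \<Gamma> \<Longrightarrow> g ^^ n \<in> \<Gamma>"
  by (induction n) (simp_all only: funpow.simps \<Gamma>_id \<Gamma>_comp)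

lemma proj_map_mpow:
  assumes "invertible A"
  shows "proj_map (mpow A n) = proj_map A ^^ n"
proof (induction n)
  case 0
  show ?case by (simp only: mpow_0 proj_map_id funpow.simps)
next
  case (Suc n)
  have "invertible (mpow A n)"
  proof (induction n)
    case 0
    show ?case unfolding mpow_0 invertible_def by (intro exI[of _ "mat 1"]) simp
  next
    case (Suc n)
    then show ?case using assms by (simp add: mpow_Suc invertible_mult)
  qed
  then show ?case by (simp only: mpow_Suc proj_map_mult Suc funpow.simps)
qed

text \<open>A periodic point \<open>x\<close> of a lift yields the fixed point \<open>x + A x + \<dots> + A\<^sup>m\<^sup>-\<^sup>1 x\<close>.\<close>

lemma torsion_free:
  assumes g: "g \<in> \<Gamma>" and m: "m > 0" and gm: "g ^^ m = id"
  shows "g = id"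
proof -
  obtain A where A: "preserves A" "proj_map A = g" using lift_exists[OF g] by blast
  obtain x where x: "x \<in> C" using nonempty_C by blast
  have invA: "invertible A" using A(1) by (simp add: preserves_def)
  have "rp2_of (mpow A m *v x) = rp2_of x"
    using proj_map_mpow[OF invA, of m] proj_map_rp2_of[OF C_nonzero[OF x], of "mpow A m"] A(2) gm by simp
  then obtain k where k: "k > 0" "mpow A m *v x = k *\<^sub>R x"
    using C_same_point[OF x preserves_C[OF preserves_mpow[OF A(1)] x]] by metis
  \<comment> \<open>The scaling makes the m-th power of t A fix x itself, not just its line, so the
    sum over the period is fixed by t A.\<close>
  define t where "t = 1 / root m k"
  have t: "t > 0" and tm: "t ^ m * k = 1"
    using k(1) m by (simp_all add: t_def power_one_over real_root_pow_pos2)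
  define y where "y = (\<Sum>i<m. (t ^ i) *\<^sub>R (mpow A i *v x))"
  have term_C: "(t ^ i) *\<^sub>R (mpow A i *v x) \<in> C" for i
    using scale_C[OF preserves_C[OF preserves_mpow[OF A(1)] x]] t by simp
  have "(\<Sum>i<Suc j. (t ^ i) *\<^sub>R (mpow A i *v x)) \<in> C" for j
  proof (induction j)
    case 0
    show ?case using term_C[of 0] by simp
  next
    case (Suc j)
    then show ?case using add_C[OF Suc term_C[of "Suc j"]] by simp
  qed
  moreover obtain j where "m = Suc j" using m by (cases m) auto
  ultimately have yC: "y \<in> C" unfolding y_def by blast
  have "t *\<^sub>R (A *v y) = (\<Sum>i<m. (t ^ Suc i) *\<^sub>R (mpow A (Suc i) *v x))"
    unfolding y_def
    by (simp add: linear_sum[OF matrix_vector_mul_linear] scaleR_sum_right mpow_Suc_vec matrix_vector_mult_scaleR)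
  also have "\<dots> = (\<Sum>i<Suc m. (t ^ i) *\<^sub>R (mpow A i *v x)) - x"
    unfolding sum.lessThan_Suc_shift by simp
  also have "\<dots> = y + (t ^ m * k) *\<^sub>R x - x" unfolding sum.lessThan_Suc y_def k(2) by simp
  finally have "t *\<^sub>R (A *v y) = y" using tm by simp
  then have "rp2_of (A *v y) = rp2_of y" using rp2_of_scale[of t "A *v y"] t by simp
  then have "g (rp2_of y) = rp2_of y" using A(2) proj_map_rp2_of[OF C_nonzero[OF yC]] by metis
  then show ?thesis by (rule \<Gamma>_free[OF g rp2_of_in_\<Omega>[OF yC]])
qed

lemma funpow_inj:
  assumes g: "g \<in> \<Gamma>" "g \<noteq> id" and eq: "g ^^ i = g ^^ j"
  shows "i = j"
proof -
  have le: False if "i < j" "g ^^ i = g ^^ j" for i j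
  proof -
    obtain d where d: "d > 0" "j = i + d" using less_imp_add_positive[OF \<open>i < j\<close>] by blast
    obtain x where x: "x \<in> \<Omega>" using nonempty_\<Omega> by blast
    define y where "y = (g ^^ i) x"
    have "y \<in> \<Omega>" using \<Gamma>_inv[OF funpow_in[OF g(1)]] x by (simp add: y_def)
    moreover have "(g ^^ d) y = y"
    proof -
      have "g ^^ j = g ^^ d \<circ> g ^^ i" unfolding d(2) add.commute[of i] by (rule funpow_add)
      then show ?thesis using that(2) unfolding y_def by (metis comp_apply)
    qed
    ultimately have "g ^^ d = id" using \<Gamma>_free[OF funpow_in[OF g(1)]] by blast
    then show False using torsion_free[OF g(1) d(1)] g(2) by blast
  qed
  show ?thesis using le[of i j] le[of j i] eq by (metis linorder_neqE_nat)
qed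

text \<open>Orbit points converging inside the domain are eventually constant by discreteness;
  freeness then makes the group elements constant too, although each occurs only finitely
  often.\<close>

lemma finite_to_one_escapes:
  assumes A: "\<And>n. preserves (A n)" and g: "\<And>n. proj_map (A n) \<in> \<Gamma>"
    and fin: "\<And>h. finite {n. proj_map (A n) = h}"
  shows "escapes A"
  unfolding escapes_def
proof (intro ballI allI impI notI)
  fix x r s z
  assume x: "x \<in> C" and z: "z \<in> C"
    and r: "strict_mono (r :: nat \<Rightarrow> nat) \<and> (\<forall>n. s n > (0::real)) \<and> (\<lambda>n. s n *\<^sub>R (A (r n) *v x)) \<longlonglongrightarrow> z"
  have "\<not> rp2_of z islimpt {g (rp2_of x) | g. g \<in> \<Gamma>}" by (intro discrete rp2_of_in_\<Omega> x z)
  then obtain T where T: "rp2_of z \<in> T" "open T"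
    and only: "\<And>y. \<lbrakk>y \<in> {g (rp2_of x) | g. g \<in> \<Gamma>}; y \<in> T\<rbrakk> \<Longrightarrow> y = rp2_of z"
    unfolding islimpt_def by blast
  have pt: "rp2_of (s n *\<^sub>R (A (r n) *v x)) = proj_map (A (r n)) (rp2_of x)" for n
  proof -
    have "s n \<noteq> 0" using r by (metis less_irrefl)
    then show ?thesis by (simp add: rp2_of_scale proj_map_rp2_of[OF C_nonzero[OF x]])
  qed
  have "\<forall>\<^sub>F n in sequentially. s n *\<^sub>R (A (r n) *v x) \<noteq> 0 \<and> rp2_of (s n *\<^sub>R (A (r n) *v x)) \<in> T"
    using r by (intro rp2_of_tendsto_eventually[OF C_nonzero[OF z] _ T(2,1)]) blast
  then obtain m where m: "\<And>n. n \<ge> m \<Longrightarrow> proj_map (A (r n)) (rp2_of x) \<in> T"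
    unfolding eventually_sequentially pt by blast
  have orb: "proj_map (A (r n)) (rp2_of x) \<in> {g (rp2_of x) | g. g \<in> \<Gamma>}" for n using g by blast
  have same: "proj_map (A (r n)) = proj_map (A (r m))" if "n \<ge> m" for n
    using only[OF orb m[OF that]] only[OF orb m[of m]] by (intro free_agree[OF g g rp2_of_in_\<Omega>[OF x]]) simp
  have "r ` {m..} \<subseteq> {n. proj_map (A n) = proj_map (A (r m))}"
    by (intro image_subsetI CollectI same) (simp only: atLeast_iff)
  then have "finite (r ` {m..})" by (rule finite_subset[OF _ fin])
  moreover have "inj_on r {m..}"
    by (rule inj_on_subset[OF strict_mono_imp_inj_on[OF conjunct1[OF r]] subset_UNIV])
  ultimately have "finite {m..}" by (rule finite_imageD)
  then show False using infinite_Ici[of m] by contradiction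
qed

lemma conj_saddle:
  assumes g: "invertible A" and M: "M ** M' = mat 1" "M' ** M = mat 1"
    and s: "saddle_point (proj_map A) x"
  shows "hyperbolic (proj_map (M ** A ** M'))" "saddle_point (proj_map (M ** A ** M')) (proj_map M x)"
proof -
  obtain P l i j k where d: "diagonalizes (proj_map A) P l" and l: "l $ j < l $ i" "l $ i < l $ k"
    and x: "x = rp2_of (P *v axis i 1)"
    using s unfolding saddle_point_def by blast
  have d': "diagonalizes (proj_map (M ** A ** M')) (M ** P) l" by (rule diagonalizes_conj[OF d g M])
  then show "hyperbolic (proj_map (M ** A ** M'))" unfolding hyperbolic_def by blast
  have "invertible P" using d unfolding diagonalizes_def by blast
  then have "P *v axis i 1 \<noteq> 0" by (rule invertible_mult_nonzero) (simp add: axis_eq_0_iff)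
  then have "proj_map M x = rp2_of ((M ** P) *v axis i 1)"
    unfolding x by (simp add: proj_map_rp2_of matrix_vector_mul_assoc)
  then show "saddle_point (proj_map (M ** A ** M')) (proj_map M x)"
    unfolding saddle_point_def using d' l by blast
qed

abbreviation F :: "rp2 set" where "F \<equiv> nonsaddle_fixed_points \<Gamma>"

text \<open>If h f were a saddle point of k, then f would be a saddle point of the conjugate of k by
  the inverse of h, which belongs to the group.\<close>

lemma F_invariant:
  assumes h: "h \<in> \<Gamma>" and f: "f \<in> F"
  shows "h f \<in> F"
proof -
  obtain h' where h': "h' \<in> \<Gamma>" "h' \<circ> h = id" "h \<circ> h' = id" using \<Gamma>_inverse[OF h] by blast
  have hh: "h' (h x) = x" "h (h' x) = x" for x using h'(2,3) by (simp_all add: fun_eq_iff)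
  obtain g where g: "g \<in> \<Gamma>" "g \<noteq> id" "g f = f" and ns: "\<And>g. \<lbrakk>g \<in> \<Gamma>; hyperbolic g\<rbrakk> \<Longrightarrow> \<not> saddle_point g f"
    using f unfolding nonsaddle_fixed_points_def by blast
  have "h \<circ> g \<circ> h' \<in> \<Gamma>" by (intro \<Gamma>_comp h g h')
  moreover have "(h \<circ> g \<circ> h') (h f) = h f" using hh g(3) by simp
  moreover have "h \<circ> g \<circ> h' \<noteq> id"
  proof
    assume e: "h \<circ> g \<circ> h' = id"
    have "g x = x" for x
    proof -
      have "h (g (h' (h x))) = h x" using e by (metis comp_apply id_apply)
      then show ?thesis using hh by metis
    qed
    then show False using g(2) by (auto simp: fun_eq_iff)
  qed
  moreover have "\<not> saddle_point k (h f)" if k: "k \<in> \<Gamma>" "hyperbolic k" for k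
  proof
    assume s: "saddle_point k (h f)"
    obtain K where K: "invertible K" "k = proj_map K" using projective[OF k(1)] by blast
    obtain H where H: "invertible H" "h' = proj_map H" using projective[OF h'(1)] by blast
    define H' where "H' = matrix_inv H"
    have HH: "H ** H' = mat 1" "H' ** H = mat 1" unfolding H'_def by (rule matrix_inv_mult[OF H(1)])+
    then have iH: "invertible H'" unfolding invertible_def by blast
    have "proj_map H' = h \<circ> (proj_map H \<circ> proj_map H')" using h'(3) H(2) by (simp add: o_assoc)
    also have "\<dots> = h" unfolding proj_map_mult[OF iH, symmetric] HH proj_map_id by simp
    finally have H': "proj_map H' = h" .
    have "proj_map (H ** K ** H') = h' \<circ> k \<circ> h"
      by (simp only: proj_map_mult[OF iH] proj_map_mult[OF K(1)] H' H(2)[symmetric] K(2)[symmetric])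
    moreover have "h' \<circ> k \<circ> h \<in> \<Gamma>" by (intro \<Gamma>_comp h h' k)
    moreover have "proj_map H (h f) = f" using hh H(2) by simp
    ultimately show False
      using conj_saddle[OF K(1) HH, of "h f"] s K(2) ns[of "h' \<circ> k \<circ> h"] by simp
  qed
  ultimately show ?thesis unfolding nonsaddle_fixed_points_def by blast
qed

lemma F_disjoint: "closure F \<inter> \<Omega> = {}"
proof -
  have "F \<inter> \<Omega> = {}" using \<Gamma>_free unfolding nonsaddle_fixed_points_def by blast
  then show ?thesis using open_Int_closure_eq_empty[OF open_\<Omega>, of F] by (simp add: Int_commute)
qed

text \<open>The point of u lies outside the domain, so the orbit points that converge to it are
  different from it.\<close>

lemma attracts_islimpt:
  assumes at: "attracts A u \<phi> r N" and g: "\<And>n. proj_map (A n) \<in> \<Gamma>" and x: "x \<in> \<Omega>"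
  shows "rp2_of u islimpt {g x | g. g \<in> \<Gamma>}"
proof (rule islimptI)
  fix T assume T: "rp2_of u \<in> T" "open T"
  obtain v where v: "v \<in> C" "a \<bullet> v = 1" "x = rp2_of v" using \<Omega>_lift_C[OF x] by blast
  have u: "u \<in> closure C" "u \<noteq> 0" "u \<notin> C" and \<phi>: "\<phi> \<bullet> v > 0" and N: "\<And>n. N n > 0"
    and lim: "(\<lambda>n. N n *\<^sub>R (A (r n) *v v)) \<longlonglongrightarrow> (\<phi> \<bullet> v) *\<^sub>R u"
    using at v(1) unfolding attracts_def by blast+
  have un: "rp2_of u \<notin> \<Omega>" using closure_pos[OF u(1,2)] u(3) by (simp add: C_def)
  have pt: "rp2_of (N n *\<^sub>R (A (r n) *v v)) = proj_map (A (r n)) x" for n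
    using N[of n] unfolding v(3) by (simp add: rp2_of_scale proj_map_rp2_of[OF C_nonzero[OF v(1)]])
  have "\<forall>\<^sub>F n in sequentially. N n *\<^sub>R (A (r n) *v v) \<noteq> 0 \<and> rp2_of (N n *\<^sub>R (A (r n) *v v)) \<in> T"
    using u \<phi> T by (intro rp2_of_tendsto_eventually[OF _ lim]) (simp_all add: rp2_of_scale)
  then obtain n where "proj_map (A (r n)) x \<in> T" unfolding eventually_sequentially pt by blast
  moreover have "proj_map (A (r n)) x \<noteq> rp2_of u" using \<Gamma>_inv[OF g, of "r n" x] x un by metis
  moreover have "proj_map (A (r n)) x \<in> {g x | g. g \<in> \<Gamma>}" using g[of "r n"] by blast
  ultimately show "\<exists>y\<in>{g x | g. g \<in> \<Gamma>}. y \<in> T \<and> y \<noteq> rp2_of u" by (intro bexI conjI)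
qed

lemma mpow_escapes:
  assumes A: "preserves A" and g: "proj_map A \<in> \<Gamma>" "proj_map A \<noteq> id"
  shows "escapes (mpow A)"
proof (rule finite_to_one_escapes)
  have invA: "invertible A" using A by (simp add: preserves_def)
  show "preserves (mpow A n)" for n by (rule preserves_mpow[OF A])
  show "proj_map (mpow A n) \<in> \<Gamma>" for n unfolding proj_map_mpow[OF invA] by (rule funpow_in[OF g(1)])
  show "finite {n. proj_map (mpow A n) = h}" for h
  proof -
    have "{n. proj_map (mpow A n) = h} \<subseteq> {n}" if "proj_map (mpow A n) = h" for n
      using funpow_inj[OF g] that unfolding proj_map_mpow[OF invA] by blast
    then show ?thesis by (metis (mono_tags, lifting) empty_Collect_eq finite.emptyI finite.insertI finite_subset)
  qed
qed

lemma three_eigenvectors_saddle: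
  assumes ind: "u \<noteq> (0::real^3)" "w \<notin> span {u}" "f \<notin> span {u, w}"
    and A: "A *v u = l *\<^sub>R u" "A *v w = m *\<^sub>R w" "A *v f = k *\<^sub>R f" "0 < m" "m < k" "k < l"
  shows "hyperbolic (proj_map A)" "saddle_point (proj_map A) (rp2_of f)"
proof -
  \<comment> \<open>\<open>vector\<close> lists rows; transposing puts the eigenvectors into the
    columns, in the order of decreasing eigenvalues used for d.\<close>
  define P :: "real^3^3" where "P = transpose (vector [u, f, w])"
  define d :: "real^3" where "d = vector [l, k, m]"
  have Pv: "P *v x = x $ 1 *\<^sub>R u + x $ 2 *\<^sub>R f + x $ 3 *\<^sub>R w" for x
    by (simp add: P_def vec_eq_iff matrix_vector_mult_def transpose_def sum_3 forall_3)
  have Dv: "diag3 d *v x = vector [l * x $ 1, k * x $ 2, m * x $ 3]" for x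
    by (simp add: d_def vec_eq_iff matrix_vector_mult_def diag3_def sum_3 forall_3)
  have wu: "w \<noteq> 0" using ind(2) span_zero by metis
  have sc: "t = 0" if "t *\<^sub>R z \<in> span S" "z \<notin> span S" for t and z :: "real^3" and S
  proof (rule ccontr)
    assume "t \<noteq> 0"
    then show False using span_scale[OF that(1), of "1 / t"] that(2) by simp
  qed
  have "x = 0" if x0: "P *v x = 0" for x
  proof -
    have s: "u \<in> span {u, w}" "w \<in> span {u, w}" by (auto intro: span_base)
    have "x $ 2 *\<^sub>R f = - (x $ 1 *\<^sub>R u) - x $ 3 *\<^sub>R w"
      using x0 unfolding Pv by (simp add: algebra_simps eq_neg_iff_add_eq_0)
    then have "x $ 2 *\<^sub>R f \<in> span {u, w}" using s by (simp add: span_diff span_neg span_scale)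
    then have x2: "x $ 2 = 0" by (rule sc[OF _ ind(3)])
    then have "x $ 3 *\<^sub>R w = - (x $ 1 *\<^sub>R u)" using x0 unfolding Pv by (simp add: eq_neg_iff_add_eq_0 add.commute)
    then have "x $ 3 *\<^sub>R w \<in> span {u}" by (simp add: span_neg span_scale span_base)
    then have x3: "x $ 3 = 0" by (rule sc[OF _ ind(2)])
    then have "x $ 1 = 0" using x0 x2 ind(1) unfolding Pv by simp
    then show ?thesis using x2 x3 by (simp add: vec_eq_iff forall_3)
  qed
  then have iP: "invertible P" unfolding invertible_left_inverse matrix_left_invertible_ker by blast
  have AP: "A ** P = P ** diag3 d"
    unfolding matrix_eq matrix_vector_mul_assoc[symmetric] Pv Dv
    by (simp add: matrix_vector_right_distrib matrix_vector_mult_scaleR A mult.commute)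
  have "P ** diag3 d ** matrix_inv P = A ** (P ** matrix_inv P)" unfolding AP[symmetric] by (simp only: matrix_mul_assoc)
  then have "A = P ** diag3 d ** matrix_inv P" by (simp only: matrix_inv_mult[OF iP] matrix_mul_rid)
  moreover have "\<forall>i. d $ i > 0" "inj (($) d)"
    using A(4-6) by (auto simp: d_def forall_3 inj_def)
  ultimately have D: "diagonalizes (proj_map A) P d" unfolding diagonalizes_def using iP by metis
  then show "hyperbolic (proj_map A)" unfolding hyperbolic_def by blast
  have "f = P *v axis 2 1" unfolding Pv by (simp add: axis_def)
  then have "d $ 3 < d $ 2 \<and> d $ 2 < d $ 1 \<and> rp2_of f = rp2_of (P *v axis 2 1)" using A(5,6) by (simp add: d_def)
  then show "saddle_point (proj_map A) (rp2_of f)" unfolding saddle_point_def using D by blast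
qed

lemma F_islimpt:
  assumes ns: "\<not> simplicial" and f: "f \<in> F" and x: "x \<in> \<Omega>"
  shows "f islimpt {g x | g. g \<in> \<Gamma>}"
proof -
  obtain g where g: "g \<in> \<Gamma>" "g \<noteq> id" "g f = f"
    and nsad: "\<And>g. \<lbrakk>g \<in> \<Gamma>; hyperbolic g\<rbrakk> \<Longrightarrow> \<not> saddle_point g f"
    using f unfolding nonsaddle_fixed_points_def by blast
  obtain A1 where A1: "preserves A1" "proj_map A1 = g" using lift_exists[OF g(1)] by blast
  obtain v where v: "v \<noteq> 0" "f = rp2_of v" by (rule rp2_of_cases)
  have iA1: "invertible A1" using A1(1) by (simp add: preserves_def)
  have "rp2_of (A1 *v v) = rp2_of v" using g(3) v A1(2) proj_map_rp2_of by metis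
  then obtain k where k: "k \<noteq> 0" "A1 *v v = k *\<^sub>R v"
    using rp2_of_eq_iff[OF v(1) invertible_mult_nonzero[OF iA1 v(1)]] by metis
  define A where "A = mpow A1 2"
  have A: "preserves A" unfolding A_def by (rule preserves_mpow[OF A1(1)])
  have iA: "invertible A" using A by (simp add: preserves_def)
  have Av: "A *v v = k^2 *\<^sub>R v" unfolding A_def by (rule mpow_eigen[OF k(2)])
  have pA: "proj_map A = g ^^ 2" unfolding A_def proj_map_mpow[OF iA1] A1(2) by simp
  have gA: "proj_map A \<in> \<Gamma>" unfolding pA by (rule funpow_in[OF g(1)])
  \<comment> \<open>Passing to the square is harmless only because the group has no torsion.\<close>
  have nA: "proj_map A \<noteq> id" using torsion_free[OF g(1), of 2] g(2) unfolding pA by auto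
  define B where "B = matrix_inv A"
  have AB: "A ** B = mat 1" "B ** A = mat 1" unfolding B_def by (rule matrix_inv_mult[OF iA])+
  then have iB: "invertible B" unfolding invertible_def by blast
  have "B *v x \<in> C \<longleftrightarrow> x \<in> C" for x
  proof -
    have "A *v (B *v x) \<in> C \<longleftrightarrow> B *v x \<in> C" using A by (simp add: preserves_def)
    then show ?thesis by (simp add: matrix_vector_mul_assoc AB)
  qed
  then have B: "preserves B" using iB by (simp add: preserves_def)
  have pAB: "proj_map A \<circ> proj_map B = id" using proj_map_mult[OF iB, of A] AB proj_map_id by simp
  obtain h where h: "h \<in> \<Gamma>" "h \<circ> proj_map A = id" using \<Gamma>_inverse[OF gA] by blast
  have "proj_map B = (h \<circ> proj_map A) \<circ> proj_map B" unfolding h(2) by simp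
  also have "\<dots> = h" unfolding o_assoc[symmetric] pAB by simp
  finally have gB: "proj_map B \<in> \<Gamma>" using h(1) by simp
  have nB: "proj_map B \<noteq> id" using pAB nA by auto
  obtain u \<phi> r N where atA: "attracts (mpow A) u \<phi> r N"
    using escapes_imp_attracts[OF ns preserves_mpow[OF A] mpow_escapes[OF A gA nA]] by blast
  obtain w \<psi> q M where atB: "attracts (mpow B) w \<psi> q M"
    using escapes_imp_attracts[OF ns preserves_mpow[OF B] mpow_escapes[OF B gB nB]] by blast
  have limit: "f islimpt {g x | g. g \<in> \<Gamma>}" if at: "attracts (mpow D) u \<phi> r N" and D: "invertible D" "proj_map D \<in> \<Gamma>"
    and s: "v \<in> span {u}" for D u \<phi> r N
  proof -
    obtain t where t: "v = t *\<^sub>R u" using s by (auto simp: span_singleton)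
    then have "t \<noteq> 0" using v(1) by auto
    then have "f = rp2_of u" unfolding v(2) t by (rule rp2_of_scale)
    then show ?thesis
      using attracts_islimpt[OF at _ x] funpow_in[OF D(2)] proj_map_mpow[OF D(1)] by simp
  qed
  show ?thesis
  proof (cases "v \<in> span {u} \<or> v \<in> span {w}")
    case True
    then show ?thesis using limit[OF atA iA gA] limit[OF atB iB gB] by blast
  next
    case False
    have noeig: "A *v y \<noteq> j *\<^sub>R y" if y: "y \<in> C" "j > 0" for y j
    proof
      assume "A *v y = j *\<^sub>R y"
      then have "proj_map A (rp2_of y) = rp2_of y"
        using proj_map_rp2_of[OF C_nonzero[OF y(1)]] rp2_of_scale[of j y] y(2) by simp
      then show False using \<Gamma>_free[OF gA rp2_of_in_\<Omega>[OF y(1)]] nA by blast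
    qed
    have k2: "k^2 > 0" using k(1) by simp
    obtain l m where lm: "A *v u = l *\<^sub>R u" "A *v w = m *\<^sub>R w" "m > 0" "m < k^2" "k^2 < l"
      "u \<noteq> 0" "w \<notin> span {u}" "v \<notin> span {u, w}"
      by (rule fixed_point_classification[OF ns A B AB atA atB noeig Av k2]) (use False in auto)
    have "hyperbolic (proj_map A)" "saddle_point (proj_map A) (rp2_of v)"
      by (rule three_eigenvectors_saddle[OF lm(6-8) lm(1,2) Av lm(3-5)])+
    then show ?thesis using nsad[OF gA] v(2) by blast
  qed
qed

lemma chart_hull_lift:
  assumes "rp2_of v \<in> chart_hull a X" "a \<bullet> v = 1"
  shows "v \<in> convex hull {v. a \<bullet> v = 1 \<and> rp2_of v \<in> X}"
proof -
  obtain w where w: "w \<in> convex hull {v. a \<bullet> v = 1 \<and> rp2_of v \<in> X}" "rp2_of v = rp2_of w"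
    using assms(1) unfolding chart_hull_def by blast
  have "convex hull {v. a \<bullet> v = 1 \<and> rp2_of v \<in> X} \<subseteq> {v. a \<bullet> v = 1}"
    by (intro hull_minimal convex_hyperplane) auto
  then have aw: "a \<bullet> w = 1" using w(1) by blast
  have "v \<noteq> 0" "w \<noteq> 0" using aw assms(2) by auto
  then obtain k where "w = k *\<^sub>R v" using rp2_of_eq_iff w(2) by metis
  then have "w = v" using aw assms(2) by simp
  then show ?thesis using w(1) by simp
qed

text \<open>The open set swept out by the segments from a point of \<open>F\<close> to a neighbourhood of \<open>x\<close> lies in the hull.\<close>

lemma F_subset_closure_hull:
  assumes f: "f \<in> F" "f \<in> closure \<Omega>" and x: "x \<in> hull_interior a \<Omega> F"
  shows "f \<in> closure (hull_interior a \<Omega> F)"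
proof -
  define D where "D = hull_interior a \<Omega> F"
  have D: "open D" "D \<subseteq> \<Omega>" "D \<subseteq> chart_hull a (closure F)"
    unfolding D_def hull_interior_def using interior_subset by auto
  define H where "H = convex hull {v. a \<bullet> v = 1 \<and> rp2_of v \<in> closure F}"
  obtain v where v: "a \<bullet> v = 1" "f = rp2_of v" using \<Omega>_lift[OF f(2)] by blast
  have vH: "v \<in> H" unfolding H_def using f(1) v closure_subset by (intro hull_inc) auto
  have vC: "v \<in> closure C" using closure_C_iff[of v] v f(2) by simp
  have "x \<in> \<Omega>" using x D(2) D_def by blast
  then obtain z where z: "z \<in> C" "a \<bullet> z = 1" "x = rp2_of z" by (rule \<Omega>_lift_C)
  define V where "V = C \<inter> cone_of D"
  have V: "open V" unfolding V_def using open_C open_cone_of[OF D(1)] by blast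
  have zV: "z \<in> V" using z x C_nonzero[OF z(1)] unfolding V_def cone_of_def D_def by simp
  have inD: "rp2_of ((1 - t) *\<^sub>R v + t *\<^sub>R z) \<in> D \<and> (1 - t) *\<^sub>R v + t *\<^sub>R z \<noteq> 0"
    if t: "0 < t" "t \<le> 1" for t
  proof -
    define W where "W = (\<lambda>y. (1 - t) *\<^sub>R v + t *\<^sub>R y) ` V"
    have "W = (+) ((1 - t) *\<^sub>R v) ` ((*\<^sub>R) t ` V)" unfolding W_def image_image ..
    then have oW: "open W" using V t(1) by (simp add: open_translation open_scaling)
    have WC: "(1 - t) *\<^sub>R v + t *\<^sub>R y \<in> C" if "y \<in> V" for y
      using that t vC by (intro add_closure_C scale_closure scale_C) (auto simp: V_def)
    have W0: "0 \<notin> W" unfolding W_def using WC zero_notin by force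
    have "rp2_of ` W \<subseteq> chart_hull a (closure F) \<inter> \<Omega>"
    proof (intro image_subsetI IntI)
      fix y' assume "y' \<in> W"
      then obtain y where y: "y \<in> V" "y' = (1 - t) *\<^sub>R v + t *\<^sub>R y" unfolding W_def by blast
      show "rp2_of y' \<in> \<Omega>" unfolding y(2) by (rule rp2_of_in_\<Omega>[OF WC[OF y(1)]])
      have yC: "y \<in> C" "rp2_of y \<in> D" using y(1) by (auto simp: V_def cone_of_def)
      define j where "j = a \<bullet> y"
      have j: "j > 0" unfolding j_def by (rule C_pos[OF yC(1)])
      have "rp2_of ((1 / j) *\<^sub>R y) \<in> chart_hull a (closure F)"
        using yC(2) D(3) j rp2_of_scale[of "1 / j" y] by auto
      moreover have "a \<bullet> ((1 / j) *\<^sub>R y) = 1" using j by (simp add: j_def)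
      ultimately have yH: "(1 / j) *\<^sub>R y \<in> H" unfolding H_def by (rule chart_hull_lift)
      \<comment> \<open>The value of a at y', by which the weights are divided because the hull is
        formed in the plane a = 1.\<close>
      define e where "e = (1 - t) + t * j"
      have tj: "t * j > 0" using t j by simp
      then have e: "e > 0" using t unfolding e_def by linarith
      have "((1 - t) / e) *\<^sub>R v + (t * j / e) *\<^sub>R ((1 / j) *\<^sub>R y) \<in> H"
      proof (rule convexD[OF _ vH yH])
        show "convex H" unfolding H_def by (rule convex_convex_hull)
        show "0 \<le> (1 - t) / e" "0 \<le> t * j / e" using t e tj by simp_all
        show "(1 - t) / e + t * j / e = 1" using e by (simp add: e_def flip: add_divide_distrib)
      qed
      moreover have "((1 - t) / e) *\<^sub>R v + (t * j / e) *\<^sub>R ((1 / j) *\<^sub>R y) = (1 / e) *\<^sub>R y'"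
        using j unfolding y(2) by (simp add: scaleR_right_distrib)
      ultimately have "(1 / e) *\<^sub>R y' \<in> H" by (simp only:)
      then have "rp2_of ((1 / e) *\<^sub>R y') \<in> chart_hull a (closure F)"
        unfolding chart_hull_def H_def by (rule imageI)
      then show "rp2_of y' \<in> chart_hull a (closure F)" using rp2_of_scale[of "1 / e" y'] e by simp
    qed
    then have WD: "rp2_of ` W \<subseteq> D"
      unfolding D_def hull_interior_def by (rule interior_maximal[OF _ open_rp2_image[OF oW W0]])
    have zW: "(1 - t) *\<^sub>R v + t *\<^sub>R z \<in> W" unfolding W_def by (rule imageI[OF zV])
    show ?thesis
    proof
      show "rp2_of ((1 - t) *\<^sub>R v + t *\<^sub>R z) \<in> D" by (rule subsetD[OF WD imageI[OF zW]])
      show "(1 - t) *\<^sub>R v + t *\<^sub>R z \<noteq> 0" using zW W0 by metis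
    qed
  qed
  define q where "q n = (1 - 1 / real (Suc n)) *\<^sub>R v + (1 / real (Suc n)) *\<^sub>R z" for n
  have "q \<longlonglongrightarrow> (1 - 0) *\<^sub>R v + 0 *\<^sub>R z"
    unfolding q_def by (intro tendsto_intros LIMSEQ_Suc[OF lim_1_over_n])
  then have "q \<longlonglongrightarrow> v" by simp
  moreover have "q n \<in> cone_of D" for n
    using inD[of "1 / real (Suc n)"] by (simp add: q_def cone_of_def)
  moreover have "v \<noteq> 0" using v(1) by auto
  ultimately have "rp2_of v \<in> closure D" by (intro rp2_of_limit_in_closure[of v q D])
  then show ?thesis unfolding v(2) D_def .
qed

lemma accumulation_in_closure_F:
  assumes ns: "\<not> simplicial" and x: "x \<in> hull_interior a \<Omega> F"
    and y: "y \<in> closure \<Omega>" "y islimpt {g x | g. g \<in> \<Gamma>}"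
  shows "y \<in> closure F"
proof -
  have x\<Omega>: "x \<in> \<Omega>" and xh: "x \<in> chart_hull a (closure F)"
    using x interior_subset unfolding hull_interior_def by auto
  obtain z where z: "z \<in> C" "a \<bullet> z = 1" "x = rp2_of z" using \<Omega>_lift_C[OF x\<Omega>] by blast
  obtain v where v: "a \<bullet> v = 1" "y = rp2_of v" using \<Omega>_lift[OF y(1)] by blast
  have v0: "v \<noteq> 0" using v(1) by auto
  have y\<Omega>: "y \<notin> \<Omega>" using discrete[OF x\<Omega>] y(2) by blast
  have "open {v. a \<bullet> v > 0}" by (rule open_halfspace_gt)
  then obtain e where e: "e > 0" "ball v e \<subseteq> {v. a \<bullet> v > 0}"
    using v(1) open_contains_ball by (metis mem_Collect_eq zero_less_one)
  have "\<exists>g w. g \<in> \<Gamma> \<and> g x = rp2_of w \<and> w \<in> ball v (e / real (Suc n))" for n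
  proof -
    let ?B = "ball v (e / real (Suc n))"
    have e': "e / real (Suc n) > 0" using e(1) by simp
    have "e / real (Suc n) \<le> e" using e(1) by (simp add: divide_le_eq)
    then have "?B \<subseteq> {v. a \<bullet> v > 0}" using e(2) subset_ball by blast
    moreover have "0 \<notin> {v. a \<bullet> v > 0}" by simp
    ultimately have "0 \<notin> ?B" by (rule contra_subsetD)
    then have oB: "open (rp2_of ` ?B)" by (intro open_rp2_image open_ball)
    have yB: "y \<in> rp2_of ` ?B" using e' v(2) by (intro image_eqI[of _ _ v]) simp_all
    obtain p where p: "p \<in> {g x | g. g \<in> \<Gamma>}" "p \<in> rp2_of ` ?B"
      by (rule islimptE[OF y(2) yB oB])
    obtain g where "g \<in> \<Gamma>" "p = g x" using p(1) by blast
    moreover obtain w where "w \<in> ?B" "p = rp2_of w" using p(2) by (rule imageE)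
    ultimately show ?thesis by (intro exI conjI) simp_all
  qed
  then have "\<exists>g w. \<forall>n. g n \<in> \<Gamma> \<and> g n x = rp2_of (w n) \<and> w n \<in> ball v (e / real (Suc n))"
    by (subst choice_iff[symmetric], subst choice_iff[symmetric]) (rule allI)
  then obtain g w where g: "\<And>n. g n \<in> \<Gamma>" and gx: "\<And>n. g n x = rp2_of (w n)"
    and w: "\<And>n. w n \<in> ball v (e / real (Suc n))"
    by blast
  have wlim: "w \<longlonglongrightarrow> v"
  proof (rule metric_LIMSEQ_I)
    fix r :: real assume "r > 0"
    then obtain m where m: "e / r < real m" using reals_Archimedean2 by blast
    show "\<exists>no. \<forall>n\<ge>no. dist (w n) v < r"
    proof (intro exI allI impI)
      fix n assume "n \<ge> m"
      then have "e / r < real (Suc n)" using m by linarith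
      then have "e / real (Suc n) < r" using \<open>r > 0\<close> by (simp add: field_simps del: of_nat_Suc)
      then show "dist (w n) v < r" using w[of n] by (simp add: dist_commute)
    qed
  qed
  have aw: "a \<bullet> w n > 0" for n
  proof -
    have "e / real (Suc n) \<le> e" using e(1) by (simp add: divide_le_eq)
    then show ?thesis using e(2) w[of n] subset_ball by blast
  qed
  have "\<exists>A. preserves A \<and> proj_map A = g n" for n using lift_exists[OF g] by blast
  then obtain A where A: "\<And>n. preserves (A n)" and pA: "\<And>n. proj_map (A n) = g n" by metis
  have "\<exists>s>0. w n = s *\<^sub>R (A n *v z)" for n
  proof -
    have Az: "A n *v z \<in> C" by (rule preserves_C[OF A z(1)])
    have "rp2_of (A n *v z) = rp2_of (w n)"
      using gx[of n] pA[of n] z(3) proj_map_rp2_of[OF C_nonzero[OF z(1)]] by metis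
    moreover have "w n \<in> C" unfolding C_def using aw gx[of n] \<Gamma>_inv[OF g, of n x] x\<Omega> by simp
    ultimately show ?thesis using C_same_point[OF Az] by metis
  qed
  then obtain s where s: "\<And>n. s n > 0" and ws: "\<And>n. w n = s n *\<^sub>R (A n *v z)" by metis
  \<comment> \<open>If one element h occurred infinitely often, the constant point h x of the domain
    would be the limit of a subsequence, whereas y lies outside the domain.\<close>
  have fin: "finite {n. proj_map (A n) = h}" for h
  proof (rule ccontr)
    assume inf: "infinite {n. proj_map (A n) = h}"
    then obtain n0 where "proj_map (A n0) = h" using not_finite_existsD by blast
    then have "h x \<in> \<Omega>" using \<Gamma>_inv[OF g, of n0 x] x\<Omega> pA[of n0] by simp
    then obtain q where q: "q \<in> C" "a \<bullet> q = 1" "h x = rp2_of q" by (rule \<Omega>_lift_C)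
    \<comment> \<open>This vector vanishes exactly when w n lies on the line of q, so its nonzero
      limit keeps w n off that line for large n.\<close>
    have "(\<lambda>n. w n - (a \<bullet> w n) *\<^sub>R q) \<longlonglongrightarrow> v - (a \<bullet> v) *\<^sub>R q" by (intro tendsto_intros wlim)
    moreover have "v - (a \<bullet> v) *\<^sub>R q \<noteq> 0"
    proof
      assume "v - (a \<bullet> v) *\<^sub>R q = 0"
      then have "v = q" using v(1) by simp
      then show False using q(1) y\<Omega> v(2) rp2_of_in_\<Omega> by metis
    qed
    ultimately have "\<forall>\<^sub>F n in sequentially. w n - (a \<bullet> w n) *\<^sub>R q \<noteq> 0" by (rule tendsto_imp_eventually_ne)
    then obtain m where m: "\<And>n. n \<ge> m \<Longrightarrow> w n - (a \<bullet> w n) *\<^sub>R q \<noteq> 0" unfolding eventually_sequentially by blast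
    obtain n where n: "n \<ge> m" "proj_map (A n) = h"
      using inf unfolding infinite_nat_iff_unbounded_le by blast
    have "rp2_of q = rp2_of (w n)" using gx[of n] pA[of n] n(2) q(3) by simp
    moreover have "w n \<noteq> 0" using aw[of n] by auto
    ultimately obtain k where "w n = k *\<^sub>R q" using rp2_of_eq_iff[OF C_nonzero[OF q(1)]] by metis
    then show False using m[OF n(1)] q(2) by simp
  qed
  have "proj_map (A n) \<in> \<Gamma>" for n unfolding pA by (rule g)
  then have "escapes A" using finite_to_one_escapes[OF A _ fin] by blast
  then obtain u \<phi> r N where at: "attracts A u \<phi> r N" using escapes_imp_attracts[where A=A, OF ns A] by blast
  have slim: "(\<lambda>n. s n *\<^sub>R (A n *v z)) \<longlonglongrightarrow> v" using wlim unfolding ws[abs_def] .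
  obtain k where k: "k > 0" "v = k *\<^sub>R u" by (rule attracts_direction[OF at A z(1) s slim v0])
  have yu: "y = rp2_of u" unfolding v(2) k(2) using k(1) by (intro rp2_of_scale) simp
  have u: "u \<noteq> 0" and N: "\<And>n. N n > 0" and lim: "\<And>x. (\<lambda>n. N n *\<^sub>R (A (r n) *v x)) \<longlonglongrightarrow> (\<phi> \<bullet> x) *\<^sub>R u"
    and \<phi>: "\<phi> \<bullet> z > 0"
    using at z(1) unfolding attracts_def by blast+
  have "\<exists>v'. a \<bullet> v' = 1 \<and> rp2_of v' \<in> closure F \<and> \<phi> \<bullet> v' \<noteq> 0"
  \<comment> \<open>A functional that vanishes on all lifts of the closure of \<open>F\<close>
    vanishes on their hull, hence at z, where \<phi> is positive.\<close>
  proof (rule ccontr)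
    assume no: "\<nexists>v'. a \<bullet> v' = 1 \<and> rp2_of v' \<in> closure F \<and> \<phi> \<bullet> v' \<noteq> 0"
    have "convex hull {v. a \<bullet> v = 1 \<and> rp2_of v \<in> closure F} \<subseteq> {v. \<phi> \<bullet> v = 0}"
    proof (intro hull_minimal convex_hyperplane subsetI CollectI)
      fix q assume "q \<in> {v. a \<bullet> v = 1 \<and> rp2_of v \<in> closure F}"
      then show "\<phi> \<bullet> q = 0" using no by blast
    qed
    moreover have "z \<in> convex hull {v. a \<bullet> v = 1 \<and> rp2_of v \<in> closure F}"
      by (rule chart_hull_lift[OF xh[unfolded z(3)] z(2)])
    ultimately have "z \<in> {v. \<phi> \<bullet> v = 0}" by (rule subsetD)
    then show False using \<phi> by simp
  qed
  then obtain v' where v': "a \<bullet> v' = 1" "rp2_of v' \<in> closure F" "\<phi> \<bullet> v' \<noteq> 0" by blast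
  have "v' \<noteq> 0" using v'(1) by auto
  then have "v' \<in> closure (cone_of F)" using v'(2) closure_rp2_iff by blast
  moreover have "open {v. \<phi> \<bullet> v \<noteq> 0}"
  proof -
    have "{v. \<phi> \<bullet> v \<noteq> 0} = - {v. \<phi> \<bullet> v = 0}" by auto
    then show ?thesis using closed_hyperplane[of \<phi> 0] by (simp add: open_Compl)
  qed
  ultimately obtain f where f: "f \<in> cone_of F" "\<phi> \<bullet> f \<noteq> 0"
    using v'(3) unfolding closure_iff_nhds_not_empty by blast
  have "N n *\<^sub>R (A (r n) *v f) \<in> cone_of F" for n
  proof -
    have f': "f \<noteq> 0" "rp2_of f \<in> F" using f(1) by (simp_all add: cone_of_def)
    have "A (r n) *v f \<noteq> 0" using A[of "r n"] by (intro invertible_mult_nonzero[OF _ f'(1)]) (simp add: preserves_def)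
    moreover have "rp2_of (A (r n) *v f) \<in> F"
      using F_invariant[OF g f'(2)] pA[of "r n"] proj_map_rp2_of[OF f'(1)] by metis
    ultimately show ?thesis using N[of n] by (simp add: cone_of_def rp2_of_scale)
  qed
  then have "rp2_of ((\<phi> \<bullet> f) *\<^sub>R u) \<in> closure F"
    using f(2) u by (intro rp2_of_limit_in_closure[OF _ lim]) simp_all
  then show ?thesis unfolding yu using f(2) by (simp add: rp2_of_scale)
qed

text \<open>That \<open>F\<close> lies in the closure of the domain is known only because its points
  are limits of orbits; this is what allows the hull to reach them. Passing from \<open>F\<close> to
  its closure keeps limits proper, since orbit points are inside the domain and the closure of
  \<open>F\<close> is not.\<close>

theorem boundary_accumulation_eq:
  assumes ns: "\<not> simplicial" and x: "x \<in> hull_interior a \<Omega> F"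
  shows "boundary_accumulation \<Gamma> (hull_interior a \<Omega> F) x = closure F"
proof (rule subset_antisym)
  define D where "D = hull_interior a \<Omega> F"
  have D: "open D" "D \<subseteq> \<Omega>" unfolding D_def hull_interior_def using interior_subset by auto
  have x\<Omega>: "x \<in> \<Omega>" using x D(2) D_def by blast
  have "y \<in> closure F" if "y \<in> frontier D" "y islimpt {g x | g. g \<in> \<Gamma>}" for y
  proof -
    have "y \<in> closure \<Omega>" using that(1) closure_mono[OF D(2)] unfolding frontier_def by blast
    then show ?thesis by (rule accumulation_in_closure_F[OF ns x _ that(2)])
  qed
  then show "boundary_accumulation \<Gamma> (hull_interior a \<Omega> F) x \<subseteq> closure F"
    unfolding boundary_accumulation_def D_def[symmetric] by blast
  have lim: "f islimpt {g x | g. g \<in> \<Gamma>}" if "f \<in> F" for f by (rule F_islimpt[OF ns that x\<Omega>])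
  have orb: "{g x | g. g \<in> \<Gamma>} \<subseteq> \<Omega>" using \<Gamma>_inv x\<Omega> by blast
  have "F \<subseteq> closure D"
  proof
    fix f assume f: "f \<in> F"
    have "f \<in> closure \<Omega>" using islimpt_subset[OF lim[OF f] orb] unfolding closure_def by simp
    then show "f \<in> closure D" unfolding D_def by (rule F_subset_closure_hull[OF f _ x])
  qed
  then have FD: "closure F \<subseteq> closure D" by (rule closure_minimal[OF _ closed_closure])
  have "y islimpt {g x | g. g \<in> \<Gamma>}" if y: "y \<in> closure F" for y
  proof (rule islimptI)
    fix T assume T: "y \<in> T" "open T"
    have "F \<inter> T \<noteq> {}" using y T unfolding closure_iff_nhds_not_empty by blast
    then obtain f where f: "f \<in> F" "f \<in> T" by blast
    obtain p where p: "p \<in> {g x | g. g \<in> \<Gamma>}" "p \<in> T"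
      by (rule islimptE[OF lim[OF f(1)] f(2) T(2)])
    have "p \<noteq> y" using p(1) orb y F_disjoint by blast
    then show "\<exists>p\<in>{g x | g. g \<in> \<Gamma>}. p \<in> T \<and> p \<noteq> y" using p by blast
  qed
  moreover have "closure F \<subseteq> frontier D"
  proof
    fix y assume y: "y \<in> closure F"
    then have "y \<notin> D" using F_disjoint D(2) by auto
    then show "y \<in> frontier D" using subsetD[OF FD y] unfolding frontier_def interior_open[OF D(1)] by simp
  qed
  ultimately show "closure F \<subseteq> boundary_accumulation \<Gamma> (hull_interior a \<Omega> F) x"
    unfolding boundary_accumulation_def D_def[symmetric] by blast
qed

end

section \<open>Actions on a triangle\<close>

text \<open>The octant is tested near its j-th edge, on the vectors axis j plus e times the all-ones
  vector. A negative entry would make coordinate i nonpositive for some e > 0, chosen according to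
  the sign of the row sum.\<close>

lemma nonneg_matrix_of_orthant:
  fixes M :: "real^'n::finite^'n"
  assumes M: "\<And>x. (\<And>i. x $ i > 0) \<Longrightarrow> \<forall>i. (M *v x) $ i > 0"
  shows "M $ i $ j \<ge> 0"
proof (rule ccontr)
  assume neg: "\<not> M $ i $ j \<ge> 0"
  define s where "s = (\<Sum>k\<in>UNIV. M $ i $ k)"
  have val: "(M *v (axis j 1 + e *\<^sub>R 1)) $ i = M $ i $ j + e * s" for e
  proof -
    have "(M *v axis j 1) $ i = M $ i $ j" by (simp add: matrix_vector_mult_basis column_def)
    moreover have "(M *v 1) $ i = s" by (simp add: matrix_vector_mult_def s_def)
    ultimately show ?thesis by (simp add: matrix_vector_right_distrib matrix_vector_mult_scaleR)
  qed
  have pos: "M $ i $ j + e * s > 0" if "e > 0" for e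
  proof -
    have "(axis j 1 + e *\<^sub>R 1 :: real^'n) $ k > 0" for k using that by (simp add: axis_def)
    then show ?thesis using M val by metis
  qed
  show False
  proof (cases "s > 0")
    case True
    then have "- (M $ i $ j) / s > 0" using neg by (intro divide_pos_pos) simp_all
    then show False using pos[of "- (M $ i $ j) / s"] True by simp
  next
    case False
    then show False using pos[of 1] neg by simp
  qed
qed

text \<open>M and its inverse are nonnegative, so each off-diagonal entry of a product of the two is
  a sum of nonnegative terms equal to zero. All these terms vanish, which leaves one nonzero entry
  in each row of M.\<close>

lemma monomial_of_orthant:
  fixes M N :: "real^'n::finite^'n"
  assumes MN: "M ** N = mat 1" "N ** M = mat 1"
    and M: "\<And>x. (\<And>i. x $ i > 0) \<Longrightarrow> \<forall>i. (M *v x) $ i > 0"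
    and N: "\<And>x. (\<And>i. x $ i > 0) \<Longrightarrow> \<forall>i. (N *v x) $ i > 0"
  obtains \<sigma> c where "bij \<sigma>" "\<And>i. c i > 0" "\<And>x i. (M *v x) $ i = c i * x $ \<sigma> i"
proof -
  have M0: "M $ i $ j \<ge> 0" for i j by (rule nonneg_matrix_of_orthant[OF M])
  have N0: "N $ i $ j \<ge> 0" for i j by (rule nonneg_matrix_of_orthant[OF N])
  have prod0: "A $ i $ k * B $ k $ j = 0"
    if "A ** B = mat 1" "\<And>i j. A $ i $ j \<ge> 0" "\<And>i j. B $ i $ j \<ge> 0" "i \<noteq> j" for A B :: "real^'n^'n" and i k j
  proof -
    have "(\<Sum>k\<in>UNIV. A $ i $ k * B $ k $ j) = (A ** B) $ i $ j" by (simp add: matrix_matrix_mult_def)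
    also have "\<dots> = 0" using that(1,4) by (simp add: mat_def)
    finally show ?thesis using that(2,3) by (simp add: sum_nonneg_eq_0_iff)
  qed
  have row: "\<exists>k. A $ i $ k > 0 \<and> B $ k $ i > 0"
    if "A ** B = mat 1" "\<And>i j. A $ i $ j \<ge> 0" "\<And>i j. B $ i $ j \<ge> 0" for A B :: "real^'n^'n" and i
  proof (rule ccontr)
    assume no: "\<nexists>k. A $ i $ k > 0 \<and> B $ k $ i > 0"
    have z: "A $ i $ k * B $ k $ i = 0" for k
    proof -
      have "\<not> (A $ i $ k > 0 \<and> B $ k $ i > 0)" using no by blast
      then show ?thesis using that(2)[of i k] that(3)[of k i] by (auto simp: less_le)
    qed
    have "(A ** B) $ i $ i = 0" by (simp only: matrix_matrix_mult_def vec_lambda_beta z sum.neutral_const)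
    then show False using that(1) by (simp add: mat_def)
  qed
  have "\<forall>i. \<exists>k. M $ i $ k > 0 \<and> N $ k $ i > 0" using row[OF MN(1) M0 N0] by blast
  then obtain \<sigma> where \<sigma>: "\<And>i. M $ i $ \<sigma> i > 0" "\<And>i. N $ \<sigma> i $ i > 0" by metis
  have only: "M $ i $ k = 0" if "k \<noteq> \<sigma> i" for i k
    using prod0[OF MN(2) N0 M0, of "\<sigma> i" k i] that \<sigma>(2)[of i] by auto
  have "inj \<sigma>"
  proof (rule injI, rule ccontr)
    fix i j assume "\<sigma> i = \<sigma> j" "i \<noteq> j"
    then show False using prod0[OF MN(1) M0 N0, of i j "\<sigma> i"] \<sigma>(1)[of i] \<sigma>(2)[of j] by simp
  qed
  then have "bij \<sigma>" by (simp add: bij_def finite_UNIV_inj_surj)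
  moreover have "(M *v x) $ i = M $ i $ \<sigma> i * x $ \<sigma> i" for x i
  proof -
    have "(M *v x) $ i = (\<Sum>k\<in>UNIV. M $ i $ k * x $ k)" by (simp add: matrix_vector_mult_def)
    also have "\<dots> = (\<Sum>k\<in>{\<sigma> i}. M $ i $ k * x $ k)" using only by (intro sum.mono_neutral_right) auto
    finally show ?thesis by simp
  qed
  ultimately show ?thesis using \<sigma>(1) that[of \<sigma> "\<lambda>i. M $ i $ \<sigma> i"] by blast
qed

lemma permutation_3_cases:
  fixes \<sigma> :: "3 \<Rightarrow> 3"
  assumes "bij \<sigma>"
  obtains (id) "\<sigma> = id"
    | (cycle) "\<And>i. \<sigma> i \<noteq> i" "\<And>i. \<sigma> (\<sigma> (\<sigma> i)) = i" "\<And>i. \<sigma> (\<sigma> i) \<noteq> i"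
    | (swap) i j m where "i \<noteq> j" "i \<noteq> m" "j \<noteq> m" "\<sigma> i = j" "\<sigma> j = i" "\<sigma> m = m"
proof -
  have ne: "\<sigma> 1 \<noteq> \<sigma> 2" "\<sigma> 1 \<noteq> \<sigma> 3" "\<sigma> 2 \<noteq> \<sigma> 3"
    using bij_is_inj[OF assms] by (simp_all add: inj_eq)
  consider "\<sigma> 1 = 1" "\<sigma> 2 = 2" "\<sigma> 3 = 3" | "\<sigma> 1 = 2" "\<sigma> 2 = 3" "\<sigma> 3 = 1" | "\<sigma> 1 = 3" "\<sigma> 2 = 1" "\<sigma> 3 = 2"
    | "\<sigma> 1 = 2" "\<sigma> 2 = 1" "\<sigma> 3 = 3" | "\<sigma> 1 = 3" "\<sigma> 2 = 2" "\<sigma> 3 = 1" | "\<sigma> 1 = 1" "\<sigma> 2 = 3" "\<sigma> 3 = 2"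
    using ne exhaust_3[of "\<sigma> 1"] exhaust_3[of "\<sigma> 2"] exhaust_3[of "\<sigma> 3"] by auto
  then show ?thesis
  proof cases
    case 1
    then have "\<forall>i. \<sigma> i = i" by (simp add: forall_3)
    then show ?thesis by (intro id) (simp add: fun_eq_iff)
  next
    case 2
    then have "\<forall>i. \<sigma> i \<noteq> i \<and> \<sigma> (\<sigma> (\<sigma> i)) = i \<and> \<sigma> (\<sigma> i) \<noteq> i" by (simp add: forall_3)
    then show ?thesis by (intro cycle) auto
  next
    case 3
    then have "\<forall>i. \<sigma> i \<noteq> i \<and> \<sigma> (\<sigma> (\<sigma> i)) = i \<and> \<sigma> (\<sigma> i) \<noteq> i" by (simp add: forall_3)
    then show ?thesis by (intro cycle) auto
  next
    case 4
    then show ?thesis using swap[of 1 2 3] by simp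
  next
    case 5
    then show ?thesis using swap[of 1 3 2] by simp
  next
    case 6
    then show ?thesis using swap[of 2 3 1] by simp
  qed
qed

lemma (in proper_cone) escapesD:
  assumes "escapes A" "x \<in> C" "strict_mono (r :: nat \<Rightarrow> nat)" "\<And>n. s n > (0::real)"
    "(\<lambda>n. s n *\<^sub>R (A (r n) *v x)) \<longlonglongrightarrow> z"
  shows "z \<notin> C"
proof -
  note bspec[OF assms(1)[unfolded escapes_def] assms(2)]
  then have "strict_mono r \<and> (\<forall>n. s n > 0) \<and> (\<lambda>n. s n *\<^sub>R (A (r n) *v x)) \<longlonglongrightarrow> z \<longrightarrow> z \<notin> C"
    by (elim allE)
  then show ?thesis using assms(3-5) by simp
qed

locale triangle_action = rp2_action \<Omega> a \<Gamma> for \<Omega> a \<Gamma> +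
  fixes P :: "real^3^3"
  assumes P: "invertible P" and P_C: "\<And>x. P *v x \<in> C \<longleftrightarrow> (\<forall>i. x $ i > 0)"
begin

text \<open>Homogeneous coordinates with respect to the vertices of the triangle; not the 0-simplex
  of the same name.\<close>

definition pt :: "real^3 \<Rightarrow> rp2" where "pt x = rp2_of (P *v x)"

text \<open>The coefficients c are determined only up to a common positive factor, so later
  statements use their ratios.\<close>

definition represents :: "(rp2 \<Rightarrow> rp2) \<Rightarrow> (3 \<Rightarrow> 3) \<Rightarrow> (3 \<Rightarrow> real) \<Rightarrow> bool"
  where "represents g \<sigma> c \<longleftrightarrow> bij \<sigma> \<and> (\<forall>i. c i > 0) \<and>
    (\<forall>x. (\<forall>i. x $ i > 0) \<longrightarrow> g (pt x) = pt (\<chi> i. c i * x $ \<sigma> i))"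

lemma pt_in: "\<forall>i. x $ i > 0 \<Longrightarrow> pt x \<in> \<Omega>"
  unfolding pt_def by (rule rp2_of_in_\<Omega>) (simp add: P_C)

lemma pt_scale: "k > 0 \<Longrightarrow> pt (k *\<^sub>R x) = pt x"
  unfolding pt_def by (simp add: matrix_vector_mult_scaleR rp2_of_scale)

lemma pt_eqD:
  assumes x: "\<forall>i. x $ i > 0" and y: "\<forall>i. y $ i > 0" and eq: "pt x = pt y"
  obtains k where "k > 0" "y = k *\<^sub>R x"
proof -
  have "P *v x \<in> C" "P *v y \<in> C" using x y P_C by auto
  then obtain k where k: "k > 0" "P *v y = k *\<^sub>R (P *v x)" using C_same_point eq unfolding pt_def by metis
  then have "matrix_inv P *v (P *v y) = matrix_inv P *v (P *v (k *\<^sub>R x))" by (simp add: matrix_vector_mult_scaleR)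
  then have "y = k *\<^sub>R x" by (simp add: matrix_vector_mul_assoc matrix_inv_mult[OF P])
  then show ?thesis using that k(1) by blast
qed

lemma representsD:
  assumes "represents g \<sigma> c"
  shows "bij \<sigma>" "c i > 0" "\<forall>i. x $ i > 0 \<Longrightarrow> g (pt x) = pt (\<chi> i. c i * x $ \<sigma> i)"
  using assms by (auto simp: represents_def)

lemma represents_exists:
  assumes g: "g \<in> \<Gamma>"
  shows "\<exists>\<sigma> c. represents g \<sigma> c"
proof -
  obtain A where A: "preserves A" "proj_map A = g" using lift_exists[OF g] by blast
  have iA: "invertible A" and AC: "\<And>x. A *v x \<in> C \<longleftrightarrow> x \<in> C" using A(1) by (auto simp: preserves_def)
  define Q B where "Q = matrix_inv P" and "B = matrix_inv A"
  have Q: "P *v (Q *v x) = x" "Q *v (P *v x) = x" and B: "A *v (B *v x) = x" "B *v (A *v x) = x" for x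
    unfolding Q_def B_def by (simp_all add: matrix_vector_mul_assoc matrix_inv_mult[OF P] matrix_inv_mult[OF iA])
  define M N where "M = Q ** A ** P" and "N = Q ** B ** P"
  have Mv: "M *v x = Q *v (A *v (P *v x))" and Nv: "N *v x = Q *v (B *v (P *v x))" for x
    by (simp_all add: M_def N_def matrix_vector_mul_assoc matrix_mul_assoc)
  have MN: "M ** N = mat 1" "N ** M = mat 1"
    unfolding matrix_eq by (simp_all add: matrix_vector_mul_assoc[symmetric] Mv Nv Q B)
  have "\<forall>i. (M *v x) $ i > 0" if "\<And>i. x $ i > 0" for x
  proof -
    have "P *v x \<in> C" using that P_C by blast
    then have "P *v (M *v x) \<in> C" unfolding Mv Q AC .
    then show ?thesis unfolding P_C .
  qed
  moreover have "\<forall>i. (N *v x) $ i > 0" if "\<And>i. x $ i > 0" for x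
  proof -
    have "A *v (B *v (P *v x)) \<in> C" using that P_C unfolding B by blast
    then have "P *v (N *v x) \<in> C" unfolding Nv Q AC .
    then show ?thesis unfolding P_C .
  qed
  ultimately obtain \<sigma> c where \<sigma>: "bij \<sigma>" "\<And>i. c i > 0" "\<And>x i. (M *v x) $ i = c i * x $ \<sigma> i"
    using monomial_of_orthant[OF MN] by blast
  have "represents g \<sigma> c"
    unfolding represents_def
  proof (intro conjI \<sigma>(1) allI impI \<sigma>(2))
    fix x :: "real^3" assume "\<forall>i. x $ i > 0"
    then have "P *v x \<in> C" using P_C by blast
    then have "g (pt x) = rp2_of (A *v (P *v x))" unfolding pt_def A(2)[symmetric] by (rule proj_map_rp2_of[OF C_nonzero])
    also have "\<dots> = pt (M *v x)" unfolding pt_def Mv Q ..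
    also have "M *v x = (\<chi> i. c i * x $ \<sigma> i)" by (simp add: vec_eq_iff \<sigma>(3))
    finally show "g (pt x) = pt (\<chi> i. c i * x $ \<sigma> i)" .
  qed
  then show ?thesis by blast
qed

lemma represents_unique:
  assumes g: "represents g \<sigma> c" "represents g \<tau> e"
  obtains k where "k > 0" "\<sigma> = \<tau>" "\<And>i. c i = k * e i"
proof -
  have eq: "\<exists>k>0. \<forall>i. c i * x $ \<sigma> i = k * (e i * x $ \<tau> i)" if x: "\<forall>i. x $ i > 0" for x :: "real^3"
  proof -
    have "pt (\<chi> i. e i * x $ \<tau> i) = pt (\<chi> i. c i * x $ \<sigma> i)" using representsD(3)[OF g(1) x] representsD(3)[OF g(2) x] by simp
    then obtain k where "k > 0" "(\<chi> i. c i * x $ \<sigma> i) = k *\<^sub>R (\<chi> i. e i * x $ \<tau> i)"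
      using pt_eqD[of "\<chi> i. e i * x $ \<tau> i" "\<chi> i. c i * x $ \<sigma> i"] x representsD(2)[OF g(1)] representsD(2)[OF g(2)]
      by (metis (no_types, lifting) mult_pos_pos vec_lambda_beta)
    then show ?thesis by (auto simp: vec_eq_iff)
  qed
  obtain k where k: "k > 0" "\<And>i. c i = k * e i" using eq[of 1] by auto
  have e0: "e i > 0" for i by (rule representsD(2)[OF g(2)])
  have "x $ \<sigma> i = x $ \<tau> i" if x: "\<forall>i. x $ i > 0" for x :: "real^3" and i
  proof -
    obtain j where j: "j > 0" "\<And>i. c i * x $ \<sigma> i = j * (e i * x $ \<tau> i)" using eq[OF x] by blast
    have kj: "k * x $ \<sigma> i = j * x $ \<tau> i" for i
    proof -
      have "e i * (k * x $ \<sigma> i) = e i * (j * x $ \<tau> i)" using j(2)[of i] k(2)[of i] by (simp add: ac_simps)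
      then show ?thesis using e0[of i] by simp
    qed
    \<comment> \<open>Summing over all coordinates removes the permutations, so the scalar j found
      for x agrees with the scalar k found for the all-ones vector.\<close>
    have s: "(\<Sum>i\<in>UNIV. x $ \<rho> i) = (\<Sum>i\<in>UNIV. x $ i)" if "bij \<rho>" for \<rho> :: "3 \<Rightarrow> 3"
      using sum.reindex_bij_betw[OF that, of "($) x"] .
    have "k * (\<Sum>i\<in>UNIV. x $ \<sigma> i) = j * (\<Sum>i\<in>UNIV. x $ \<tau> i)" unfolding sum_distrib_left kj ..
    then have "k * (\<Sum>i\<in>UNIV. x $ i) = j * (\<Sum>i\<in>UNIV. x $ i)"
      unfolding s[OF representsD(1)[OF g(1)]] s[OF representsD(1)[OF g(2)]] .
    moreover have "(\<Sum>i\<in>UNIV. x $ i) > 0" using x by (intro sum_pos) auto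
    ultimately have "k = j" by simp
    then show ?thesis using kj[of i] k(1) by simp
  qed
  note same = this
  have "\<sigma> = \<tau>"
  proof
    fix i
    \<comment> \<open>A positive vector with one distinguished coordinate, which detects the
      index.\<close>
    have "(1 + axis (\<sigma> i) 1 :: real^3) $ \<sigma> i = (1 + axis (\<sigma> i) 1 :: real^3) $ \<tau> i"
      by (rule same) (simp add: axis_def)
    then show "\<sigma> i = \<tau> i" by (simp add: axis_def split: if_splits)
  qed
  then show ?thesis using that k by blast
qed

text \<open>The permutations act on indices, so they compose in the opposite order.\<close>

lemma represents_comp:
  assumes g: "represents g \<sigma> c" and h: "represents h \<tau> e"
  shows "represents (g \<circ> h) (\<tau> \<circ> \<sigma>) (\<lambda>i. c i * e (\<sigma> i))"
  unfolding represents_def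
proof (intro conjI allI impI)
  show "bij (\<tau> \<circ> \<sigma>)" using representsD(1) g h bij_comp by blast
  show "c i * e (\<sigma> i) > 0" for i using representsD(2)[OF g] representsD(2)[OF h] by simp
  fix x :: "real^3" assume x: "\<forall>i. x $ i > 0"
  have y: "\<forall>i. (\<chi> i. e i * x $ \<tau> i) $ i > 0" using x representsD(2)[OF h] by simp
  show "(g \<circ> h) (pt x) = pt (\<chi> i. c i * e (\<sigma> i) * x $ (\<tau> \<circ> \<sigma>) i)"
    using representsD(3)[OF h x] representsD(3)[OF g y] by (simp add: mult.assoc)
qed

lemma represents_id: "represents id id (\<lambda>i. 1)"
  by (simp add: represents_def)

lemma scalar_imp_id:
  assumes g: "g \<in> \<Gamma>" "represents g id c" and const: "\<And>i. c i = k"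
  shows "g = id"
proof -
  have one: "\<forall>i. (1 :: real^3) $ i > 0" by simp
  have "k > 0" using representsD(2)[OF g(2)] const by metis
  moreover have "(\<chi> i. c i * (1 :: real^3) $ id i) = k *\<^sub>R 1" by (simp add: vec_eq_iff const)
  ultimately have "g (pt 1) = pt 1" using representsD(3)[OF g(2) one] pt_scale by simp
  then show ?thesis by (rule \<Gamma>_free[OF g(1) pt_in[OF one]])
qed

text \<open>The cube of an element permuting the vertices cyclically is the identity.\<close>

lemma not_cycle:
  assumes g: "g \<in> \<Gamma>" "represents g \<sigma> c" and ne: "\<sigma> i \<noteq> i" "\<sigma> (\<sigma> i) \<noteq> i"
  shows False
proof -
  have b: "bij \<sigma>" by (rule representsD(1)[OF g(2)])
  show False using b
  proof (cases rule: permutation_3_cases)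
    case cycle
    have r: "represents (g \<circ> g \<circ> g) (\<sigma> \<circ> (\<sigma> \<circ> \<sigma>)) (\<lambda>i. c i * c (\<sigma> i) * c ((\<sigma> \<circ> \<sigma>) i))"
      by (intro represents_comp g(2))
    have s: "\<sigma> \<circ> (\<sigma> \<circ> \<sigma>) = id" using cycle(2) by (simp add: fun_eq_iff)
    \<comment> \<open>Going once around the cycle multiplies all three coefficients, whatever the
      starting index, so the cube is scalar.\<close>
    have "c i * c (\<sigma> i) * c ((\<sigma> \<circ> \<sigma>) i) = (\<Prod>j\<in>UNIV. c j)" for i
    proof -
      have d: "i \<noteq> \<sigma> i" "i \<noteq> \<sigma> (\<sigma> i)" "\<sigma> i \<noteq> \<sigma> (\<sigma> i)" using cycle by metis+
      have "card {i, \<sigma> i, \<sigma> (\<sigma> i)} = CARD(3)" using d by simp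
      then have "{i, \<sigma> i, \<sigma> (\<sigma> i)} = UNIV" by (intro card_eq_UNIV_imp_eq_UNIV) simp_all
      then have "(\<Prod>j\<in>UNIV. c j) = (\<Prod>j\<in>{i, \<sigma> i, \<sigma> (\<sigma> i)}. c j)" by simp
      also have "\<dots> = c i * c (\<sigma> i) * c (\<sigma> (\<sigma> i))" using d by (simp add: mult.assoc)
      finally show ?thesis by simp
    qed
    then have "g \<circ> g \<circ> g = id" using r unfolding s by (intro scalar_imp_id \<Gamma>_comp g(1))
    then have "g ^^ 3 = id" by (simp only: numeral_3_eq_3 funpow.simps o_assoc comp_id)
    then have "g = id" using torsion_free[OF g(1), of 3] by simp
    then obtain k :: real where "\<sigma> = id" using represents_unique g(2) represents_id by metis
    then show False using ne by simp
  next
    case (swap j k m)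
    then have "i = j \<or> i = k \<or> i = m"
    proof -
      have "card {j, k, m} = CARD(3)" using swap by simp
      then have "{j, k, m} = UNIV" by (intro card_eq_UNIV_imp_eq_UNIV) simp_all
      then show ?thesis by blast
    qed
    then show False using ne swap by metis
  qed (use ne in simp)
qed

text \<open>Infinitely many such elements, with coefficients normalised to 1 in the first place,
  would have a convergent subsequence. The bounds on both c i / c j and its inverse keep the limit
  in the open octant, so an orbit would converge inside the domain.\<close>

lemma finite_bounded_diagonal: "finite {g \<in> \<Gamma>. \<exists>c. represents g id c \<and> (\<forall>i j. c i / c j \<le> B)}" (is "finite ?G")
proof (rule ccontr)
  assume "infinite ?G"
  then obtain g :: "nat \<Rightarrow> _" where g: "inj g" "range g \<subseteq> ?G" using infinite_countable_subset[of ?G] by blast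
  have g\<Gamma>: "g n \<in> \<Gamma>" for n using g(2) by blast
  have "\<exists>c. represents (g n) id c \<and> (\<forall>i j. c i / c j \<le> B)" for n using g(2) by blast
  then obtain c where c: "\<And>n. represents (g n) id (c n)" "\<And>n i j. c n i / c n j \<le> B" by metis
  have c0: "c n i > 0" for n i by (rule representsD(2)[OF c(1)])
  define y :: "nat \<Rightarrow> real^3" where "y n = (\<chi> i. c n i / c n 1)" for n
  have y0: "\<forall>i. y n $ i > 0" for n using c0 by (simp add: y_def)
  have yB: "y n $ i \<le> B" "1 \<le> B * y n $ i" for n i
  proof -
    show "y n $ i \<le> B" using c(2) by (simp add: y_def)
    show "1 \<le> B * y n $ i" using c(2)[of n 1 i] c0[of n 1] c0[of n i] by (simp add: y_def field_simps)
  qed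
  have "norm (y n) \<le> 3 * B" for n
  proof -
    have "norm (y n) \<le> (\<Sum>i\<in>UNIV. \<bar>y n $ i\<bar>)" by (rule norm_le_l1_cart)
    also have "\<dots> \<le> (\<Sum>i\<in>(UNIV :: 3 set). B)" using yB(1) y0 by (intro sum_mono) (simp add: abs_of_pos)
    finally show ?thesis by simp
  qed
  then have "bounded (range y)" by (auto simp: bounded_iff)
  then obtain l r where lr: "strict_mono (r :: nat \<Rightarrow> nat)" "(y \<circ> r) \<longlonglongrightarrow> l"
    using bounded_imp_convergent_subsequence by blast
  have l0: "\<forall>i. l $ i > 0"
  proof
    fix i
    have lim: "(\<lambda>n. (y \<circ> r) n $ i) \<longlonglongrightarrow> l $ i" by (rule tendsto_vec_nth[OF lr(2)])
    have "1 \<le> B * l $ i"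
      by (rule LIMSEQ_le_const[OF tendsto_mult[OF tendsto_const lim]]) (simp add: yB(2))
    moreover have "0 \<le> l $ i"
      by (rule LIMSEQ_le_const[OF lim]) (simp add: y0 less_imp_le)
    ultimately show "l $ i > 0" by (cases "l $ i = 0") auto
  qed
  have "\<exists>A. preserves A \<and> proj_map A = g n" for n using lift_exists[OF g\<Gamma>] by blast
  then obtain A where A: "\<And>n. preserves (A n)" "\<And>n. proj_map (A n) = g n" by metis
  have PC1: "P *v 1 \<in> C" unfolding P_C by simp
  have esc: "escapes A"
  proof (rule finite_to_one_escapes[OF A(1)])
    show "proj_map (A n) \<in> \<Gamma>" for n unfolding A(2) by (rule g\<Gamma>)
    show "finite {n. proj_map (A n) = h}" for h
      using finite_vimageI[OF _ g(1), of "{h}"] by (simp add: A(2) vimage_def)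
  qed
  have "\<exists>s>0. P *v y n = s *\<^sub>R (A n *v (P *v 1))" for n
  proof (rule C_same_point)
    show "A n *v (P *v 1) \<in> C" by (rule preserves_C[OF A(1) PC1])
    show "P *v y n \<in> C" unfolding P_C by (rule y0)
    have "rp2_of (A n *v (P *v 1)) = g n (pt 1)"
      unfolding pt_def A(2)[symmetric] by (rule proj_map_rp2_of[OF C_nonzero[OF PC1], symmetric])
    also have "\<dots> = pt (\<chi> i. c n i * (1 :: real^3) $ id i)" by (rule representsD(3)[OF c(1)]) simp
    also have "(\<chi> i. c n i * (1 :: real^3) $ id i) = c n 1 *\<^sub>R y n"
      using c0[of n 1] by (simp add: vec_eq_iff y_def)
    also have "pt \<dots> = pt (y n)" by (rule pt_scale[OF c0])
    finally show "rp2_of (A n *v (P *v 1)) = rp2_of (P *v y n)" unfolding pt_def .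
  qed blast
  then obtain s where s: "\<And>n. s n > 0" "\<And>n. P *v y n = s n *\<^sub>R (A n *v (P *v 1))" by metis
  have "(\<lambda>n. P *v (y \<circ> r) n) \<longlonglongrightarrow> P *v l"
    by (rule tendsto_matrix_vector_mult[OF tendsto_const lr(2)])
  then have sl: "(\<lambda>n. s (r n) *\<^sub>R (A (r n) *v (P *v 1))) \<longlonglongrightarrow> P *v l" by (simp add: s(2))
  have "P *v l \<notin> C" by (rule escapesD[OF esc PC1 lr(1) s(1) sl])
  then show False using l0 P_C by blast
qed

definition rat :: "(rp2 \<Rightarrow> rp2) \<Rightarrow> 3 \<Rightarrow> 3 \<Rightarrow> real"
  where "rat g i j = (let c = (SOME c. \<exists>\<sigma>. represents g \<sigma> c) in c i / c j)"

lemma rat_eq: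
  assumes "represents g \<sigma> c"
  shows "rat g i j = c i / c j"
proof -
  define e where "e = (SOME c. \<exists>\<sigma>. represents g \<sigma> c)"
  have "\<exists>\<sigma>. represents g \<sigma> e" unfolding e_def
    by (rule someI_ex[where P = "\<lambda>c. \<exists>\<sigma>. represents g \<sigma> c"]) (use assms in blast)
  then obtain \<tau> where r: "represents g \<tau> e" by blast
  obtain k where k: "k > 0" "\<And>i. e i = k * c i" by (rule represents_unique[OF r assms]) (rule that)
  have "rat g i j = e i / e j" unfolding rat_def e_def Let_def ..
  then show ?thesis using k by simp
qed

lemma ln_rat_comp:
  assumes g: "represents g id c" and h: "represents h id e"
  shows "ln (rat (g \<circ> h) i j) = ln (rat g i j) + ln (rat h i j)"
proof -
  have gh: "represents (g \<circ> h) (id \<circ> id) (\<lambda>i. c i * e (id i))" by (rule represents_comp[OF g h])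
  have "c k > 0" "e k > 0" for k using representsD(2)[OF g] representsD(2)[OF h] by blast+
  then have "ln ((c i * e i) / (c j * e j)) = (ln (c i) + ln (e i)) - (ln (c j) + ln (e j))"
    "ln (c i / c j) = ln (c i) - ln (c j)" "ln (e i / e j) = ln (e i) - ln (e j)"
    by (simp_all only: ln_divide_pos ln_mult_pos mult_pos_pos)
  then show ?thesis unfolding rat_eq[OF gh] rat_eq[OF g] rat_eq[OF h] by simp
qed

lemma finite_bounded_ln_rat:
  "finite {g \<in> \<Gamma>. \<exists>c. represents g id c \<and> (\<forall>i. \<bar>ln (rat g i m)\<bar> \<le> R)}"
proof (rule finite_subset[OF _ finite_bounded_diagonal[of "exp (2 * R)"]], rule subsetI)
  fix g assume "g \<in> {g \<in> \<Gamma>. \<exists>c. represents g id c \<and> (\<forall>i. \<bar>ln (rat g i m)\<bar> \<le> R)}"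
  then obtain c where g: "g \<in> \<Gamma>" "represents g id c" and b: "\<And>i. \<bar>ln (rat g i m)\<bar> \<le> R" by blast
  have c0: "c i > 0" for i by (rule representsD(2)[OF g(2)])
  \<comment> \<open>The ratio is split through the index m, which costs the bound R twice.\<close>
  have "c i / c j \<le> exp (2 * R)" for i j
  proof -
    have "ln (c i / c j) = ln (c i / c m) - ln (c j / c m)"
      by (simp only: ln_divide_pos c0)
    also have "\<dots> = ln (rat g i m) - ln (rat g j m)" unfolding rat_eq[OF g(2)] ..
    also have "\<dots> \<le> 2 * R" using b[of i] b[of j] by linarith
    finally have "exp (ln (c i / c j)) \<le> exp (2 * R)" by simp
    then show ?thesis using c0 by simp
  qed
  then show "g \<in> {g \<in> \<Gamma>. \<exists>c. represents g id c \<and> (\<forall>i j. c i / c j \<le> exp (2 * R))}" using g by blast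
qed

lemma ln_rat_zero:
  assumes g: "g \<in> \<Gamma>" "represents g id c" and z: "\<And>i. ln (rat g i m) = 0"
  shows "g = id"
proof (rule scalar_imp_id[OF g])
  fix i
  have "c i / c m > 0" using representsD(2)[OF g(2)] by simp
  then have "c i / c m = 1" using z[of i] unfolding rat_eq[OF g(2)] by simp
  then show "c i = c m" by simp
qed

end

section \<open>Euler characteristic of quotients of a triangle\<close>

locale triangle_cover = triangle_action \<Omega> a \<Gamma> P + galois_cover \<Omega> q S \<Gamma>
  for \<Omega> a \<Gamma> P and q :: "rp2 \<Rightarrow> 'a::topological_space" and S
begin

text \<open>Logarithms of the ratios to the third coefficient make the group a discrete group of
  translations of the plane, written as complex numbers.\<close>

lemma euler_char_nonneg_of_diagonal:
  assumes all: "\<And>g. g \<in> \<Gamma> \<Longrightarrow> \<exists>c. represents g id c"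
  shows "euler_char S \<ge> 0"
proof (rule euler_char_nonneg_translations)
  define \<tau> where "\<tau> g = Complex (ln (rat g 1 3)) (ln (rat g 2 3))" for g
  have r33: "ln (rat g 3 3) = 0" if g: "g \<in> \<Gamma>" for g
  proof -
    obtain c where c: "represents g id c" using all[OF g] by blast
    show ?thesis unfolding rat_eq[OF c] using representsD(2)[OF c, of 3] by simp
  qed
  show "\<tau> (g \<circ> h) = \<tau> g + \<tau> h" if gh: "g \<in> \<Gamma>" "h \<in> \<Gamma>" for g h
  proof -
    obtain c e where "represents g id c" "represents h id e" using all gh by blast
    then show ?thesis unfolding \<tau>_def by (simp add: ln_rat_comp complex_eq_iff)
  qed
  show "g = id" if g: "g \<in> \<Gamma>" and z: "\<tau> g = 0" for g
  proof -
    obtain c where c: "represents g id c" using all[OF g] by blast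
    have "\<forall>i. ln (rat g i 3) = 0" using z r33[OF g] by (simp add: forall_3 \<tau>_def complex_eq_iff)
    then show ?thesis using ln_rat_zero[OF g c, of 3] by blast
  qed
  show "finite {x \<in> \<tau> ` \<Gamma>. cmod x \<le> R}" for R
  proof (rule finite_subset[OF _ finite_imageI[OF finite_bounded_ln_rat[of 3 R], of \<tau>]], rule subsetI)
    fix x assume "x \<in> {x \<in> \<tau> ` \<Gamma>. cmod x \<le> R}"
    then obtain g where g: "g \<in> \<Gamma>" "x = \<tau> g" and R: "cmod x \<le> R" by blast
    obtain c where c: "represents g id c" using all[OF g(1)] by blast
    have "\<bar>ln (rat g 1 3)\<bar> \<le> R" "\<bar>ln (rat g 2 3)\<bar> \<le> R"
      using abs_Re_le_cmod[of x] abs_Im_le_cmod[of x] R by (simp_all add: g(2) \<tau>_def)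
    then have "\<forall>i. \<bar>ln (rat g i 3)\<bar> \<le> R" using r33[OF g(1)] by (simp add: forall_3)
    then show "x \<in> \<tau> ` {g \<in> \<Gamma>. \<exists>c. represents g id c \<and> (\<forall>i. \<bar>ln (rat g i 3)\<bar> \<le> R)}" using g c by blast
  qed
qed

text \<open>If some element \<open>g\<^sub>0\<close> swaps two vertices, then modulo boundaries \<open>4 g\<close> is homologous to
  \<open>g\<^sup>2 (g\<^sub>0 g\<^sup>2 g\<^sub>0\<^sup>-\<^sup>1)\<close>, which commutes with the swap.\<close>

lemma euler_char_nonneg_of_swap:
  assumes g0: "g0 \<in> \<Gamma>" "represents g0 \<sigma> d"
    and ijm: "i \<noteq> j" "i \<noteq> m" "j \<noteq> m" "\<sigma> i = j" "\<sigma> j = i" "\<sigma> m = m"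
  shows "euler_char S \<ge> 0"
proof -
  have "card {i, j, m} = CARD(3)" using ijm by simp
  then have U: "{i, j, m} = UNIV" by (intro card_eq_UNIV_imp_eq_UNIV) simp_all
  have all: "(\<forall>k. Q k) \<longleftrightarrow> Q i \<and> Q j \<and> Q m" for Q :: "3 \<Rightarrow> bool"
  proof -
    have "(\<forall>k. Q k) \<longleftrightarrow> (\<forall>k\<in>{i, j, m}. Q k)" unfolding U by simp
    then show ?thesis by simp
  qed
  \<comment> \<open>The diagonal elements with equal coefficients at the two swapped vertices. One
    ratio determines such an element, so their logarithms form a discrete subgroup of the
    line.\<close>
  define \<Delta> where "\<Delta> = {g \<in> \<Gamma>. \<exists>c. represents g id c \<and> c i = c j}"
  define \<tau> where "\<tau> g = ln (rat g i m)" for g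
  have rat_all: "(\<forall>k. Q (ln (rat g k m))) \<longleftrightarrow> Q (\<tau> g) \<and> Q 0"
    if g: "represents g id c" "c i = c j" for g c and Q :: "real \<Rightarrow> bool"
    unfolding all \<tau>_def rat_eq[OF g(1)] using g(2) representsD(2)[OF g(1), of m] by simp
  have sq: "\<exists>c. represents (g \<circ> g) id c" if g: "g \<in> \<Gamma>" for g
  proof -
    obtain \<pi> c where c: "represents g \<pi> c" using represents_exists[OF g] by blast
    have "\<pi> \<circ> \<pi> = id"
    proof (cases rule: permutation_3_cases[OF representsD(1)[OF c]])
      case 2
      show ?thesis using not_cycle[OF g c 2(1) 2(3)] by (rule FalseE)
    next
      case (3 i' j' m')
      have "card {i', j', m'} = CARD(3)" using 3 by simp
      then have U': "{i', j', m'} = UNIV" by (intro card_eq_UNIV_imp_eq_UNIV) simp_all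
      have "\<forall>k\<in>{i', j', m'}. \<pi> (\<pi> k) = k" using 3 by simp
      then show ?thesis unfolding U' by (simp add: fun_eq_iff)
    qed simp
    then show ?thesis using represents_comp[OF c c] by auto
  qed
  have \<sigma>\<sigma>: "\<sigma> (\<sigma> k) = k" for k
  proof -
    have "\<forall>k. \<sigma> (\<sigma> k) = k" unfolding all using ijm by simp
    then show ?thesis by blast
  qed
  \<comment> \<open>Conjugation by the swap permutes the coefficients of a diagonal element, up to a
    common factor. The product of the element and its conjugate is therefore symmetric in i and
    j.\<close>
  have conj: "\<exists>k\<in>\<Gamma>. \<exists>e. k \<circ> g0 = g0 \<circ> g \<and> represents k id e \<and> (\<exists>t>0. \<forall>l. e l = t * c (\<sigma> l))"
    if g: "g \<in> \<Gamma>" "represents g id c" for g c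
  proof -
    obtain h0 where h0: "h0 \<in> \<Gamma>" "h0 \<circ> g0 = id" using \<Gamma>_inverse[OF g0(1)] by blast
    define k where "k = g0 \<circ> g \<circ> h0"
    have k: "k \<in> \<Gamma>" unfolding k_def by (intro \<Gamma>_comp g0 g h0)
    have kg: "k \<circ> g0 = g0 \<circ> g" unfolding k_def o_assoc[symmetric] h0(2) by simp
    obtain \<pi> e where e: "represents k \<pi> e" using represents_exists[OF k] by blast
    have r1: "represents (g0 \<circ> g) (\<sigma> \<circ> \<pi>) (\<lambda>l. e l * d (\<pi> l))" using represents_comp[OF e g0(2)] unfolding kg .
    have r2: "represents (g0 \<circ> g) (id \<circ> \<sigma>) (\<lambda>l. d l * c (\<sigma> l))" by (rule represents_comp[OF g0(2) g(2)])
    obtain t where t: "t > 0" "\<sigma> \<circ> \<pi> = id \<circ> \<sigma>" "\<And>l. e l * d (\<pi> l) = t * (d l * c (\<sigma> l))"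
      by (rule represents_unique[OF r1 r2]) blast
    have "\<pi> l = l" for l
    proof -
      have "\<sigma> (\<sigma> (\<pi> l)) = \<sigma> (\<sigma> l)" using t(2) by (simp add: fun_eq_iff)
      then show ?thesis unfolding \<sigma>\<sigma> .
    qed
    then have \<pi>: "\<pi> = id" by (simp add: fun_eq_iff)
    have "e l = t * c (\<sigma> l)" for l
      using t(3)[of l] representsD(2)[OF g0(2), of l] unfolding \<pi> by simp
    then show ?thesis using k kg e t(1) unfolding \<pi> by blast
  qed
  show ?thesis
  proof (rule euler_char_nonneg_cyclic[of \<Delta> \<tau>])
    show "\<Delta> \<subseteq> \<Gamma>" unfolding \<Delta>_def by blast
    show "id \<in> \<Delta>" unfolding \<Delta>_def using \<Gamma>_id represents_id by blast
    show "g \<circ> h \<in> \<Delta>" if gh: "g \<in> \<Delta>" "h \<in> \<Delta>" for g h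
    proof -
      obtain c e where g: "g \<in> \<Gamma>" "represents g id c" "c i = c j" and h: "h \<in> \<Gamma>" "represents h id e" "e i = e j"
        using gh unfolding \<Delta>_def by blast
      have "represents (g \<circ> h) id (\<lambda>l. c l * e l)" using represents_comp[OF g(2) h(2)] by simp
      moreover have "c i * e i = c j * e j" using g(3) h(3) by simp
      ultimately show ?thesis unfolding \<Delta>_def using \<Gamma>_comp[OF g(1) h(1)] by blast
    qed
    show "\<exists>h\<in>\<Delta>. h \<circ> g = id" if gD: "g \<in> \<Delta>" for g
    proof -
      obtain c where g: "g \<in> \<Gamma>" "represents g id c" "c i = c j" using gD unfolding \<Delta>_def by blast
      obtain h where h: "h \<in> \<Gamma>" "h \<circ> g = id" using \<Gamma>_inverse[OF g(1)] by blast
      obtain \<pi> e where e: "represents h \<pi> e" using represents_exists[OF h(1)] by blast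
      have r: "represents id (id \<circ> \<pi>) (\<lambda>l. e l * c (\<pi> l))" using represents_comp[OF e g(2)] unfolding h(2) .
      obtain t where t: "id \<circ> \<pi> = id" "\<And>l. e l * c (\<pi> l) = t * 1" by (rule represents_unique[OF r represents_id]) blast
      have \<pi>: "\<pi> = id" using t(1) by simp
      have "e i * c j = e j * c j" using t(2)[of i] t(2)[of j] g(3) unfolding \<pi> by simp
      then have "e i = e j" using representsD(2)[OF g(2), of j] by simp
      then show ?thesis using h e unfolding \<Delta>_def \<pi> by blast
    qed
    show "\<tau> (g \<circ> h) = \<tau> g + \<tau> h" if gh: "g \<in> \<Delta>" "h \<in> \<Delta>" for g h
    proof -
      obtain c e where "represents g id c" "represents h id e" using gh unfolding \<Delta>_def by blast
      then show ?thesis unfolding \<tau>_def by (rule ln_rat_comp)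
    qed
    show "g = id" if "g \<in> \<Delta>" "\<tau> g = 0" for g
    proof -
      obtain c where g: "g \<in> \<Gamma>" "represents g id c" "c i = c j" using \<open>g \<in> \<Delta>\<close> unfolding \<Delta>_def by blast
      have "\<forall>k. ln (rat g k m) = 0" using rat_all[OF g(2,3), of "\<lambda>x. x = 0"] \<open>\<tau> g = 0\<close> by blast
      then show ?thesis using ln_rat_zero[OF g(1,2)] by blast
    qed
    show "finite {x \<in> \<tau> ` \<Delta>. \<bar>x\<bar> \<le> R}" for R
    proof (rule finite_subset[OF _ finite_imageI[OF finite_bounded_ln_rat[of m R], of \<tau>]], rule subsetI)
      fix x assume "x \<in> {x \<in> \<tau> ` \<Delta>. \<bar>x\<bar> \<le> R}"
      then obtain g c where g: "g \<in> \<Gamma>" "represents g id c" "c i = c j" "x = \<tau> g" and R: "\<bar>x\<bar> \<le> R"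
        unfolding \<Delta>_def by blast
      have "\<bar>0::real\<bar> \<le> R" using R by linarith
      then have "\<forall>k. \<bar>ln (rat g k m)\<bar> \<le> R" using rat_all[OF g(2,3), of "\<lambda>x. \<bar>x\<bar> \<le> R"] R g(4) by blast
      then show "x \<in> \<tau> ` {g \<in> \<Gamma>. \<exists>c. represents g id c \<and> (\<forall>k. \<bar>ln (rat g k m)\<bar> \<le> R)}" using g by blast
    qed
    show "\<exists>h\<in>\<Delta>. \<exists>n::int. n \<noteq> 0 \<and> bdry 1 Y (frag_cmul n (loop g) - loop h)" if g: "g \<in> \<Gamma>" for g
    proof -
      obtain c where c: "represents (g \<circ> g) id c" using sq[OF g] by blast
      have gg: "g \<circ> g \<in> \<Gamma>" by (rule \<Gamma>_comp[OF g g])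
      obtain k e t where k: "k \<in> \<Gamma>" "k \<circ> g0 = g0 \<circ> (g \<circ> g)" "represents k id e" "t > 0" "\<And>l. e l = t * c (\<sigma> l)"
        using conj[OF gg c] by blast
      define h where "h = (g \<circ> g) \<circ> k"
      have h: "h \<in> \<Gamma>" unfolding h_def by (rule \<Gamma>_comp[OF gg k(1)])
      have "represents h id (\<lambda>l. c l * e l)" using represents_comp[OF c k(3)] unfolding h_def by simp
      moreover have "c i * e i = c j * e j" unfolding k(5) ijm by simp
      ultimately have "h \<in> \<Delta>" unfolding \<Delta>_def using h by blast
      moreover have "bdry 1 Y (frag_cmul 4 (loop g) - loop h)"
      proof -
        have b1: "bdry 1 Y (loop (g \<circ> g) - (loop g + loop g))" by (rule loop_comp[OF g g])
        have b2: "bdry 1 Y (loop h - (loop (g \<circ> g) + loop k))" unfolding h_def by (rule loop_comp[OF gg k(1)])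
        have b3: "bdry 1 Y (loop (k \<circ> g0) - (loop k + loop g0))" by (rule loop_comp[OF k(1) g0(1)])
        have b4: "bdry 1 Y (loop (k \<circ> g0) - (loop g0 + loop (g \<circ> g)))" unfolding k(2) by (rule loop_comp[OF g0(1) gg])
        have "frag_cmul 4 (loop g) = loop g + loop g + (loop g + loop g)"
          using frag_cmul_distrib[of 1 1 "loop g"] frag_cmul_distrib[of 2 2 "loop g"] by simp
        \<comment> \<open>Conjugation is invisible in homology: k g0 = g0 g^2 shows that the loops
          of k and of g^2 are homologous, and each is homologous to twice the loop of g.\<close>
        then have "frag_cmul 4 (loop g) - loop h =
          (loop (k \<circ> g0) - (loop k + loop g0)) - (loop (k \<circ> g0) - (loop g0 + loop (g \<circ> g)))
          - (loop h - (loop (g \<circ> g) + loop k)) - (loop (g \<circ> g) - (loop g + loop g)) - (loop (g \<circ> g) - (loop g + loop g))"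
          by (simp add: algebra_simps)
        then show ?thesis using b1 b2 b3 b4 by (simp only: singular_relboundary_diff)
      qed
      ultimately show ?thesis by (intro bexI[of _ h] exI[of _ 4]) simp_all
    qed
  qed
qed

theorem euler_char_nonneg: "euler_char S \<ge> 0"
proof (cases "\<forall>g\<in>\<Gamma>. \<exists>c. represents g id c")
  case True
  then show ?thesis using euler_char_nonneg_of_diagonal by blast
next
  case False
  then obtain g where g: "g \<in> \<Gamma>" "\<nexists>c. represents g id c" by blast
  obtain \<sigma> d where d: "represents g \<sigma> d" using represents_exists[OF g(1)] by blast
  show ?thesis
  proof (cases rule: permutation_3_cases[OF representsD(1)[OF d]])
    case 1
    then show ?thesis using d g(2) by blast
  next
    case 2
    show ?thesis using not_cycle[OF g(1) d 2(1) 2(3)] by (rule FalseE)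
  next
    case (3 i j m)
    then show ?thesis by (rule euler_char_nonneg_of_swap[OF g(1) d])
  qed
qed

end

section \<open>Developing maps\<close>

lemma covering_space_homeomorphic:
  fixes p :: "'b::topological_space \<Rightarrow> 'a::topological_space" and f :: "'b \<Rightarrow> 'c::topological_space"
  assumes cov: "covering_space St p S" and h: "homeomorphism St W f f'"
  shows "covering_space W (p \<circ> f') S"
  unfolding covering_space_def
proof (intro conjI ballI)
  note h' = homeomorphism_symD[OF h]
  have im: "f' ` W = St" "f ` St = W" by (rule homeomorphism_image2[OF h], rule homeomorphism_image1[OF h])
  show "continuous_on W (p \<circ> f')"
    by (rule continuous_on_compose[OF homeomorphism_cont2[OF h]])
      (unfold im, rule covering_space_imp_continuous[OF cov])
  show "(p \<circ> f') ` W = S" unfolding image_comp[symmetric] im by (rule covering_space_imp_surjective[OF cov])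
  fix x assume x: "x \<in> S"
  define even where "even T v \<longleftrightarrow> \<Union>v = St \<inter> p -` T \<and> (\<forall>u\<in>v. openin (top_of_set St) u) \<and>
    pairwise disjnt v \<and> (\<forall>u\<in>v. \<exists>q. homeomorphism u T p q)" for T v
  have "\<forall>x\<in>S. \<exists>T. x \<in> T \<and> openin (top_of_set S) T \<and> (\<exists>v. even T v)"
    using cov unfolding covering_space_def even_def by (elim conjE)
  then obtain T v where T: "x \<in> T" "openin (top_of_set S) T" and ev: "even T v" using x by blast
  have v: "\<Union>v = St \<inter> p -` T" "\<And>u. u \<in> v \<Longrightarrow> openin (top_of_set St) u" "pairwise disjnt v"
    "\<And>u. u \<in> v \<Longrightarrow> \<exists>q. homeomorphism u T p q"
    using ev unfolding even_def by simp_all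
  have sub: "u \<subseteq> St" if "u \<in> v" for u using v(2)[OF that] openin_imp_subset by blast
  have f'f: "f' (f y) = y" if "y \<in> St" for y using h that by (rule homeomorphism_apply1)
  have ff': "f (f' y) = y" if "y \<in> W" for y using h that by (rule homeomorphism_apply2)
  show "\<exists>T. x \<in> T \<and> openin (top_of_set S) T \<and>
      (\<exists>v. \<Union>v = W \<inter> (p \<circ> f') -` T \<and> (\<forall>u\<in>v. openin (top_of_set W) u) \<and> pairwise disjnt v \<and>
        (\<forall>u\<in>v. \<exists>q. homeomorphism u T (p \<circ> f') q))"
  proof (rule exI[of _ T], intro conjI T exI[of _ "(`) f ` v"] ballI)
    show "\<Union> ((`) f ` v) = W \<inter> (p \<circ> f') -` T"
    proof (intro subset_antisym subsetI)
      fix y assume "y \<in> \<Union> ((`) f ` v)"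
      then obtain u z where z: "u \<in> v" "z \<in> u" "y = f z" by blast
      then have "z \<in> St \<inter> p -` T" using v(1) by blast
      then show "y \<in> W \<inter> (p \<circ> f') -` T" using f'f im(2) unfolding z(3) by auto
    next
      fix y assume y: "y \<in> W \<inter> (p \<circ> f') -` T"
      then have "f' y \<in> St \<inter> p -` T" using im(1) by auto
      then obtain u where "u \<in> v" "f' y \<in> u" using v(1) by blast
      then show "y \<in> \<Union> ((`) f ` v)" using ff'[of y] y by force
    qed
    show "openin (top_of_set W) u" if "u \<in> (`) f ` v" for u
      using that v(2) homeomorphism_imp_open_map[OF h] by blast
    show "pairwise disjnt ((`) f ` v)"
    proof (rule pairwiseI)
      fix U U' assume "U \<in> (`) f ` v" "U' \<in> (`) f ` v" "U \<noteq> U'"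
      then obtain u u' where u: "u \<in> v" "u' \<in> v" "u \<noteq> u'" "U = f ` u" "U' = f ` u'" by blast
      have "disjnt u u'" using v(3) u(1-3) by (rule pairwiseD)
      then show "disjnt U U'"
        using f'f sub[OF u(1)] sub[OF u(2)] unfolding u(4,5) disjnt_iff by (metis (no_types, lifting) imageE subsetD)
    qed
    show "\<exists>q. homeomorphism u T (p \<circ> f') q" if u: "u \<in> (`) f ` v" for u
    proof -
      obtain w where w: "w \<in> v" "u = f ` w" using u by blast
      obtain q where q: "homeomorphism w T p q" using v(4)[OF w(1)] by blast
      have "homeomorphism w u f f'" using homeomorphism_of_subsets[OF h sub[OF w(1)] subset_refl] w(2) by simp
      then show ?thesis using homeomorphism_compose[OF homeomorphism_symD q] by blast
    qed
  qed
qed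

lemma deck_transformation_comp:
  assumes "deck_transformation St p T" "deck_transformation St p T'"
  shows "deck_transformation St p (T \<circ> T')"
proof -
  obtain R R' where R: "homeomorphism St St T R" "homeomorphism St St T' R'"
    and p: "\<forall>x\<in>St. p (T x) = p x" "\<forall>x\<in>St. p (T' x) = p x"
    using assms unfolding deck_transformation_def by blast
  have "homeomorphism St St (T \<circ> T') (R' \<circ> R)" by (rule homeomorphism_compose[OF R(2,1)])
  moreover have "p ((T \<circ> T') x) = p x" if "x \<in> St" for x
  proof -
    have "T' x \<in> St" using homeomorphism_image1[OF R(2)] that by blast
    then show ?thesis using p that by simp
  qed
  ultimately show ?thesis unfolding deck_transformation_def by blast
qed

lemma deck_transformation_inverse:
  assumes "deck_transformation St p T"
  obtains R where "deck_transformation St p R" "\<And>x. x \<in> St \<Longrightarrow> R x \<in> St" "\<And>x. x \<in> St \<Longrightarrow> T (R x) = x"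
    "\<And>x. x \<in> St \<Longrightarrow> R (T x) = x"
proof -
  obtain R where R: "homeomorphism St St T R" and p: "\<forall>x\<in>St. p (T x) = p x"
    using assms unfolding deck_transformation_def by blast
  have in_St: "R x \<in> St" if "x \<in> St" for x using homeomorphism_image2[OF R] that by blast
  have TR: "T (R x) = x" if "x \<in> St" for x using R that by (rule homeomorphism_apply2)
  have RT: "R (T x) = x" if "x \<in> St" for x using R that by (rule homeomorphism_apply1)
  have "p (R x) = p x" if "x \<in> St" for x using p in_St[OF that] TR[OF that] by metis
  then have "deck_transformation St p R" unfolding deck_transformation_def using homeomorphism_symD[OF R] by blast
  then show ?thesis using that in_St TR RT by blast
qed

lemma deck_transformation_in: "\<lbrakk>deck_transformation St p T; x \<in> St\<rbrakk> \<Longrightarrow> T x \<in> St"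
  unfolding deck_transformation_def homeomorphism_def by blast

text \<open>For h off the line of v both v + e h and v - e h are eigenvectors for small e; comparing
  coefficients forces their eigenvalues to agree with that of v.\<close>

lemma eigenvectors_on_open:
  fixes M :: "real^'n::finite^'n"
  assumes W: "open W" "v \<in> W" and v0: "v \<noteq> 0" and eig: "\<And>x. x \<in> W \<Longrightarrow> \<exists>k. M *v x = k *\<^sub>R x"
  obtains k where "\<And>h. M *v h = k *\<^sub>R h"
proof -
  obtain k where k: "M *v v = k *\<^sub>R v" using eig[OF W(2)] by blast
  have "M *v h = k *\<^sub>R h" for h
  proof (cases "h \<in> span {v}")
    case True
    then obtain t where "h = t *\<^sub>R v" by (auto simp: span_singleton)
    then show ?thesis by (simp add: matrix_vector_mult_scaleR k mult.commute)
  next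
    case False
    then have h0: "h \<noteq> 0" using span_zero by metis
    obtain r where r: "r > 0" "ball v r \<subseteq> W" using W open_contains_ball by blast
    define e where "e = r / (2 * norm h)"
    have e: "e > 0" "e * norm h < r" using r(1) h0 by (simp_all add: e_def)
    have "v + e *\<^sub>R h \<in> ball v r" "v - e *\<^sub>R h \<in> ball v r" using e by (simp_all add: dist_norm)
    then obtain i j where ij: "M *v (v + e *\<^sub>R h) = i *\<^sub>R (v + e *\<^sub>R h)" "M *v (v - e *\<^sub>R h) = j *\<^sub>R (v - e *\<^sub>R h)"
      using eig r(2) by blast
    have p: "k *\<^sub>R v + e *\<^sub>R (M *v h) = i *\<^sub>R v + (i * e) *\<^sub>R h"
      using ij(1) by (simp add: matrix_vector_right_distrib matrix_vector_mult_scaleR k scaleR_right_distrib)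
    have m: "k *\<^sub>R v - e *\<^sub>R (M *v h) = j *\<^sub>R v - (j * e) *\<^sub>R h"
      using ij(2) by (simp add: matrix_vector_mult_diff_distrib matrix_vector_mult_scaleR k scaleR_right_diff_distrib)
    have "(2 * k) *\<^sub>R v = (i + j) *\<^sub>R v + ((i - j) * e) *\<^sub>R h"
    proof -
      have "(2 * k) *\<^sub>R v = (k *\<^sub>R v + e *\<^sub>R (M *v h)) + (k *\<^sub>R v - e *\<^sub>R (M *v h))"
        by (simp add: scaleR_2 flip: scaleR_scaleR)
      also have "\<dots> = (i + j) *\<^sub>R v + ((i - j) * e) *\<^sub>R h" unfolding p m by (simp add: algebra_simps)
      finally show ?thesis .
    qed
    then have hv: "((i - j) * e) *\<^sub>R h = (2 * k - (i + j)) *\<^sub>R v" by (simp add: algebra_simps)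
    have "i = j"
    proof (rule ccontr)
      assume "i \<noteq> j"
      then have n: "(i - j) * e \<noteq> 0" using e(1) by simp
      have "(1 / ((i - j) * e)) *\<^sub>R (((i - j) * e) *\<^sub>R h) \<in> span {v}"
        unfolding hv by (intro span_scale span_base) simp
      then show False using False n by simp
    qed
    then have "(2 * k - (i + j)) *\<^sub>R v = 0" using hv by simp
    then have "i = k" using v0 \<open>i = j\<close> by simp
    then have "e *\<^sub>R (M *v h) = e *\<^sub>R (k *\<^sub>R h)" using p by (simp add: mult.commute)
    then show ?thesis by (rule scaleR_left_imp_eq[rotated]) (use e(1) in simp)
  qed
  then show ?thesis by (rule that)
qed

text \<open>Serves to delete one orbit point from a neighbourhood when limit points are
  excluded.\<close>

lemma closed_rp2_singleton: "closed {x :: rp2}"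
proof -
  obtain w where w: "w \<noteq> 0" "x = rp2_of w" by (rule rp2_of_cases)
  have "{v. v \<noteq> 0 \<and> rp2_of v \<in> - {x}} = - span {w}"
  proof (rule subset_antisym; rule subsetI)
    fix v assume v: "v \<in> {v. v \<noteq> 0 \<and> rp2_of v \<in> - {x}}"
    show "v \<in> - span {w}"
    proof
      assume "v \<in> span {w}"
      then obtain k where k: "v = k *\<^sub>R w" by (auto simp: span_singleton)
      then have "k \<noteq> 0" using v by auto
      then show False using v w(2) rp2_of_scale[of k w] unfolding k by simp
    qed
  next
    fix v assume v: "v \<in> - span {w}"
    then have "v \<noteq> 0" using span_zero by auto
    moreover have "rp2_of v \<noteq> x"
    proof
      assume "rp2_of v = x"
      then obtain k where "v = k *\<^sub>R w" using rp2_of_eq_iff[OF w(1) \<open>v \<noteq> 0\<close>] w(2) by metis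
      then show False using v by (simp add: span_scale span_base)
    qed
    ultimately show "v \<in> {v. v \<noteq> 0 \<and> rp2_of v \<in> - {x}}" by simp
  qed
  then have "open (- {x})" unfolding open_rp2_def by (simp add: open_Compl closed_subspace subspace_span)
  then show ?thesis unfolding closed_def .
qed

context convex_domain
begin

text \<open>Openness of the projection gives continuity of the inverse. The domain is thereby
  homeomorphic to a convex set, hence contractible relative to each of its points.\<close>

lemma slice_homeomorphic: "\<exists>s. homeomorphism (C \<inter> {v. a \<bullet> v = 1}) \<Omega> rp2_of s"
proof -
  let ?K = "C \<inter> {v. a \<bullet> v = 1}"
  define s where "s x = (SOME v. v \<in> ?K \<and> rp2_of v = x)" for x
  have s: "s x \<in> ?K \<and> rp2_of (s x) = x" if "x \<in> \<Omega>" for x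
  proof -
    have "\<exists>v. v \<in> ?K \<and> rp2_of v = x" using \<Omega>_lift_C[OF that] by blast
    then show ?thesis unfolding s_def by (rule someI_ex)
  qed
  have s_rp2: "s (rp2_of v) = (1 / (a \<bullet> v)) *\<^sub>R v" if v: "v \<in> C" for v
  proof -
    have sv: "s (rp2_of v) \<in> C" "a \<bullet> s (rp2_of v) = 1" "rp2_of (s (rp2_of v)) = rp2_of v"
      using s[OF rp2_of_in_\<Omega>[OF v]] by auto
    obtain k where k: "k > 0" "v = k *\<^sub>R s (rp2_of v)" by (rule C_same_point[OF sv(1) v sv(3)])
    have "a \<bullet> v = k" using sv(2) arg_cong[OF k(2), of "inner a"] by simp
    then show ?thesis using k by (metis (no_types) divide_self_if less_irrefl mult.commute scaleR_one scaleR_scaleR times_divide_eq_right mult.right_neutral)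
  qed
  have "homeomorphism ?K \<Omega> rp2_of s"
  proof (rule homeomorphismI)
    show "continuous_on ?K rp2_of"
      by (rule continuous_on_subset[OF continuous_on_rp2_of]) auto
    show "continuous_on \<Omega> s"
      unfolding continuous_on_open_vimage[OF open_\<Omega>]
    proof (intro allI impI)
      fix U :: "(real^3) set" assume U: "open U"
      define V where "V = C \<inter> (\<lambda>v. (1 / (a \<bullet> v)) *\<^sub>R v) -` U"
      have "continuous_on C (\<lambda>v. (1 / (a \<bullet> v)) *\<^sub>R v)"
        by (intro continuous_intros) (auto simp: C_def)
      then have "open V" unfolding V_def using continuous_open_preimage[OF _ open_C U] by blast
      moreover have "0 \<notin> V" using zero_notin by (simp add: V_def)
      ultimately have "open (rp2_of ` V)" by (rule open_rp2_image)
      moreover have "s -` U \<inter> \<Omega> = rp2_of ` V"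
      proof (rule subset_antisym; rule subsetI)
        fix x assume x: "x \<in> s -` U \<inter> \<Omega>"
        then have "s x \<in> V" using s[of x] by (simp add: V_def)
        moreover have "x = rp2_of (s x)" using s[of x] x by simp
        ultimately show "x \<in> rp2_of ` V" by blast
      next
        fix x assume "x \<in> rp2_of ` V"
        then obtain v where v: "v \<in> V" "x = rp2_of v" by blast
        then have vC: "v \<in> C" and "(1 / (a \<bullet> v)) *\<^sub>R v \<in> U" by (auto simp: V_def)
        then show "x \<in> s -` U \<inter> \<Omega>" unfolding v(2) using s_rp2[OF vC] rp2_of_in_\<Omega>[OF vC] by simp
      qed
      ultimately show "open (s -` U \<inter> \<Omega>)" by simp
    qed
    show "rp2_of ` ?K \<subseteq> \<Omega>" using rp2_of_in_\<Omega> by blast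
    show "s ` \<Omega> \<subseteq> ?K" using s by blast
    show "s (rp2_of v) = v" if "v \<in> ?K" for v using s_rp2[of v] that by simp
    show "rp2_of (s x) = x" if "x \<in> \<Omega>" for x using s[OF that] by blast
  qed
  then show ?thesis by blast
qed

lemma contractible_rel_\<Omega>:
  assumes "x \<in> \<Omega>"
  shows "contractible_rel \<Omega> x"
proof -
  obtain s where s: "homeomorphism (C \<inter> {v. a \<bullet> v = 1}) \<Omega> rp2_of s" using slice_homeomorphic by blast
  obtain v where v: "v \<in> C" "a \<bullet> v = 1" "x = rp2_of v" using \<Omega>_lift_C[OF assms] by blast
  have "convex (C \<inter> {v. a \<bullet> v = 1})" by (intro convex_Int convex_C convex_hyperplane)
  then have "contractible_rel (C \<inter> {v. a \<bullet> v = 1}) v" using v by (intro convex_imp_contractible_rel) auto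
  then show ?thesis unfolding v(3) by (rule contractible_rel_homeomorphic[OF _ s])
qed

text \<open>The quotient of the two matrices has every vector of the open cone as an eigenvector, so
  it is scalar.\<close>

lemma projective_maps_agree:
  assumes g: "g \<in> carrier PGL3" and h: "h \<in> carrier PGL3" and eq: "\<And>x. x \<in> \<Omega> \<Longrightarrow> g x = h x"
  shows "g = h"
proof -
  obtain A B where A: "invertible A" "g = proj_map A" and B: "invertible B" "h = proj_map B"
    using g h by (auto simp: PGL3_def)
  obtain v where v: "v \<in> C" using nonempty_C by blast
  note invB = matrix_inv_mult[OF B(1)]
  have "\<exists>k. (matrix_inv B ** A) *v x = k *\<^sub>R x" if x: "x \<in> C" for x
  proof -
    have x0: "x \<noteq> 0" using x zero_notin by blast
    have "rp2_of (B *v x) = rp2_of (A *v x)"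
      using eq[OF rp2_of_in_\<Omega>[OF x]] unfolding A(2) B(2) by (simp add: proj_map_rp2_of x0)
    then obtain k where "A *v x = k *\<^sub>R (B *v x)"
      using rp2_of_eq_iff[OF invertible_mult_nonzero[OF B(1) x0] invertible_mult_nonzero[OF A(1) x0]] by blast
    then have "matrix_inv B *v (A *v x) = k *\<^sub>R x"
      by (simp add: matrix_vector_mult_scaleR matrix_vector_mul_assoc invB)
    then show ?thesis by (auto simp: matrix_vector_mul_assoc)
  qed
  moreover have "v \<noteq> 0" using v zero_notin by blast
  ultimately obtain k where k: "\<And>x. (matrix_inv B ** A) *v x = k *\<^sub>R x"
    using eigenvectors_on_open[OF open_C v] by metis
  have "A *v x = (k *\<^sub>R B) *v x" for x
  proof -
    have "A *v x = (B ** matrix_inv B) *v (A *v x)" by (simp add: invB)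
    also have "\<dots> = B *v ((matrix_inv B ** A) *v x)" by (simp only: matrix_vector_mul_assoc matrix_mul_assoc)
    finally show ?thesis unfolding k by (simp add: matrix_vector_mult_scaleR flip: scaleR_matrix_vector_assoc)
  qed
  then have Ak: "A = k *\<^sub>R B" unfolding matrix_eq by blast
  have "k \<noteq> 0"
  proof
    assume "k = 0"
    then have "A *v v = 0" unfolding Ak by simp
    then show False using invertible_mult_nonzero[OF A(1) \<open>v \<noteq> 0\<close>] by simp
  qed
  then show ?thesis unfolding A(2) B(2) Ak by (rule proj_map_scale)
qed

end

lemma PGL3_I: "invertible A \<Longrightarrow> proj_map A \<in> carrier PGL3"
  by (auto simp: PGL3_def)

lemma PGL3_id: "id \<in> carrier PGL3"
proof -
  have "invertible (mat 1 :: real^3^3)" unfolding invertible_def by (intro exI[of _ "mat 1"]) simp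
  from PGL3_I[OF this] show ?thesis unfolding proj_map_id .
qed

lemma PGL3_comp: "\<lbrakk>g \<in> carrier PGL3; h \<in> carrier PGL3\<rbrakk> \<Longrightarrow> g \<circ> h \<in> carrier PGL3"
proof -
  assume "g \<in> carrier PGL3" "h \<in> carrier PGL3"
  then obtain A B where "invertible A" "g = proj_map A" "invertible B" "h = proj_map B" by (auto simp: PGL3_def)
  then show ?thesis using PGL3_I[OF invertible_mult[of A B]] proj_map_mult[of B A] by simp
qed

lemma PGL3_inverse:
  assumes "g \<in> carrier PGL3"
  obtains h where "h \<in> carrier PGL3" "h \<circ> g = id" "g \<circ> h = id"
proof -
  obtain A where A: "invertible A" "g = proj_map A" using assms by (auto simp: PGL3_def)
  note inv = matrix_inv_mult[OF A(1)]
  have i: "invertible (matrix_inv A)" using inv unfolding invertible_def by blast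
  show ?thesis
    using that[OF PGL3_I[OF i]] proj_map_mult[OF A(1), of "matrix_inv A"] proj_map_mult[OF i, of A]
    unfolding A(2) inv proj_map_id by simp
qed

section \<open>The holonomy group as the deck group of the domain\<close>

locale developed_cover = convex_domain \<Omega> a for \<Omega> a +
  fixes S :: "'a::topological_space set" and St :: "'b::topological_space set" and p :: "'b \<Rightarrow> 'a" and b :: 'b
    and \<rho> :: "(real \<Rightarrow> 'a) set \<Rightarrow> rp2 \<Rightarrow> rp2" and \<phi> :: "'b \<Rightarrow> rp2" and \<phi>' :: "rp2 \<Rightarrow> 'b"
  assumes cov: "covering_space St p S" and b: "b \<in> St"
    and hom: "\<rho> \<in> hom (fundamental_group S (p b)) PGL3"
    and equi: "equivariant S St p b \<rho> \<phi>"
    and homeo: "homeomorphism St \<Omega> \<phi> \<phi>'"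
begin

definition \<Gamma> :: "(rp2 \<Rightarrow> rp2) set" where "\<Gamma> = \<rho> ` carrier (fundamental_group S (p b))"

lemma \<phi>_in: "x \<in> St \<Longrightarrow> \<phi> x \<in> \<Omega>" and \<phi>'_in: "y \<in> \<Omega> \<Longrightarrow> \<phi>' y \<in> St"
  and \<phi>'_\<phi>: "x \<in> St \<Longrightarrow> \<phi>' (\<phi> x) = x" and \<phi>_\<phi>': "y \<in> \<Omega> \<Longrightarrow> \<phi> (\<phi>' y) = y"
  using homeo unfolding homeomorphism_def by blast+

lemma contractible_rel_St:
  assumes "x \<in> St"
  shows "contractible_rel St x"
  using contractible_rel_homeomorphic[OF contractible_rel_\<Omega>[OF \<phi>_in[OF assms]] homeomorphism_symD[OF homeo]]
  unfolding \<phi>'_\<phi>[OF assms] .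

lemma path_connected_St: "path_connected St"
  by (rule contractible_rel_imp_path_connected[OF contractible_rel_St[OF b]])

lemma p_in: "x \<in> St \<Longrightarrow> p x \<in> S"
  using covering_space_imp_surjective[OF cov] by blast

text \<open>\<open>\<Gamma>\<close> is the group of projective maps induced by deck transformations.\<close>

lemma deck_in_\<Gamma>:
  assumes T: "deck_transformation St p T"
  shows "\<exists>g\<in>\<Gamma>. \<forall>x\<in>St. \<phi> (T x) = g (\<phi> x)"
proof -
  have Tb: "T b \<in> St" by (rule deck_transformation_in[OF T b])
  obtain \<gamma> where \<gamma>: "path \<gamma>" "path_image \<gamma> \<subseteq> St" "pathstart \<gamma> = b" "pathfinish \<gamma> = T b"
    using path_connected_St b Tb unfolding path_connected_def by blast
  have cp: "continuous_on St p" by (rule covering_space_imp_continuous[OF cov])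
  have "path (p \<circ> \<gamma>)" by (rule path_continuous_image[OF \<gamma>(1) continuous_on_subset[OF cp \<gamma>(2)]])
  moreover have "path_image (p \<circ> \<gamma>) \<subseteq> S" using \<gamma>(2) p_in unfolding path_image_compose by blast
  moreover have "pathstart (p \<circ> \<gamma>) = p b" "pathfinish (p \<circ> \<gamma>) = p b"
    using \<gamma>(3,4) T b by (simp_all add: pathstart_compose pathfinish_compose deck_transformation_def)
  ultimately have "loop_class S (p \<circ> \<gamma>) \<in> carrier (fundamental_group S (p b))"
    unfolding fundamental_group_def by auto
  then have "\<rho> (loop_class S (p \<circ> \<gamma>)) \<in> \<Gamma>" unfolding \<Gamma>_def by blast
  moreover have "\<forall>x\<in>St. \<phi> (T x) = \<rho> (loop_class S (p \<circ> \<gamma>)) (\<phi> x)"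
    using equi T \<gamma> unfolding equivariant_def by blast
  ultimately show ?thesis by blast
qed

text \<open>Lift the loop to a path from b. The deck transformation that takes b to its end point is
  the one which equivariance pairs with the class of the loop.\<close>

lemma \<Gamma>_deck:
  assumes g: "g \<in> \<Gamma>"
  obtains T where "deck_transformation St p T" "\<forall>x\<in>St. \<phi> (T x) = g (\<phi> x)"
proof -
  obtain \<delta> where \<delta>: "path \<delta>" "path_image \<delta> \<subseteq> S" "pathstart \<delta> = p b" "pathfinish \<delta> = p b"
    and g\<delta>: "g = \<rho> (loop_class S \<delta>)"
    using g unfolding \<Gamma>_def fundamental_group_def by auto
  have cI: "contractible_rel {0..1::real} 0" by (rule convex_imp_contractible_rel) simp_all
  have e: "p b = \<delta> 0" using \<delta>(3) by (simp add: pathstart_def)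
  obtain \<gamma> where \<gamma>: "continuous_on {0..1} \<gamma>" "\<gamma> ` {0..1} \<subseteq> St" "\<gamma> 0 = b" "\<And>t. t \<in> {0..1} \<Longrightarrow> p (\<gamma> t) = \<delta> t"
    by (rule lift_from_contractible[OF cov cI \<delta>(1)[unfolded path_def] \<delta>(2)[unfolded path_image_def] b e])
      (rule that)
  have g1: "\<gamma> 1 \<in> St" using \<gamma>(2) by auto
  have "p b = p (\<gamma> 1)" using \<gamma>(4)[of 1] \<delta>(4) by (simp add: pathfinish_def)
  then obtain T where T: "deck_transformation St p T" "T b = \<gamma> 1"
    using deck_transformation_exists[OF cov contractible_rel_St b g1] by blast
  have \<gamma>p: "path \<gamma>" "path_image \<gamma> \<subseteq> St" "pathstart \<gamma> = b" "pathfinish \<gamma> = T b"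
    using \<gamma> T(2) by (simp_all add: path_def path_image_def pathstart_def pathfinish_def)
  have h: "homotopic_paths S \<delta> (p \<circ> \<gamma>)"
    by (rule homotopic_paths_eq[OF \<delta>(1,2)]) (simp add: \<gamma>(4))
  have "loop_class S (p \<circ> \<gamma>) = loop_class S \<delta>"
  proof (rule subset_antisym; rule subsetI)
    fix \<eta> assume "\<eta> \<in> loop_class S (p \<circ> \<gamma>)"
    then show "\<eta> \<in> loop_class S \<delta>" unfolding loop_class_def using homotopic_paths_trans[OF h] by blast
  next
    fix \<eta> assume "\<eta> \<in> loop_class S \<delta>"
    then show "\<eta> \<in> loop_class S (p \<circ> \<gamma>)"
      unfolding loop_class_def using homotopic_paths_trans[OF homotopic_paths_sym[OF h]] by blast
  qed
  then have "\<forall>x\<in>St. \<phi> (T x) = g (\<phi> x)"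
    using equi T(1) \<gamma>p unfolding equivariant_def g\<delta> by metis
  then show ?thesis using that[OF T(1)] by blast
qed

lemma \<Gamma>_PGL3: "g \<in> \<Gamma> \<Longrightarrow> g \<in> carrier PGL3"
  using hom unfolding \<Gamma>_def hom_def by auto

text \<open>The criterion through which the group laws of \<open>\<Gamma>\<close> are derived from
  those of deck transformations, without composing loops.\<close>

lemma in_\<Gamma>:
  assumes g: "g \<in> carrier PGL3" and T: "deck_transformation St p T" and eq: "\<And>x. x \<in> St \<Longrightarrow> \<phi> (T x) = g (\<phi> x)"
  shows "g \<in> \<Gamma>"
proof -
  obtain h where h: "h \<in> \<Gamma>" "\<forall>x\<in>St. \<phi> (T x) = h (\<phi> x)" using deck_in_\<Gamma>[OF T] by blast
  have "g x = h x" if "x \<in> \<Omega>" for x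
    using eq[OF \<phi>'_in[OF that]] bspec[OF h(2) \<phi>'_in[OF that]] \<phi>_\<phi>'[OF that] by simp
  then have "g = h" by (rule projective_maps_agree[OF g \<Gamma>_PGL3[OF h(1)]])
  then show ?thesis using h(1) by simp
qed

lemma deck_on_\<Omega>:
  assumes "\<forall>x\<in>St. \<phi> (T x) = g (\<phi> x)" "y \<in> \<Omega>"
  shows "g y = \<phi> (T (\<phi>' y))"
  using bspec[OF assms(1) \<phi>'_in[OF assms(2)]] \<phi>_\<phi>'[OF assms(2)] by simp

lemma id_in_\<Gamma>: "id \<in> \<Gamma>"
proof (rule in_\<Gamma>[OF PGL3_id])
  show "deck_transformation St p id" unfolding deck_transformation_def using homeomorphism_ident[of St] by (auto simp: id_def)
qed simp

lemma comp_in_\<Gamma>: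
  assumes g: "g \<in> \<Gamma>" and h: "h \<in> \<Gamma>"
  shows "g \<circ> h \<in> \<Gamma>"
proof -
  obtain T where T: "deck_transformation St p T" "\<forall>x\<in>St. \<phi> (T x) = g (\<phi> x)" using \<Gamma>_deck[OF g] by blast
  obtain R where R: "deck_transformation St p R" "\<forall>x\<in>St. \<phi> (R x) = h (\<phi> x)" using \<Gamma>_deck[OF h] by blast
  show ?thesis
  proof (rule in_\<Gamma>)
    show "g \<circ> h \<in> carrier PGL3" by (intro PGL3_comp \<Gamma>_PGL3 g h)
    show "deck_transformation St p (T \<circ> R)" by (rule deck_transformation_comp[OF T(1) R(1)])
    show "\<phi> ((T \<circ> R) x) = (g \<circ> h) (\<phi> x)" if "x \<in> St" for x
      using bspec[OF T(2) deck_transformation_in[OF R(1) that]] bspec[OF R(2) that] by simp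
  qed
qed

lemma inverse_in_\<Gamma>:
  assumes g: "g \<in> \<Gamma>"
  shows "\<exists>h\<in>\<Gamma>. h \<circ> g = id \<and> g \<circ> h = id"
proof -
  obtain T where T: "deck_transformation St p T" "\<forall>x\<in>St. \<phi> (T x) = g (\<phi> x)" using \<Gamma>_deck[OF g] by blast
  obtain R where R: "deck_transformation St p R" "\<And>x. x \<in> St \<Longrightarrow> R x \<in> St" "\<And>x. x \<in> St \<Longrightarrow> T (R x) = x"
    by (rule deck_transformation_inverse[OF T(1)]) (rule that)
  obtain h where h: "h \<in> carrier PGL3" "h \<circ> g = id" "g \<circ> h = id" using PGL3_inverse[OF \<Gamma>_PGL3[OF g]] by blast
  have "h \<in> \<Gamma>"
  proof (rule in_\<Gamma>[OF h(1) R(1)])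
    fix x assume x: "x \<in> St"
    have "h (g (\<phi> (R x))) = \<phi> (R x)" using h(2) by (simp add: fun_eq_iff)
    then show "\<phi> (R x) = h (\<phi> x)" using bspec[OF T(2) R(2)[OF x]] R(3)[OF x] by simp
  qed
  then show ?thesis using h(2,3) by blast
qed

lemma \<Gamma>_maps: "\<lbrakk>g \<in> \<Gamma>; x \<in> \<Omega>\<rbrakk> \<Longrightarrow> g x \<in> \<Omega>"
proof -
  assume g: "g \<in> \<Gamma>" and x: "x \<in> \<Omega>"
  obtain T where T: "deck_transformation St p T" "\<forall>x\<in>St. \<phi> (T x) = g (\<phi> x)" using \<Gamma>_deck[OF g] by blast
  show ?thesis unfolding deck_on_\<Omega>[OF T(2) x] by (rule \<phi>_in[OF deck_transformation_in[OF T(1) \<phi>'_in[OF x]]])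
qed

lemma \<Gamma>_fibre: "\<lbrakk>g \<in> \<Gamma>; x \<in> \<Omega>\<rbrakk> \<Longrightarrow> p (\<phi>' (g x)) = p (\<phi>' x)"
proof -
  assume g: "g \<in> \<Gamma>" and x: "x \<in> \<Omega>"
  obtain T where T: "deck_transformation St p T" "\<forall>x\<in>St. \<phi> (T x) = g (\<phi> x)" using \<Gamma>_deck[OF g] by blast
  have "\<phi>' (g x) = T (\<phi>' x)"
    unfolding deck_on_\<Omega>[OF T(2) x] by (rule \<phi>'_\<phi>[OF deck_transformation_in[OF T(1) \<phi>'_in[OF x]]])
  then show ?thesis using T(1) \<phi>'_in[OF x] unfolding deck_transformation_def by simp
qed

lemma free_\<Gamma>:
  assumes g: "g \<in> \<Gamma>" and x: "x \<in> \<Omega>" and fixed: "g x = x"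
  shows "g = id"
proof (rule projective_maps_agree[OF \<Gamma>_PGL3[OF g] PGL3_id])
  fix y assume y: "y \<in> \<Omega>"
  obtain T where T: "deck_transformation St p T" "\<forall>x\<in>St. \<phi> (T x) = g (\<phi> x)" using \<Gamma>_deck[OF g] by blast
  have "\<phi>' (g x) = T (\<phi>' x)"
    unfolding deck_on_\<Omega>[OF T(2) x] by (rule \<phi>'_\<phi>[OF deck_transformation_in[OF T(1) \<phi>'_in[OF x]]])
  then have fx: "T (\<phi>' x) = id (\<phi>' x)" using fixed by simp
  have did: "deck_transformation St p id" unfolding deck_transformation_def using homeomorphism_ident[of St] by (auto simp: id_def)
  have "T (\<phi>' y) = id (\<phi>' y)"
    by (rule deck_transformation_unique[OF cov path_connected_imp_connected[OF path_connected_St] T(1) did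
          \<phi>'_in[OF x] fx \<phi>'_in[OF y]])
  then show "g y = id y" unfolding deck_on_\<Omega>[OF T(2) y] using \<phi>_\<phi>'[OF y] by simp
qed

text \<open>Orbit points correspond to points of a single fibre of p, and a neighbourhood on which p
  is injective contains at most one of them. A limit point would supply two: one orbit point
  different from y, and another after the first has been removed.\<close>

lemma discrete_\<Gamma>:
  assumes x: "x \<in> \<Omega>" and y: "y \<in> \<Omega>"
  shows "\<not> y islimpt {g x | g. g \<in> \<Gamma>}"
proof
  assume lim: "y islimpt {g x | g. g \<in> \<Gamma>}"
  obtain u where u: "openin (top_of_set St) u" "\<phi>' y \<in> u" "inj_on p u"
    by (rule covering_fibre_isolated[OF cov \<phi>'_in[OF y]])
  have "openin (top_of_set \<Omega>) (\<phi> ` u)" by (rule homeomorphism_imp_open_map[OF homeo u(1)])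
  then have oU: "open (\<phi> ` u)" by (rule openin_open_trans[OF _ open_\<Omega>])
  have yU: "y \<in> \<phi> ` u" by (rule image_eqI[where f = \<phi>, OF \<phi>_\<phi>'[OF y, symmetric] u(2)])
  have uSt: "u \<subseteq> St" by (rule openin_imp_subset[OF u(1)])
  have same: "z = z'" if z: "z \<in> {g x | g. g \<in> \<Gamma>}" "z \<in> \<phi> ` u" "z' \<in> {g x | g. g \<in> \<Gamma>}" "z' \<in> \<phi> ` u" for z z'
  proof -
    have "p (\<phi>' z) = p (\<phi>' x)" "p (\<phi>' z') = p (\<phi>' x)" using z(1,3) \<Gamma>_fibre[OF _ x] by blast+
    moreover obtain w w' where w: "w \<in> u" "z = \<phi> w" and w': "w' \<in> u" "z' = \<phi> w'" using z(2,4) by blast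
    moreover have "\<phi>' z = w" "\<phi>' z' = w'" using w w' \<phi>'_\<phi> uSt by auto
    ultimately have "p w = p w'" by simp
    then show ?thesis using inj_onD[OF u(3)] w w' by metis
  qed
  obtain z where z: "z \<in> {g x | g. g \<in> \<Gamma>}" "z \<in> \<phi> ` u" "z \<noteq> y" by (rule islimptE[OF lim yU oU])
  have o: "open (\<phi> ` u - {z})" by (rule open_Diff[OF oU closed_rp2_singleton])
  have "y \<in> \<phi> ` u - {z}" using yU z(3) by blast
  then obtain z' where "z' \<in> {g x | g. g \<in> \<Gamma>}" "z' \<in> \<phi> ` u - {z}" by (rule islimptE[OF lim _ o])
  then show False using same[OF z(1,2)] by blast
qed

lemma rp2_action: "rp2_action \<Omega> a \<Gamma>"
proof unfold_locales
  show "\<exists>A. invertible A \<and> g = proj_map A" if "g \<in> \<Gamma>" for g using \<Gamma>_PGL3[OF that] by (auto simp: PGL3_def)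
  show "g x \<in> \<Omega> \<longleftrightarrow> x \<in> \<Omega>" if g: "g \<in> \<Gamma>" for g x
  proof
    assume gx: "g x \<in> \<Omega>"
    obtain h where h: "h \<in> \<Gamma>" "h \<circ> g = id" using inverse_in_\<Gamma>[OF g] by blast
    have "h (g x) = x" using h(2) by (simp add: fun_eq_iff)
    then show "x \<in> \<Omega>" using \<Gamma>_maps[OF h(1) gx] by simp
  qed (rule \<Gamma>_maps[OF g])
  show "id \<in> \<Gamma>" by (rule id_in_\<Gamma>)
  show "g \<circ> h \<in> \<Gamma>" if "g \<in> \<Gamma>" "h \<in> \<Gamma>" for g h using that by (rule comp_in_\<Gamma>)
  show "\<exists>h\<in>\<Gamma>. h \<circ> g = id \<and> g \<circ> h = id" if "g \<in> \<Gamma>" for g using that by (rule inverse_in_\<Gamma>)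
  show "g = id" if "g \<in> \<Gamma>" "x \<in> \<Omega>" "g x = x" for g x using that by (rule free_\<Gamma>)
  show "\<not> y islimpt {g x | g. g \<in> \<Gamma>}" if "x \<in> \<Omega>" "y \<in> \<Omega>" for x y using that by (rule discrete_\<Gamma>)
qed

lemma galois_cover: "galois_cover \<Omega> (p \<circ> \<phi>') S \<Gamma>"
proof unfold_locales
  show "covering_space \<Omega> (p \<circ> \<phi>') S" by (rule covering_space_homeomorphic[OF cov homeo])
  show "contractible_rel \<Omega> x" if "x \<in> \<Omega>" for x by (rule contractible_rel_\<Omega>[OF that])
  show "\<Omega> \<noteq> {}" by (rule nonempty_\<Omega>)
  have cont: "continuous_on \<Omega> g" if g: "g \<in> \<Gamma>" for g
  proof -
    obtain T where T: "deck_transformation St p T" "\<forall>x\<in>St. \<phi> (T x) = g (\<phi> x)" using \<Gamma>_deck[OF g] by blast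
    obtain R where R: "homeomorphism St St T R" using T(1) unfolding deck_transformation_def by blast
    have "homeomorphism \<Omega> \<Omega> (\<phi> \<circ> (T \<circ> \<phi>')) (\<phi> \<circ> R \<circ> \<phi>')"
      by (rule homeomorphism_compose[OF homeomorphism_compose[OF homeomorphism_symD[OF homeo] R] homeo])
    then have "continuous_on \<Omega> (\<phi> \<circ> (T \<circ> \<phi>'))" by (rule homeomorphism_cont1)
    then show ?thesis by (rule continuous_on_eq) (simp add: deck_on_\<Omega>[where g = g, OF T(2)])
  qed
  show "deck_transformation \<Omega> (p \<circ> \<phi>') g" if g: "g \<in> \<Gamma>" for g
    unfolding deck_transformation_def
  proof (intro conjI ballI)
    obtain h where h: "h \<in> \<Gamma>" "h \<circ> g = id" "g \<circ> h = id" using inverse_in_\<Gamma>[OF g] by blast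
    have "homeomorphism \<Omega> \<Omega> g h"
    proof (rule homeomorphismI)
      show "continuous_on \<Omega> g" "continuous_on \<Omega> h" by (rule cont[OF g], rule cont[OF h(1)])
      show "g ` \<Omega> \<subseteq> \<Omega>" "h ` \<Omega> \<subseteq> \<Omega>" using \<Gamma>_maps g h(1) by blast+
      show "h (g x) = x" "g (h x) = x" for x using h(2,3) by (simp_all add: fun_eq_iff)
    qed
    then show "\<exists>T'. homeomorphism \<Omega> \<Omega> g T'" by blast
    show "(p \<circ> \<phi>') (g x) = (p \<circ> \<phi>') x" if "x \<in> \<Omega>" for x using \<Gamma>_fibre[OF g that] by simp
  qed
  show "id \<in> \<Gamma>" by (rule id_in_\<Gamma>)
  show "g \<circ> h \<in> \<Gamma>" if "g \<in> \<Gamma>" "h \<in> \<Gamma>" for g h using that by (rule comp_in_\<Gamma>)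
  show "\<exists>h\<in>\<Gamma>. h \<circ> g = id \<and> g \<circ> h = id" if "g \<in> \<Gamma>" for g using that by (rule inverse_in_\<Gamma>)
  show "g = id" if "g \<in> \<Gamma>" "x \<in> \<Omega>" "g x = x" for g x using that by (rule free_\<Gamma>)
  show "\<exists>g\<in>\<Gamma>. g x = y" if xy: "x \<in> \<Omega>" "y \<in> \<Omega>" "(p \<circ> \<phi>') x = (p \<circ> \<phi>') y" for x y
  proof -
    have "p (\<phi>' x) = p (\<phi>' y)" using xy(3) by simp
    then obtain T where T: "deck_transformation St p T" "T (\<phi>' x) = \<phi>' y"
      using deck_transformation_exists[OF cov contractible_rel_St \<phi>'_in[OF xy(1)] \<phi>'_in[OF xy(2)]] by blast
    obtain g where g: "g \<in> \<Gamma>" "\<forall>x\<in>St. \<phi> (T x) = g (\<phi> x)" using deck_in_\<Gamma>[OF T(1)] by blast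
    have "g x = y" using bspec[OF g(2) \<phi>'_in[OF xy(1)]] T(2) \<phi>_\<phi>' xy(1,2) by simp
    then show ?thesis using g(1) by blast
  qed
qed

lemma not_simplicial:
  assumes "euler_char S < 0"
  shows "\<not> simplicial"
proof
  assume simplicial
  then obtain P :: "real^3^3" where P: "invertible P" "\<And>x. P *v x \<in> C \<longleftrightarrow> (\<forall>i. x $ i > 0)"
    unfolding simplicial_def by blast
  interpret act: rp2_action \<Omega> a \<Gamma> by (rule rp2_action)
  interpret cover: galois_cover \<Omega> "p \<circ> \<phi>'" S \<Gamma> by (rule galois_cover)
  interpret triangle_cover \<Omega> a \<Gamma> P "p \<circ> \<phi>'" S by unfold_locales (fact P)+
  show False using euler_char_nonneg assms by simp
qed

end

theorem lemmaA3:
  fixes S :: "'a::topological_space set" and A :: "('a, real^2) chart set"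
    and St :: "'b::topological_space set" and p :: "'b \<Rightarrow> 'a" and b :: 'b
    and \<mu> :: "('a, 'c::topological_space) marked_surface set"
    and \<rho> :: "(real \<Rightarrow> 'a) set \<Rightarrow> rp2 \<Rightarrow> rp2"
    and \<Omega> \<Omega>' F :: "rp2 set" and \<Gamma> :: "(rp2 \<Rightarrow> rp2) set" and a :: "real^3"
  assumes "oriented_smooth_surface S A" and "connected S"
    and "finite_type S" and "euler_char S < 0"
    and "universal_cover St p S" and "b \<in> St"
    and "\<mu> \<in> convex_structures S A St p"
    and "\<rho> \<in> holonomy S A St p b \<mu>"
    and "developing_image S A St p b \<mu> \<rho> \<Omega>"
    and "\<Gamma> = \<rho> ` carrier (fundamental_group S (p b))"
    and "F = nonsaddle_fixed_points \<Gamma>"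
    and "closure \<Omega> \<subseteq> affine_chart a"
    and "\<Omega>' = hull_interior a \<Omega> F"
  shows "(\<forall>x\<in>\<Omega>'. boundary_accumulation \<Gamma> \<Omega>' x = closure F) \<and>
    (\<forall>x1\<in>\<Omega>'. \<forall>x2\<in>\<Omega>'. boundary_accumulation \<Gamma> \<Omega>' x1 = boundary_accumulation \<Gamma> \<Omega>' x2)"
proof -
  obtain \<phi> where \<phi>: "developing_pair S A St p b \<mu> \<phi> \<rho>" and \<Omega>: "\<Omega> = \<phi> ` St"
    using assms(9) unfolding developing_image_def by blast
  then obtain \<phi>' where homeo: "homeomorphism St \<Omega> \<phi> \<phi>'"
    unfolding developing_pair_def isomorphism_def by blast
  interpret developed_cover \<Omega> a S St p b \<rho> \<phi> \<phi>'
    using \<phi> homeo assms(5,6,12) unfolding \<Omega>[symmetric] developing_pair_def universal_cover_def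
    by unfold_locales blast+
  have \<Gamma>: "\<Gamma> = developed_cover.\<Gamma> S p b \<rho>" unfolding \<Gamma>_def assms(10) ..
  interpret act: rp2_action \<Omega> a \<Gamma> unfolding \<Gamma> by (rule rp2_action)
  have "boundary_accumulation \<Gamma> \<Omega>' x = closure F" if "x \<in> \<Omega>'" for x
    using act.boundary_accumulation_eq[OF not_simplicial[OF assms(4)]] that
    unfolding assms(11,13) by blast
  then show ?thesis by simp
qed

end
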